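(* Let $n\ge 2$ and $w\in[n,\infty]$. Then \[ \dim_H(\Theta_n(w))\ge n-2+\frac{1}{w^2+1},\qquad \dim_H(\Theta^n)>n-2+\frac{1}{n^2+1} \] (with $\frac{1}{w^2+1}=0$ for $w=\infty$). Moreover $\dim_P(\Theta^2)\ge 1$ and $\dim_P(\Theta^n)=n-1$ for $n\ge3$; in particular $\Theta^n\neq\emptyset$. Conversely, $\dim_H(\Theta^2)\le \frac75$, $\dim_H(\Theta^3)\le\frac{17-\sqrt{13}}{8}$, and $\dim_H(\Theta^n)\le n-2+\frac2n$ for $n\ge4$.
   Context: Use the maximum norm. For $\underline{x}=(\xi_1,\dots,\xi_n)\in\mathbb{R}^n$ write $\underline{x}^*=(\xi_1,\dots,\xi_n,1)$, and for $\mathbf y\in\mathbb{R}^{n+1}$ let $\hat{\mathbf y}$ be its first $n$ coordinates. $\underline{x}$ is totally irrational if $\mathbf q\cdot\underline{x}^*\ne 0$ for all nonzero $\mathbf q\in\mathbb{Z}^{n+1}$. $\mathbf q\in\mathbb{Z}^{n+1}$ is a best approximation for $\underline{x}$ if $|\mathbf q\cdot\underline{x}^*|=\min\{|\mathbf b\cdot\underline{x}^*|:\mathbf b\in\mathbb{Z}^{n+1},0<\Vert\hat{\mathbf b}\Vert\le\Vert\hat{\mathbf q}\Vert\}$; ordered by increasing norm they form the sequence $(\mathbf q_j)_{j\ge1}$. Exponents: $\hat\omega(\underline{x})=\sup\{t>0:\limsup_{Q\to\infty}Q^t\min_{0<\Vert\hat{\mathbf b}\Vert\le Q}|\mathbf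 b\cdot\underline{x}^*|<\infty\}$ and $\omega(\underline{x})$ defined identically with $\liminf$ in place of $\limsup$ (minima over $\mathbf b\in\mathbb{Z}^{n+1}$). Let $\mathbf e_1,\dots,\mathbf e_{n+1}$ be the standard basis and $\mathcal H_i=\langle\mathbf e_i,\mathbf e_{n+1}\rangle_{\mathbb Z}$. Consider the properties: (i) $\underline{x}$ is totally irrational; (ii) some tail $(\mathbf q_j)_{j\ge j_0}$ lies in $\mathcal H_1\cup\mathcal H_2$; (iii) some tail lies in $\langle\mathbf e_1,\mathbf e_2,\mathbf e_{n+1}\rangle_{\mathbb Z}$; (iv) for all $j\ge j_0$, either $\mathbf q_{2j}\in\mathcal H_1,\mathbf q_{2j+1}\in\mathcal H_2$, or $\mathbf q_{2j}\in\mathcal H_2,\mathbf q_{2j+1}\in\mathcal H_1$; (v) for $j\ge j_0$, $\mathbf q_j,\mathbf q_{j+1},\mathbf q_{j+2}$ are linearly independent; (vi) $\hat\omega(\underline{x})=w$ and $\omega(\underline{x})=w^2$. $\Theta^n$ is the set of $\underline{x}\in\mathbb{R}^n$ satisfying (i)–(v), and $\Theta_n(w)$ (for $w\in[n,\infty]$) is the set satisfying (i)–(vi). $\dim_H,\dim_P$ are Hausdorff and packing dimension. *)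

theory Defs
  imports "HOL-Analysis.Analysis"
begin

text \<open>
  Boundedness of the covering sets is required because \<^const>\<open>diameter\<close> has no meaningful
  value on unbounded sets.  Both dimensions are infima over the exponents \<open>s > 0\<close>; admitting
  \<open>s = 0\<close> would not change them, as vanishing at \<open>s\<close> implies vanishing at every larger exponent,
  and it avoids \<^term>\<open>0 powr 0 = (0::real)\<close>.  The empty set has dimension 0.
  The metric is that of the type; on the Euclidean spaces, replacing it by the (bi-Lipschitz
  equivalent) maximum metric gives the same dimensions.
\<close>

definition hausdorff_premeasure :: "real \<Rightarrow> real \<Rightarrow> 'a::metric_space set \<Rightarrow> ennreal" where
  "hausdorff_premeasure s \<delta> A =
     (INF U \<in> {U :: nat \<Rightarrow> 'a set. A \<subseteq> (\<Union>i. U i) \<and> (\<forall>i. bounded (U i) \<and> diameter (U i) \<le> \<delta>)}.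
        \<Sum>i. ennreal (diameter (U i) powr s))"

definition hausdorff_measure :: "real \<Rightarrow> 'a::metric_space set \<Rightarrow> ennreal" where
  "hausdorff_measure s A = (SUP \<delta> \<in> {0<..}. hausdorff_premeasure s \<delta> A)"

definition hausdorff_dim :: "'a::metric_space set \<Rightarrow> ereal" where
  "hausdorff_dim A = Inf {ereal s |s. 0 < s \<and> hausdorff_measure s A = 0}"

text \<open>
  A \<open>\<delta>\<close>-packing is a family of disjoint closed balls with centres in \<open>A\<close>, given as a set of pairs
  of centre and radius.  Restricting to finite packings does not affect the supremum of the sums.
\<close>

definition delta_packings :: "real \<Rightarrow> 'a::metric_space set \<Rightarrow> ('a \<times> real) set set" where
  "delta_packings \<delta> A =
     {C. finite C \<and> (\<forall>(x, r) \<in> C. x \<in> A \<and> 0 < r \<and> r \<le> \<delta>) \<and>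
         pairwise (\<lambda>(x, r) (y, t). disjnt (cball x r) (cball y t)) C}"

definition packing_premeasure :: "real \<Rightarrow> 'a::metric_space set \<Rightarrow> ennreal" where
  "packing_premeasure s A =
     (INF \<delta> \<in> {0<..}. SUP C \<in> delta_packings \<delta> A. \<Sum>(x, r) \<in> C. ennreal ((2 * r) powr s))"

definition packing_measure :: "real \<Rightarrow> 'a::metric_space set \<Rightarrow> ennreal" where
  "packing_measure s A =
     (INF F \<in> {F :: nat \<Rightarrow> 'a set. A \<subseteq> (\<Union>i. F i)}. \<Sum>i. packing_premeasure s (F i))"

definition packing_dim :: "'a::metric_space set \<Rightarrow> ereal" where
  "packing_dim A = Inf {ereal s |s. 0 < s \<and> packing_measure s A = 0}"

text \<open>
  With \<open>n = CARD('n)\<close>, the space of dimension \<open>n + 1\<close> is \<^typ>\<open>(real ^ 'n) \<times> real\<close>: the first \<open>n\<close>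
  coordinates of \<open>y\<close> are \<^term>\<open>fst y\<close>, and \<open>\<bullet>\<close> is the standard inner product.
  \<^const>\<open>infnorm\<close> is the maximum norm.
\<close>

type_synonym 'n ext = "(real ^ 'n) \<times> real"

definition star :: "real ^ 'n \<Rightarrow> 'n::finite ext" where
  "star x = (x, 1)"

definition int_lattice :: "'a::euclidean_space set" where
  "int_lattice = {q. \<forall>b \<in> Basis. q \<bullet> b \<in> \<int>}"

definition int_span :: "'a::real_vector set \<Rightarrow> 'a set" where
  "int_span S = {\<Sum>v \<in> T. of_int (c v) *\<^sub>R v |T c. finite T \<and> T \<subseteq> S}"

definition totally_irrational :: "real ^ 'n::finite \<Rightarrow> bool" where
  "totally_irrational x \<longleftrightarrow> (\<forall>q \<in> int_lattice. q \<noteq> 0 \<longrightarrow> q \<bullet> star x \<noteq> 0)"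

definition admissible :: "real \<Rightarrow> 'n::finite ext set" where
  "admissible Q = {b \<in> int_lattice. 0 < infnorm (fst b) \<and> infnorm (fst b) \<le> Q}"

definition best_approx :: "real ^ 'n::finite \<Rightarrow> 'n ext \<Rightarrow> bool" where
  "best_approx x q \<longleftrightarrow>
     q \<in> admissible (infnorm (fst q)) \<and>
     (\<forall>b \<in> admissible (infnorm (fst q)). \<bar>q \<bullet> star x\<bar> \<le> \<bar>b \<bullet> star x\<bar>)"

text \<open>
  The sequence is indexed by \<open>j \<ge> 1\<close>; the value at 0 is irrelevant.  For totally irrational \<open>x\<close>,
  best approximations of equal norm agree up to sign, and one of each pair \<open>\<plusminus>q\<close> is listed.
\<close>

definition best_approx_seq :: "real ^ 'n::finite \<Rightarrow> (nat \<Rightarrow> 'n ext) \<Rightarrow> bool" where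
  "best_approx_seq x q \<longleftrightarrow>
     (\<forall>j\<ge>1. best_approx x (q j)) \<and>
     strict_mono_on {1..} (\<lambda>j. infnorm (fst (q j))) \<and>
     (\<forall>b. best_approx x b \<longrightarrow> (\<exists>j\<ge>1. b = q j \<or> b = - q j))"

text \<open>
  The infimum is attained for \<open>Q \<ge> 1\<close>; smaller \<open>Q\<close> do not matter for the exponents.
\<close>

definition min_form :: "real ^ 'n::finite \<Rightarrow> real \<Rightarrow> real" where
  "min_form x Q = (INF b \<in> admissible Q. \<bar>b \<bullet> star x\<bar>)"

definition omega_hat :: "real ^ 'n::finite \<Rightarrow> ereal" where
  "omega_hat x =
     Sup {ereal t |t. 0 < t \<and> Limsup at_top (\<lambda>Q. ereal (Q powr t * min_form x Q)) < \<infinity>}"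

definition omega :: "real ^ 'n::finite \<Rightarrow> ereal" where
  "omega x =
     Sup {ereal t |t. 0 < t \<and> Liminf at_top (\<lambda>Q. ereal (Q powr t * min_form x Q)) < \<infinity>}"

definition e_vec :: "'n \<Rightarrow> 'n::finite ext" where
  "e_vec i = (axis i 1, 0)"

definition e_last :: "'n::finite ext" where
  "e_last = (0, 1)"

definition H_lattice :: "'n \<Rightarrow> 'n::finite ext set" where
  "H_lattice i = int_span {e_vec i, e_last}"

text \<open>
  The indices \<open>i1\<close> and \<open>i2\<close> are those of the first two coordinates; the index type \<open>'n\<close> carries
  no order.
\<close>

definition Theta :: "'n \<Rightarrow> 'n \<Rightarrow> (real ^ 'n::finite) set" where
  "Theta i1 i2 =
     {x. totally_irrational x \<and>
         (\<exists>q. best_approx_seq x q \<and>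
            (\<exists>j0\<ge>1. \<forall>j\<ge>j0. q j \<in> H_lattice i1 \<union> H_lattice i2) \<and>
            (\<exists>j0\<ge>1. \<forall>j\<ge>j0. q j \<in> int_span {e_vec i1, e_vec i2, e_last}) \<and>
            (\<exists>j0\<ge>1. \<forall>j\<ge>j0.
               (q (2 * j) \<in> H_lattice i1 \<and> q (2 * j + 1) \<in> H_lattice i2) \<or>
               (q (2 * j) \<in> H_lattice i2 \<and> q (2 * j + 1) \<in> H_lattice i1)) \<and>
            (\<exists>j0\<ge>1. \<forall>j\<ge>j0.
               distinct [q j, q (j + 1), q (j + 2)] \<and>
               independent {q j, q (j + 1), q (j + 2)}))}"

definition Theta_exp :: "'n \<Rightarrow> 'n \<Rightarrow> ereal \<Rightarrow> (real ^ 'n::finite) set" where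
  "Theta_exp i1 i2 w = {x \<in> Theta i1 i2. omega_hat x = w \<and> omega x = w ^ 2}"

end

theory Submission
  imports Defs "HOL-Probability.Probability" "HOL-Number_Theory.Totient"
begin

text \<open>
  The best approximations of a point of \<open>Theta\<close> are fractions \<open>P j / c j\<close> with increasing denominators,
  approximating \<open>x $ i1\<close> for one parity of \<open>j\<close> and \<open>x $ i2\<close> for the other, and Dirichlet's theorem bounds the
  error by \<open>c (j + 1) powr (- n)\<close>.  Distinct fractions of bounded denominator are far apart, so few pairs of
  boxes are needed at each scale: this gives the upper bounds.

  For the lower bounds, two interlaced random sequences of fractions with coprime consecutive denominators are
  chosen; their limits are the coordinates \<open>i1\<close> and \<open>i2\<close>.  By Borel--Cantelli, for almost every choice of the
  other \<open>n - 2\<close> coordinates no other integer form is smaller infinitely often, and the mass distribution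
  principle applies to the law of the point.  Adding digits to fractions with power denominators gives the
  bounds for \<open>Theta\<close>; choosing neighbours, \<open>P'' * c - P * c'' = 1\<close>, prescribes the size of the forms from both
  sides, and with it the exponents.
\<close>

section \<open>Hausdorff and packing measures\<close>

text \<open>The coordinates other than \<open>i1\<close> and \<open>i2\<close> always contribute
  \<open>n - 2\<close>, as grid cells from above and as Lebesgue measure from below; the real work
  concerns one pair of real numbers. Coprimality of consecutive denominators \<open>c\<close>,
  \<open>c'\<close> makes the best approximations computable: a form in the two coordinates with
  coefficients below \<open>c'\<close>, multiplied by \<open>c * c'\<close>, is an integer up to a
  small error, and this integer vanishes only for multiples of the intended best approximation.

  Two constructions are needed. The distance of a truncated expansion from its limit varies with the
  digits, so it does not fix the exponents, but the denominators may grow so fast that the last free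
  blocks dominate; the resulting \<open>1 / (2 * n)\<close> exceeds \<open>1 / (n^2 + 1)\<close>,
  whence the strict inequality. A neighbour lies at distance exactly \<open>1 / (c * c'')\<close>,
  which pins down the exponents once the sizes of the denominators are prescribed.

  From above, the single bound \<open>n - 2 + 2 / n\<close> serves all \<open>n\<close>: it is 1 for
  \<open>n = 2\<close> and 5/3 for \<open>n = 3\<close>, below the two special values.\<close>

lemma suminf_ennreal_half_powers:
  assumes "0 \<le> e"
  shows "(\<Sum>k. ennreal (e * (1/2) ^ Suc k)) = ennreal e"
proof (rule suminf_ennreal_eq)
  show "(\<lambda>k. e * (1/2) ^ Suc k) sums e"
    using sums_mult[OF power_half_series, of e] by simp
qed (use assms in simp)

lemma hausdorff_premeasure_le_cover:
  assumes "A \<subseteq> (\<Union>i. U i)" "\<And>i::nat. bounded (U i)" "\<And>i. diameter (U i) \<le> \<delta>"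
  shows "hausdorff_premeasure s \<delta> A \<le> (\<Sum>i. ennreal (diameter (U i) powr s))"
  unfolding hausdorff_premeasure_def by (rule INF_lower) (use assms in auto)

lemma hausdorff_premeasure_lessE:
  assumes "hausdorff_premeasure s \<delta> A < e"
  obtains U :: "nat \<Rightarrow> 'a::metric_space set"
  where "A \<subseteq> (\<Union>i. U i)" "\<And>i. bounded (U i)" "\<And>i. diameter (U i) \<le> \<delta>"
    "(\<Sum>i. ennreal (diameter (U i) powr s)) < e"
  using assms unfolding hausdorff_premeasure_def INF_less_iff by auto

lemma hausdorff_premeasure_mono:
  "A \<subseteq> B \<Longrightarrow> hausdorff_premeasure s \<delta> A \<le> hausdorff_premeasure s \<delta> B"
  unfolding hausdorff_premeasure_def by (rule INF_superset_mono) auto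

lemma hausdorff_premeasure_UN:
  fixes A :: "nat \<Rightarrow> 'a::metric_space set"
  shows "hausdorff_premeasure s \<delta> (\<Union>k. A k) \<le> (\<Sum>k. hausdorff_premeasure s \<delta> (A k))"
proof (rule ennreal_le_epsilon)
  fix e :: real
  assume fin: "(\<Sum>k. hausdorff_premeasure s \<delta> (A k)) < top" and e: "0 < e"
  have lt: "hausdorff_premeasure s \<delta> (A k) < top" for k
    using ennreal_suminf_lessD[OF fin] .
  have "\<exists>U. A k \<subseteq> (\<Union>i. U i) \<and> (\<forall>i::nat. bounded (U i) \<and> diameter (U i) \<le> \<delta>) \<and>
      (\<Sum>i. ennreal (diameter (U i) powr s)) < hausdorff_premeasure s \<delta> (A k) + ennreal (e * (1/2) ^ Suc k)" for k
  proof -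
    have "hausdorff_premeasure s \<delta> (A k) < hausdorff_premeasure s \<delta> (A k) + ennreal (e * (1/2) ^ Suc k)"
      using lt[of k] e by (simp add: ennreal_add_left_cancel_less[of _ 0, simplified])
    then show ?thesis
      by (elim hausdorff_premeasure_lessE) blast
  qed
  then obtain U where U: "\<And>k. A k \<subseteq> (\<Union>i. U k i)"
    "\<And>k i::nat. bounded (U k i)" "\<And>k i. diameter (U k i) \<le> \<delta>"
    "\<And>k. (\<Sum>i. ennreal (diameter (U k i) powr s)) < hausdorff_premeasure s \<delta> (A k) + ennreal (e * (1/2) ^ Suc k)"
    by metis
  define V where "V i = (case prod_decode i of (k, l) \<Rightarrow> U k l)" for i
  have "(\<Union>k. A k) \<subseteq> (\<Union>i. V i)"
  proof
    fix x assume "x \<in> (\<Union>k. A k)"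
    then obtain k l where "x \<in> U k l" using U(1) by blast
    then have "x \<in> V (prod_encode (k, l))" by (simp add: V_def)
    then show "x \<in> (\<Union>i. V i)" by blast
  qed
  then have "hausdorff_premeasure s \<delta> (\<Union>k. A k) \<le> (\<Sum>i. ennreal (diameter (V i) powr s))"
    by (rule hausdorff_premeasure_le_cover) (auto simp: V_def U split: prod.split)
  also have "\<dots> = (\<Sum>i. (\<lambda>p. ennreal (diameter (U (fst p) (snd p)) powr s)) (prod_decode i))"
    by (simp add: V_def case_prod_unfold)
  also have "\<dots> = (\<Sum>k. \<Sum>l. ennreal (diameter (U k l) powr s))"
    by (rule suminf_ennreal_2dimen) simp
  also have "\<dots> \<le> (\<Sum>k. hausdorff_premeasure s \<delta> (A k) + ennreal (e * (1/2) ^ Suc k))"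
    by (rule suminf_le) (use U(4) in \<open>auto intro: less_imp_le\<close>)
  also have "\<dots> = (\<Sum>k. hausdorff_premeasure s \<delta> (A k)) + ennreal e"
    by (simp only: suminf_add[OF summableI summableI, symmetric] suminf_ennreal_half_powers[OF less_imp_le[OF e]])
  finally show "hausdorff_premeasure s \<delta> (\<Union>k. A k) \<le> (\<Sum>k. hausdorff_premeasure s \<delta> (A k)) + ennreal e" .
qed

lemma hausdorff_premeasure_finite_cover:
  fixes A :: "'a::metric_space set"
  assumes "finite F" "A \<subseteq> \<Union>F" "\<And>U x y. U \<in> F \<Longrightarrow> x \<in> U \<Longrightarrow> y \<in> U \<Longrightarrow> dist x y \<le> d"
    and "0 \<le> d" "d \<le> \<delta>" "0 < s"
  shows "hausdorff_premeasure s \<delta> A \<le> ennreal (real (card F) * d powr s)"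
proof -
  obtain f where f: "bij_betw f {0..<card F} F"
    using ex_bij_betw_nat_finite[OF assms(1)] by blast
  \<comment> \<open>The finite cover is padded with empty sets, whose diameter and weight are
    0.\<close>
  define U where "U i = (if i < card F then f i else {})" for i
  have UF: "U i \<in> F" if "i < card F" for i
    using f that by (auto simp: U_def bij_betw_def)
  have dU: "dist x y \<le> d" if "x \<in> U i" "y \<in> U i" for x y i
    using that UF[of i] assms(3) by (cases "i < card F") (auto simp: U_def)
  have bd: "bounded (U i)" for i
    unfolding bounded_two_points using dU by blast
  have di: "diameter (U i) \<le> d" for i
    using dU \<open>0 \<le> d\<close> unfolding diameter_def by (auto intro!: cSUP_least)
  have "A \<subseteq> (\<Union>i. U i)"
  proof
    fix x assume "x \<in> A"
    then obtain W where "W \<in> F" "x \<in> W" using assms(2) by blast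
    then have "W \<in> f ` {0..<card F}" using f by (simp add: bij_betw_def)
    then obtain i where "i < card F" "W = f i" by auto
    then show "x \<in> (\<Union>i. U i)" using \<open>x \<in> W\<close> by (auto simp: U_def intro!: exI[of _ i])
  qed
  then have "hausdorff_premeasure s \<delta> A \<le> (\<Sum>i. ennreal (diameter (U i) powr s))"
    by (rule hausdorff_premeasure_le_cover) (use bd di \<open>d \<le> \<delta>\<close> in \<open>auto intro: order_trans\<close>)
  also have "\<dots> = (\<Sum>i<card F. ennreal (diameter (U i) powr s))"
    using \<open>0 < s\<close> by (intro suminf_finite) (auto simp: U_def)
  also have "\<dots> \<le> (\<Sum>i<card F. ennreal (d powr s))"
    using di bd \<open>0 < s\<close> by (intro sum_mono ennreal_leI powr_mono2) (auto intro: diameter_ge_0)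
  also have "\<dots> = ennreal (real (card F) * d powr s)"
    by (simp add: ennreal_mult ennreal_of_nat_eq_real_of_nat)
  finally show ?thesis .
qed

lemma hausdorff_measure_eq_0_iff:
  "hausdorff_measure s A = 0 \<longleftrightarrow> (\<forall>\<delta>>0. hausdorff_premeasure s \<delta> A = 0)"
proof -
  have "hausdorff_measure s A \<le> 0 \<longleftrightarrow> (\<forall>\<delta>>0. hausdorff_premeasure s \<delta> A \<le> 0)"
    unfolding hausdorff_measure_def SUP_le_iff by auto
  then show ?thesis by simp
qed

lemma hausdorff_measure_UN_eq_0:
  fixes A :: "nat \<Rightarrow> 'a::metric_space set"
  assumes "\<And>k. hausdorff_measure s (A k) = 0" "B \<subseteq> (\<Union>k. A k)"
  shows "hausdorff_measure s B = 0"
  unfolding hausdorff_measure_eq_0_iff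
proof (intro allI impI)
  fix \<delta> :: real assume "0 < \<delta>"
  have "hausdorff_premeasure s \<delta> B \<le> (\<Sum>k. hausdorff_premeasure s \<delta> (A k))"
    using hausdorff_premeasure_mono[OF assms(2)] hausdorff_premeasure_UN by (rule order_trans)
  also have "\<dots> = 0" using assms(1) \<open>0 < \<delta>\<close> by (simp add: hausdorff_measure_eq_0_iff)
  finally show "hausdorff_premeasure s \<delta> B = 0" by simp
qed

text \<open>A Borel-Cantelli lemma for Hausdorff measure: \<open>A\<close> is contained in every
  tail union of the \<open>E l\<close>, so its premeasure is at most each tail of a convergent
  series. The bound is asked for only beyond an \<open>l1\<close> depending on \<delta>, because the
  sets covering \<open>E l\<close> get small only as \<open>l\<close> grows.\<close>

lemma hausdorff_measure_limsup_eq_0: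
  fixes A :: "'a::metric_space set"
  assumes cover: "\<And>l0. A \<subseteq> (\<Union>l. E (l + l0))"
    and bound: "\<And>\<delta>. 0 < \<delta> \<Longrightarrow> \<exists>l1::nat. \<forall>l\<ge>l1. hausdorff_premeasure s \<delta> (E l) \<le> ennreal (g l)"
    and g: "summable g" "\<And>l. 0 \<le> g l"
  shows "hausdorff_measure s A = 0"
  unfolding hausdorff_measure_eq_0_iff
proof (intro allI impI)
  fix \<delta> :: real assume "0 < \<delta>"
  then obtain l1 where l1: "\<And>l. l \<ge> l1 \<Longrightarrow> hausdorff_premeasure s \<delta> (E l) \<le> ennreal (g l)"
    using bound by blast
  have tail: "hausdorff_premeasure s \<delta> A \<le> ennreal (\<Sum>l. g (l + l0))" if "l0 \<ge> l1" for l0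
  proof -
    have "hausdorff_premeasure s \<delta> A \<le> (\<Sum>l. hausdorff_premeasure s \<delta> (E (l + l0)))"
      using hausdorff_premeasure_mono[OF cover] hausdorff_premeasure_UN by (rule order_trans)
    also have "\<dots> \<le> (\<Sum>l. ennreal (g (l + l0)))"
      by (intro suminf_le l1) (use that in auto)
    also have "\<dots> = ennreal (\<Sum>l. g (l + l0))"
      using g by (intro suminf_ennreal2) (auto simp: summable_iff_shift)
    finally show ?thesis .
  qed
  have "(\<lambda>l0. \<Sum>l. g (l + l0)) \<longlonglongrightarrow> 0"
    using suminf_exist_split2[OF g(1)] .
  then have lim: "(\<lambda>l0. ennreal (\<Sum>l. g (l + l0))) \<longlonglongrightarrow> 0"
    by (metis ennreal_0 tendsto_ennrealI)
  have "hausdorff_premeasure s \<delta> A \<le> 0"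
    by (rule tendsto_lowerbound[OF lim])
       (use tail in \<open>auto simp: eventually_sequentially intro!: exI[of _ l1]\<close>)
  then show "hausdorff_premeasure s \<delta> A = 0" by simp
qed

text \<open>
  The balls are only required to have a measurable superset of small measure, so that no
  measurability of the map \<open>X\<close> is involved.
\<close>

lemma mass_distribution_hausdorff:
  fixes X :: "'w \<Rightarrow> 'a::metric_space"
  assumes G: "G \<in> sets M" "emeasure M G \<noteq> 0" "emeasure M G \<noteq> top" and E: "X ` G \<subseteq> E"
    and s: "0 < s" and C: "0 < C" and r0: "0 < r0"
    and ball: "\<And>x r. 0 < r \<Longrightarrow> r \<le> r0 \<Longrightarrow>
        \<exists>V\<in>sets M. {w\<in>G. dist x (X w) \<le> r} \<subseteq> V \<and> emeasure M V \<le> ennreal (C * r powr s)"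
  shows "hausdorff_measure s E \<noteq> 0"
proof
  assume "hausdorff_measure s E = 0"
  then have zero: "hausdorff_premeasure s r0 E = 0"
    using r0 by (simp add: hausdorff_measure_eq_0_iff)
  define m where "m = measure M G"
  have m1: "emeasure M G = ennreal m" using G(3) by (simp add: m_def emeasure_eq_ennreal_measure)
  then have "m \<noteq> 0" using G(2) by auto
  then have m: "emeasure M G = ennreal m" "0 < m" using m1 by (simp_all add: m_def less_le)
  \<comment> \<open>Chosen so that the final estimate of the mass of \<open>G\<close> is
    \<open>C * (e + e) = m / 2\<close>, a contradiction.\<close>
  define e where "e = m / (4 * C)"
  have e: "0 < e" using m C by (simp add: e_def)
  have "hausdorff_premeasure s r0 E < ennreal e" using zero e by simp
  then obtain U where U: "E \<subseteq> (\<Union>i. U i)" "\<And>i::nat. bounded (U i)" "\<And>i. diameter (U i) \<le> r0"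
    "(\<Sum>i. ennreal (diameter (U i) powr s)) < ennreal e"
    by (rule hausdorff_premeasure_lessE) (use that in blast)
  \<comment> \<open>The ball bound needs positive radii, so a set of diameter 0 gets an artificial
    radius, so small that its weight is at most the \<open>i\<close>-th term of a series with sum
    \<open>e\<close>.\<close>
  define q where "q i = (if diameter (U i) = 0 then min r0 ((e * (1/2) ^ Suc i) powr (1/s)) else diameter (U i))" for i
  have dge: "0 \<le> diameter (U i)" for i using U(2) by (rule diameter_ge_0)
  have q: "0 < q i" "q i \<le> r0" "diameter (U i) \<le> q i" for i
  proof -
    define t where "t = (e * (1/2) ^ Suc i) powr (1/s)"
    have "0 < t" "q i = (if diameter (U i) = 0 then min r0 t else diameter (U i))"
      using e by (auto simp: t_def q_def)
    then show "0 < q i" "q i \<le> r0" "diameter (U i) \<le> q i"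
      using dge[of i] r0 U(3)[of i] by auto
  qed
  have qs: "q i powr s \<le> diameter (U i) powr s + e * (1/2) ^ Suc i" for i
  proof (cases "diameter (U i) = 0")
    case True
    have "q i powr s \<le> ((e * (1/2) ^ Suc i) powr (1/s)) powr s"
      using True s q(1)[of i] by (intro powr_mono2) (auto simp: q_def)
    also have "\<dots> = e * (1/2) ^ Suc i" using s e by (simp add: powr_powr)
    finally show ?thesis using True s by simp
  qed (use e in \<open>auto simp: q_def\<close>)
  have "\<forall>i. \<exists>V. V \<in> sets M \<and> {w\<in>G. X w \<in> U i} \<subseteq> V \<and> emeasure M V \<le> ennreal (C * q i powr s)"
  proof
    fix i
    show "\<exists>V. V \<in> sets M \<and> {w\<in>G. X w \<in> U i} \<subseteq> V \<and> emeasure M V \<le> ennreal (C * q i powr s)"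
    proof (cases "U i = {}")
      case False
      then obtain x where x: "x \<in> U i" by blast
      have "{w\<in>G. X w \<in> U i} \<subseteq> {w\<in>G. dist x (X w) \<le> q i}"
        using diameter_bounded_bound[OF U(2) x] q(3)[of i] by (auto intro: order_trans)
      with ball[OF q(1)[of i] q(2)[of i], of x] show ?thesis by blast
    qed (auto intro!: exI[of _ "{}"])
  qed
  from choice[OF this] obtain V where V: "\<And>i. V i \<in> sets M" "\<And>i. {w\<in>G. X w \<in> U i} \<subseteq> V i"
    "\<And>i. emeasure M (V i) \<le> ennreal (C * q i powr s)" by auto
  have "G \<subseteq> (\<Union>i. V i)"
  proof
    fix w assume w: "w \<in> G"
    then obtain i where "X w \<in> U i" using E U(1) by blast
    then show "w \<in> (\<Union>i. V i)" using V(2)[of i] w by blast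
  qed
  then have "emeasure M G \<le> emeasure M (\<Union>i. V i)" using V(1) by (intro emeasure_mono) auto
  also have "\<dots> \<le> (\<Sum>i. emeasure M (V i))" using V(1) by (intro emeasure_subadditive_countably) auto
  also have "\<dots> \<le> (\<Sum>i. ennreal (C * (diameter (U i) powr s + e * (1/2) ^ Suc i)))"
    using C qs by (intro suminf_le order_trans[OF V(3)] ennreal_leI mult_left_mono) (auto simp: less_imp_le)
  also have "\<dots> = ennreal C * (\<Sum>i. ennreal (diameter (U i) powr s) + ennreal (e * (1/2) ^ Suc i))"
    using C e by (subst ennreal_suminf_cmult[symmetric]) (simp add: ennreal_mult ennreal_plus[symmetric] del: ennreal_plus)
  also have "\<dots> = ennreal C * ((\<Sum>i. ennreal (diameter (U i) powr s)) + ennreal e)"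
    by (simp only: suminf_add[OF summableI summableI, symmetric] suminf_ennreal_half_powers[OF less_imp_le[OF e]])
  also have "\<dots> \<le> ennreal C * (ennreal e + ennreal e)"
    using U(4) by (intro mult_left_mono add_mono) (auto simp: less_imp_le)
  also have "\<dots> = ennreal (m / 2)"
    using C e by (simp add: ennreal_plus[symmetric] ennreal_mult[symmetric] e_def del: ennreal_plus)
  finally show False using m by (simp add: ennreal_le_iff2)
qed

text \<open>A sequence of radii suffices here, in contrast to the Hausdorff version: the packing
  premeasure is an infimum over \<delta> of suprema over all packings, so one scale below each
  \<delta> can be tested. A maximal \<open>2 * r k\<close>-separated subset of a piece carries
  disjoint balls of radius \<open>r k\<close>, and balls of twice that radius about its points cover
  the piece.\<close>

lemma mass_distribution_packing:
  fixes X :: "'w \<Rightarrow> 'a::metric_space"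
  assumes G: "G \<in> sets M" "emeasure M G \<noteq> 0" "emeasure M G \<noteq> top" and E: "X ` G \<subseteq> E"
    and C: "0 < C" and r: "\<And>k::nat. 0 < r k" "r \<longlonglongrightarrow> 0"
    and ball: "\<And>x k. \<exists>V\<in>sets M. {w\<in>G. dist x (X w) \<le> 2 * r k} \<subseteq> V \<and>
        emeasure M V \<le> ennreal (C * (2 * r k) powr s)"
  shows "packing_measure s E \<noteq> 0"
proof
  assume zero: "packing_measure s E = 0"
  define m where "m = measure M G"
  have m1: "emeasure M G = ennreal m" using G(3) by (simp add: m_def emeasure_eq_ennreal_measure)
  then have "m \<noteq> 0" using G(2) by auto
  then have m: "emeasure M G = ennreal m" "0 < m" using m1 by (simp_all add: m_def less_le)
  define e where "e = m / (4 * C)"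
  have e: "0 < e" using m C by (simp add: e_def)
  obtain F :: "nat \<Rightarrow> 'a set" where F: "E \<subseteq> (\<Union>i. F i)" "(\<Sum>i. packing_premeasure s (F i)) < ennreal e"
  proof -
    have "packing_measure s E < ennreal e" using zero e by simp
    then show ?thesis using that unfolding packing_measure_def INF_less_iff by auto
  qed
  have fin: "packing_premeasure s (F i) < top" for i
    using F(2) by (meson ennreal_suminf_lessD less_trans ennreal_less_top)
  have "\<forall>i. \<exists>V. V \<in> sets M \<and> {w\<in>G. X w \<in> F i} \<subseteq> V \<and>
     emeasure M V \<le> ennreal C * (packing_premeasure s (F i) + ennreal (e * (1/2) ^ Suc i))"
  proof
    fix i
    define b where "b = packing_premeasure s (F i) + ennreal (e * (1/2) ^ Suc i)"
    have "packing_premeasure s (F i) < b"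
      using fin[of i] e by (simp add: b_def ennreal_add_left_cancel_less[of _ 0, simplified])
    then obtain \<delta> where \<delta>: "0 < \<delta>" "(SUP C \<in> delta_packings \<delta> (F i). \<Sum>(x, r) \<in> C. ennreal ((2 * r) powr s)) < b"
      unfolding packing_premeasure_def INF_less_iff by auto
    have btop: "b < top" using fin[of i] by (simp add: b_def)
    obtain k where k: "r k < \<delta>"
      using order_tendstoD(2)[OF r(2) \<delta>(1)] by (auto simp: eventually_sequentially)
    define rr where "rr = r k"
    \<comment> \<open>Separated sets are packings with a common radius. The finite packing sum
      bounds their cardinality, so one of maximal cardinality exists, and no point of
      \<open>F i\<close> can be far from it.\<close>
    define \<P> where "\<P> = {S. finite S \<and> S \<subseteq> F i \<and> pairwise (\<lambda>x y. 2 * rr < dist x y) S}"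
    have cardb: "ennreal (real (card S)) * ennreal ((2 * rr) powr s) \<le> b" if "S \<in> \<P>" for S
    proof -
      have "(\<lambda>x. (x, rr)) ` S \<in> delta_packings \<delta> (F i)"
      proof -
        have "disjnt (cball x rr) (cball y rr)" if "2 * rr < dist x y" for x y :: 'a
        proof -
          have False if "dist x z \<le> rr" "dist y z \<le> rr" for z
            using \<open>2 * rr < dist x y\<close> that dist_triangle2[of x y z] by simp
          then show ?thesis by (auto simp: disjnt_def)
        qed
        then show ?thesis
          using \<open>S \<in> \<P>\<close> k r(1)[of k] unfolding delta_packings_def \<P>_def rr_def
          by (auto simp: pairwise_def)
      qed
      then have "(\<Sum>(x, r) \<in> (\<lambda>x. (x, rr)) ` S. ennreal ((2 * r) powr s)) \<le>
          (SUP C \<in> delta_packings \<delta> (F i). \<Sum>(x, r) \<in> C. ennreal ((2 * r) powr s))"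
        by (rule SUP_upper)
      also have "\<dots> \<le> b" using \<delta>(2) by simp
      also have "(\<Sum>(x, r) \<in> (\<lambda>x. (x, rr)) ` S. ennreal ((2 * r) powr s)) = (\<Sum>x\<in>S. ennreal ((2 * rr) powr s))"
        by (subst sum.reindex) (auto simp: inj_on_def)
      finally show ?thesis by (simp add: ennreal_of_nat_eq_real_of_nat)
    qed
    have pos: "0 < (2 * rr) powr s" using r(1)[of k] by (simp add: rr_def)
    have cardb': "real (card S) \<le> enn2real b / (2 * rr) powr s" if "S \<in> \<P>" for S
    proof -
      have "ennreal (real (card S) * (2 * rr) powr s) \<le> ennreal (enn2real b)"
        using cardb[OF that] btop by (simp add: ennreal_mult)
      then show ?thesis using pos
        by (subst (asm) ennreal_le_iff) (auto simp: field_simps)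
    qed
    have "\<exists>m. (\<exists>T\<in>\<P>. card T = m) \<and> (\<forall>m'. (\<exists>T\<in>\<P>. card T = m') \<longrightarrow> m' \<le> m)"
    proof (rule Nat.ex_has_greatest_nat[where P = "\<lambda>m. \<exists>T\<in>\<P>. card T = m"])
      show "\<exists>T\<in>\<P>. card T = 0" by (intro bexI[of _ "{}"]) (auto simp: \<P>_def)
      have "card T \<le> nat \<lceil>enn2real b / (2 * rr) powr s\<rceil>" if "T \<in> \<P>" for T
        using cardb'[OF that] real_nat_ceiling_ge[of "enn2real b / (2 * rr) powr s"] by linarith
      then show "\<forall>m. (\<exists>T\<in>\<P>. card T = m) \<longrightarrow> m \<le> nat \<lceil>enn2real b / (2 * rr) powr s\<rceil>" by blast
    qed
    then obtain S where S: "S \<in> \<P>" "\<And>T. T \<in> \<P> \<Longrightarrow> card T \<le> card S" by blast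
    have near: "\<exists>x\<in>S. dist x y \<le> 2 * rr" if "y \<in> F i" for y
    proof (rule ccontr)
      assume "\<not> (\<exists>x\<in>S. dist x y \<le> 2 * rr)"
      then have far: "\<And>x. x \<in> S \<Longrightarrow> 2 * rr < dist x y" by force
      have "y \<notin> S" using far[of y] r(1)[of k] by (auto simp: rr_def)
      have "insert y S \<in> \<P>"
        using S(1) that far by (auto simp: \<P>_def pairwise_insert dist_commute)
      then have "card (insert y S) \<le> card S" by (rule S(2))
      moreover have "finite S" using S(1) by (simp add: \<P>_def)
      ultimately show False using \<open>y \<notin> S\<close> by simp
    qed
    have "\<forall>x. \<exists>V\<in>sets M. {w\<in>G. dist x (X w) \<le> 2 * rr} \<subseteq> V \<and>
        emeasure M V \<le> ennreal (C * (2 * rr) powr s)"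
      using ball unfolding rr_def by blast
    then have "\<forall>x. \<exists>V. V \<in> sets M \<and> {w\<in>G. dist x (X w) \<le> 2 * rr} \<subseteq> V \<and>
        emeasure M V \<le> ennreal (C * (2 * rr) powr s)" by blast
    from choice[OF this] obtain V where V: "\<And>x. V x \<in> sets M"
      "\<And>x. {w\<in>G. dist x (X w) \<le> 2 * rr} \<subseteq> V x"
      "\<And>x. emeasure M (V x) \<le> ennreal (C * (2 * rr) powr s)" by auto
    have "finite S" using S by (simp add: \<P>_def)
    have "emeasure M (\<Union>x\<in>S. V x) \<le> (\<Sum>x\<in>S. emeasure M (V x))"
      using V(1) \<open>finite S\<close> by (intro emeasure_subadditive_finite) auto
    also have "\<dots> \<le> (\<Sum>x\<in>S. ennreal (C * (2 * rr) powr s))" by (intro sum_mono V)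
    also have "\<dots> = ennreal C * (ennreal (real (card S)) * ennreal ((2 * rr) powr s))"
      using C by (simp add: ennreal_mult ennreal_of_nat_eq_real_of_nat ac_simps)
    also have "\<dots> \<le> ennreal C * b" by (intro mult_left_mono cardb S) auto
    finally have "emeasure M (\<Union>x\<in>S. V x) \<le> ennreal C * b" .
    moreover have "{w\<in>G. X w \<in> F i} \<subseteq> (\<Union>x\<in>S. V x)" using near V(2) by fast
    moreover have "(\<Union>x\<in>S. V x) \<in> sets M" using V(1) \<open>finite S\<close> by auto
    ultimately show "\<exists>V. V \<in> sets M \<and> {w\<in>G. X w \<in> F i} \<subseteq> V \<and> emeasure M V \<le>
        ennreal C * (packing_premeasure s (F i) + ennreal (e * (1/2) ^ Suc i))"
      unfolding b_def by blast
  qed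
  from choice[OF this] obtain V where V: "\<And>i. V i \<in> sets M" "\<And>i. {w\<in>G. X w \<in> F i} \<subseteq> V i"
    "\<And>i. emeasure M (V i) \<le> ennreal C * (packing_premeasure s (F i) + ennreal (e * (1/2) ^ Suc i))"
    by (auto simp del: power_Suc)
  have "G \<subseteq> (\<Union>i. V i)"
  proof
    fix w assume w: "w \<in> G"
    then obtain i where "X w \<in> F i" using E F(1) by blast
    then show "w \<in> (\<Union>i. V i)" using V(2)[of i] w by blast
  qed
  then have "emeasure M G \<le> emeasure M (\<Union>i. V i)" using V(1) by (intro emeasure_mono) auto
  also have "\<dots> \<le> (\<Sum>i. emeasure M (V i))" using V(1) by (intro emeasure_subadditive_countably) auto
  also have "\<dots> \<le> (\<Sum>i. ennreal C * (packing_premeasure s (F i) + ennreal (e * (1/2) ^ Suc i)))"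
    by (intro suminf_le V) auto
  also have "\<dots> = ennreal C * ((\<Sum>i. packing_premeasure s (F i)) + ennreal e)"
    by (simp only: ennreal_suminf_cmult suminf_add[OF summableI summableI, symmetric]
        suminf_ennreal_half_powers[OF less_imp_le[OF e]])
  also have "\<dots> \<le> ennreal C * (ennreal e + ennreal e)"
    using F(2) by (intro mult_left_mono add_mono) (auto simp: less_imp_le)
  also have "\<dots> = ennreal (m / 2)"
    using C e by (simp add: ennreal_plus[symmetric] ennreal_mult[symmetric] e_def del: ennreal_plus)
  finally show False using m by (simp add: ennreal_le_iff2)
qed

text \<open>A box counting criterion: packing sums are sorted by the dyadic size of the radius.
  Balls of one size class have centres so far apart that a set of the cover at that scale contains
  at most one of them, which bounds their number by a multiple of \<open>2 powr (t * k)\<close>. At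
  an exponent \<open>s > t\<close> the classes form a geometric series, whose tail vanishes with
  \<delta>.\<close>

lemma packing_premeasure_eq_0:
  fixes F :: "'a::metric_space set"
  assumes \<rho>0: "0 < \<rho>0" and ts: "t < s" and K: "0 \<le> K"
    and cov: "\<And>\<rho>. 0 < \<rho> \<Longrightarrow> \<rho> < \<rho>0 \<Longrightarrow> \<exists>\<U>. finite \<U> \<and> F \<subseteq> \<Union>\<U> \<and>
        (\<forall>U\<in>\<U>. \<forall>x\<in>U. \<forall>y\<in>U. dist x y \<le> \<rho>) \<and> real (card \<U>) \<le> K * \<rho> powr (- t)"
  shows "packing_premeasure s F = 0"
proof -
  have card_sep: "real (card S) \<le> K * \<rho> powr (- t)"
    if S: "finite S" "S \<subseteq> F" "pairwise (\<lambda>x y. \<rho> < dist x y) S" "0 < \<rho>" "\<rho> < \<rho>0" for S \<rho>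
  proof -
    obtain \<U> where \<U>: "finite \<U>" "F \<subseteq> \<Union>\<U>" "\<And>U x y. U \<in> \<U> \<Longrightarrow> x \<in> U \<Longrightarrow> y \<in> U \<Longrightarrow> dist x y \<le> \<rho>"
      "real (card \<U>) \<le> K * \<rho> powr (- t)" using cov[OF S(4,5)] by metis
    have "\<forall>x\<in>S. \<exists>U. U \<in> \<U> \<and> x \<in> U" using S(2) \<U>(2) by blast
    then obtain f where f: "\<And>x. x \<in> S \<Longrightarrow> f x \<in> \<U> \<and> x \<in> f x" by metis
    have "inj_on f S"
    proof (rule inj_onI)
      fix x y assume "x \<in> S" "y \<in> S" "f x = f y"
      then have "dist x y \<le> \<rho>" using \<U>(3)[of "f x" x y] f by auto
      then show "x = y" using S(3) \<open>x \<in> S\<close> \<open>y \<in> S\<close> by (force simp: pairwise_def)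
    qed
    then have "card S \<le> card \<U>" using f \<U>(1) by (intro card_inj_on_le) auto
    then show ?thesis using \<U>(4) by linarith
  qed
  define \<theta> where "\<theta> = (1/2::real) powr (s - t)"
  have \<theta>: "0 < \<theta>" "\<theta> < 1"
  proof -
    have "\<theta> < (1/2) powr 0" unfolding \<theta>_def using ts by (intro powr_less_mono') auto
    then show "\<theta> < 1" by simp
  qed (simp add: \<theta>_def)
  \<comment> \<open>\<open>2 powr s\<close> comes from passing from radius to diameter,
    \<open>2 powr \<bar>s\<bar>\<close> from replacing a radius between \<open>(1/2) ^ Suc k\<close>
    and \<open>(1/2) ^ k\<close> by the smaller value, for either sign of \<open>s\<close>.\<close>
  define g where "g k = K * 2 powr s * 2 powr \<bar>s\<bar> * \<theta> ^ k" for k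
  have sg: "summable g" unfolding g_def using \<theta> by (intro summable_mult summable_geometric) auto
  have g0: "0 \<le> g k" for k using K \<theta> by (simp add: g_def)
  have key: "(\<Sum>(x, r) \<in> C. ennreal ((2 * r) powr s)) \<le> ennreal (\<Sum>k. g (k + k0))"
    if k0: "(1/2) ^ k0 < \<rho>0" and C: "C \<in> delta_packings ((1/2) ^ k0) F" for C k0
  proof -
    have finC: "finite C" and Cr: "\<And>x r. (x, r) \<in> C \<Longrightarrow> x \<in> F \<and> 0 < r \<and> r \<le> (1/2) ^ k0"
      and Cd: "pairwise (\<lambda>(x, r) (y, t). disjnt (cball x r) (cball y t)) C"
      using C by (auto simp: delta_packings_def)
    have "\<exists>k\<ge>k0. (1/2) ^ Suc k < r \<and> r \<le> (1/2) ^ k" if "(x, r) \<in> C" for x r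
    proof -
      have r: "0 < r" "r \<le> (1/2) ^ k0" using Cr[OF that] by auto
      obtain N where N: "(1/2) ^ N < r" using r(1) by (metis real_arch_pow_inv half_gt_zero_iff less_eq_real_def one_less_numeral_iff semiring_norm(76) divide_less_eq_1_pos zero_less_numeral)
      define k where "k = (LEAST k. (1/2) ^ Suc k < r)"
      have ex: "(1/2) ^ Suc N < r" using N zero_less_power[of "1/2::real" N] unfolding power_Suc by linarith
      have k1: "(1/2) ^ Suc k < r" unfolding k_def by (rule LeastI[of "\<lambda>k. (1/2) ^ Suc k < r", OF ex])
      have "k0 \<le> k"
      proof (rule ccontr)
        assume "\<not> k0 \<le> k"
        then have "(1/2::real) ^ k0 \<le> (1/2) ^ Suc k" by (intro power_decreasing) auto
        then show False using k1 r by linarith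
      qed
      moreover have "r \<le> (1/2) ^ k"
      proof (cases "k = k0")
        case False
        then obtain k' where k': "k = Suc k'" using \<open>k0 \<le> k\<close> by (cases k) auto
        have "\<not> (1/2) ^ Suc k' < r" using not_less_Least[of k' "\<lambda>k. (1/2) ^ Suc k < r"] k' k_def by simp
        then show ?thesis using k' by simp
      qed (use r in simp)
      ultimately show ?thesis using k1 by blast
    qed
    then have "\<forall>c\<in>C. \<exists>k\<ge>k0. (1/2) ^ Suc k < snd c \<and> snd c \<le> (1/2) ^ k" by force
    then obtain kk where kk: "\<And>c. c \<in> C \<Longrightarrow> k0 \<le> kk c \<and> (1/2) ^ Suc (kk c) < snd c \<and> snd c \<le> (1/2) ^ kk c"
      by metis
    have part: "(\<Sum>c | c \<in> C \<and> kk c = k. (2 * snd c) powr s) \<le> g k" if "k0 \<le> k" for k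
    proof -
      define Ck where "Ck = {c\<in>C. kk c = k}"
      have "finite Ck" using finC by (simp add: Ck_def)
      have rk: "(1/2) ^ Suc k < r" "r \<le> (1/2) ^ k" if "(x, r) \<in> Ck" for x r
        using kk[of "(x, r)"] that by (auto simp: Ck_def)
      \<comment> \<open>Both radii exceed \<open>(1/2) ^ Suc k\<close>, so centres no farther apart
        than that would put \<open>y\<close> into both balls.\<close>
      have sep: "(1/2) ^ Suc k < dist x y" if "(x, r) \<in> Ck" "(y, t) \<in> Ck" "(x, r) \<noteq> (y, t)" for x y r t
      proof (rule ccontr)
        assume "\<not> (1/2) ^ Suc k < dist x y"
        then have "y \<in> cball x r" "y \<in> cball y t" using rk[OF that(1)] rk[OF that(2)] by (auto intro: less_imp_le order_trans)
        moreover have "disjnt (cball x r) (cball y t)"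
          using Cd that by (force simp: pairwise_def Ck_def)
        ultimately show False by (auto simp: disjnt_def)
      qed
      have inj: "inj_on fst Ck"
      proof (rule inj_onI)
        fix c d assume "c \<in> Ck" "d \<in> Ck" "fst c = fst d"
        then show "c = d" using sep[of "fst c" "snd c" "fst d" "snd d"]
          by (metis dist_self prod.collapse not_less_iff_gr_or_eq zero_less_power half_gt_zero zero_less_one)
      qed
      have "real (card (fst ` Ck)) \<le> K * ((1/2) ^ Suc k) powr (- t)"
      proof (rule card_sep)
        show "pairwise (\<lambda>x y. (1/2) ^ Suc k < dist x y) (fst ` Ck)"
          using sep by (force simp: pairwise_def)
        have "(1/2::real) ^ Suc k \<le> (1/2) ^ k0" using that by (intro power_decreasing) auto
        then show "(1/2) ^ Suc k < \<rho>0" using k0 by linarith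
        show "fst ` Ck \<subseteq> F" using Cr by (force simp: Ck_def)
      qed (use \<open>finite Ck\<close> in auto)
      then have cb: "real (card Ck) \<le> K * ((1/2) ^ Suc k) powr (- t)" using inj by (simp add: card_image)
      have each: "(2 * r) powr s \<le> 2 powr s * 2 powr \<bar>s\<bar> * ((1/2) ^ Suc k) powr s" if "(x, r) \<in> Ck" for x r
      proof -
        have r: "(1/2) ^ Suc k < r" "r \<le> 2 * (1/2) ^ Suc k" using rk[OF that] by auto
        have "0 < r" using r(1) zero_less_power[of "1/2::real" "Suc k"] by linarith
        have "r powr s \<le> 2 powr \<bar>s\<bar> * ((1/2) ^ Suc k) powr s"
        proof (cases "0 \<le> s")
          case True
          have "r powr s \<le> (2 * (1/2) ^ Suc k) powr s" using r True \<open>0 < r\<close> by (intro powr_mono2) auto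
          then show ?thesis using True by (subst (asm) powr_mult) auto
        next
          case False
          have "r powr s \<le> ((1/2) ^ Suc k) powr s"
            using r(1) False by (intro powr_mono2') auto
          also have "\<dots> \<le> 2 powr \<bar>s\<bar> * ((1/2) ^ Suc k) powr s"
            using ge_one_powr_ge_zero[of 2 "\<bar>s\<bar>"] by (simp add: mult_le_cancel_right1)
          finally show ?thesis .
        qed
        then show ?thesis using \<open>0 < r\<close> by (simp add: powr_mult mult.assoc)
      qed
      have "(\<Sum>c\<in>Ck. (2 * snd c) powr s) \<le> (\<Sum>c\<in>Ck. 2 powr s * 2 powr \<bar>s\<bar> * ((1/2) ^ Suc k) powr s)"
        using each by (intro sum_mono) (auto simp del: power_Suc)
      also have "\<dots> = real (card Ck) * (2 powr s * 2 powr \<bar>s\<bar> * ((1/2) ^ Suc k) powr s)" by simp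
      also have "\<dots> \<le> (K * ((1/2) ^ Suc k) powr (- t)) * (2 powr s * 2 powr \<bar>s\<bar> * ((1/2) ^ Suc k) powr s)"
        by (intro mult_right_mono cb) auto
      also have "\<dots> = K * 2 powr s * 2 powr \<bar>s\<bar> * ((1/2) ^ Suc k) powr (s - t)"
        by (simp add: powr_diff powr_minus field_simps del: power_Suc)
      also have "((1/2::real) ^ Suc k) powr (s - t) = \<theta> ^ Suc k"
        unfolding \<theta>_def by (simp add: powr_powr powr_realpow[symmetric] ac_simps del: power_Suc)
      also have "K * 2 powr s * 2 powr \<bar>s\<bar> * \<theta> ^ Suc k \<le> g k"
        unfolding g_def using K \<theta> by (intro mult_left_mono power_decreasing) auto
      finally show ?thesis by (simp add: Ck_def)
    qed
    have "(\<Sum>(x, r) \<in> C. ennreal ((2 * r) powr s)) = ennreal (\<Sum>c\<in>C. (2 * snd c) powr s)"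
      by (simp add: case_prod_unfold sum_ennreal)
    also have "(\<Sum>c\<in>C. (2 * snd c) powr s) = (\<Sum>k\<in>kk ` C. \<Sum>c | c \<in> C \<and> kk c = k. (2 * snd c) powr s)"
      using finC by (rule sum.image_gen)
    also have "\<dots> \<le> (\<Sum>k\<in>kk ` C. g k)" using kk by (intro sum_mono part) auto
    also have "\<dots> = (\<Sum>k\<in>(\<lambda>k. k - k0) ` kk ` C. g (k + k0))"
      using kk by (intro sum.reindex_bij_witness[of _ "\<lambda>k. k + k0" "\<lambda>k. k - k0"]) force+
    also have "\<dots> \<le> (\<Sum>k. g (k + k0))"
      using finC g0 sg by (intro sum_le_suminf) (auto simp: summable_iff_shift)
    finally show ?thesis by (simp add: ennreal_leI)
  qed
  have upper: "packing_premeasure s F \<le> ennreal (\<Sum>k. g (k + k0))" if "(1/2) ^ k0 < \<rho>0" for k0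
    unfolding packing_premeasure_def
    by (rule INF_lower2[of "(1/2) ^ k0"]) (auto intro!: SUP_least key[OF that])
  have "(\<lambda>k0. \<Sum>k. g (k + k0)) \<longlonglongrightarrow> 0"
    using suminf_exist_split2[OF sg] .
  then have lim: "(\<lambda>k0. ennreal (\<Sum>k. g (k + k0))) \<longlonglongrightarrow> 0"
    by (metis ennreal_0 tendsto_ennrealI)
  have "(\<lambda>k. (1/2::real) ^ k) \<longlonglongrightarrow> 0" by (rule LIMSEQ_power_zero) simp
  then have "\<forall>\<^sub>F k in sequentially. (1/2) ^ k < \<rho>0" using \<rho>0 by (rule order_tendstoD(2))
  then have "\<forall>\<^sub>F k in sequentially. packing_premeasure s F \<le> ennreal (\<Sum>j. g (j + k))"
    by eventually_elim (rule upper)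
  then have "packing_premeasure s F \<le> 0"
    by (intro tendsto_lowerbound[OF lim]) auto
  then show ?thesis by simp
qed

lemma packing_measure_eq_0:
  fixes F :: "'i::countable \<Rightarrow> 'a::metric_space set"
  assumes "A \<subseteq> (\<Union>i. F i)" "\<And>i. packing_premeasure s (F i) = 0"
  shows "packing_measure s A = 0"
proof -
  have "x \<in> (\<Union>k. F (from_nat k))" if "x \<in> A" for x
    using assms(1) that by (metis UNIV_I UN_E UN_I from_nat_to_nat subsetD)
  then have "packing_measure s A \<le> (\<Sum>k. packing_premeasure s (F (from_nat k)))"
    unfolding packing_measure_def by (intro INF_lower) auto
  also have "\<dots> = 0" using assms(2) by simp
  finally show ?thesis by simp
qed

section \<open>Dimension bounds from vanishing and non-vanishing measures\<close>

lemma hausdorff_dim_geI: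
  assumes "\<And>s. 0 < s \<Longrightarrow> s < d \<Longrightarrow> hausdorff_measure s A \<noteq> 0"
  shows "ereal d \<le> hausdorff_dim A"
  unfolding hausdorff_dim_def using assms by (intro Inf_greatest) (auto simp: not_less[symmetric])

lemma hausdorff_dim_leI:
  assumes "\<And>s. 0 < s \<Longrightarrow> d < s \<Longrightarrow> hausdorff_measure s A = 0" "0 \<le> d"
  shows "hausdorff_dim A \<le> ereal d"
proof (rule ereal_le_epsilon2)
  fix e :: real assume "0 < e"
  then show "hausdorff_dim A \<le> ereal d + ereal e"
    unfolding hausdorff_dim_def using assms by (intro Inf_lower) (auto intro!: exI[of _ "d + e"])
qed

lemma packing_dim_geI:
  assumes "\<And>s. 0 < s \<Longrightarrow> s < d \<Longrightarrow> packing_measure s A \<noteq> 0"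
  shows "ereal d \<le> packing_dim A"
  unfolding packing_dim_def using assms by (intro Inf_greatest) (auto simp: not_less[symmetric])

lemma packing_dim_leI:
  assumes "\<And>s. 0 < s \<Longrightarrow> d < s \<Longrightarrow> packing_measure s A = 0" "0 \<le> d"
  shows "packing_dim A \<le> ereal d"
proof (rule ereal_le_epsilon2)
  fix e :: real assume "0 < e"
  then show "packing_dim A \<le> ereal d + ereal e"
    unfolding packing_dim_def using assms by (intro Inf_lower) (auto intro!: exI[of _ "d + e"])
qed

section \<open>Upper bounds\<close>

lemma card_separated_le:
  fixes S :: "real set"
  assumes S: "S \<subseteq> {u..u + d}" and \<sigma>: "0 < \<sigma>" and sep: "pairwise (\<lambda>x y. \<sigma> \<le> \<bar>x - y\<bar>) S"
    and d: "0 \<le> d"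
  shows "finite S" "real (card S) \<le> d / \<sigma> + 1"
proof -
  define f where "f x = \<lfloor>(x - u) / \<sigma>\<rfloor>" for x
  have inj: "inj_on f S"
  proof (rule inj_onI, rule ccontr)
    fix x y assume "x \<in> S" "y \<in> S" "f x = f y" "x \<noteq> y"
    then have "\<bar>(x - u) / \<sigma> - (y - u) / \<sigma>\<bar> < 1" unfolding f_def by linarith
    also have "(x - u) / \<sigma> - (y - u) / \<sigma> = (x - y) / \<sigma>" by (simp add: diff_divide_distrib)
    finally have "\<bar>x - y\<bar> < \<sigma>" using \<sigma> by (simp add: field_simps)
    then show False using sep \<open>x \<in> S\<close> \<open>y \<in> S\<close> \<open>x \<noteq> y\<close> by (force simp: pairwise_def)
  qed
  have "f ` S \<subseteq> {0..\<lfloor>d / \<sigma>\<rfloor>}"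
  proof
    fix k assume "k \<in> f ` S"
    then obtain x where x: "x \<in> S" "k = f x" by blast
    then have "0 \<le> (x - u) / \<sigma>" "(x - u) / \<sigma> \<le> d / \<sigma>" using S \<sigma> by (auto simp: divide_le_cancel)
    then show "k \<in> {0..\<lfloor>d / \<sigma>\<rfloor>}" using x(2) by (simp add: f_def floor_mono)
  qed
  then show fin: "finite S" using inj by (meson finite_atLeastAtMost_int finite_imageD finite_subset)
  have "card S \<le> card {0..\<lfloor>d / \<sigma>\<rfloor>}"
    using inj \<open>f ` S \<subseteq> _\<close> by (intro card_inj_on_le) auto
  also have "\<dots> = nat (\<lfloor>d / \<sigma>\<rfloor> + 1)" by simp
  finally have "real (card S) \<le> real_of_int (\<lfloor>d / \<sigma>\<rfloor> + 1)"
  proof -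
    assume "card S \<le> nat (\<lfloor>d / \<sigma>\<rfloor> + 1)"
    moreover have "0 \<le> \<lfloor>d / \<sigma>\<rfloor>" using d \<sigma> by simp
    ultimately show ?thesis by linarith
  qed
  then show "real (card S) \<le> d / \<sigma> + 1" by linarith
qed

text \<open>Values rather than pairs of numerator and denominator: a number with several
  representations counts once, and distinct values are automatically separated.\<close>

definition dyadic_fractions :: "nat \<Rightarrow> real set" where
  "dyadic_fractions k = {real_of_int p / real a |p a. 2 ^ k \<le> a \<and> a < 2 ^ Suc k}"

text \<open>Distinct fractions with denominators below \<open>2 ^ Suc k\<close> differ by at least
  \<open>1 / 4 ^ Suc k\<close>; an interval of length \<open>2 * d\<close> therefore holds at most
  \<open>2 * d * 4 ^ Suc k + 1\<close> of them.\<close>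

lemma card_dyadic_fractions_le:
  assumes "0 \<le> d"
  shows "finite (dyadic_fractions k \<inter> {v - d..v + d})"
    "real (card (dyadic_fractions k \<inter> {v - d..v + d})) \<le> 8 * d * 4 ^ k + 1"
proof -
  have sep: "pairwise (\<lambda>x y. 1 / 4 ^ Suc k \<le> \<bar>x - y\<bar>) (dyadic_fractions k \<inter> {v - d..v + d})"
  proof (rule pairwiseI)
    fix x y assume "x \<in> dyadic_fractions k \<inter> {v - d..v + d}" "y \<in> dyadic_fractions k \<inter> {v - d..v + d}" "x \<noteq> y"
    then obtain p a q b where x: "x = real_of_int p / real a" "2 ^ k \<le> a" "a < 2 ^ Suc k"
      and y: "y = real_of_int q / real b" "2 ^ k \<le> b" "b < 2 ^ Suc k"
      unfolding dyadic_fractions_def by blast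
    have pos: "0 < a" "0 < b" using x(2) y(2) by (auto intro: less_le_trans[of 0 "2 ^ k"])
    have "x - y = real_of_int (p * int b - q * int a) / (real a * real b)"
      using pos by (simp add: x y field_simps)
    moreover have "p * int b - q * int a \<noteq> 0"
      using \<open>x \<noteq> y\<close> calculation by (metis div_0 eq_iff_diff_eq_0 of_int_0)
    then have "1 \<le> \<bar>real_of_int (p * int b - q * int a)\<bar>" by linarith
    ultimately have "1 / (real a * real b) \<le> \<bar>x - y\<bar>"
      using pos by (simp add: abs_mult divide_right_mono)
    moreover have "real a * real b \<le> 2 ^ Suc k * 2 ^ Suc k"
    proof (intro mult_mono)
      show "real a \<le> 2 ^ Suc k" "real b \<le> 2 ^ Suc k"
        using x(3) y(3) by (metis less_imp_le of_nat_le_iff of_nat_numeral of_nat_power)+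
    qed auto
    then have "1 / 4 ^ Suc k \<le> 1 / (real a * real b)"
      using pos by (intro divide_left_mono) (auto simp flip: power_mult_distrib)
    ultimately show "1 / 4 ^ Suc k \<le> \<bar>x - y\<bar>" by linarith
  qed
  have sub: "dyadic_fractions k \<inter> {v - d..v + d} \<subseteq> {v - d..(v - d) + 2 * d}" by auto
  show "finite (dyadic_fractions k \<inter> {v - d..v + d})"
    by (rule card_separated_le(1)[OF sub _ sep]) (use assms in auto)
  have "real (card (dyadic_fractions k \<inter> {v - d..v + d})) \<le> 2 * d / (1 / 4 ^ Suc k) + 1"
    by (rule card_separated_le(2)[OF sub _ sep]) (use assms in auto)
  then show "real (card (dyadic_fractions k \<inter> {v - d..v + d})) \<le> 8 * d * 4 ^ k + 1" by simp
qed

lemma dist_le_of_components: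
  fixes x y :: "real ^ 'n::finite"
  assumes "\<And>i. \<bar>x $ i - y $ i\<bar> \<le> r"
  shows "dist x y \<le> real CARD('n) * r"
proof -
  have "dist x y \<le> (\<Sum>i\<in>UNIV. \<bar>(x - y) $ i\<bar>)" unfolding dist_norm by (rule norm_le_l1_cart)
  also have "\<dots> \<le> real CARD('n) * r" using sum_bounded_above[of UNIV "\<lambda>i. \<bar>(x - y) $ i\<bar>" r] assms by simp
  finally show ?thesis .
qed

lemma hausdorff_premeasure_empty:
  "0 < s \<Longrightarrow> 0 \<le> \<delta> \<Longrightarrow> hausdorff_premeasure s \<delta> ({} :: 'a::metric_space set) = 0"
  using hausdorff_premeasure_finite_cover[of "{}" "{} :: 'a set" 0 \<delta> s] by simp

text \<open>Reduces both upper bounds to counting pairs of approximate values for two coordinates: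
  the other coordinates are covered by a grid of mesh \<rho>. The base
  \<open>(2 * m + 3) / \<rho>\<close> bounds \<open>2 * \<lceil>m / \<rho>\<rceil> + 1\<close>, as
  \<rho> is at most 1.\<close>

lemma grid_cover:
  fixes E :: "(real ^ 'n::finite) set" and \<alpha> \<beta> :: 'n
  assumes ne: "\<alpha> \<noteq> \<beta>" and W: "finite W" and \<rho>: "0 < \<rho>" "\<rho> \<le> 1" and m: "0 \<le> m"
    and E: "\<And>x. x \<in> E \<Longrightarrow> (\<forall>i. \<bar>x $ i\<bar> \<le> m) \<and> (\<exists>(p, q)\<in>W. \<bar>x $ \<alpha> - p\<bar> \<le> \<rho> \<and> \<bar>x $ \<beta> - q\<bar> \<le> \<rho>)"
  shows "\<exists>\<U>. finite \<U> \<and> E \<subseteq> \<Union>\<U> \<and> (\<forall>U\<in>\<U>. \<forall>x\<in>U. \<forall>y\<in>U. dist x y \<le> 2 * real CARD('n) * \<rho>) \<and>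
    real (card \<U>) \<le> real (card W) * ((2 * m + 3) / \<rho>) ^ (CARD('n) - 2)"
proof -
  define R where "R = UNIV - {\<alpha>, \<beta>}"
  have cR: "card R = CARD('n) - 2" using ne by (simp add: R_def card_Diff_subset)
  define I where "I = {- \<lceil>m / \<rho>\<rceil>..\<lceil>m / \<rho>\<rceil>}"
  have "0 \<le> m / \<rho>" using m \<rho> by simp
  then have "0 \<le> \<lceil>m / \<rho>\<rceil>" by linarith
  then have "real (card I) = 2 * real_of_int \<lceil>m / \<rho>\<rceil> + 1" by (simp add: I_def)
  also have "\<dots> \<le> 2 * (m / \<rho>) + 3" by linarith
  also have "\<dots> \<le> (2 * m + 3) / \<rho>" using \<rho> by (simp add: field_simps)
  finally have cI: "real (card I) \<le> (2 * m + 3) / \<rho>" .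
  define G where "G = PiE R (\<lambda>_. I)"
  have cG: "finite G" "card G = card I ^ (CARD('n) - 2)"
    by (auto simp: G_def I_def card_PiE cR intro!: finite_PiE)
  define B :: "(real \<times> real) \<times> ('n \<Rightarrow> int) \<Rightarrow> (real ^ 'n) set" where
    "B w = {x. \<bar>x $ \<alpha> - fst (fst w)\<bar> \<le> \<rho> \<and> \<bar>x $ \<beta> - snd (fst w)\<bar> \<le> \<rho> \<and>
       (\<forall>i\<in>R. \<bar>x $ i - \<rho> * real_of_int (snd w i)\<bar> \<le> \<rho>)}" for w
  define \<U> where "\<U> = B ` (W \<times> G)"
  have "finite \<U>" using W cG by (simp add: \<U>_def)
  moreover have "E \<subseteq> \<Union>\<U>"
  proof
    fix x assume "x \<in> E"
    then obtain p q where x: "\<And>i. \<bar>x $ i\<bar> \<le> m" "(p, q) \<in> W" "\<bar>x $ \<alpha> - p\<bar> \<le> \<rho>" "\<bar>x $ \<beta> - q\<bar> \<le> \<rho>"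
      using E by fast
    define h where "h = restrict (\<lambda>i. \<lfloor>x $ i / \<rho>\<rfloor>) R"
    have "\<lfloor>x $ i / \<rho>\<rfloor> \<in> I" for i
    proof -
      have "\<bar>x $ i / \<rho>\<bar> \<le> m / \<rho>" using x(1)[of i] \<rho> by (simp add: divide_right_mono)
      then have "- (m / \<rho>) \<le> x $ i / \<rho>" "x $ i / \<rho> \<le> m / \<rho>" by linarith+
      then show ?thesis unfolding I_def atLeastAtMost_iff by linarith
    qed
    then have "h \<in> G" by (simp add: h_def G_def)
    moreover have "\<bar>x $ i - \<rho> * real_of_int (h i)\<bar> \<le> \<rho>" if "i \<in> R" for i
    proof -
      have "\<bar>x $ i / \<rho> - real_of_int (h i)\<bar> \<le> 1" using that by (simp add: h_def) linarith
      moreover have "x $ i - \<rho> * real_of_int (h i) = \<rho> * (x $ i / \<rho> - real_of_int (h i))"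
        using \<rho> by (simp add: field_simps)
      ultimately show ?thesis using \<rho> by (simp add: abs_mult mult_left_le)
    qed
    ultimately have "x \<in> B ((p, q), h)" using x by (simp add: B_def)
    then show "x \<in> \<Union>\<U>" using \<open>h \<in> G\<close> x(2) by (auto simp: \<U>_def)
  qed
  moreover have "dist x y \<le> 2 * real CARD('n) * \<rho>" if "U \<in> \<U>" "x \<in> U" "y \<in> U" for U x y
  proof -
    have "\<exists>w. x \<in> B w \<and> y \<in> B w" using that unfolding \<U>_def by blast
    then obtain w where w: "x \<in> B w" "y \<in> B w" by blast
    have "\<bar>x $ i - y $ i\<bar> \<le> 2 * \<rho>" for i
    proof -
      have "i = \<alpha> \<or> i = \<beta> \<or> i \<in> R" by (auto simp: R_def)
      then obtain t where "\<bar>x $ i - t\<bar> \<le> \<rho>" "\<bar>y $ i - t\<bar> \<le> \<rho>" using w unfolding B_def by blast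
      then show ?thesis by linarith
    qed
    then have "dist x y \<le> real CARD('n) * (2 * \<rho>)" by (rule dist_le_of_components)
    then show ?thesis by simp
  qed
  moreover have "real (card \<U>) \<le> real (card W) * ((2 * m + 3) / \<rho>) ^ (CARD('n) - 2)"
  proof -
    have "card \<U> \<le> card (W \<times> G)" unfolding \<U>_def using W cG by (intro card_image_le) auto
    also have "\<dots> = card W * card G" by (rule card_cartesian_product)
    finally have "real (card \<U>) \<le> real (card W) * real (card I) ^ (CARD('n) - 2)"
      using cG by (metis of_nat_le_iff of_nat_mult of_nat_power)
    also have "\<dots> \<le> real (card W) * ((2 * m + 3) / \<rho>) ^ (CARD('n) - 2)"
      by (intro mult_left_mono power_mono cI) auto
    finally show ?thesis .
  qed
  ultimately show ?thesis by blast
qed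

text \<open>
  What remains of the paper's conditions (iv) and (v) for the upper bounds: \<open>c j\<close> and \<open>- P j\<close>
  are the coordinates of the \<open>j\<close>-th best approximation, which alternate between the two lattices.
\<close>

definition interlaced :: "'n::finite \<Rightarrow> 'n \<Rightarrow> (nat \<Rightarrow> nat) \<Rightarrow> (nat \<Rightarrow> int) \<Rightarrow> real ^ 'n \<Rightarrow> bool" where
  "interlaced \<alpha> \<beta> c P x \<longleftrightarrow> (\<forall>j. 0 < c j \<and> c j < c (Suc j) \<and>
     \<bar>real (c j) * x $ (if even j then \<alpha> else \<beta>) - real_of_int (P j)\<bar> \<le> 2 / real (c (Suc j)) ^ CARD('n) \<and>
     P j * int (c (j + 2)) \<noteq> P (j + 2) * int (c j))"

lemma interlaced_ge: "interlaced \<alpha> \<beta> c P x \<Longrightarrow> Suc j \<le> c j"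
proof (induction j)
  case 0 then show ?case by (auto simp: interlaced_def intro: Suc_leI)
next
  case (Suc j)
  then have "Suc j \<le> c j" "c j < c (Suc j)" by (auto simp: interlaced_def)
  then show ?case by linarith
qed

text \<open>The fractions of index \<open>j\<close> and \<open>j + 2\<close> approximate the same
  number and differ, so their determinant is a nonzero integer, and it is a combination of the two
  errors. The later error contributes at most 1/2 because \<open>4 \<le> c (j + 3)\<close>; hence
  \<open>c (j + 2)\<close> times the earlier error bound is at least 1/2.\<close>

lemma interlaced_growth:
  fixes x :: "real ^ 'n::finite"
  assumes i: "interlaced \<alpha> \<beta> c P x" and n: "2 \<le> CARD('n)"
  shows "c (Suc j) ^ CARD('n) \<le> 4 * c (j + 2)"
proof -
  define z a b d y where "z = real (c j)" "a = real (c (Suc j))" "b = real (c (j + 2))" "d = real (c (j + 3))"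
    "y = x $ (if even j then \<alpha> else \<beta>)"
  note defs = this
  have z: "\<bar>z * y - real_of_int (P j)\<bar> \<le> 2 / a ^ CARD('n)"
    using i[unfolded interlaced_def, rule_format, of j] by (simp add: defs)
  have e: "Suc (j + 2) = j + 3" by simp
  have b: "\<bar>b * y - real_of_int (P (j + 2))\<bar> \<le> 2 / d ^ CARD('n)"
    using i[unfolded interlaced_def, rule_format, of "j + 2", unfolded e] by (simp add: defs)
  have lt: "c j < c (Suc j)" "c (Suc j) < c (j + 2)" "c (j + 2) < c (j + 3)"
    using i[unfolded interlaced_def, rule_format, of j] i[unfolded interlaced_def, rule_format, of "Suc j"]
      i[unfolded interlaced_def, rule_format, of "j + 2"] by (auto simp: eval_nat_numeral)
  have pos: "1 \<le> z" "z < a" "a < b" "b < d" "4 \<le> d"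
    using lt interlaced_ge[OF i, of j] interlaced_ge[OF i, of "j + 3"] by (auto simp: defs)
  have "P j * int (c (j + 2)) \<noteq> P (j + 2) * int (c j)" using i by (simp add: interlaced_def)
  then have "1 \<le> \<bar>P j * int (c (j + 2)) - P (j + 2) * int (c j)\<bar>" by linarith
  then have "1 \<le> \<bar>real_of_int (P j * int (c (j + 2)) - P (j + 2) * int (c j))\<bar>" by linarith
  also have "real_of_int (P j * int (c (j + 2)) - P (j + 2) * int (c j)) =
      z * (b * y - real_of_int (P (j + 2))) - b * (z * y - real_of_int (P j))"
    by (simp add: defs algebra_simps)
  also have "\<bar>\<dots>\<bar> \<le> z * (2 / d ^ CARD('n)) + b * (2 / a ^ CARD('n))"
  proof -
    have "\<bar>z * (b * y - real_of_int (P (j + 2)))\<bar> \<le> z * (2 / d ^ CARD('n))"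
      "\<bar>b * (z * y - real_of_int (P j))\<bar> \<le> b * (2 / a ^ CARD('n))"
      using mult_left_mono[OF b, of z] mult_left_mono[OF z, of b] pos by (auto simp: abs_mult)
    then show ?thesis by linarith
  qed
  also have "z * (2 / d ^ CARD('n)) \<le> 1 / 2"
  proof -
    have "d * d \<le> d ^ CARD('n)" using power_increasing[OF n, of d] pos by (simp add: power2_eq_square)
    then have "2 / d ^ CARD('n) \<le> 2 / (d * d)" using pos by (intro divide_left_mono) auto
    then have "z * (2 / d ^ CARD('n)) \<le> d * (2 / (d * d))" using pos by (intro mult_mono) auto
    also have "\<dots> = 2 / d" using pos by simp
    also have "\<dots> \<le> 2 / 4" using pos by (intro divide_left_mono) auto
    finally show ?thesis by simp
  qed
  finally have "1 / 2 \<le> b * (2 / a ^ CARD('n))" by simp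
  moreover have "0 < a ^ CARD('n)" using pos by simp
  ultimately have "a ^ CARD('n) \<le> 4 * b" by (simp add: field_simps)
  then have "real (c (Suc j) ^ CARD('n)) \<le> real (4 * c (j + 2))" by (simp add: defs)
  then show ?thesis by (simp only: of_nat_le_iff)
qed

text \<open>Serves the sum of the covering bounds, where the square counts pairs of dyadic indices
  up to \<open>l\<close>. Two of the three powers keep \<open>(l + 1) * \<phi> ^ l\<close> bounded
  after squaring, and the third remains as a geometric series.\<close>

lemma summable_square_powser:
  fixes \<phi> :: real
  assumes "0 \<le> \<phi>" "\<phi> < 1"
  shows "summable (\<lambda>l. (real l + 1)\<^sup>2 * (\<phi> ^ l) ^ 3)"
proof -
  have "(\<lambda>l. real l * \<phi> ^ l + \<phi> ^ l) \<longlonglongrightarrow> 0 + 0"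
    using assms by (intro tendsto_add powser_times_n_limit_0 LIMSEQ_power_zero) auto
  then have "Bseq (\<lambda>l. real l * \<phi> ^ l + \<phi> ^ l)"
    by (intro convergent_imp_Bseq) (auto simp: convergent_def)
  then obtain B where B: "\<And>l. \<bar>real l * \<phi> ^ l + \<phi> ^ l\<bar> \<le> B" by (auto simp: Bseq_def)
  show ?thesis
  proof (rule summable_comparison_test'[where N = 0])
    show "summable (\<lambda>l. B\<^sup>2 * \<phi> ^ l)" using assms by (intro summable_mult summable_geometric) auto
    fix l
    have "((real l + 1) * \<phi> ^ l)\<^sup>2 \<le> B\<^sup>2"
      using B[of l] assms by (intro power_mono) (auto simp: algebra_simps)
    then have "((real l + 1) * \<phi> ^ l)\<^sup>2 * \<phi> ^ l \<le> B\<^sup>2 * \<phi> ^ l" using assms by (intro mult_right_mono) auto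
    then show "norm ((real l + 1)\<^sup>2 * (\<phi> ^ l) ^ 3) \<le> B\<^sup>2 * \<phi> ^ l"
      using assms by (simp add: power_mult_distrib eval_nat_numeral ac_simps)
  qed
qed

text \<open>Three consecutive fractions \<open>P / z\<close>, \<open>Q / a\<close>,
  \<open>R / b\<close> are used, the outer ones for the same coordinate; \<open>i\<close>,
  \<open>k\<close>, \<open>l\<close> are the binary orders of \<open>z\<close>, \<open>a\<close>,
  \<open>b\<close>. There are about \<open>4 ^ i\<close> and \<open>4 ^ k\<close> values for the
  first two, but \<open>R / b\<close> must be within about \<open>1 / (z * a ^ n)\<close> of
  \<open>P / z\<close>, which leaves \<open>4 ^ l / (2 ^ i * 2 ^ (k * n))\<close> values. Each
  triple fixes the two coordinates up to about \<open>1 / (a * b ^ n)\<close>. At exponent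
  \<open>2 / n\<close> the powers of \<open>b\<close> cancel, and what remains is bounded because
  \<open>z ^ n \<le> 4 * a\<close>; the surplus of \<open>s\<close> makes the sum over
  \<open>l\<close> converge.\<close>

lemma interlaced_hausdorff_null:
  fixes \<alpha> \<beta> :: "'n::finite"
  assumes ne: "\<alpha> \<noteq> \<beta>" and n: "2 \<le> CARD('n)" and s: "real CARD('n) - 2 + 2 / real CARD('n) < s" and m: "0 \<le> m"
  shows "hausdorff_measure s {x :: real ^ 'n. (\<forall>i. \<bar>x $ i\<bar> \<le> m) \<and> (\<exists>c P. interlaced \<alpha> \<beta> c P x)} = 0"
    (is "hausdorff_measure s ?A = 0")
proof -
  define N where "N = CARD('n)"
  define \<epsilon> where "\<epsilon> = s - (real N - 2) - 2 / real N"
  have N: "2 \<le> N" and \<epsilon>: "0 < \<epsilon>" using n s by (auto simp: N_def \<epsilon>_def)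
  have Npos: "0 < real N" using N by simp
  have s0: "0 < s"
  proof -
    have "0 \<le> real CARD('n) - 2" "0 < 2 / real CARD('n)" using n by auto
    then show ?thesis using s by linarith
  qed
  \<comment> \<open>The last error is bounded by means of \<open>b\<close> itself instead of the
    following denominator, so that the set depends on three denominators only.\<close>
  define E3 :: "nat \<Rightarrow> nat \<Rightarrow> nat \<Rightarrow> (real ^ 'n) set" where
    "E3 i k l = {x. (\<forall>i. \<bar>x $ i\<bar> \<le> m) \<and> (\<exists>z a b P Q R. 2 ^ i \<le> z \<and> z < 2 ^ Suc i \<and> 2 ^ k \<le> a \<and> a < 2 ^ Suc k \<and>
        2 ^ l \<le> b \<and> b < 2 ^ Suc l \<and> z < a \<and> a < b \<and> z ^ N \<le> 4 * a \<and> a ^ N \<le> 4 * b \<and>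
        \<bar>real z * x $ \<beta> - real_of_int P\<bar> \<le> 2 / real a ^ N \<and> \<bar>real a * x $ \<alpha> - real_of_int Q\<bar> \<le> 2 / real b ^ N \<and>
        \<bar>real b * x $ \<beta> - real_of_int R\<bar> \<le> 2 / real b ^ N)}" for i k l
  define K where "K = (8 * m + 17)\<^sup>2 * 40 * (2 * m + 3) ^ (N - 2) * (2 * real N) powr s * 8 * 2 powr s"
  \<comment> \<open>The cube of \<open>\<phi> ^ l\<close> is
    \<open>2 powr (- l * N * \<epsilon>)\<close>, the decay of the cover of order \<open>l\<close>;
    the third root prepares for \<open>summable_square_powser\<close>.\<close>
  define \<phi> where "\<phi> = 2 powr (- (real N * \<epsilon> / 3))"
  have \<phi>: "0 < \<phi>" "\<phi> < 1"
  proof -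
    have "\<phi> < 2 powr 0" unfolding \<phi>_def using Npos \<epsilon> by (intro powr_less_mono) auto
    then show "\<phi> < 1" by simp
  qed (simp add: \<phi>_def)
  have K0: "0 \<le> K" using m by (simp add: K_def)
  have E3_bound: "hausdorff_premeasure s \<delta> (E3 i k l) \<le> ennreal (K * (\<phi> ^ l) ^ 3)"
    if \<delta>: "2 * real N * (2 / 2 ^ l) \<le> \<delta>" for i k l \<delta>
  proof (cases "E3 i k l = {}")
    case True
    have "0 \<le> \<delta>" using \<delta> order_trans[of 0 "2 * real N * (2 / 2 ^ l)" \<delta>] by simp
    then show ?thesis using True s0 by (simp add: hausdorff_premeasure_empty)
  next
    case False
    then obtain z a b :: nat where zab: "2 ^ i \<le> z" "z < 2 ^ Suc i" "2 ^ k \<le> a" "a < 2 ^ Suc k"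
        "2 ^ l \<le> b" "b < 2 ^ Suc l" "z < a" "a < b" "z ^ N \<le> 4 * a" "a ^ N \<le> 4 * b"
      unfolding E3_def by blast
    have "(2::nat) ^ i < 2 ^ Suc l" using zab by linarith
    then have il: "i \<le> l" by (subst (asm) power_strict_increasing_iff) auto
    have "(2 ^ i) ^ N \<le> z ^ N" using zab by (intro power_mono) auto
    then have "(2::nat) ^ (i * N) < 2 ^ (k + 3)" using zab by (simp add: power_mult power_add)
    then have iN: "i * N \<le> k + 3" by (subst (asm) power_strict_increasing_iff) auto
    have "(2 ^ k) ^ N \<le> a ^ N" using zab by (intro power_mono) auto
    then have "(2::nat) ^ (k * N) < 2 ^ (l + 3)" using zab by (simp add: power_mult power_add)
    then have kN: "k * N \<le> l + 3" by (subst (asm) power_strict_increasing_iff) auto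
    \<comment> \<open>By the triangle inequality \<open>R / b\<close> and \<open>P / z\<close>
      differ by at most twice \<open>2 / (z * a ^ N)\<close>.\<close>
    define r where "r = 4 / (2 ^ i * 2 ^ (k * N) :: real)"
    define \<rho> where "\<rho> = 2 / (2 ^ k * 2 ^ (l * N) :: real)"
    \<comment> \<open>All approximation errors are at most 2, so fractions near a number bounded by
      \<open>m\<close> are bounded by \<open>m + 2\<close>; the count \<open>8 * (m + 2) + 1\<close>
      is the source of \<open>8 * m + 17\<close>.\<close>
    define A where "A j = dyadic_fractions j \<inter> {0 - (m + 2)..0 + (m + 2)}" for j
    define B where "B v = dyadic_fractions l \<inter> {v - r..v + r}" for v
    define W where "W = (\<Union>v\<in>A i. A k \<times> B v)"
    have finA: "finite (A j)" and cardA: "real (card (A j)) \<le> (8 * m + 17) * 4 ^ j" for j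
    proof -
      show "finite (A j)" unfolding A_def by (rule card_dyadic_fractions_le) (use m in auto)
      have "real (card (A j)) \<le> 8 * (m + 2) * 4 ^ j + 1"
        unfolding A_def by (rule card_dyadic_fractions_le) (use m in auto)
      also have "\<dots> \<le> 8 * (m + 2) * 4 ^ j + 4 ^ j" by simp
      finally show "real (card (A j)) \<le> (8 * m + 17) * 4 ^ j" by (simp add: algebra_simps)
    qed
    have r0: "0 \<le> r" by (simp add: r_def)
    have finB: "finite (B v)" and cardB: "real (card (B v)) \<le> 40 * 4 ^ l / (2 ^ i * 2 ^ (k * N))" for v
    proof -
      show "finite (B v)" unfolding B_def by (rule card_dyadic_fractions_le) (rule r0)
      have "real (card (B v)) \<le> 8 * r * 4 ^ l + 1"
        unfolding B_def by (rule card_dyadic_fractions_le) (rule r0)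
      \<comment> \<open>The interval is not much shorter than the spacing of the fractions, so the
        additive 1 in the count costs only a constant factor.\<close>
      moreover have "(2::real) ^ i * 2 ^ (k * N) \<le> 2 ^ l * 2 ^ (l + 3)"
        using il kN by (intro mult_mono power_increasing) auto
      then have "1 \<le> 8 * (4 ^ l / (2 ^ i * 2 ^ (k * N) :: real))"
        by (simp add: field_simps power_add flip: power_mult_distrib)
      moreover have "8 * r * 4 ^ l = 32 * (4 ^ l / (2 ^ i * 2 ^ (k * N)))" by (simp add: r_def)
      ultimately have "real (card (B v)) \<le> 40 * (4 ^ l / (2 ^ i * 2 ^ (k * N)))" by linarith
      then show "real (card (B v)) \<le> 40 * 4 ^ l / (2 ^ i * 2 ^ (k * N))" by simp
    qed
    have finW: "finite W" unfolding W_def using finA finB by auto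
    have cardW: "real (card W) \<le> (8 * m + 17)\<^sup>2 * 40 * (4 ^ i * 4 ^ k * 4 ^ l / (2 ^ i * 2 ^ (k * N)))"
    proof -
      have "card W \<le> (\<Sum>v\<in>A i. card (A k \<times> B v))" unfolding W_def by (rule card_UN_le[OF finA])
      then have "real (card W) \<le> (\<Sum>v\<in>A i. real (card (A k)) * real (card (B v)))"
        by (simp add: card_cartesian_product flip: of_nat_mult of_nat_sum)
      also have "\<dots> \<le> (\<Sum>v\<in>A i. ((8 * m + 17) * 4 ^ k) * (40 * 4 ^ l / (2 ^ i * 2 ^ (k * N))))"
        using m by (intro sum_mono mult_mono cardA cardB) auto
      also have "\<dots> = real (card (A i)) * (((8 * m + 17) * 4 ^ k) * (40 * 4 ^ l / (2 ^ i * 2 ^ (k * N))))" by simp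
      also have "\<dots> \<le> ((8 * m + 17) * 4 ^ i) * (((8 * m + 17) * 4 ^ k) * (40 * 4 ^ l / (2 ^ i * 2 ^ (k * N))))"
        using m by (intro mult_right_mono cardA) auto
      finally show ?thesis by (simp add: power2_eq_square field_simps)
    qed
    have lN: "l \<le> l * N" using N by simp
    have \<rho>0: "0 < \<rho>" by (simp add: \<rho>_def)
    have \<rho>le: "\<rho> \<le> 2 / 2 ^ l"
    proof -
      have "(1::real) * 2 ^ l \<le> 2 ^ k * 2 ^ (l * N)" using lN by (intro mult_mono power_increasing) auto
      then show ?thesis unfolding \<rho>_def by (intro divide_left_mono) auto
    qed
    have "1 \<le> l" using zab by (cases l) auto
    then have "(2::real) \<le> 2 ^ l" using power_increasing[of 1 l "2::real"] by simp
    then have "2 / 2 ^ l \<le> (1::real)" by simp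
    then have \<rho>1: "\<rho> \<le> 1" using \<rho>le by linarith
    have "\<exists>\<U>. finite \<U> \<and> E3 i k l \<subseteq> \<Union>\<U> \<and> (\<forall>U\<in>\<U>. \<forall>x\<in>U. \<forall>y\<in>U. dist x y \<le> 2 * real CARD('n) * \<rho>) \<and>
       real (card \<U>) \<le> real (card W) * ((2 * m + 3) / \<rho>) ^ (CARD('n) - 2)"
    proof (rule grid_cover[OF ne finW \<rho>0 \<rho>1 m])
      fix x assume "x \<in> E3 i k l"
      then obtain z a b P Q R where x: "\<And>i. \<bar>x $ i\<bar> \<le> m" and zab: "2 ^ i \<le> z" "z < 2 ^ Suc i" "2 ^ k \<le> a" "a < 2 ^ Suc k"
        "2 ^ l \<le> b" "b < 2 ^ Suc l" "z < a" "a < b"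
        and P: "\<bar>real z * x $ \<beta> - real_of_int P\<bar> \<le> 2 / real a ^ N"
        and Q: "\<bar>real a * x $ \<alpha> - real_of_int Q\<bar> \<le> 2 / real b ^ N"
        and R: "\<bar>real b * x $ \<beta> - real_of_int R\<bar> \<le> 2 / real b ^ N"
        unfolding E3_def by blast
      have ge: "(2::real) ^ i \<le> real z" "(2::real) ^ k \<le> real a" "(2::real) ^ l \<le> real b" "1 \<le> real z"
        using zab(1,3,5) order_trans[OF _ zab(1), of 1]
        by (metis of_nat_le_iff of_nat_numeral of_nat_power, metis of_nat_le_iff of_nat_numeral of_nat_power,
            metis of_nat_le_iff of_nat_numeral of_nat_power, simp)
      have pos: "0 < real z" "real z < real a" "real a < real b" using ge zab by auto
      have dv: "\<bar>t - u / w\<bar> \<le> e / w" if "\<bar>w * t - u\<bar> \<le> e" "0 < w" for t u w e :: real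
      proof -
        have "\<bar>t - u / w\<bar> = \<bar>w * t - u\<bar> / w" using that by (simp add: abs_if field_simps)
        then show ?thesis using that by (simp add: divide_right_mono)
      qed
      have bn: "(2::real) ^ (l * N) \<le> real b ^ N" "(2::real) ^ (k * N) \<le> real a ^ N"
        using ge by (auto simp: power_mult intro!: power_mono)
      have a1: "\<bar>x $ \<alpha> - real_of_int Q / real a\<bar> \<le> \<rho>"
      proof -
        have "\<bar>x $ \<alpha> - real_of_int Q / real a\<bar> \<le> 2 / real b ^ N / real a" using dv[OF Q] pos by simp
        also have "\<dots> = 2 / (real a * real b ^ N)" by simp
        also have "\<dots> \<le> \<rho>" unfolding \<rho>_def using ge bn pos by (intro divide_left_mono mult_mono) auto
        finally show ?thesis .
      qed
      have b1: "\<bar>x $ \<beta> - real_of_int R / real b\<bar> \<le> 2 / (real b * real b ^ N)"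
        using dv[OF R] pos by (simp add: mult.commute)
      also have "\<dots> \<le> 2 / (real a * real b ^ N)" using pos by (intro divide_left_mono mult_right_mono) auto
      also have "\<dots> \<le> \<rho>" unfolding \<rho>_def using ge bn pos by (intro divide_left_mono mult_mono) auto
      finally have b2: "\<bar>x $ \<beta> - real_of_int R / real b\<bar> \<le> \<rho>" .
      have z1: "\<bar>x $ \<beta> - real_of_int P / real z\<bar> \<le> 2 / (real z * real a ^ N)"
        using dv[OF P] pos by (simp add: mult.commute)
      have anb: "2 / (real b * real b ^ N) \<le> 2 / (real z * real a ^ N)"
        using pos by (intro divide_left_mono mult_mono power_mono) auto
      have le_r: "2 * (2 / (real z * real a ^ N)) \<le> r"
      proof -
        have "2 * (2 / (real z * real a ^ N)) = 4 / (real z * real a ^ N)" by simp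
        also have "\<dots> \<le> r" unfolding r_def using ge bn pos by (intro divide_left_mono mult_mono) auto
        finally show ?thesis .
      qed
      have "real z * real a ^ N \<ge> 1 * 1" using ge pos by (intro mult_mono one_le_power) auto
      then have "2 / (real z * real a ^ N) \<le> 2" by (simp add: divide_le_eq)
      then have "\<bar>real_of_int P / real z\<bar> \<le> m + 2" using z1 x[of \<beta>] by linarith
      moreover have "\<bar>real_of_int Q / real a\<bar> \<le> m + 2" using a1 x[of \<alpha>] \<rho>1 by linarith
      moreover have "\<bar>real_of_int R / real b - real_of_int P / real z\<bar> \<le> r"
        using b1 z1 anb le_r by linarith
      ultimately have "(real_of_int Q / real a, real_of_int R / real b) \<in> W"
        unfolding W_def A_def B_def using zab
        by (auto simp: dyadic_fractions_def abs_le_iff simp del: abs_divide intro!: bexI[of _ "real_of_int P / real z"])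
      then show "(\<forall>i. \<bar>x $ i\<bar> \<le> m) \<and> (\<exists>(p, q)\<in>W. \<bar>x $ \<alpha> - p\<bar> \<le> \<rho> \<and> \<bar>x $ \<beta> - q\<bar> \<le> \<rho>)"
        using x a1 b2 by blast
    qed
    then obtain \<U> where \<U>: "finite \<U>" "E3 i k l \<subseteq> \<Union>\<U>"
      "\<And>U x y. U \<in> \<U> \<Longrightarrow> x \<in> U \<Longrightarrow> y \<in> U \<Longrightarrow> dist x y \<le> 2 * real N * \<rho>"
      "real (card \<U>) \<le> real (card W) * ((2 * m + 3) / \<rho>) ^ (N - 2)" unfolding N_def by blast
    have "2 * real N * \<rho> \<le> 2 * real N * (2 / 2 ^ l)" using \<rho>le Npos by (intro mult_left_mono) auto
    then have "2 * real N * \<rho> \<le> \<delta>" using \<delta> by linarith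
    then have "hausdorff_premeasure s \<delta> (E3 i k l) \<le> ennreal (real (card \<U>) * (2 * real N * \<rho>) powr s)"
      using \<U> s0 \<rho>0 Npos by (intro hausdorff_premeasure_finite_cover) auto
    also have "\<dots> \<le> ennreal (K * (\<phi> ^ l) ^ 3)"
    proof (rule ennreal_leI)
      define e where "e = real i + 2 * real k + 2 * real l - real k * real N"
      have p4: "(4::real) ^ j = 2 powr (2 * real j)" for j
      proof -
        have "(4::real) ^ j = 2 ^ (2 * j)" by (simp add: power_mult)
        then show ?thesis using powr_realpow[of 2 "2 * j"] by simp
      qed
      have p2: "(2::real) ^ j = 2 powr real j" for j by (simp add: powr_realpow)
      have cnt: "4 ^ i * 4 ^ k * 4 ^ l / (2 ^ i * 2 ^ (k * N)) = (2::real) powr e"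
        unfolding p4 p2 e_def by (simp add: powr_add[symmetric] powr_diff[symmetric]) (simp add: algebra_simps)
      have \<rho>p: "\<rho> = 2 powr (1 - real k - real l * real N)"
        unfolding \<rho>_def p2 by (simp add: powr_add[symmetric] powr_diff)
      have \<rho>n: "\<rho> ^ (N - 2) = \<rho> powr (real N - 2)" using N \<rho>0 by (simp add: powr_realpow[symmetric] of_nat_diff)
      have "real (card \<U>) * (2 * real N * \<rho>) powr s \<le>
          ((8 * m + 17)\<^sup>2 * 40 * 2 powr e * ((2 * m + 3) / \<rho>) ^ (N - 2)) * (2 * real N * \<rho>) powr s"
        using \<U>(4) cardW m \<rho>0 unfolding cnt
        by (intro mult_right_mono order_trans[OF \<U>(4)] mult_right_mono) auto
      also have "\<dots> = (8 * m + 17)\<^sup>2 * 40 * (2 * m + 3) ^ (N - 2) * (2 * real N) powr s *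
          (2 powr e * (\<rho> powr s / \<rho> powr (real N - 2)))"
        using \<rho>0 Npos by (simp add: power_divide \<rho>n powr_mult field_simps)
      also have "2 powr e * (\<rho> powr s / \<rho> powr (real N - 2)) =
          2 powr (e + (1 - real k - real l * real N) * (s - (real N - 2)))"
        unfolding \<rho>p by (simp add: powr_diff[symmetric] powr_powr powr_add[symmetric] algebra_simps)
      also have "\<dots> \<le> 2 powr (3 + s - real l * (real N * \<epsilon>))"
      proof (rule powr_mono)
        have "real i * real N \<le> real k + 3" using iN by (metis of_nat_add of_nat_le_iff of_nat_mult of_nat_numeral)
        then have i1: "real i \<le> (real k + 3) / real N" using Npos by (simp add: field_simps)
        have s': "s - (real N - 2) = 2 / real N + \<epsilon>" by (simp add: \<epsilon>_def)
        \<comment> \<open>The terms \<open>2 * l\<close> from the count and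
          \<open>l * N * (2 / N)\<close> from the diameters cancel; only the surplus \<epsilon>
          keeps a factor \<open>l\<close>.\<close>
        have "e + (1 - real k - real l * real N) * (2 / real N + \<epsilon>) =
            real i + real k * (2 - real N - 2 / real N - \<epsilon>) + (2 / real N + \<epsilon>) - real l * (real N * \<epsilon>)"
          using Npos by (simp add: e_def field_simps)
        moreover have "real k * (2 - real N - 2 / real N - \<epsilon>) \<le> real k * (- 1 / real N)"
        proof (rule mult_left_mono)
          have "0 \<le> 1 / real N" using Npos by simp
          moreover have "2 / real N = 2 * (1 / real N)" "- 1 / real N = - (1 / real N)" by simp_all
          moreover have "2 \<le> real N" using N by simp
          ultimately show "2 - real N - 2 / real N - \<epsilon> \<le> - 1 / real N" using \<epsilon> by linarith
        qed simp
        moreover have "3 / real N \<le> 3" using N by (simp add: field_simps)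
        moreover have "(real k + 3) / real N = real k / real N + 3 / real N" by (simp add: add_divide_distrib)
        moreover have "2 / real N + \<epsilon> \<le> s" using N by (simp add: \<epsilon>_def)
        ultimately show "e + (1 - real k - real l * real N) * (s - (real N - 2)) \<le> 3 + s - real l * (real N * \<epsilon>)"
          unfolding s' using i1 by (simp only: mult_minus_right divide_minus_left times_divide_eq_right mult_1_right) linarith
      qed simp
      also have "\<dots> = 8 * 2 powr s * (\<phi> ^ l) ^ 3"
      proof -
        have "(\<phi> ^ l) ^ 3 = \<phi> powr (real l * 3)" using \<phi> by (simp add: powr_realpow[symmetric] powr_powr)
        also have "\<dots> = 2 powr (- real l * (real N * \<epsilon>))" by (simp add: \<phi>_def powr_powr mult.commute mult.left_commute)
        finally have "(\<phi> ^ l) ^ 3 = 2 powr (- real l * (real N * \<epsilon>))" .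
        moreover have "(2::real) powr 3 = 8" by (simp add: powr_numeral)
        ultimately show ?thesis by (simp add: powr_add powr_diff powr_minus field_simps)
      qed
      finally show "real (card \<U>) * (2 * real N * \<rho>) powr s \<le> K * (\<phi> ^ l) ^ 3"
        using m by (simp add: K_def mult_left_mono mult.assoc)
    qed
    finally show ?thesis .
  qed
  \<comment> \<open>The pairs \<open>(i, k)\<close> are encoded as numbers, with empty sets for the
    irrelevant ones, because countable subadditivity is stated for sequences.\<close>
  define F where "F l t = (case prod_decode t of (i, k) \<Rightarrow> if i \<le> l \<and> k \<le> l then E3 i k l else {})" for l t
  define E where "E l = (\<Union>t. F l t)" for l
  have E_eq: "E l = (\<Union>i\<in>{..l}. \<Union>k\<in>{..l}. E3 i k l)" for l
  proof (intro equalityI subsetI)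
    fix x assume "x \<in> E l"
    then obtain t where t: "x \<in> F l t" unfolding E_def by blast
    obtain i k where ik: "prod_decode t = (i, k)" by (cases "prod_decode t")
    then have "i \<le> l \<and> k \<le> l \<and> x \<in> E3 i k l" using t by (auto simp: F_def split: if_splits)
    then show "x \<in> (\<Union>i\<in>{..l}. \<Union>k\<in>{..l}. E3 i k l)" by blast
  next
    fix x assume "x \<in> (\<Union>i\<in>{..l}. \<Union>k\<in>{..l}. E3 i k l)"
    then obtain i k where "i \<le> l" "k \<le> l" "x \<in> E3 i k l" by auto
    then have "x \<in> F l (prod_encode (i, k))" by (simp add: F_def)
    then show "x \<in> E l" unfolding E_def by blast
  qed
  show ?thesis
  proof (rule hausdorff_measure_limsup_eq_0[where E = E and g = "\<lambda>l. K * ((real l + 1)\<^sup>2 * (\<phi> ^ l) ^ 3)"])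
    show "summable (\<lambda>l. K * ((real l + 1)\<^sup>2 * (\<phi> ^ l) ^ 3))"
      using \<phi> by (intro summable_mult summable_square_powser) auto
    show "0 \<le> K * ((real l + 1)\<^sup>2 * (\<phi> ^ l) ^ 3)" for l using K0 \<phi> by simp
    show "\<exists>l1. \<forall>l\<ge>l1. hausdorff_premeasure s \<delta> (E l) \<le> ennreal (K * ((real l + 1)\<^sup>2 * (\<phi> ^ l) ^ 3))"
      if "0 < \<delta>" for \<delta>
    proof -
      have "(\<lambda>l. 2 * real N * (2 * (1 / 2) ^ l)) \<longlonglongrightarrow> 2 * real N * (2 * 0)"
        by (intro tendsto_mult tendsto_const LIMSEQ_power_zero) auto
      then have "\<forall>\<^sub>F l in sequentially. 2 * real N * (2 * (1 / 2) ^ l) < \<delta>"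
        using that by (intro order_tendstoD(2)) auto
      then obtain l1 where "\<forall>l\<ge>l1. 2 * real N * (2 * (1 / 2) ^ l) < \<delta>"
        unfolding eventually_sequentially by blast
      then have l1: "2 * real N * (2 / 2 ^ l) \<le> \<delta>" if "l \<ge> l1" for l
        using that by (force simp: power_one_over)
      have "hausdorff_premeasure s \<delta> (E l) \<le> ennreal (K * ((real l + 1)\<^sup>2 * (\<phi> ^ l) ^ 3))" if "l \<ge> l1" for l
      proof -
        define T where "T = prod_encode ` ({..l} \<times> {..l})"
        have cT: "finite T" "card T = (l + 1) * (l + 1)"
          by (auto simp: T_def card_image inj_prod_encode card_cartesian_product)
        have empty: "hausdorff_premeasure s \<delta> ({} :: (real ^ 'n) set) = 0"
          using s0 \<open>0 < \<delta>\<close> by (simp add: hausdorff_premeasure_empty)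
        have outside: "hausdorff_premeasure s \<delta> (F l t) = 0" if "t \<notin> T" for t
        proof -
          have "\<not> (fst (prod_decode t) \<le> l \<and> snd (prod_decode t) \<le> l)"
          proof
            assume "fst (prod_decode t) \<le> l \<and> snd (prod_decode t) \<le> l"
            then have "prod_decode t \<in> {..l} \<times> {..l}" by (auto simp: mem_Times_iff)
            then show False using that unfolding T_def by (metis image_eqI prod_decode_inverse)
          qed
          then show ?thesis using empty by (auto simp: F_def case_prod_unfold)
        qed
        have "hausdorff_premeasure s \<delta> (E l) \<le> (\<Sum>t. hausdorff_premeasure s \<delta> (F l t))"
          unfolding E_def by (rule hausdorff_premeasure_UN)
        also have "\<dots> = (\<Sum>t\<in>T. hausdorff_premeasure s \<delta> (F l t))"
          using cT outside by (intro suminf_finite) auto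
        also have "\<dots> \<le> (\<Sum>t\<in>T. ennreal (K * (\<phi> ^ l) ^ 3))"
        proof (rule sum_mono)
          fix t assume "t \<in> T"
          then obtain i k where "t = prod_encode (i, k)" "i \<le> l" "k \<le> l" by (auto simp: T_def)
          then show "hausdorff_premeasure s \<delta> (F l t) \<le> ennreal (K * (\<phi> ^ l) ^ 3)"
            using E3_bound[OF l1[OF \<open>l \<ge> l1\<close>]] by (simp add: F_def)
        qed
        also have "\<dots> = ennreal (K * ((real l + 1)\<^sup>2 * (\<phi> ^ l) ^ 3))"
          using cT K0 \<phi> by (simp add: ennreal_of_nat_eq_real_of_nat ennreal_mult'[symmetric] power2_eq_square algebra_simps)
        finally show ?thesis .
      qed
      then show ?thesis by blast
    qed
    show "?A \<subseteq> (\<Union>l. E (l + l0))" for l0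
    proof
      fix x assume "x \<in> ?A"
      then obtain c P where x: "\<And>i. \<bar>x $ i\<bar> \<le> m" and i: "interlaced \<alpha> \<beta> c P x" by blast
      \<comment> \<open>Odd, so that the terms \<open>j\<close>, \<open>j + 1\<close>,
        \<open>j + 2\<close> approximate the coordinates \<beta>, \<alpha>, \<beta>; positive, so
        that the growth estimate also applies at \<open>j - 1\<close>; at least
        \<open>2 ^ l0\<close>, so that the third denominator has order at least
        \<open>l0\<close>.\<close>
      define j where "j = 2 * 2 ^ l0 + (1 :: nat)"
      define z a b where "z = c j" "a = c (Suc j)" "b = c (j + 2)"
      note defs = this
      have ij: "0 < c j \<and> c j < c (Suc j) \<and> \<bar>real (c j) * x $ (if even j then \<alpha> else \<beta>) - real_of_int (P j)\<bar> \<le> 2 / real (c (Suc j)) ^ CARD('n)" for j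
        using i by (auto simp: interlaced_def)
      have lt: "0 < z" "z < a" "a < b" "b < c (j + 3)" using ij[of j] ij[of "Suc j"] ij[of "j + 2"]
        by (auto simp: defs eval_nat_numeral)
      have odd: "odd j" by (simp add: j_def)
      have gr: "a ^ N \<le> 4 * b" "z ^ N \<le> 4 * a"
        using interlaced_growth[OF i n, of j] interlaced_growth[OF i n, of "j - 1"]
        by (auto simp: defs N_def j_def eval_nat_numeral)
      obtain i' where i': "2 ^ i' \<le> z" "z < 2 ^ Suc i'" using ex_power_ivl1[of 2 z] lt by auto
      obtain k where k: "2 ^ k \<le> a" "a < 2 ^ Suc k" using ex_power_ivl1[of 2 a] lt by auto
      obtain l where l: "2 ^ l \<le> b" "b < 2 ^ Suc l" using ex_power_ivl1[of 2 b] lt by auto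
      have "(2::nat) ^ i' < 2 ^ Suc l" "(2::nat) ^ k < 2 ^ Suc l" using i' k l lt by linarith+
      then have il: "i' \<le> l" "k \<le> l" by (auto simp: power_strict_increasing_iff less_Suc_eq_le simp del: power_Suc)
      have "2 ^ l0 \<le> j" unfolding j_def by simp
      then have "(2::nat) ^ l0 < 2 ^ Suc l" using l lt interlaced_ge[OF i, of j] by (simp add: defs)
      then have "l0 \<le> l" by (auto simp: power_strict_increasing_iff less_Suc_eq_le simp del: power_Suc)
      have bb: "2 / real (c (j + 3)) ^ N \<le> 2 / real b ^ N"
        using lt by (intro divide_left_mono power_mono) auto
      have "\<bar>real z * x $ \<beta> - real_of_int (P j)\<bar> \<le> 2 / real a ^ N"
        using ij[of j] odd by (simp add: defs N_def)
      moreover have "\<bar>real a * x $ \<alpha> - real_of_int (P (Suc j))\<bar> \<le> 2 / real b ^ N"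
        using ij[of "Suc j"] odd by (simp add: defs N_def)
      moreover have "\<bar>real b * x $ \<beta> - real_of_int (P (j + 2))\<bar> \<le> 2 / real b ^ N"
      proof -
        have "\<bar>real b * x $ \<beta> - real_of_int (P (j + 2))\<bar> \<le> 2 / real (c (j + 3)) ^ N"
          using ij[of "j + 2"] odd by (simp add: defs N_def numeral_3_eq_3)
        then show ?thesis using bb by linarith
      qed
      ultimately have "x \<in> E3 i' k l" unfolding E3_def using x i' k l lt gr by blast
      then have "x \<in> E l" using il by (auto simp: E_eq)
      then show "x \<in> (\<Union>l. E (l + l0))" using \<open>l0 \<le> l\<close> by (intro UN_I[of "l - l0"]) auto
    qed
  qed
qed
text \<open>Fix a scale \<rho> and stop at the first index whose error bound is at most \<rho>. One
  coordinate is then known up to \<rho> from a fraction \<open>Q / a\<close>, the other one only up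
  to some \<tau> > \<rho> from the preceding \<open>P / z\<close>, so its interval is cut into about
  \<open>\<tau> / \<rho>\<close> steps. With \<open>z\<close> and \<open>a\<close> of orders
  \<open>i \<le> k\<close> the count is about \<open>4 ^ k * 4 ^ i * \<tau> / \<rho>\<close>, and
  \<open>i + 2 * k \<le> k * n\<close> holds because \<open>n\<close> is at least 3: the pair costs
  a multiple of \<open>1 / \<rho>\<close>, as one free coordinate does.\<close>

lemma interlaced_packing_null:
  fixes \<alpha> \<beta> :: "'n::finite"
  assumes ne: "\<alpha> \<noteq> \<beta>" and n: "3 \<le> CARD('n)" and s: "real CARD('n) - 1 < s" and m: "0 \<le> m"
    and a0: "0 < a0" "0 < a1"
  shows "packing_premeasure s {x :: real ^ 'n. (\<forall>i. \<bar>x $ i\<bar> \<le> m) \<and>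
    (\<exists>c P. interlaced \<alpha> \<beta> c P x \<and> c 0 = a0 \<and> c 1 = a1)} = 0"
    (is "packing_premeasure s ?F = 0")
proof -
  define N where "N = CARD('n)"
  have N: "3 \<le> N" using n by (simp add: N_def)
  have Npos: "0 < real N" using N by simp
  define \<epsilon> where "\<epsilon> = (s - (real N - 1)) / 2"
  have \<epsilon>: "0 < \<epsilon>" using s by (simp add: \<epsilon>_def N_def)
  define t where "t = real N - 1 + \<epsilon>"
  have ts: "t < s" using s by (simp add: t_def \<epsilon>_def N_def field_simps)
  \<comment> \<open>Below this threshold the error bound at index 0 still exceeds \<rho>, so the
    stopping index has a predecessor; this is why the first two denominators are fixed.\<close>
  define \<rho>0 where "\<rho>0 = min 1 (2 / (real a0 * real a1 ^ N))"
  have \<rho>0: "0 < \<rho>0" using a0 by (simp add: \<rho>0_def)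
  define K1 where "K1 = (8 * m + 17)\<^sup>2 * 10 * (2 * m + 3) ^ (N - 2)"
  have K1: "0 \<le> K1" using m by (simp add: K1_def)
  \<comment> \<open>\<open>C * \<rho> powr (- \<epsilon> / 2)\<close> bounds the number of binary
    orders at scale \<rho>, which is logarithmic; the square of it costs
    \<open>\<rho> powr (- \<epsilon>)\<close>.\<close>
  define C where "C = 3 + (1 / ln 2) * (2 / \<epsilon>)"
  have C: "0 \<le> C" using \<epsilon> by (simp add: C_def)
  define K where "K = 2 * C\<^sup>2 * K1 * (2 * real N) powr t"
  have cov: "\<exists>\<U>. finite \<U> \<and> ?F \<subseteq> \<Union>\<U> \<and> (\<forall>U\<in>\<U>. \<forall>x\<in>U. \<forall>y\<in>U. dist x y \<le> \<rho>') \<and>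
      real (card \<U>) \<le> K * \<rho>' powr (- t)" if \<rho>': "0 < \<rho>'" "\<rho>' < \<rho>0" for \<rho>'
  proof -
    \<comment> \<open>\<open>grid_cover\<close> with mesh \<rho> produces sets of diameter
      \<open>2 * N * \<rho>\<close>.\<close>
    define \<rho> where "\<rho> = \<rho>' / (2 * real N)"
    have "\<rho>' \<le> \<rho>' * (2 * real N)" using \<rho>' N by (simp add: mult_le_cancel_left1)
    then have "\<rho> \<le> \<rho>'" using Npos by (simp add: \<rho>_def divide_le_eq)
    then have \<rho>: "0 < \<rho>" "\<rho> < \<rho>0" "\<rho> \<le> 1" "2 * real N * \<rho> = \<rho>'"
      using \<rho>' Npos by (auto simp: \<rho>_def \<rho>0_def)
    define kmax where "kmax = nat \<lceil>log 2 (2 / \<rho>)\<rceil>"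
    \<comment> \<open>\<gamma> belongs to the stopping index and \<gamma>' to its predecessor; which
      of them is \<alpha> depends on the parity of the index, so both orders occur.\<close>
    define Pc where "Pc \<gamma> \<gamma>' i k = {x :: real ^ 'n. (\<forall>i. \<bar>x $ i\<bar> \<le> m) \<and> (\<exists>z a P Q. 2 ^ i \<le> z \<and> z < 2 ^ Suc i \<and>
        2 ^ k \<le> a \<and> a < 2 ^ Suc k \<and> z < a \<and> \<rho> < 2 / (real z * real a ^ N) \<and>
        \<bar>x $ \<gamma> - real_of_int Q / real a\<bar> \<le> \<rho> \<and>
        \<bar>x $ \<gamma>' - real_of_int P / real z\<bar> \<le> 2 / (real z * real a ^ N))}" for \<gamma> \<gamma>' :: 'n and i k :: nat
    have piece: "\<exists>\<U>. finite \<U> \<and> Pc \<gamma> \<gamma>' i k \<subseteq> \<Union>\<U> \<and> (\<forall>U\<in>\<U>. \<forall>x\<in>U. \<forall>y\<in>U. dist x y \<le> \<rho>') \<and>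
        real (card \<U>) \<le> K1 * \<rho> powr (- (real N - 1))" if gne: "\<gamma> \<noteq> \<gamma>'" for \<gamma> \<gamma>' i k
    proof (cases "Pc \<gamma> \<gamma>' i k = {}")
      case True
      then show ?thesis using K1 by (intro exI[of _ "{}"]) auto
    next
      case False
      then obtain z a :: nat where zab: "2 ^ i \<le> z" "z < 2 ^ Suc i" "2 ^ k \<le> a" "a < 2 ^ Suc k" "z < a"
          "\<rho> < 2 / (real z * real a ^ N)"
        unfolding Pc_def by blast
      have "(2::nat) ^ i < 2 ^ Suc k" using zab by linarith
      then have ik: "i \<le> k" by (auto simp: power_strict_increasing_iff less_Suc_eq_le simp del: power_Suc)
      define \<tau> where "\<tau> = 2 / (2 ^ i * 2 ^ (k * N) :: real)"
      have le_\<tau>: "2 / (real z * real a ^ N) \<le> \<tau>" if "2 ^ i \<le> z" "2 ^ k \<le> a" for z a :: nat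
      proof -
        have "(2::real) ^ i \<le> real z" "(2::real) ^ k \<le> real a"
          using that by (metis of_nat_le_iff of_nat_numeral of_nat_power)+
        moreover from this have "0 < real z" "0 < real a" by (auto intro: less_le_trans[of 0 "2 ^ _"])
        moreover have "2 ^ i * (2 ^ k) ^ N \<le> real z * real a ^ N"
          using calculation by (intro mult_mono power_mono) auto
        ultimately show ?thesis unfolding \<tau>_def power_mult by (intro divide_left_mono) auto
      qed
      have \<rho>\<tau>: "\<rho> < \<tau>" using le_\<tau>[OF zab(1,3)] zab(6) by linarith
      define A where "A j = dyadic_fractions j \<inter> {0 - (m + 2)..0 + (m + 2)}" for j
      have finA: "finite (A j)" and cardA: "real (card (A j)) \<le> (8 * m + 17) * 4 ^ j" for j
      proof -
        show "finite (A j)" unfolding A_def by (rule card_dyadic_fractions_le) (use m in auto)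
        have "real (card (A j)) \<le> 8 * (m + 2) * 4 ^ j + 1"
          unfolding A_def by (rule card_dyadic_fractions_le) (use m in auto)
        also have "\<dots> \<le> 8 * (m + 2) * 4 ^ j + 4 ^ j" by simp
        finally show "real (card (A j)) \<le> (8 * m + 17) * 4 ^ j" by (simp add: algebra_simps)
      qed
      define H where "H = {- \<lceil>\<tau> / \<rho>\<rceil>..\<lceil>\<tau> / \<rho>\<rceil>}"
      have "0 \<le> \<tau> / \<rho>" using \<rho> \<rho>\<tau> by simp
      then have "0 \<le> \<lceil>\<tau> / \<rho>\<rceil>" by linarith
      then have "real (card H) = 2 * real_of_int \<lceil>\<tau> / \<rho>\<rceil> + 1" by (simp add: H_def)
      also have "\<dots> \<le> 2 * (\<tau> / \<rho>) + 3" by linarith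
      also have "\<dots> \<le> 5 * (\<tau> / \<rho>)"
      proof -
        have "1 \<le> \<tau> / \<rho>" using \<rho> \<rho>\<tau> by simp
        then show ?thesis by linarith
      qed
      finally have cardH: "real (card H) \<le> 5 * (\<tau> / \<rho>)" .
      define W where "W = A k \<times> (\<lambda>(v, h). v + \<rho> * real_of_int h) ` (A i \<times> H)"
      have finW: "finite W" unfolding W_def using finA by (auto simp: H_def)
      have "card W \<le> card (A k) * (card (A i) * card H)"
        unfolding W_def card_cartesian_product
        by (intro mult_left_mono order_trans[OF card_image_le]) (auto simp: finA H_def card_cartesian_product)
      then have "real (card W) \<le> real (card (A k)) * (real (card (A i)) * real (card H))"
        by (simp flip: of_nat_mult)
      also have "\<dots> \<le> ((8 * m + 17) * 4 ^ k) * (((8 * m + 17) * 4 ^ i) * (5 * (\<tau> / \<rho>)))"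
        using m \<rho> \<rho>\<tau> by (intro mult_mono cardA cardH mult_nonneg_nonneg) auto
      also have "\<dots> = (8 * m + 17)\<^sup>2 * 10 * (4 ^ k * 4 ^ i / (2 ^ i * 2 ^ (k * N))) / \<rho>"
        by (simp add: \<tau>_def power2_eq_square)
      also have "\<dots> \<le> (8 * m + 17)\<^sup>2 * 10 * 1 / \<rho>"
      proof -
        have "(4::real) ^ k * 4 ^ i = 2 ^ i * (2 ^ i * 2 ^ (2 * k))"
          by (simp add: power_mult mult.assoc[symmetric] flip: power_mult_distrib)
        also have "\<dots> \<le> 2 ^ i * 2 ^ (k * N)"
        proof -
          have "k * 3 \<le> k * N" using N by (intro mult_left_mono) auto
          then have "i + 2 * k \<le> k * N" using ik by linarith
          then show ?thesis by (simp flip: power_add)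
        qed
        finally have "(4::real) ^ k * 4 ^ i / (2 ^ i * 2 ^ (k * N)) \<le> 1" by simp
        then show ?thesis using \<rho> m by (intro divide_right_mono mult_left_mono) auto
      qed
      finally have cardW: "real (card W) \<le> (8 * m + 17)\<^sup>2 * 10 / \<rho>" by simp
      have "\<exists>\<U>. finite \<U> \<and> Pc \<gamma> \<gamma>' i k \<subseteq> \<Union>\<U> \<and> (\<forall>U\<in>\<U>. \<forall>x\<in>U. \<forall>y\<in>U. dist x y \<le> 2 * real CARD('n) * \<rho>) \<and>
         real (card \<U>) \<le> real (card W) * ((2 * m + 3) / \<rho>) ^ (CARD('n) - 2)"
      proof (rule grid_cover[OF gne finW \<rho>(1,3) m])
        fix x assume "x \<in> Pc \<gamma> \<gamma>' i k"
        then obtain z a P Q where x: "\<And>i. \<bar>x $ i\<bar> \<le> m" and zab: "2 ^ i \<le> z" "z < 2 ^ Suc i" "2 ^ k \<le> a" "a < 2 ^ Suc k"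
          and Q: "\<bar>x $ \<gamma> - real_of_int Q / real a\<bar> \<le> \<rho>"
          and P: "\<bar>x $ \<gamma>' - real_of_int P / real z\<bar> \<le> 2 / (real z * real a ^ N)"
          unfolding Pc_def by blast
        define d where "d = x $ \<gamma>' - real_of_int P / real z"
        have d: "\<bar>d\<bar> \<le> \<tau>" using P le_\<tau>[OF zab(1,3)] by (simp add: d_def)
        have "\<tau> \<le> 2"
        proof -
          have "(1::real) * 1 \<le> 2 ^ i * 2 ^ (k * N)" by (intro mult_mono) auto
          then show ?thesis by (simp add: \<tau>_def divide_le_eq)
        qed
        then have "\<bar>real_of_int P / real z\<bar> \<le> m + 2" using d x[of \<gamma>'] unfolding d_def by linarith
        moreover have "\<bar>real_of_int Q / real a\<bar> \<le> m + 2" using Q x[of \<gamma>] \<rho> by linarith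
        moreover have "\<lfloor>d / \<rho>\<rfloor> \<in> H"
        proof -
          have "\<bar>d / \<rho>\<bar> \<le> \<tau> / \<rho>" using d \<rho> by (simp add: divide_right_mono)
          then have "- (\<tau> / \<rho>) \<le> d / \<rho>" "d / \<rho> \<le> \<tau> / \<rho>" by linarith+
          then show ?thesis unfolding H_def atLeastAtMost_iff by linarith
        qed
        moreover have "\<bar>x $ \<gamma>' - (real_of_int P / real z + \<rho> * real_of_int \<lfloor>d / \<rho>\<rfloor>)\<bar> \<le> \<rho>"
        proof -
          have "\<bar>d / \<rho> - real_of_int \<lfloor>d / \<rho>\<rfloor>\<bar> \<le> 1" by linarith
          moreover have "d - \<rho> * real_of_int \<lfloor>d / \<rho>\<rfloor> = \<rho> * (d / \<rho> - real_of_int \<lfloor>d / \<rho>\<rfloor>)"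
            using \<rho> by (simp add: field_simps)
          ultimately have "\<bar>d - \<rho> * real_of_int \<lfloor>d / \<rho>\<rfloor>\<bar> \<le> \<rho>" using \<rho> by (simp add: abs_mult mult_left_le)
          then show ?thesis by (simp add: d_def)
        qed
        moreover have "(real_of_int Q / real a, real_of_int P / real z + \<rho> * real_of_int \<lfloor>d / \<rho>\<rfloor>) \<in> W"
        proof -
          have "real_of_int Q / real a \<in> A k" "real_of_int P / real z \<in> A i"
            using calculation(1,2) zab by (auto simp: A_def dyadic_fractions_def abs_le_iff simp del: abs_divide)
          then show ?thesis using calculation(3) by (force simp: W_def)
        qed
        ultimately show "(\<forall>i. \<bar>x $ i\<bar> \<le> m) \<and> (\<exists>(p, q)\<in>W. \<bar>x $ \<gamma> - p\<bar> \<le> \<rho> \<and> \<bar>x $ \<gamma>' - q\<bar> \<le> \<rho>)"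
          using x Q by blast
      qed
      then obtain \<U> where \<U>: "finite \<U>" "Pc \<gamma> \<gamma>' i k \<subseteq> \<Union>\<U>" "\<forall>U\<in>\<U>. \<forall>x\<in>U. \<forall>y\<in>U. dist x y \<le> \<rho>'"
        "real (card \<U>) \<le> real (card W) * ((2 * m + 3) / \<rho>) ^ (N - 2)" using \<rho>(4) unfolding N_def by auto
      have "real (card \<U>) \<le> ((8 * m + 17)\<^sup>2 * 10 / \<rho>) * ((2 * m + 3) / \<rho>) ^ (N - 2)"
        using m \<rho> by (intro order_trans[OF \<U>(4)] mult_right_mono cardW) auto
      also have "\<dots> = K1 * (1 / \<rho>) ^ (N - 1)"
      proof -
        have "N - 1 = Suc (N - 2)" using N by simp
        then show ?thesis by (simp add: K1_def power_divide)
      qed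
      also have "(1 / \<rho>) ^ (N - 1) = \<rho> powr (- (real N - 1))"
      proof -
        have "(1 / \<rho>) ^ (N - 1) = (1 / \<rho>) powr real (N - 1)"
          using \<rho> by (intro powr_realpow[symmetric]) simp
        also have "real (N - 1) = real N - 1" using N by (simp add: of_nat_diff)
        also have "(1 / \<rho>) powr (real N - 1) = \<rho> powr (- (real N - 1))"
          unfolding powr_minus_divide using \<rho> by (subst powr_divide) auto
        finally show ?thesis .
      qed
      finally show ?thesis using \<U> by blast
    qed
    have "\<forall>w. \<exists>\<U>. case w of (g, i, k) \<Rightarrow> finite \<U> \<and> Pc (if g then \<alpha> else \<beta>) (if g then \<beta> else \<alpha>) i k \<subseteq> \<Union>\<U> \<and>
        (\<forall>U\<in>\<U>. \<forall>x\<in>U. \<forall>y\<in>U. dist x y \<le> \<rho>') \<and> real (card \<U>) \<le> K1 * \<rho> powr (- (real N - 1))"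
      using piece[of \<alpha> \<beta>] piece[of \<beta> \<alpha>] ne by auto
    from choice[OF this] obtain \<V> where \<V>0: "\<And>w. case w of (g, i, k) \<Rightarrow> finite (\<V> w) \<and>
        Pc (if g then \<alpha> else \<beta>) (if g then \<beta> else \<alpha>) i k \<subseteq> \<Union>(\<V> w) \<and>
        (\<forall>U\<in>\<V> w. \<forall>x\<in>U. \<forall>y\<in>U. dist x y \<le> \<rho>') \<and> real (card (\<V> w)) \<le> K1 * \<rho> powr (- (real N - 1))"
      by auto
    have \<V>: "finite (\<V> (g, i, k))" "Pc (if g then \<alpha> else \<beta>) (if g then \<beta> else \<alpha>) i k \<subseteq> \<Union>(\<V> (g, i, k))"
        "\<forall>U\<in>\<V> (g, i, k). \<forall>x\<in>U. \<forall>y\<in>U. dist x y \<le> \<rho>'"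
        "real (card (\<V> (g, i, k))) \<le> K1 * \<rho> powr (- (real N - 1))" for g i k
      using \<V>0[of "(g, i, k)"] unfolding prod.case by blast+
    define T where "T = (UNIV :: bool set) \<times> {..kmax} \<times> {..kmax}"
    define \<U> where "\<U> = (\<Union>w\<in>T. \<V> w)"
    have finT: "finite T" and cardT: "card T = 2 * ((kmax + 1) * (kmax + 1))"
      by (auto simp: T_def card_cartesian_product)
    have "finite \<U>" using \<V>(1) finT by (auto simp: \<U>_def T_def)
    moreover have "?F \<subseteq> \<Union>\<U>"
    proof
      fix x assume "x \<in> ?F"
      then obtain c P where x: "\<And>i. \<bar>x $ i\<bar> \<le> m" and i: "interlaced \<alpha> \<beta> c P x" and c01: "c 0 = a0" "c 1 = a1" by auto
      have ij: "0 < c j \<and> c j < c (Suc j) \<and> \<bar>real (c j) * x $ (if even j then \<alpha> else \<beta>) - real_of_int (P j)\<bar> \<le> 2 / real (c (Suc j)) ^ N" for j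
        using i by (auto simp: interlaced_def N_def)
      have dv: "\<bar>x $ (if even j then \<alpha> else \<beta>) - real_of_int (P j) / real (c j)\<bar> \<le> 2 / (real (c j) * real (c (Suc j)) ^ N)" for j
      proof -
        have "x $ (if even j then \<alpha> else \<beta>) - real_of_int (P j) / real (c j) =
            (real (c j) * x $ (if even j then \<alpha> else \<beta>) - real_of_int (P j)) / real (c j)"
          using ij[of j] by (simp add: field_simps)
        then have "\<bar>x $ (if even j then \<alpha> else \<beta>) - real_of_int (P j) / real (c j)\<bar> \<le> 2 / real (c (Suc j)) ^ N / real (c j)"
          using ij[of j] by (simp add: divide_right_mono del: divide_divide_eq_left)
        then show ?thesis by (simp add: mult.commute)
      qed
      define j where "j = (LEAST j. 2 / (real (c j) * real (c (Suc j)) ^ N) \<le> \<rho>)"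
      have "\<exists>j. 2 / (real (c j) * real (c (Suc j)) ^ N) \<le> \<rho>"
      proof -
        obtain j where j: "2 / \<rho> < real j" using reals_Archimedean2 by blast
        have "real j * 1 \<le> real (c j) * real (c (Suc j)) ^ N"
          using interlaced_ge[OF i, of j] interlaced_ge[OF i, of "Suc j"] by (intro mult_mono one_le_power) auto
        then have "2 / \<rho> < real (c j) * real (c (Suc j)) ^ N" using j by linarith
        moreover have "0 < real (c j) * real (c (Suc j)) ^ N" using ij[of j] by simp
        ultimately show ?thesis using \<rho> by (intro exI[of _ j]) (simp add: field_simps)
      qed
      then have j1: "2 / (real (c j) * real (c (Suc j)) ^ N) \<le> \<rho>" unfolding j_def by (rule LeastI_ex)
      have "j \<noteq> 0"
      proof
        assume "j = 0"
        then show False using j1 c01 \<rho>(2) by (simp add: \<rho>0_def)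
      qed
      then obtain j' where j': "j = Suc j'" by (cases j) auto
      have j2: "\<rho> < 2 / (real (c j') * real (c j) ^ N)"
        using not_less_Least[of j' "\<lambda>j. 2 / (real (c j) * real (c (Suc j)) ^ N) \<le> \<rho>"] j' by (simp add: j_def[symmetric])
      obtain i' where i': "2 ^ i' \<le> c j'" "c j' < 2 ^ Suc i'" using ex_power_ivl1[of 2 "c j'"] ij[of j'] by auto
      obtain k where k: "2 ^ k \<le> c j" "c j < 2 ^ Suc k" using ex_power_ivl1[of 2 "c j"] ij[of j] by auto
      have lt: "c j' < c j" using ij[of j'] j' by simp
      have "x \<in> Pc (if even j then \<alpha> else \<beta>) (if even j then \<beta> else \<alpha>) i' k"
        unfolding Pc_def using x i' k lt j2 dv[of j'] order_trans[OF dv[of j] j1] j' by (cases "even j") auto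
      then have "x \<in> \<Union>(\<V> (even j, i', k))" using \<V>(2)[of "even j" i' k] by blast
      moreover have "k \<le> kmax"
      proof -
        have "2 ^ k \<le> real (c j)" using k by (metis of_nat_le_iff of_nat_numeral of_nat_power)
        also have "\<dots> = 1 * real (c j) ^ 1" by simp
        also have "\<dots> \<le> real (c j') * real (c j) ^ N"
          using ij[of j] ij[of j'] N by (intro mult_mono power_increasing) auto
        also have "\<dots> < 2 / \<rho>"
        proof -
          have "0 < real (c j') * real (c j) ^ N" using ij[of j] ij[of j'] by simp
          then show ?thesis using j2 \<rho> by (simp add: field_simps)
        qed
        finally have "2 powr real k < 2 / \<rho>" by (simp add: powr_realpow)
        then have "real k < log 2 (2 / \<rho>)" using \<rho> by (subst less_log_iff) auto
        then show ?thesis unfolding kmax_def by linarith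
      qed
      moreover have "i' \<le> k"
      proof -
        have "(2::nat) ^ i' < 2 ^ Suc k" using i' k lt by linarith
        then show ?thesis by (auto simp: power_strict_increasing_iff less_Suc_eq_le simp del: power_Suc)
      qed
      moreover from calculation have "(even j, i', k) \<in> T" by (simp add: T_def)
      ultimately show "x \<in> \<Union>\<U>" unfolding \<U>_def by blast
    qed
    moreover have "\<forall>U\<in>\<U>. \<forall>x\<in>U. \<forall>y\<in>U. dist x y \<le> \<rho>'" using \<V>(3) by (auto simp: \<U>_def T_def)
    moreover have "real (card \<U>) \<le> K * \<rho>' powr (- t)"
    proof -
      have "card \<U> \<le> (\<Sum>w\<in>T. card (\<V> w))" unfolding \<U>_def by (rule card_UN_le[OF finT])
      then have "real (card \<U>) \<le> (\<Sum>w\<in>T. real (card (\<V> w)))" by (simp flip: of_nat_sum)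
      also have "\<dots> \<le> (\<Sum>w\<in>T. K1 * \<rho> powr (- (real N - 1)))"
        using \<V>(4) by (intro sum_mono) (auto simp: T_def)
      also have "\<dots> = 2 * (real kmax + 1)\<^sup>2 * (K1 * \<rho> powr (- (real N - 1)))"
        by (simp add: cardT power2_eq_square algebra_simps)
      also have "\<dots> \<le> 2 * (C * \<rho> powr (- \<epsilon> / 2))\<^sup>2 * (K1 * \<rho> powr (- (real N - 1)))"
      proof (intro mult_right_mono mult_left_mono power_mono)
        have ge1: "1 \<le> \<rho> powr (- \<epsilon> / 2)"
          using \<rho> \<epsilon> powr_mono'[of "- \<epsilon> / 2" 0 \<rho>] by simp
        have "0 \<le> log 2 (2 / \<rho>)" using \<rho> by simp
        then have "real kmax \<le> log 2 (2 / \<rho>) + 1" unfolding kmax_def by linarith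
        also have "log 2 (2 / \<rho>) = 1 + ln (1 / \<rho>) / ln 2" using \<rho> by (simp add: log_def ln_div diff_divide_distrib)
        also have "ln (1 / \<rho>) / ln 2 \<le> ((1 / \<rho>) powr (\<epsilon> / 2) / (\<epsilon> / 2)) / ln 2"
          using \<rho> \<epsilon> by (intro divide_right_mono ln_powr_bound) auto
        also have "(1 / \<rho>) powr (\<epsilon> / 2) = \<rho> powr (- \<epsilon> / 2)"
          unfolding minus_divide_left[symmetric] powr_minus_divide using \<rho> by (subst powr_divide) auto
        finally have "real kmax + 1 \<le> 3 + \<rho> powr (- \<epsilon> / 2) / (\<epsilon> / 2) / ln 2" by simp
        also have "\<dots> \<le> 3 * \<rho> powr (- \<epsilon> / 2) + \<rho> powr (- \<epsilon> / 2) / (\<epsilon> / 2) / ln 2" using ge1 by simp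
        also have "\<dots> = C * \<rho> powr (- \<epsilon> / 2)" by (simp add: C_def field_simps)
        finally show "real kmax + 1 \<le> C * \<rho> powr (- \<epsilon> / 2)" .
      qed (use K1 in auto)
      also have "\<dots> = 2 * C\<^sup>2 * K1 * \<rho> powr (- t)"
      proof -
        have "(\<rho> powr (- \<epsilon> / 2))\<^sup>2 * \<rho> powr (- (real N - 1)) = \<rho> powr (- t)"
          by (simp add: power2_eq_square powr_add[symmetric] t_def)
        moreover have "2 * (C * r)\<^sup>2 * (K1 * q) = 2 * C\<^sup>2 * K1 * (r\<^sup>2 * q)" for r q :: real
          by (simp add: power_mult_distrib)
        ultimately show ?thesis by metis
      qed
      also have "\<rho> powr (- t) = (2 * real N) powr t * \<rho>' powr (- t)"
        unfolding \<rho>_def using \<rho>' Npos by (subst powr_divide) (auto simp: powr_minus_divide)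
      finally show ?thesis by (simp add: K_def mult.assoc)
    qed
    ultimately show ?thesis by blast
  qed
  show ?thesis by (rule packing_premeasure_eq_0[OF \<rho>0 ts _ cov]) (use K1 in \<open>auto simp: K_def\<close>)
qed

section \<open>Best approximations\<close>

lemma infnorm_eq_component:
  fixes v :: "real ^ 'n::finite"
  obtains i where "infnorm v = \<bar>v $ i\<bar>"
proof -
  have "infnorm v = Max (range (\<lambda>i. \<bar>v $ i\<bar>))"
    unfolding infnorm_cart by (subst cSup_eq_Max) (auto simp: full_SetCompr_eq)
  also have "\<dots> \<in> range (\<lambda>i. \<bar>v $ i\<bar>)" by (rule Max_in) auto
  finally show ?thesis using that by auto
qed

lemma infnorm_le_iff: "infnorm (v :: real ^ 'n::finite) \<le> r \<longleftrightarrow> (\<forall>i. \<bar>v $ i\<bar> \<le> r)"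
  by (metis infnorm_eq_component component_le_infnorm_cart order_trans)

lemma infnorm_less_iff: "infnorm (v :: real ^ 'n::finite) < r \<longleftrightarrow> (\<forall>i. \<bar>v $ i\<bar> < r)"
  by (metis infnorm_eq_component component_le_infnorm_cart le_less_trans)

lemma infnorm_axis: "infnorm (axis i a :: real ^ 'n::finite) = \<bar>a\<bar>"
proof (rule antisym)
  show "infnorm (axis i a :: real ^ 'n) \<le> \<bar>a\<bar>" by (auto simp: infnorm_le_iff axis_def)
  show "\<bar>a\<bar> \<le> infnorm (axis i a :: real ^ 'n)"
    using component_le_infnorm_cart[of "axis i a :: real ^ 'n" i] by simp
qed

lemma int_lattice_iff:
  "(b :: 'n::finite ext) \<in> int_lattice \<longleftrightarrow> (\<forall>i. fst b $ i \<in> \<int>) \<and> snd b \<in> \<int>"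
  unfolding int_lattice_def Basis_prod_def Basis_vec_def
  by (cases b) (auto simp: inner_axis)

lemma inner_star: "b \<bullet> star x = fst b \<bullet> x + snd b"
  by (simp add: star_def inner_prod_def)

lemma inner_axis_cart: "axis i a \<bullet> x = a * x $ i" for x :: "real ^ 'n::finite"
  by (simp add: inner_axis' )

lemma int_vectors_bounded:
  fixes R :: real
  assumes R: "0 \<le> R"
  shows "finite {v :: real ^ 'n::finite. \<forall>i. v $ i \<in> \<int> \<and> \<bar>v $ i\<bar> \<le> R}"
    "real (card {v :: real ^ 'n. \<forall>i. v $ i \<in> \<int> \<and> \<bar>v $ i\<bar> \<le> R}) \<le> (2 * R + 1) ^ CARD('n)"
proof -
  define I where "I = {- \<lfloor>R\<rfloor>..\<lfloor>R\<rfloor>}"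
  define G where "G = PiE (UNIV :: 'n set) (\<lambda>_. I)"
  have sub: "{v :: real ^ 'n. \<forall>i. v $ i \<in> \<int> \<and> \<bar>v $ i\<bar> \<le> R} \<subseteq> (\<lambda>h. \<chi> i. real_of_int (h i)) ` G"
  proof
    fix v :: "real ^ 'n" assume v: "v \<in> {v. \<forall>i. v $ i \<in> \<int> \<and> \<bar>v $ i\<bar> \<le> R}"
    then have "\<forall>i. \<exists>k. v $ i = real_of_int k" by (auto elim: Ints_cases)
    then obtain h where h: "\<And>i. v $ i = real_of_int (h i)" by metis
    have "h i \<in> I" for i
    proof -
      have "\<bar>real_of_int (h i)\<bar> \<le> R" using v h by auto
      then show ?thesis unfolding I_def by (auto simp: le_floor_iff) linarith
    qed
    then have "h \<in> G" by (auto simp: G_def)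
    moreover have "v = (\<chi> i. real_of_int (h i))" using h by (simp add: vec_eq_iff)
    ultimately show "v \<in> (\<lambda>h. \<chi> i. real_of_int (h i)) ` G" by blast
  qed
  have finG: "finite G" unfolding G_def I_def by (intro finite_PiE) auto
  show "finite {v :: real ^ 'n. \<forall>i. v $ i \<in> \<int> \<and> \<bar>v $ i\<bar> \<le> R}"
    using sub finG finite_surj by blast
  have "card {v :: real ^ 'n. \<forall>i. v $ i \<in> \<int> \<and> \<bar>v $ i\<bar> \<le> R} \<le> card G"
    using sub finG by (meson card_image_le card_mono finite_imageI order_trans)
  also have "card G = card I ^ CARD('n)" by (simp add: G_def card_PiE)
  finally have "real (card {v :: real ^ 'n. \<forall>i. v $ i \<in> \<int> \<and> \<bar>v $ i\<bar> \<le> R}) \<le> real (card I ^ CARD('n))"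
    by (rule of_nat_mono)
  also have "\<dots> = real (card I) ^ CARD('n)" by simp
  also have "\<dots> \<le> (2 * R + 1) ^ CARD('n)"
  proof (rule power_mono)
    have "0 \<le> \<lfloor>R\<rfloor>" using R by simp
    then have "real (card I) = 2 * real_of_int \<lfloor>R\<rfloor> + 1" by (simp add: I_def)
    then show "real (card I) \<le> 2 * R + 1" by linarith
  qed simp
  finally show "real (card {v :: real ^ 'n. \<forall>i. v $ i \<in> \<int> \<and> \<bar>v $ i\<bar> \<le> R}) \<le> (2 * R + 1) ^ CARD('n)" .
qed

section \<open>Existence of best approximations and Dirichlet's theorem\<close>

lemma finite_small_lattice_vectors:
  fixes x :: "real ^ 'n::finite"
  shows "finite {b \<in> admissible Q. \<bar>b \<bullet> star x\<bar> \<le> R}"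
proof -
  define V where "V = {v :: real ^ 'n. \<forall>i. v $ i \<in> \<int> \<and> \<bar>v $ i\<bar> \<le> \<bar>Q\<bar>}"
  define T where "T v = {t \<in> \<int>. - R - v \<bullet> x \<le> t \<and> t \<le> R - v \<bullet> x}" for v
  have "finite (SIGMA v:V. T v)"
    unfolding V_def T_def by (intro finite_SigmaI int_vectors_bounded finite_int_segment) simp
  moreover have "{b \<in> admissible Q. \<bar>b \<bullet> star x\<bar> \<le> R} \<subseteq> (SIGMA v:V. T v)"
  proof
    fix b assume "b \<in> {b \<in> admissible Q. \<bar>b \<bullet> star x\<bar> \<le> R}"
    then have b: "b \<in> int_lattice" "infnorm (fst b) \<le> Q" "\<bar>fst b \<bullet> x + snd b\<bar> \<le> R"
      by (auto simp: admissible_def inner_star)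
    have "\<bar>fst b $ i\<bar> \<le> \<bar>Q\<bar>" for i using b(2) by (auto simp: infnorm_le_iff intro: order_trans)
    then have "fst b \<in> V" using b(1) by (auto simp: V_def int_lattice_iff)
    moreover have "snd b \<in> T (fst b)" using b by (auto simp: T_def int_lattice_iff)
    ultimately show "b \<in> (SIGMA v:V. T v)" by (metis SigmaI prod.collapse)
  qed
  ultimately show ?thesis by (rule rev_finite_subset)
qed

text \<open>Only competitors no worse than \<open>b\<close> need to be compared, and these are
  finitely many; any other one is worse than \<open>b\<close>, hence than the minimiser.\<close>

lemma best_approx_exists:
  assumes b: "b \<in> admissible Q"
  shows "\<exists>q. best_approx x q \<and> infnorm (fst q) \<le> infnorm (fst b) \<and> \<bar>q \<bullet> star x\<bar> \<le> \<bar>b \<bullet> star x\<bar>"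
proof -
  define S where "S = {q \<in> admissible (infnorm (fst b)). \<bar>q \<bullet> star x\<bar> \<le> \<bar>b \<bullet> star x\<bar>}"
  have "finite S" unfolding S_def by (rule finite_small_lattice_vectors)
  have "b \<in> S" using b by (simp add: S_def admissible_def)
  obtain q where q: "q \<in> S" "\<And>c. c \<in> S \<Longrightarrow> \<bar>q \<bullet> star x\<bar> \<le> \<bar>c \<bullet> star x\<bar>"
  proof -
    have "Min ((\<lambda>q. \<bar>q \<bullet> star x\<bar>) ` S) \<in> (\<lambda>q. \<bar>q \<bullet> star x\<bar>) ` S"
      using \<open>finite S\<close> \<open>b \<in> S\<close> by (intro Min_in) auto
    then obtain q where "q \<in> S" "\<bar>q \<bullet> star x\<bar> = Min ((\<lambda>q. \<bar>q \<bullet> star x\<bar>) ` S)" by auto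
    then show ?thesis using that[of q] Min_le[of "(\<lambda>q. \<bar>q \<bullet> star x\<bar>) ` S"] \<open>finite S\<close> by auto
  qed
  have "\<bar>q \<bullet> star x\<bar> \<le> \<bar>c \<bullet> star x\<bar>" if "c \<in> admissible (infnorm (fst q))" for c
  proof (cases "\<bar>c \<bullet> star x\<bar> \<le> \<bar>b \<bullet> star x\<bar>")
    case True
    then have "c \<in> S" using that q(1) by (auto simp: S_def admissible_def)
    then show ?thesis by (rule q(2))
  qed (use q(1) in \<open>auto simp: S_def\<close>)
  then have "best_approx x q" using q(1) by (auto simp: best_approx_def S_def admissible_def)
  then show ?thesis using q(1) by (intro exI[of _ q]) (simp add: S_def admissible_def)
qed

text \<open>Pigeonhole principle: the \<open>M ^ n\<close> vectors with entries in
  \<open>{..<M}\<close> yield fractional parts in \<open>M ^ n - 1\<close> intervals. The strict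
  bound on the norm is what later separates this form from the next best approximation, and the
  factor 2 absorbs the missing interval.\<close>

lemma dirichlet_form:
  fixes x :: "real ^ 'n::finite"
  assumes M: "2 \<le> M"
  shows "\<exists>b \<in> int_lattice. 0 < infnorm (fst b) \<and> infnorm (fst b) < real M \<and> \<bar>b \<bullet> star x\<bar> \<le> 2 / real M ^ CARD('n)"
proof -
  define V where "V = PiE (UNIV :: 'n set) (\<lambda>_. {..<M})"
  have cV: "finite V" "card V = M ^ CARD('n)" unfolding V_def by (auto simp: card_PiE intro!: finite_PiE)
  define K where "K = M ^ CARD('n) - 1"
  have M1: "2 \<le> M ^ CARD('n)"
    using power_increasing[of 1 "CARD('n)" M] M by (simp add: Suc_leI)
  then have K: "0 < K" "card V = Suc K" by (auto simp: K_def cV)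
  define f where "f v = frac (\<Sum>i\<in>UNIV. real (v i) * x $ i)" for v
  define g where "g v = nat \<lfloor>real K * f v\<rfloor>" for v
  have "g ` V \<subseteq> {..<K}"
  proof
    fix k assume "k \<in> g ` V"
    then obtain v where v: "k = g v" by blast
    have "0 \<le> f v" "f v < 1" by (auto simp: f_def frac_lt_1)
    then have "0 \<le> real K * f v" "real K * f v < real K * 1"
      using K by (auto intro!: mult_strict_left_mono)
    then show "k \<in> {..<K}" unfolding v g_def by (simp add: nat_less_iff floor_less_iff)
  qed
  then have "\<not> inj_on g V" using card_inj_on_le[of g V "{..<K}"] K by auto
  then obtain v w where vw: "v \<in> V" "w \<in> V" "g v = g w" "v \<noteq> w" by (auto simp: inj_on_def)
  have "\<bar>real K * f v - real K * f w\<bar> < 1"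
  proof -
    have "0 \<le> \<lfloor>real K * f v\<rfloor>" "0 \<le> \<lfloor>real K * f w\<rfloor>" by (simp_all add: f_def)
    then have "\<lfloor>real K * f v\<rfloor> = \<lfloor>real K * f w\<rfloor>" using vw(3) unfolding g_def by linarith
    then show ?thesis by linarith
  qed
  then have "real K * \<bar>f v - f w\<bar> < 1" by (simp add: abs_mult flip: right_diff_distrib)
  then have d: "\<bar>f v - f w\<bar> \<le> 1 / real K" using K by (simp add: field_simps less_imp_le)
  have dK: "1 / real K \<le> 2 / real M ^ CARD('n)"
  proof -
    have "real M ^ CARD('n) = real K + 1" using M1 by (simp add: K_def of_nat_diff)
    then show ?thesis using K by (simp add: field_simps)
  qed
  define b :: "'n ext" where "b = (\<chi> i. real (v i) - real (w i),
     real_of_int (\<lfloor>\<Sum>i\<in>UNIV. real (w i) * x $ i\<rfloor> - \<lfloor>\<Sum>i\<in>UNIV. real (v i) * x $ i\<rfloor>))"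
  have "b \<in> int_lattice" by (auto simp: b_def int_lattice_iff)
  moreover have "0 < infnorm (fst b)"
  proof -
    obtain i where "v i \<noteq> w i" using vw(4) by auto
    then have "fst b \<noteq> 0" by (auto simp: b_def vec_eq_iff)
    then show ?thesis by (simp add: infnorm_pos_lt)
  qed
  moreover have "infnorm (fst b) < real M"
  proof -
    have "v i < M" "w i < M" for i using vw(1,2) by (auto simp: V_def)
    then have vM: "real (v i) < real M" "real (w i) < real M" for i by simp_all
    have "\<bar>real (v i) - real (w i)\<bar> < real M" for i
      using vM[of i] of_nat_0_le_iff[of "v i", where 'a = real] of_nat_0_le_iff[of "w i", where 'a = real] by linarith
    then show ?thesis by (simp add: infnorm_less_iff b_def)
  qed
  moreover have "b \<bullet> star x = f v - f w"
    by (simp add: inner_star b_def inner_vec_def f_def frac_def left_diff_distrib sum_subtractf)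
  ultimately show ?thesis using d dK by (metis order_trans)
qed

text \<open>The Dirichlet form for \<open>M\<close> has norm below that of \<open>q (Suc j)\<close>,
  so a best approximation at least as good is, up to sign, one of the first \<open>j\<close>; and
  \<open>q j\<close> is at least as good as all of these.\<close>

lemma best_approx_seq_bound:
  fixes x :: "real ^ 'n::finite"
  assumes q: "best_approx_seq x q" and j: "1 \<le> j" and M: "infnorm (fst (q (Suc j))) = real M" "2 \<le> M"
  shows "\<bar>q j \<bullet> star x\<bar> \<le> 2 / real M ^ CARD('n)"
proof -
  obtain b where b: "b \<in> int_lattice" "0 < infnorm (fst b)" "infnorm (fst b) < real M"
    "\<bar>b \<bullet> star x\<bar> \<le> 2 / real M ^ CARD('n)"
    using dirichlet_form[OF M(2), of x] by blast
  then have "b \<in> admissible (infnorm (fst b))" by (simp add: admissible_def)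
  then obtain r where r: "best_approx x r" "infnorm (fst r) \<le> infnorm (fst b)" "\<bar>r \<bullet> star x\<bar> \<le> \<bar>b \<bullet> star x\<bar>"
    using best_approx_exists by blast
  then obtain i where i: "1 \<le> i" "r = q i \<or> r = - q i" using q unfolding best_approx_seq_def by blast
  have lt: "infnorm (fst (q i)) < infnorm (fst (q (Suc j)))"
    using i r(2) b(3) M(1) by (auto simp: infnorm_neg)
  have mono: "infnorm (fst (q r)) < infnorm (fst (q s))" if "1 \<le> r" "r < s" for r s
    using q that strict_mono_onD[of "{1..}" "\<lambda>j. infnorm (fst (q j))" r s] by (auto simp: best_approx_seq_def)
  have "\<not> Suc j < i" using mono[of "Suc j" i] lt by fastforce
  moreover have "i \<noteq> Suc j" using lt by auto
  ultimately have "i = j \<or> i < j" by linarith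
  then have "infnorm (fst (q i)) \<le> infnorm (fst (q j))" using mono[OF i(1), of j] by auto
  moreover have "best_approx x (q i)" "best_approx x (q j)" using q i(1) j by (auto simp: best_approx_seq_def)
  moreover from calculation have "q i \<in> admissible (infnorm (fst (q j)))"
    by (simp add: best_approx_def admissible_def)
  ultimately have "\<bar>q j \<bullet> star x\<bar> \<le> \<bar>q i \<bullet> star x\<bar>" unfolding best_approx_def by blast
  also have "\<dots> = \<bar>r \<bullet> star x\<bar>" using i(2) by auto
  finally show ?thesis using r(3) b(4) by linarith
qed

section \<open>Best approximations in the lattices of rank two\<close>

lemma int_span_two:
  assumes "u \<noteq> w"
  shows "int_span {u, w} = {of_int a *\<^sub>R u + of_int b *\<^sub>R w |a b. True}"
proof (intro equalityI subsetI)
  fix q assume "q \<in> int_span {u, w}"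
  then obtain T c where T: "finite T" "T \<subseteq> {u, w}" "q = (\<Sum>v\<in>T. of_int (c v) *\<^sub>R v)"
    unfolding int_span_def by blast
  define d where "d v = (if v \<in> T then c v else 0)" for v
  have "q = (\<Sum>v\<in>{u, w}. of_int (d v) *\<^sub>R v)"
    unfolding T(3) using T(2) by (intro sum.mono_neutral_cong_left) (auto simp: d_def)
  then have "q = of_int (d u) *\<^sub>R u + of_int (d w) *\<^sub>R w" using assms by simp
  then show "q \<in> {of_int a *\<^sub>R u + of_int b *\<^sub>R w |a b. True}" by blast
next
  fix q assume "q \<in> {of_int a *\<^sub>R u + of_int b *\<^sub>R w |a b. True}"
  then obtain a b where q: "q = of_int a *\<^sub>R u + of_int b *\<^sub>R w" by blast
  define c where "c v = (if v = u then a else b)" for v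
  have "q = (\<Sum>v\<in>{u, w}. of_int (c v) *\<^sub>R v)" using assms q by (simp add: c_def)
  then show "q \<in> int_span {u, w}" unfolding int_span_def by blast
qed

lemma int_span_mono: "S \<subseteq> T \<Longrightarrow> int_span S \<subseteq> int_span T"
  unfolding int_span_def by blast

lemma H_lattice_eq: "H_lattice (i :: 'n::finite) = {(axis i (of_int a), of_int b) |a b. True}"
proof -
  have "e_vec i \<noteq> (e_last :: 'n ext)" by (simp add: e_vec_def e_last_def)
  moreover have "a *\<^sub>R axis i 1 = (axis i a :: real ^ 'n)" for a
    by (simp add: vec_eq_iff axis_def)
  ultimately show ?thesis unfolding H_lattice_def
    by (subst int_span_two) (auto simp: e_vec_def e_last_def)
qed

text \<open>Normalises the sign by multiplication with \<open>sgn a\<close>: the first entry becomes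
  positive, and the last one is written \<open>- P\<close> so that the form reads as the error
  \<open>c * x $ i - P\<close>.\<close>

lemma H_lattice_best:
  fixes x :: "real ^ 'n::finite"
  assumes "best_approx x q" "q \<in> H_lattice i"
  obtains c P where "0 < c" "infnorm (fst q) = real c" "\<bar>q \<bullet> star x\<bar> = \<bar>real c * x $ i - real_of_int P\<bar>"
    "q = (axis i (real c), - real_of_int P) \<or> q = - (axis i (real c), - real_of_int P)"
proof -
  obtain a b :: int where q: "q = (axis i (of_int a), of_int b)"
    using assms(2) by (auto simp: H_lattice_eq)
  have n: "infnorm (fst q) = real (nat \<bar>a\<bar>)" by (simp add: q infnorm_axis)
  then have "0 < nat \<bar>a\<bar>" using assms(1) by (auto simp: best_approx_def admissible_def)
  have neg: "- axis i y = (axis i (- y) :: real ^ 'n)" for y by (simp add: vec_eq_iff axis_def)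
  show thesis
  proof (rule that[OF \<open>0 < nat \<bar>a\<bar>\<close> n, of "- (sgn a * b)"])
    show "q = (axis i (real (nat \<bar>a\<bar>)), - real_of_int (- (sgn a * b))) \<or>
        q = - (axis i (real (nat \<bar>a\<bar>)), - real_of_int (- (sgn a * b)))"
      using \<open>0 < nat \<bar>a\<bar>\<close> by (cases "0 < a") (auto simp: q neg)
    show "\<bar>q \<bullet> star x\<bar> = \<bar>real (nat \<bar>a\<bar>) * x $ i - real_of_int (- (sgn a * b))\<bar>"
      using \<open>0 < nat \<bar>a\<bar>\<close> by (cases "0 < a") (auto simp: q inner_star inner_axis_cart)
  qed
qed

text \<open>A vanishing determinant would give two relations, with coefficients \<open>b\<close>,
  \<open>a\<close> and \<open>t\<close>, \<open>s\<close>; independence makes all four numbers 0 and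
  hence the first vector 0.\<close>

lemma independent_parallel:
  assumes "independent {(axis i a, s), (axis i b, t)}" "(axis i a, s) \<noteq> (axis i b :: real ^ 'n::finite, t :: real)"
  shows "s * b \<noteq> t * a"
proof
  assume eq: "s * b = t * a"
  define u v where "u = (axis i a :: real ^ 'n, s)" "v = (axis i b :: real ^ 'n, t)"
  have 1: "b *\<^sub>R u - a *\<^sub>R v = 0" "t *\<^sub>R u - s *\<^sub>R v = 0"
    using eq by (auto simp: u_v_def vec_eq_iff axis_def prod_eq_iff mult.commute)
  have dep: "c = 0 \<and> d = 0" if "c *\<^sub>R u - d *\<^sub>R v = 0" for c d
  proof -
    have uv: "u \<noteq> v" using assms(2) by (simp add: u_v_def)
    define f where "f w = (if w = u then c else - d)" for w
    have "(\<Sum>w\<in>{u, v}. f w *\<^sub>R w) = 0" using that uv by (simp add: f_def)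
    moreover have "independent {u, v}" using assms(1) by (simp add: u_v_def)
    ultimately have "\<forall>w\<in>{u, v}. f w = 0"
      using dependent_finite[of "{u, v}"] by blast
    then show ?thesis using uv by (auto simp: f_def)
  qed
  have "u = 0" using dep[OF 1(1)] dep[OF 1(2)] by (auto simp: u_v_def zero_prod_def vec_eq_iff axis_def)
  then show False using assms(1) dependent_zero[of "{u, v}"] by (auto simp: u_v_def)
qed

text \<open>The alternation follows from independence and Dirichlet's theorem: two consecutive best
  approximations in the same lattice would have a nonzero integer determinant, which the error
  bounds make smaller than 1 in absolute value. The two orders of \<open>i1\<close> and
  \<open>i2\<close> account for the parity at which the tail starts.\<close>

lemma Theta_interlaced:
  fixes x :: "real ^ 'n::finite"
  assumes x: "x \<in> Theta i1 i2" and n: "2 \<le> CARD('n)"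
  shows "\<exists>c P. interlaced i1 i2 c P x \<or> interlaced i2 i1 c P x"
proof -
  define N where "N = CARD('n)"
  obtain q j1 j2 where q: "best_approx_seq x q" and j1: "1 \<le> j1" "\<And>j. j \<ge> j1 \<Longrightarrow> q j \<in> H_lattice i1 \<union> H_lattice i2"
    and j2: "\<And>j. j \<ge> j2 \<Longrightarrow> distinct [q j, q (j + 1), q (j + 2)] \<and> independent {q j, q (j + 1), q (j + 2)}"
    using x unfolding Theta_def by blast
  \<comment> \<open>Beyond both thresholds, and far enough that all norms are at least 4, which
    makes the two error terms below sum to less than 1.\<close>
  define J where "J = j1 + j2 + 4"
  have best: "best_approx x (q j)" if "1 \<le> j" for j using q that by (simp add: best_approx_seq_def)
  define k where "k j = (if q j \<in> H_lattice i1 then i1 else i2)" for j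
  have H: "q j \<in> H_lattice (k j)" if "j \<ge> j1" for j using j1(2)[OF that] by (auto simp: k_def)
  have "\<exists>c P. 0 < c \<and> infnorm (fst (q j)) = real c \<and> \<bar>q j \<bullet> star x\<bar> = \<bar>real c * x $ k j - real_of_int P\<bar> \<and>
    (q j = (axis (k j) (real c), - real_of_int P) \<or> q j = - (axis (k j) (real c), - real_of_int P))" if "j \<ge> j1" for j
  proof -
    have "1 \<le> j" using that j1(1) by simp
    from best[OF this] H[OF that] show ?thesis by (rule H_lattice_best) blast
  qed
  then obtain c P where cP: "\<And>j. j \<ge> j1 \<Longrightarrow> 0 < c j \<and> infnorm (fst (q j)) = real (c j) \<and>
      \<bar>q j \<bullet> star x\<bar> = \<bar>real (c j) * x $ k j - real_of_int (P j)\<bar> \<and>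
    (q j = (axis (k j) (real (c j)), - real_of_int (P j)) \<or> q j = - (axis (k j) (real (c j)), - real_of_int (P j)))"
    by metis
  have mono: "c j < c (Suc j)" if "j \<ge> j1" for j
  proof -
    have "infnorm (fst (q j)) < infnorm (fst (q (Suc j)))"
      using q that j1(1) strict_mono_onD[of "{1..}" "\<lambda>j. infnorm (fst (q j))" j "Suc j"]
      by (auto simp: best_approx_seq_def)
    then show ?thesis using cP[OF that] cP[of "Suc j"] that by simp
  qed
  have ge: "i < c (j1 + i)" for i
  proof (induction i)
    case 0 then show ?case using cP[of j1] by simp
  next
    case (Suc i) then show ?case using mono[of "j1 + i"] by simp
  qed
  have cJ: "4 \<le> c j" if "j \<ge> J" for j using ge[of "j - j1"] that by (simp add: J_def)
  have bound: "\<bar>real (c j) * x $ k j - real_of_int (P j)\<bar> \<le> 2 / real (c (Suc j)) ^ N" if "j \<ge> J" for j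
    using best_approx_seq_bound[OF q, of j "c (Suc j)"] cP[of j] cP[of "Suc j"] cJ[of "Suc j"] that j1(1)
    by (simp add: J_def N_def)
  \<comment> \<open>The listed vectors agree with the normalised \<open>u a\<close>,
    \<open>u b\<close> only up to sign; replacing \<open>q\<close> by \<open>u\<close> keeps the
    span, and thus independence.\<close>
  have par: "P a * int (c b) \<noteq> P b * int (c a)"
    if "a \<ge> J" "b \<ge> J" "k a = k b" "q a \<noteq> q b" "q a \<noteq> - q b" "independent {q a, q b}" for a b
  proof -
    define u where "u j = (axis (k j) (real (c j)), - real_of_int (P j))" for j
    have uq: "q a = u a \<or> q a = - u a" "q b = u b \<or> q b = - u b"
      using cP[of a] cP[of b] that(1,2) by (auto simp: u_def J_def)
    have ne: "u a \<noteq> u b" using uq that(4,5) by auto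
    have "u a \<in> span {q a, q b}" "u b \<in> span {q a, q b}"
      using uq by (metis insertI1 insertI2 minus_minus span_base span_neg)+
    have "independent {u a, u b}"
    proof (rule card_le_dim_spanning[of _ "span {q a, q b}"])
      have "q a \<in> span {u a, u b}" "q b \<in> span {u a, u b}"
        using uq by (metis insertI1 insertI2 span_base span_neg)+
      then show "span {q a, q b} \<subseteq> span {u a, u b}" by (simp add: span_minimal)
      show "{u a, u b} \<subseteq> span {q a, q b}" using \<open>u a \<in> _\<close> \<open>u b \<in> _\<close> by simp
      have "dim (span {q a, q b}) = card {q a, q b}" using that(6) by (simp add: dim_eq_card_independent)
      then show "card {u a, u b} \<le> dim (span {q a, q b})" using that(4) by (simp add: card_insert_if)
    qed simp
    then have "- real_of_int (P a) * real (c b) \<noteq> - real_of_int (P b) * real (c a)"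
      using independent_parallel[of "k a" "real (c a)" "- real_of_int (P a)" "real (c b)" "- real_of_int (P b)"] ne that(3)
      by (simp add: u_def)
    then show ?thesis by (metis mult_minus_left of_int_mult of_int_of_nat_eq)
  qed
  have anti: "q a \<noteq> - q b" if "independent {q a, q b}" "q a \<noteq> q b" for a b
  proof
    assume eq: "q a = - q b"
    have "q a \<in> span {q b}" unfolding eq by (simp add: span_base span_neg)
    then show False using that independent_insert[of "q a" "{q b}"] by (auto split: if_splits)
  qed
  have ind: "independent {q j, q (j + 1)} \<and> q j \<noteq> q (j + 1) \<and> independent {q j, q (j + 2)} \<and> q j \<noteq> q (j + 2)" if "j \<ge> J" for j
  proof -
    have "distinct [q j, q (j + 1), q (j + 2)]" "independent {q j, q (j + 1), q (j + 2)}"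
      using j2[of j] that by (simp_all add: J_def)
    then show ?thesis
      using independent_mono[of "{q j, q (j + 1), q (j + 2)}" "{q j, q (j + 1)}"]
        independent_mono[of "{q j, q (j + 1), q (j + 2)}" "{q j, q (j + 2)}"] by auto
  qed
  have alt: "k (Suc j) \<noteq> k j" if "j \<ge> J" for j
  proof
    assume eq: "k (Suc j) = k j"
    have "P j * int (c (Suc j)) \<noteq> P (Suc j) * int (c j)"
      using par[of j "Suc j"] ind[OF that] anti[of j "Suc j"] that eq by simp
    then have "1 \<le> \<bar>P j * int (c (Suc j)) - P (Suc j) * int (c j)\<bar>" by linarith
    then have "1 \<le> \<bar>real_of_int (P j * int (c (Suc j)) - P (Suc j) * int (c j))\<bar>" by linarith
    also have "real_of_int (P j * int (c (Suc j)) - P (Suc j) * int (c j)) =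
        real (c j) * (real (c (Suc j)) * x $ k j - real_of_int (P (Suc j))) - real (c (Suc j)) * (real (c j) * x $ k j - real_of_int (P j))"
      by (simp add: algebra_simps)
    also have "\<bar>\<dots>\<bar> \<le> real (c j) * (2 / real (c (Suc (Suc j))) ^ N) + real (c (Suc j)) * (2 / real (c (Suc j)) ^ N)"
    proof -
      have "\<bar>real (c j) * (real (c (Suc j)) * x $ k j - real_of_int (P (Suc j)))\<bar> \<le> real (c j) * (2 / real (c (Suc (Suc j))) ^ N)"
        using mult_left_mono[OF bound[of "Suc j"], of "real (c j)"] that eq by (simp add: abs_mult)
      moreover have "\<bar>real (c (Suc j)) * (real (c j) * x $ k j - real_of_int (P j))\<bar> \<le> real (c (Suc j)) * (2 / real (c (Suc j)) ^ N)"
        using mult_left_mono[OF bound[of j], of "real (c (Suc j))"] that by (simp add: abs_mult)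
      ultimately show ?thesis by linarith
    qed
    also have "\<dots> < 1"
    proof -
      have b: "y * (2 / z ^ N) \<le> 2 / z" if "0 \<le> y" "y \<le> z" "4 \<le> z" for y z :: real
      proof -
        have "z * z \<le> z ^ N" using power_increasing[of 2 N z] n that by (simp add: power2_eq_square N_def)
        then have "2 / z ^ N \<le> 2 / (z * z)" using that by (intro divide_left_mono) auto
        then have "y * (2 / z ^ N) \<le> z * (2 / (z * z))" using that by (intro mult_mono) auto
        then show ?thesis using that by simp
      qed
      have c: "4 \<le> c j" "c j < c (Suc j)" "c (Suc j) < c (Suc (Suc j))"
        using cJ[of j] mono[of j] mono[of "Suc j"] that by (auto simp: J_def)
      have "2 / z < 1 / 2" if "4 < z" for z :: real using that by (simp add: field_simps)
      then have "2 / real (c (Suc j)) < 1 / 2" "2 / real (c (Suc (Suc j))) < 1 / 2" using c by auto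
      moreover have "real (c j) * (2 / real (c (Suc (Suc j))) ^ N) \<le> 2 / real (c (Suc (Suc j)))"
        "real (c (Suc j)) * (2 / real (c (Suc j)) ^ N) \<le> 2 / real (c (Suc j))"
        using c by (auto intro!: b simp del: times_divide_eq_right)
      ultimately show ?thesis by linarith
    qed
    finally show False by simp
  qed
  have k12: "k j = i1 \<or> k j = i2" for j by (simp add: k_def)
  define \<alpha> where "\<alpha> = k J"
  define \<beta> where "\<beta> = k (Suc J)"
  have kk: "k (J + j) = (if even j then \<alpha> else \<beta>)" for j
  proof (induction j rule: nat_less_induct)
    case (1 j)
    consider "j = 0" | "j = 1" | i where "j = Suc (Suc i)" by (metis One_nat_def not0_implies_Suc)
    then show ?case
    proof cases
      case 3
      have "k (J + j) \<noteq> k (J + Suc i)" "k (J + Suc i) \<noteq> k (J + i)"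
        using alt[of "J + Suc i"] alt[of "J + i"] 3 by simp_all
      then have "k (J + j) = k (J + i)" using k12[of "J + j"] k12[of "J + Suc i"] k12[of "J + i"] by metis
      then show ?thesis using 1 3 by simp
    qed (auto simp: \<alpha>_def \<beta>_def)
  qed
  have "interlaced \<alpha> \<beta> (\<lambda>j. c (J + j)) (\<lambda>j. P (J + j)) x"
    unfolding interlaced_def
  proof (intro allI conjI)
    fix j
    show "0 < c (J + j)" using cJ[of "J + j"] by simp
    show "c (J + j) < c (J + Suc j)" using mono[of "J + j"] by (simp add: J_def)
    show "\<bar>real (c (J + j)) * x $ (if even j then \<alpha> else \<beta>) - real_of_int (P (J + j))\<bar> \<le> 2 / real (c (J + Suc j)) ^ CARD('n)"
      using bound[of "J + j"] by (simp add: kk N_def)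
    show "P (J + j) * int (c (J + (j + 2))) \<noteq> P (J + (j + 2)) * int (c (J + j))"
    proof (rule par)
      show "k (J + j) = k (J + (j + 2))" unfolding kk by simp
      show "q (J + j) \<noteq> q (J + (j + 2))" "independent {q (J + j), q (J + (j + 2))}"
        using ind[of "J + j"] by (auto simp: add.assoc)
      then show "q (J + j) \<noteq> - q (J + (j + 2))" by (intro anti)
    qed auto
  qed
  moreover have "(\<alpha>, \<beta>) = (i1, i2) \<or> (\<alpha>, \<beta>) = (i2, i1)"
    using alt[of J] k12[of J] k12[of "Suc J"] by (auto simp: \<alpha>_def \<beta>_def)
  ultimately show ?thesis by blast
qed

section \<open>A criterion for membership\<close>

lemma distinct_independent3I:
  fixes u v w :: "'a::real_vector"
  assumes "\<And>a b c. a *\<^sub>R u + b *\<^sub>R v + c *\<^sub>R w = 0 \<Longrightarrow> a = 0 \<and> b = 0 \<and> c = 0"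
  shows "distinct [u, v, w] \<and> independent {u, v, w}"
proof
  have "u \<noteq> v" using assms[of 1 "- 1" 0] by auto
  moreover have "u \<noteq> w" using assms[of 1 0 "- 1"] by auto
  moreover have "v \<noteq> w" using assms[of 0 1 "- 1"] by auto
  ultimately show "distinct [u, v, w]" by simp
  then have sum: "(\<Sum>y\<in>{u, v, w}. f y *\<^sub>R y) = f u *\<^sub>R u + f v *\<^sub>R v + f w *\<^sub>R w" for f
    by (simp add: add.assoc)
  show "independent {u, v, w}"
  proof
    assume "dependent {u, v, w}"
    then obtain f where f: "\<exists>y\<in>{u, v, w}. f y \<noteq> 0" "(\<Sum>y\<in>{u, v, w}. f y *\<^sub>R y) = 0"
      using dependent_finite[of "{u, v, w}"] by blast
    then have "f u = 0 \<and> f v = 0 \<and> f w = 0" using assms unfolding sum by blast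
    then show False using f(1) by auto
  qed
qed

text \<open>\<open>pos\<close> makes the approximations one-sided, so that the intended forms need
  no absolute values. The 8 in \<open>small\<close> keeps two error terms at most 1/8 each.
  \<open>generic\<close> excludes competition from integer vectors that involve further coordinates;
  only this condition is restricted to indices from \<open>J\<close> on, since it is obtained almost
  surely up to finitely many exceptions.\<close>

locale interlaced_approximations =
  fixes i1 i2 :: "'n::finite" and x :: "real ^ 'n" and c :: "nat \<Rightarrow> nat" and P :: "nat \<Rightarrow> int" and J :: nat
  assumes i12: "i1 \<noteq> i2" and n2: "2 \<le> CARD('n)"
    and c0: "0 < c 0" and c_less: "\<And>j. c j < c (Suc j)"
    and cop_P: "\<And>j. coprime (P j) (int (c j))"
    and cop_c: "\<And>j. coprime (c j) (c (Suc j))"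
    and pos: "\<And>j. 0 < real (c j) * x $ (if even j then i1 else i2) - real_of_int (P j)"
    and small: "\<And>j. 8 * (real (c j) * x $ (if even j then i1 else i2) - real_of_int (P j)) * real (c (Suc j)) ^ CARD('n) \<le> 1"
    and generic: "\<And>j v t. J \<le> j \<Longrightarrow> (\<And>i. v $ i \<in> \<int>) \<Longrightarrow> t \<in> \<int> \<Longrightarrow> (\<exists>i. i \<noteq> i1 \<and> i \<noteq> i2 \<and> v $ i \<noteq> 0) \<Longrightarrow>
        (\<And>i. \<bar>v $ i\<bar> < real (c (Suc j))) \<Longrightarrow>
        real (c j) * x $ (if even j then i1 else i2) - real_of_int (P j) < \<bar>v \<bullet> x + t\<bar>"
begin

definition k :: "nat \<Rightarrow> 'n" where "k j = (if even j then i1 else i2)"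

definition L :: "nat \<Rightarrow> real" where "L j = real (c j) * x $ k j - real_of_int (P j)"

definition Q :: "nat \<Rightarrow> 'n ext" where "Q j = (axis (k j) (real (c j)), - real_of_int (P j))"

lemma k_ne: "k j \<noteq> k (Suc j)" using i12 by (simp add: k_def)

lemma L_pos: "0 < L j" using pos by (simp add: L_def k_def)

lemma c_strict: "strict_mono c" using c_less by (simp add: strict_mono_Suc_iff)

lemma c_pos: "0 < c j" using c0 c_strict by (metis gr0I less_nat_zero_code strict_mono_less)

lemma c_ge: "j \<le> c j" using c_strict by (rule strict_mono_imp_increasing)

lemma L_le: "8 * L j * (real (c (Suc j)))\<^sup>2 \<le> 1"
proof -
  have "(real (c (Suc j)))\<^sup>2 \<le> real (c (Suc j)) ^ CARD('n)"
    using n2 c_pos[of "Suc j"] by (intro power_increasing) (auto simp: Suc_le_eq)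
  then have "8 * L j * (real (c (Suc j)))\<^sup>2 \<le> 8 * L j * real (c (Suc j)) ^ CARD('n)"
    using L_pos[of j] by (intro mult_left_mono) auto
  then show ?thesis using small[of j] by (simp add: L_def k_def)
qed

lemma star_Q: "Q j \<bullet> star x = L j"
  by (simp add: Q_def inner_star inner_axis_cart L_def)

lemma infnorm_Q: "infnorm (fst (Q j)) = real (c j)"
  by (simp add: Q_def infnorm_axis)

lemma Q_in_lattice: "Q j \<in> int_lattice"
  by (auto simp: Q_def int_lattice_iff axis_def)

text \<open>Multiplied by \<open>c j * c (Suc j)\<close>, the form becomes the integer
  \<open>I\<close> up to two errors of at most 1/8. If \<open>I \<noteq> 0\<close>, the form is at
  least \<open>3 / (4 * c j * c (Suc j))\<close> in absolute value, which exceeds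
  \<open>L j\<close>. If \<open>I = 0\<close>, coprimality forces \<open>c (Suc j)\<close> to divide
  \<open>w\<close>, so \<open>w = 0\<close>, and then \<open>c j\<close> to divide \<open>u\<close>;
  the form is a nonzero multiple of \<open>L j\<close>.\<close>

lemma form_on_plane:
  fixes u w t :: int
  assumes u: "\<bar>u\<bar> < int (c (Suc j))" and w: "\<bar>w\<bar> < int (c (Suc j))" and uw: "u \<noteq> 0 \<or> w \<noteq> 0"
  defines "V \<equiv> real_of_int u * x $ k j + real_of_int w * x $ k (Suc j) + real_of_int t"
  shows "L j < \<bar>V\<bar> \<or> (w = 0 \<and> ((u = int (c j) \<and> t = - P j) \<or> (u = - int (c j) \<and> t = P j)))"
proof -
  define a b where "a = real (c j)" "b = real (c (Suc j))"
  note ab = this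
  have ab0: "0 < a" "a < b" using c_pos[of j] c_less[of j] by (auto simp: ab)
  define I where "I = u * P j * int (c (Suc j)) + w * P (Suc j) * int (c j) + t * int (c j) * int (c (Suc j))"
  have x1: "a * x $ k j = real_of_int (P j) + L j" and x2: "b * x $ k (Suc j) = real_of_int (P (Suc j)) + L (Suc j)"
    by (simp_all add: L_def ab)
  have "V * (a * b) = real_of_int u * (a * x $ k j) * b + real_of_int w * (b * x $ k (Suc j)) * a + real_of_int t * a * b"
    by (simp add: V_def algebra_simps)
  also have "\<dots> = real_of_int I + (real_of_int u * L j * b + real_of_int w * L (Suc j) * a)"
    unfolding x1 x2 by (simp add: I_def ab algebra_simps)
  finally have V: "V * (a * b) = real_of_int I + (real_of_int u * L j * b + real_of_int w * L (Suc j) * a)" .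
  show ?thesis
  proof (cases "I = 0")
    case True
    have "int (c (Suc j)) dvd w * (P (Suc j) * int (c j))"
    proof -
      have "w * (P (Suc j) * int (c j)) = int (c (Suc j)) * (- (u * P j) - t * int (c j))"
        using True by (simp add: I_def algebra_simps)
      then show ?thesis by simp
    qed
    moreover have "coprime (int (c (Suc j))) (P (Suc j) * int (c j))"
      using cop_P[of "Suc j"] cop_c[of j] by (simp add: coprime_commute)
    ultimately have "int (c (Suc j)) dvd w" by (simp add: coprime_dvd_mult_left_iff)
    then have w0: "w = 0" using w dvd_imp_le_int[of w "int (c (Suc j))"] by force
    then have "int (c (Suc j)) * (u * P j + t * int (c j)) = 0" using True by (simp add: I_def algebra_simps)
    then have eq: "u * P j + t * int (c j) = 0" using c_pos[of "Suc j"] by simp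
    then have "u * P j = int (c j) * (- t)" by (simp add: algebra_simps)
    then have "int (c j) dvd u * P j" by simp
    then have "int (c j) dvd u" using cop_P[of j] by (simp add: coprime_dvd_mult_left_iff coprime_commute)
    then obtain m where m: "u = int (c j) * m" by blast
    then have "int (c j) * (m * P j + t) = 0" using eq by (simp add: algebra_simps)
    then have t: "t = - (m * P j)" using c_pos[of j] by simp
    have "V = real_of_int m * L j" using m t w0 by (simp add: V_def L_def algebra_simps)
    moreover have "m \<noteq> 0" using uw w0 m by auto
    ultimately show ?thesis
    proof (cases "m = 1 \<or> m = - 1")
      case False
      then have "2 \<le> \<bar>m\<bar>" using \<open>m \<noteq> 0\<close> by linarith
      then have "2 * L j \<le> real_of_int \<bar>m\<bar> * L j" using L_pos[of j] by (intro mult_right_mono) auto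
      then show ?thesis using \<open>V = _\<close> L_pos[of j] by (simp add: abs_mult)
    qed (use m t w0 in auto)
  next
    case False
    then have "1 \<le> \<bar>real_of_int I\<bar>" by linarith
    moreover have "\<bar>real_of_int u * L j * b\<bar> \<le> 1 / 8"
    proof -
      have "\<bar>real_of_int u\<bar> \<le> b" using u unfolding ab by linarith
      then have "\<bar>real_of_int u\<bar> * (L j * b) \<le> b * (L j * b)" using L_pos[of j] ab0 by (intro mult_right_mono) auto
      moreover have "8 * (b * (L j * b)) \<le> 1" using L_le[of j] by (simp add: power2_eq_square ab mult_ac)
      moreover have "\<bar>real_of_int u * L j * b\<bar> = \<bar>real_of_int u\<bar> * (L j * b)"
        using L_pos[of j] ab0 by (simp add: abs_mult)
      ultimately show ?thesis by linarith
    qed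
    moreover have "\<bar>real_of_int w * L (Suc j) * a\<bar> \<le> 1 / 8"
    proof -
      define d where "d = real (c (Suc (Suc j)))"
      have d: "b < d" using c_less[of "Suc j"] by (simp add: ab d_def)
      have "\<bar>real_of_int w\<bar> \<le> d" using w d unfolding ab by linarith
      then have "\<bar>real_of_int w\<bar> * (L (Suc j) * a) \<le> d * (L (Suc j) * d)"
        using L_pos[of "Suc j"] ab0 d by (intro mult_mono) auto
      moreover have "8 * (d * (L (Suc j) * d)) \<le> 1" using L_le[of "Suc j"] by (simp add: power2_eq_square d_def mult_ac)
      moreover have "\<bar>real_of_int w * L (Suc j) * a\<bar> = \<bar>real_of_int w\<bar> * (L (Suc j) * a)"
        using L_pos[of "Suc j"] ab0 by (simp add: abs_mult)
      ultimately show ?thesis by linarith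
    qed
    ultimately have "3 / 4 \<le> \<bar>V * (a * b)\<bar>" unfolding V by linarith
    moreover have "L j * (a * b) < 3 / 4"
    proof -
      have "L j * (a * b) \<le> L j * (b * b)" using L_pos[of j] ab0 by (intro mult_left_mono mult_right_mono) auto
      then show ?thesis using L_le[of j] by (simp add: power2_eq_square ab[symmetric])
    qed
    moreover have "\<bar>V * (a * b)\<bar> = \<bar>V\<bar> * (a * b)" using ab0 by (simp add: abs_mult)
    ultimately have "L j * (a * b) < \<bar>V\<bar> * (a * b)" by linarith
    then have "L j < \<bar>V\<bar>" by (rule mult_right_less_imp_less) (use ab0 in simp)
    then show ?thesis ..
  qed
qed

text \<open>Vectors with a nonzero entry outside \<open>i1\<close> and \<open>i2\<close> are handled
  by \<open>generic\<close>; the others have two free entries and fall under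
  \<open>form_on_plane\<close>.\<close>

lemma form_large:
  assumes j: "J \<le> j" and b: "b \<in> int_lattice" "fst b \<noteq> 0" "infnorm (fst b) < real (c (Suc j))"
  shows "L j < \<bar>b \<bullet> star x\<bar> \<or> b = Q j \<or> b = - Q j"
proof (cases "\<exists>i. i \<noteq> i1 \<and> i \<noteq> i2 \<and> fst b $ i \<noteq> 0")
  case True
  then have "L j < \<bar>fst b \<bullet> x + snd b\<bar>"
    using generic[OF j, of "fst b" "snd b"] b by (simp add: int_lattice_iff infnorm_less_iff L_def k_def)
  then show ?thesis by (simp add: inner_star)
next
  case False
  have kk: "{k j, k (Suc j)} = {i1, i2}" by (auto simp: k_def)
  obtain u w t where uwt: "fst b $ k j = real_of_int u" "fst b $ k (Suc j) = real_of_int w" "snd b = real_of_int t"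
    using b(1) unfolding int_lattice_iff by (metis Ints_cases)
  have v0: "fst b $ i = 0" if "i \<noteq> k j" "i \<noteq> k (Suc j)" for i using False that kk by auto
  have v: "fst b = axis (k j) (real_of_int u) + axis (k (Suc j)) (real_of_int w)"
    using k_ne[of j] uwt v0 by (auto simp: vec_eq_iff axis_def)
  have val: "b \<bullet> star x = real_of_int u * x $ k j + real_of_int w * x $ k (Suc j) + real_of_int t"
    by (simp add: inner_star v inner_add_left inner_axis_cart uwt(3))
  have "\<bar>fst b $ i\<bar> < real (c (Suc j))" for i using b(3) by (simp add: infnorm_less_iff)
  from this[of "k j"] this[of "k (Suc j)"] have lt: "\<bar>u\<bar> < int (c (Suc j))" "\<bar>w\<bar> < int (c (Suc j))"
    unfolding uwt by linarith+
  have "u \<noteq> 0 \<or> w \<noteq> 0"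
  proof (rule ccontr)
    assume "\<not> (u \<noteq> 0 \<or> w \<noteq> 0)"
    then have "fst b = 0" unfolding v by (simp add: vec_eq_iff axis_def)
    then show False using b(2) by simp
  qed
  from form_on_plane[OF lt this, of t] show ?thesis
  proof
    assume "w = 0 \<and> ((u = int (c j) \<and> t = - P j) \<or> (u = - int (c j) \<and> t = P j))"
    then show ?thesis
      by (cases b) (use v uwt in \<open>auto simp: Q_def vec_eq_iff axis_def\<close>)
  qed (simp add: val)
qed

text \<open>For large \<open>j\<close> the norm of \<open>q\<close> is below
  \<open>c (Suc j)\<close>, and then its form is at least \<open>L j > 0\<close> in absolute
  value.\<close>

lemma irrational: "totally_irrational x"
  unfolding totally_irrational_def
proof (intro ballI impI)
  fix q :: "'n ext" assume q: "q \<in> int_lattice" "q \<noteq> 0"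
  show "q \<bullet> star x \<noteq> 0"
  proof (cases "fst q = 0")
    case True
    then show ?thesis using q(2) by (simp add: inner_star prod_eq_iff)
  next
    case False
    obtain m :: nat where m: "infnorm (fst q) < real m" using reals_Archimedean2 by blast
    have "real m \<le> real (c (Suc (J + m)))" using c_ge[of "Suc (J + m)"] by simp
    then have "infnorm (fst q) < real (c (Suc (J + m)))" using m by linarith
    then have "L (J + m) < \<bar>q \<bullet> star x\<bar> \<or> q = Q (J + m) \<or> q = - Q (J + m)"
      using form_large[of "J + m" q] q False by simp
    then show ?thesis using L_pos[of "J + m"] star_Q[of "J + m"] by auto
  qed
qed

lemma best_Q:
  assumes "J \<le> j"
  shows "best_approx x (Q j)"
  unfolding best_approx_def
proof (intro conjI ballI)
  show "Q j \<in> admissible (infnorm (fst (Q j)))"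
    using c_pos[of j] Q_in_lattice by (simp add: admissible_def infnorm_Q)
  fix b :: "'n ext" assume b: "b \<in> admissible (infnorm (fst (Q j)))"
  then have "infnorm (fst b) < real (c (Suc j))" "fst b \<noteq> 0"
    using c_less[of j] by (auto simp: admissible_def infnorm_Q infnorm_pos_lt)
  then have "L j < \<bar>b \<bullet> star x\<bar> \<or> b = Q j \<or> b = - Q j"
    using form_large[OF assms, of b] b by (simp add: admissible_def)
  then show "\<bar>Q j \<bullet> star x\<bar> \<le> \<bar>b \<bullet> star x\<bar>" using L_pos[of j] star_Q[of j] by auto
qed

lemma c_block:
  assumes "real (c J) \<le> r"
  obtains j where "J \<le> j" "real (c j) \<le> r" "r < real (c (Suc j))"
proof -
  obtain m :: nat where m: "r < real m" using reals_Archimedean2 by blast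
  have "r < real (c m)" using m c_ge[of m] by linarith
  define i where "i = (LEAST i. r < real (c i))"
  have i: "r < real (c i)" unfolding i_def by (rule LeastI[of "\<lambda>i. r < real (c i)", OF \<open>r < real (c m)\<close>])
  then have "c J < c i" using assms by linarith
  then have "J < i" using c_strict by (simp add: strict_mono_less)
  then obtain j where j: "i = Suc j" by (cases i) auto
  have "\<not> r < real (c j)" using not_less_Least[of j "\<lambda>i. r < real (c i)"] j by (simp add: i_def[symmetric])
  then show thesis using that[of j] i j \<open>J < i\<close> by simp
qed

text \<open>A best approximation whose norm lies between \<open>c j\<close> and
  \<open>c (Suc j)\<close> cannot be worse than \<open>Q j\<close>, and \<open>form_large\<close>
  leaves no other candidates.\<close>

lemma best_is_Q:
  assumes b: "best_approx x b" "real (c J) \<le> infnorm (fst b)"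
  obtains j where "J \<le> j" "b = Q j \<or> b = - Q j"
proof -
  obtain j where j: "J \<le> j" "real (c j) \<le> infnorm (fst b)" "infnorm (fst b) < real (c (Suc j))"
    using c_block[OF b(2)] by blast
  have "Q j \<in> admissible (infnorm (fst b))"
    using j(2) c_pos[of j] Q_in_lattice by (simp add: admissible_def infnorm_Q)
  then have "\<bar>b \<bullet> star x\<bar> \<le> L j" using b(1) L_pos[of j] star_Q[of j] by (auto simp: best_approx_def)
  moreover have "b \<in> int_lattice" "fst b \<noteq> 0"
    using b(1) by (auto simp: best_approx_def admissible_def infnorm_pos_lt)
  ultimately show thesis using form_large[OF j(1) _ _ j(3)] that[OF j(1)] by fastforce
qed

lemma min_form_eq:
  assumes j: "J \<le> j" and r: "real (c j) \<le> r" "r < real (c (Suc j))"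
  shows "min_form x r = L j"
  unfolding min_form_def
proof (rule cInf_eq_minimum)
  have "Q j \<in> admissible r" using r(1) c_pos[of j] Q_in_lattice by (simp add: admissible_def infnorm_Q)
  then show "L j \<in> (\<lambda>b. \<bar>b \<bullet> star x\<bar>) ` admissible r" using L_pos[of j] star_Q[of j] by force
  fix y assume "y \<in> (\<lambda>b. \<bar>b \<bullet> star x\<bar>) ` admissible r"
  then obtain b :: "'n ext" where b: "y = \<bar>b \<bullet> star x\<bar>" "b \<in> admissible r" by blast
  then have "infnorm (fst b) < real (c (Suc j))" "fst b \<noteq> 0" "b \<in> int_lattice"
    using r(2) by (auto simp: admissible_def infnorm_pos_lt)
  then have "L j < \<bar>b \<bullet> star x\<bar> \<or> b = Q j \<or> b = - Q j" using form_large[OF j] by blast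
  then show "L j \<le> y" using b(1) L_pos[of j] star_Q[of j] by auto
qed

lemma best_unique:
  assumes "best_approx x b" "best_approx x d" "infnorm (fst b) = infnorm (fst d)"
  shows "b = d \<or> b = - d"
proof -
  have "\<bar>b \<bullet> star x\<bar> = \<bar>d \<bullet> star x\<bar>" using assms unfolding best_approx_def by (metis antisym)
  then have "(b - d) \<bullet> star x = 0 \<or> (b + d) \<bullet> star x = 0" by (auto simp: inner_diff_left inner_add_left abs_eq_iff)
  moreover have "b - d \<in> int_lattice" "b + d \<in> int_lattice"
    using assms(1,2) by (auto simp: best_approx_def admissible_def int_lattice_iff)
  ultimately have "b - d = 0 \<or> b + d = 0" using irrational unfolding totally_irrational_def by blast
  then show ?thesis by (auto simp: add_eq_0_iff2)
qed

text \<open>Signs are arbitrary since the sequence lists only one of each pair. The middle vector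
  has a coordinate of its own, and proportional outer vectors would make \<open>c (j + 2)\<close>
  divide \<open>c j\<close>, because the later fraction is reduced.\<close>

lemma Q_independent:
  assumes s: "s0 = 1 \<or> s0 = - 1" "s1 = 1 \<or> s1 = - 1" "s2 = 1 \<or> s2 = (- 1 :: real)"
  shows "distinct [s0 *\<^sub>R Q j, s1 *\<^sub>R Q (Suc j), s2 *\<^sub>R Q (Suc (Suc j))] \<and>
    independent {s0 *\<^sub>R Q j, s1 *\<^sub>R Q (Suc j), s2 *\<^sub>R Q (Suc (Suc j))}"
proof (rule distinct_independent3I)
  fix a b d :: real
  assume eq: "a *\<^sub>R s0 *\<^sub>R Q j + b *\<^sub>R s1 *\<^sub>R Q (Suc j) + d *\<^sub>R s2 *\<^sub>R Q (Suc (Suc j)) = 0"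
  have kss: "k (Suc (Suc j)) = k j" by (simp add: k_def)
  define A B D where "A = a * s0" "B = b * s1" "D = d * s2"
  note defs = this
  have e: "A * real (c j) + D * real (c (Suc (Suc j))) = 0" "B * real (c (Suc j)) = 0"
    "A * real_of_int (P j) + B * real_of_int (P (Suc j)) + D * real_of_int (P (Suc (Suc j))) = 0"
  proof -
    from eq have f: "fst (A *\<^sub>R Q j + B *\<^sub>R Q (Suc j) + D *\<^sub>R Q (Suc (Suc j))) = 0"
      and g: "snd (A *\<^sub>R Q j + B *\<^sub>R Q (Suc j) + D *\<^sub>R Q (Suc (Suc j))) = 0"
      by (simp_all add: defs)
    from f have f': "fst (A *\<^sub>R Q j + B *\<^sub>R Q (Suc j) + D *\<^sub>R Q (Suc (Suc j))) $ i = 0" for i by simp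
    show "A * real (c j) + D * real (c (Suc (Suc j))) = 0"
      using f'[of "k j"] k_ne[of j] by (simp add: Q_def axis_def kss split: if_splits)
    show "B * real (c (Suc j)) = 0"
      using f'[of "k (Suc j)"] k_ne[of j] by (simp add: Q_def axis_def kss split: if_splits)
    show "A * real_of_int (P j) + B * real_of_int (P (Suc j)) + D * real_of_int (P (Suc (Suc j))) = 0"
      using g by (simp add: Q_def algebra_simps)
  qed
  have "B = 0" using e(2) c_pos[of "Suc j"] by simp
  have "D = 0"
  proof (rule ccontr)
    assume "D \<noteq> 0"
    have "D * (real (c (Suc (Suc j))) * real_of_int (P j) - real_of_int (P (Suc (Suc j))) * real (c j)) =
      (A * real (c j) + D * real (c (Suc (Suc j)))) * real_of_int (P j) -
      (A * real_of_int (P j) + D * real_of_int (P (Suc (Suc j)))) * real (c j)" by (simp add: algebra_simps)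
    also have "\<dots> = 0" using e \<open>B = 0\<close> by simp
    finally have "real (c (Suc (Suc j))) * real_of_int (P j) = real_of_int (P (Suc (Suc j))) * real (c j)"
      using \<open>D \<noteq> 0\<close> by simp
    then have "real_of_int (int (c (Suc (Suc j))) * P j) = real_of_int (P (Suc (Suc j)) * int (c j))" by simp
    then have "int (c (Suc (Suc j))) * P j = P (Suc (Suc j)) * int (c j)" by (simp only: of_int_eq_iff)
    then have "int (c (Suc (Suc j))) dvd P (Suc (Suc j)) * int (c j)" by (metis dvd_triv_left)
    then have "int (c (Suc (Suc j))) dvd int (c j)"
      using cop_P[of "Suc (Suc j)"] by (simp add: coprime_dvd_mult_right_iff coprime_commute)
    then have "c (Suc (Suc j)) \<le> c j" using c_pos[of j] by (simp add: dvd_imp_le)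
    then show False using c_less[of j] c_less[of "Suc j"] by linarith
  qed
  then have "A = 0" using e(1) c_pos[of j] by simp
  then show "a = 0 \<and> b = 0 \<and> d = 0" using \<open>B = 0\<close> \<open>D = 0\<close> s by (auto simp: defs)
qed

text \<open>The sequence must also list best approximations of small norm, about which nothing is
  known. It is therefore obtained by enumerating the set \<open>S\<close> of all norms of best
  approximations and choosing a vector for each; beyond \<open>c J\<close> this enumeration is that
  of the \<open>c j\<close>, shifted.\<close>

theorem in_Theta: "x \<in> Theta i1 i2"
proof -
  define S where "S = {m :: nat. \<exists>b. best_approx x b \<and> infnorm (fst b) = real m}"
  have cS: "c j \<in> S" if "J \<le> j" for j using best_Q[OF that] infnorm_Q[of j] unfolding S_def by blast
  have Sc: "\<exists>j\<ge>J. m = c j" if "m \<in> S" "c J \<le> m" for m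
  proof -
    obtain b where b: "best_approx x b" "infnorm (fst b) = real m" using \<open>m \<in> S\<close> by (auto simp: S_def)
    then obtain j where "J \<le> j" "b = Q j \<or> b = - Q j" using best_is_Q[of b] \<open>c J \<le> m\<close> by auto
    then have "real m = real (c j)" using b(2) by (auto simp: infnorm_Q infnorm_neg)
    then show ?thesis using \<open>J \<le> j\<close> by auto
  qed
  have inf: "infinite S"
  proof -
    have "infinite (c ` {J..})"
      using c_strict by (auto dest!: finite_imageD simp: infinite_Ici strict_mono_imp_inj_on inj_on_subset)
    moreover have "c ` {J..} \<subseteq> S" using cS by auto
    ultimately show ?thesis by (meson finite_subset)
  qed
  define e where "e = enumerate S"
  have eS: "e i \<in> S" for i using inf by (simp add: e_def enumerate_in_set)
  \<comment> \<open>\<open>enumerate\<close> starts at 0, the sequence of best approximations at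
    1.\<close>
  define q where "q j = (SOME b. best_approx x b \<and> infnorm (fst b) = real (e (j - 1)))" for j
  have q: "best_approx x (q j)" "infnorm (fst (q j)) = real (e (j - 1))" for j
  proof -
    have "\<exists>b. best_approx x b \<and> infnorm (fst b) = real (e (j - 1))" using eS[of "j - 1"] by (simp add: S_def)
    then have "best_approx x (q j) \<and> infnorm (fst (q j)) = real (e (j - 1))" unfolding q_def by (rule someI_ex)
    then show "best_approx x (q j)" "infnorm (fst (q j)) = real (e (j - 1))" by auto
  qed
  have seq: "best_approx_seq x q"
    unfolding best_approx_seq_def
  proof (intro conjI allI impI)
    show "strict_mono_on {1..} (\<lambda>j. infnorm (fst (q j)))"
      using inf by (auto simp: strict_mono_on_def q e_def intro!: enumerate_mono)
    fix b assume b: "best_approx x b"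
    obtain i where i: "infnorm (fst b) = \<bar>fst b $ i\<bar>" by (rule infnorm_eq_component)
    have "fst b $ i \<in> \<int>" using b by (simp add: best_approx_def admissible_def int_lattice_iff)
    then obtain z where "fst b $ i = real_of_int z" by (rule Ints_cases)
    then have "infnorm (fst b) = real (nat \<bar>z\<bar>)" using i by simp
    moreover from this have "nat \<bar>z\<bar> \<in> S" using b unfolding S_def by blast
    then obtain m where "e m = nat \<bar>z\<bar>" unfolding e_def using enumerate_Ex[OF inf] by blast
    ultimately have "infnorm (fst b) = infnorm (fst (q (Suc m)))" by (simp add: q)
    then have "b = q (Suc m) \<or> b = - q (Suc m)" by (rule best_unique[OF b q(1)])
    then show "\<exists>j\<ge>1. b = q j \<or> b = - q j" by (intro exI[of _ "Suc m"]) auto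
  qed (rule q(1))
  obtain k0 where k0: "e k0 = c J" using enumerate_Ex[OF inf cS[of J]] by (auto simp: e_def)
  have ek: "e (k0 + i) = c (J + i)" for i
  proof (induction i)
    case (Suc i)
    have "e (k0 + Suc i) = (LEAST s. s \<in> S \<and> c (J + i) < s)"
      using enumerate_Suc''[OF inf, of "k0 + i"] Suc by (simp add: e_def)
    also have "\<dots> = c (J + Suc i)"
    proof (rule Least_equality)
      show "c (J + Suc i) \<in> S \<and> c (J + i) < c (J + Suc i)" using cS[of "J + Suc i"] c_less[of "J + i"] by simp
      fix s assume s: "s \<in> S \<and> c (J + i) < s"
      moreover have "c J \<le> c (J + i)" using c_strict by (simp add: strict_mono_less_eq)
      ultimately obtain j where "s = c j" using Sc[of s] by auto
      then have "J + Suc i \<le> j" using s c_strict by (simp add: strict_mono_less)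
      then show "c (J + Suc i) \<le> s" using \<open>s = c j\<close> c_strict by (simp add: strict_mono_less_eq)
    qed
    finally show ?case .
  qed (simp add: k0)
  \<comment> \<open>Index \<open>Suc k0\<close> of the sequence corresponds to index
    \<open>J\<close> of the given fractions.\<close>
  define d where "d j = J + (j - Suc k0)" for j
  have qQ: "q j = Q (d j) \<or> q j = - Q (d j)" if "Suc k0 \<le> j" for j
  proof -
    have "infnorm (fst (q j)) = infnorm (fst (Q (d j)))"
      using ek[of "j - Suc k0"] that by (simp add: q infnorm_Q d_def)
    moreover have "J \<le> d j" by (simp add: d_def)
    ultimately show ?thesis using best_unique[OF q(1) best_Q] by blast
  qed
  have dS: "d (Suc j) = Suc (d j)" if "Suc k0 \<le> j" for j using that by (simp add: d_def Suc_diff_le)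
  have QH: "Q j \<in> H_lattice (k j)" "- Q j \<in> H_lattice (k j)" for j
  proof -
    have "Q j = (axis (k j) (real_of_int (int (c j))), real_of_int (- P j))" by (simp add: Q_def)
    then show "Q j \<in> H_lattice (k j)" unfolding H_lattice_eq by blast
    have "- Q j = (axis (k j) (real_of_int (- int (c j))), real_of_int (P j))"
      by (simp add: Q_def vec_eq_iff axis_def)
    then show "- Q j \<in> H_lattice (k j)" unfolding H_lattice_eq by blast
  qed
  have qH: "q j \<in> H_lattice (k (d j))" if "Suc k0 \<le> j" for j using qQ[OF that] QH by auto
  have k12: "k j = i1 \<or> k j = i2" for j by (simp add: k_def)
  have "H_lattice i1 \<subseteq> int_span {e_vec i1, e_vec i2, e_last}" "H_lattice i2 \<subseteq> int_span {e_vec i1, e_vec i2, e_last}"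
    unfolding H_lattice_def by (intro int_span_mono; auto)+
  have ii: "\<forall>j\<ge>Suc k0. q j \<in> H_lattice i1 \<union> H_lattice i2" using qH k12 by (metis UnI1 UnI2)
  then have iii: "\<forall>j\<ge>Suc k0. q j \<in> int_span {e_vec i1, e_vec i2, e_last}"
    using \<open>H_lattice i1 \<subseteq> _\<close> \<open>H_lattice i2 \<subseteq> _\<close> by blast
  have iv: "\<forall>j\<ge>Suc k0. (q (2 * j) \<in> H_lattice i1 \<and> q (2 * j + 1) \<in> H_lattice i2) \<or>
      (q (2 * j) \<in> H_lattice i2 \<and> q (2 * j + 1) \<in> H_lattice i1)"
  proof (intro allI impI)
    fix j assume "Suc k0 \<le> j"
    then have "q (2 * j) \<in> H_lattice (k (d (2 * j)))" "q (2 * j + 1) \<in> H_lattice (k (Suc (d (2 * j))))"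
      using qH[of "2 * j"] qH[of "2 * j + 1"] dS[of "2 * j"] by auto
    then show "(q (2 * j) \<in> H_lattice i1 \<and> q (2 * j + 1) \<in> H_lattice i2) \<or>
      (q (2 * j) \<in> H_lattice i2 \<and> q (2 * j + 1) \<in> H_lattice i1)" by (auto simp: k_def split: if_splits)
  qed
  have v: "\<forall>j\<ge>Suc k0. distinct [q j, q (j + 1), q (j + 2)] \<and> independent {q j, q (j + 1), q (j + 2)}"
  proof (intro allI impI)
    fix j assume j: "Suc k0 \<le> j"
    have sg: "\<exists>s. (s = 1 \<or> s = (- 1 :: real)) \<and> q i = s *\<^sub>R Q (d i)" if "Suc k0 \<le> i" for i
      using qQ[OF that] by (metis scaleR_minus1_left scaleR_one)
    obtain s0 where s0: "s0 = 1 \<or> s0 = (- 1 :: real)" "q j = s0 *\<^sub>R Q (d j)" using sg[of j] j by blast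
    obtain s1 where s1: "s1 = 1 \<or> s1 = (- 1 :: real)" "q (j + 1) = s1 *\<^sub>R Q (Suc (d j))"
      using sg[of "j + 1"] j dS[of j] by auto
    obtain s2 where s2: "s2 = 1 \<or> s2 = (- 1 :: real)" "q (j + 2) = s2 *\<^sub>R Q (Suc (Suc (d j)))"
      using sg[of "j + 2"] j dS[of j] dS[of "Suc j"] by auto
    show "distinct [q j, q (j + 1), q (j + 2)] \<and> independent {q j, q (j + 1), q (j + 2)}"
      unfolding s0(2) s1(2) s2(2) by (rule Q_independent[OF s0(1) s1(1) s2(1)])
  qed
  have "1 \<le> Suc k0" by simp
  then show ?thesis unfolding Theta_def using irrational seq ii iii iv v by blast
qed

end

text \<open>\<open>min_form\<close> is a step function, of size about \<open>1 / X (j + 2)\<close>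
  between \<open>c j\<close> and \<open>c (j + 1)\<close>. The limes superior is governed by the
  right ends, with exponent \<open>ln (X (j + 2)) / ln (X (j + 1))\<close>, the limes inferior by
  the left ends, with exponent \<open>ln (X (j + 2)) / ln (X j)\<close>, a product of two ratios
  with limit \<open>w\<close>. Extended reals cover \<open>w = \<infinity>\<close> at the same
  time.\<close>

lemma omega_exponents:
  fixes x :: "real ^ 'n::finite" and X L :: "nat \<Rightarrow> real" and c :: "nat \<Rightarrow> nat"
  assumes mf: "\<And>j Q. J \<le> j \<Longrightarrow> real (c j) \<le> Q \<Longrightarrow> Q < real (c (Suc j)) \<Longrightarrow> min_form x Q = L j"
    and c: "strict_mono c" "\<And>j. X j \<le> real (c j)" "\<And>j. real (c j) \<le> 2 * X j"
    and L: "\<And>j. 1 / (2 * X (Suc (Suc j))) \<le> L j" "\<And>j. L j \<le> 4 / X (Suc (Suc j))"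
    and X: "\<And>j. 2 \<le> X j" "filterlim X at_top sequentially"
    and w: "(\<lambda>j. ereal (ln (X (Suc j)) / ln (X j))) \<longlonglongrightarrow> w" "0 < w"
  shows "omega_hat x = w" "omega x = w ^ 2"
proof -
  have X0: "0 < X j" "1 < X j" "0 < ln (X j)" for j using X(1)[of j] by (auto intro: ln_gt_zero)
  then have Xne: "X j \<noteq> 0" for j by (metis less_irrefl)
  have lnp: "ln (y powr t) = t * ln y" if "0 < y" for y t :: real using that by (simp add: ln_powr)
  have r2: "(\<lambda>j. ereal (ln (X (Suc (Suc j))) / ln (X j))) \<longlonglongrightarrow> w\<^sup>2"
  proof -
    have "(\<lambda>j. ereal (ln (X (Suc (Suc j))) / ln (X (Suc j))) * ereal (ln (X (Suc j)) / ln (X j))) \<longlonglongrightarrow> w * w"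
      using w(2) by (intro tendsto_mult_ereal_pos w LIMSEQ_Suc[OF w(1)])
    moreover have "ereal (ln (X (Suc (Suc j))) / ln (X (Suc j))) * ereal (ln (X (Suc j)) / ln (X j)) =
        ereal (ln (X (Suc (Suc j))) / ln (X j))" for j
      using X0(3)[of "Suc j"] by simp
    ultimately show ?thesis by (simp only: power2_eq_square)
  qed
  have blk: "\<forall>\<^sub>F Q in at_top. \<exists>j\<ge>j1. J \<le> j \<and> real (c j) \<le> Q \<and> Q < real (c (Suc j))" for j1
    unfolding eventually_at_top_linorder
  proof (intro exI[of _ "real (c (J + j1))"] allI impI)
    fix Q assume Q: "real (c (J + j1)) \<le> Q"
    obtain m :: nat where m: "Q < real m" using reals_Archimedean2 by blast
    have "m \<le> c m" using c(1) by (rule strict_mono_imp_increasing)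
    then have "Q < real (c m)" using m by linarith
    define i where "i = (LEAST i. Q < real (c i))"
    have i: "Q < real (c i)" unfolding i_def by (rule LeastI[of "\<lambda>i. Q < real (c i)", OF \<open>Q < real (c m)\<close>])
    then have "c (J + j1) < c i" using Q by linarith
    then have "J + j1 < i" using c(1) by (simp add: strict_mono_less)
    then obtain j where j: "i = Suc j" by (cases i) auto
    have "\<not> Q < real (c j)" using not_less_Least[of j "\<lambda>i. Q < real (c i)"] j by (simp add: i_def[symmetric])
    then show "\<exists>j\<ge>j1. J \<le> j \<and> real (c j) \<le> Q \<and> Q < real (c (Suc j))"
      using i j \<open>J + j1 < i\<close> by (intro exI[of _ j]) auto
  qed
  have c_large: "\<forall>\<^sub>F j in sequentially. y \<le> real (c j)" for y :: real
  proof -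
    have "\<forall>\<^sub>F j in sequentially. y \<le> X j" using X(2) by (simp add: filterlim_at_top)
    then show ?thesis by eventually_elim (use c(2) in \<open>auto intro: order_trans\<close>)
  qed
  have powr_X: "filterlim (\<lambda>j. X j powr s) at_top sequentially" if "0 < s" for s
    using filterlim_compose[OF real_powr_at_top X(2)] that .
  have up: "ereal t \<le> w" if t: "0 < t" "Limsup at_top (\<lambda>Q. ereal (Q powr t * min_form x Q)) < \<infinity>" for t
  proof (rule ccontr)
    assume "\<not> ereal t \<le> w"
    then obtain t' where t': "w < ereal t'" "t' < t" using ereal_dense2[of w "ereal t"] by (auto simp: not_le)
    obtain K where "Limsup at_top (\<lambda>Q. ereal (Q powr t * min_form x Q)) < ereal K"
      using ereal_dense2[OF t(2)] by blast
    then have "\<forall>\<^sub>F Q in at_top. ereal (Q powr t * min_form x Q) < ereal K" by (rule Limsup_lessD)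
    then obtain Q0 where Q0: "\<And>Q. Q0 \<le> Q \<Longrightarrow> Q powr t * min_form x Q < K"
      by (auto simp: eventually_at_top_linorder)
    have "\<forall>\<^sub>F j in sequentially. ereal (ln (X (Suc (Suc j))) / ln (X (Suc j))) < ereal t'"
      using order_tendstoD(2)[OF LIMSEQ_Suc[OF w(1)] t'(1)] .
    moreover have "\<forall>\<^sub>F j in sequentially. 2 powr (t + 1) * \<bar>K\<bar> \<le> X j powr (t - t')"
      using powr_X[of "t - t'"] t' by (simp add: filterlim_at_top)
    then have "\<forall>\<^sub>F j in sequentially. 2 powr (t + 1) * \<bar>K\<bar> \<le> X (Suc j) powr (t - t')"
      by (simp add: eventually_sequentially_Suc[of "\<lambda>j. _ \<le> X j powr (t - t')"])
    moreover have "\<forall>\<^sub>F j in sequentially. Q0 \<le> real (c j)" by (rule c_large)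
    moreover have "\<forall>\<^sub>F j in sequentially. J \<le> j" by (rule eventually_ge_at_top)
    ultimately have "\<forall>\<^sub>F j in sequentially. False"
    proof eventually_elim
      case (elim j)
      \<comment> \<open>Still below the next denominator, and at least \<open>X (Suc j) / 2\<close>
        because \<open>X (Suc j)\<close> is at least 2.\<close>
      define Q where "Q = real (c (Suc j)) - 1"
      have cj: "c j < c (Suc j)" using c(1) by (simp add: strict_mono_less)
      have Q: "real (c j) \<le> Q" "Q < real (c (Suc j))" using cj by (auto simp: Q_def)
      have QX: "X (Suc j) / 2 \<le> Q" using c(2)[of "Suc j"] X(1)[of "Suc j"] by (simp add: Q_def)
      have "ln (X (Suc (Suc j))) < ln (X (Suc j) powr t')"
        using elim(1) X0[of "Suc j"] by (simp add: lnp pos_divide_less_eq)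
      then have XX: "X (Suc (Suc j)) < X (Suc j) powr t'" using X0(1) by (subst (asm) ln_less_cancel_iff) (auto simp: X0(1) Xne)
      have "K \<le> X (Suc j) powr (t - t') / 2 powr (t + 1)"
      proof -
        have "K * 2 powr (t + 1) \<le> \<bar>K\<bar> * 2 powr (t + 1)" by (intro mult_right_mono) auto
        then have "K * 2 powr (t + 1) \<le> X (Suc j) powr (t - t')"
          using elim(2) by (metis mult.commute order_trans)
        then show ?thesis by (subst pos_le_divide_eq) auto
      qed
      also have "\<dots> = (X (Suc j) / 2) powr t * (1 / (2 * X (Suc j) powr t'))"
        using X0[of "Suc j"] by (simp add: powr_divide powr_diff powr_add)
      also have "\<dots> \<le> Q powr t * L j"
      proof (intro mult_mono powr_mono2)
        have "1 / (2 * X (Suc j) powr t') \<le> 1 / (2 * X (Suc (Suc j)))"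
          using XX X0[of "Suc (Suc j)"] X0[of "Suc j"] by (intro divide_left_mono) auto
        then show "1 / (2 * X (Suc j) powr t') \<le> L j" using L(1)[of j] by linarith
      qed (use t QX X0[of "Suc j"] in auto)
      also have "\<dots> = Q powr t * min_form x Q" using mf[OF elim(4) Q] by simp
      also have "\<dots> < K" using Q0[of Q] elim(3) Q by simp
      finally show ?case by simp
    qed
    then show False by simp
  qed
  have lo: "ereal t \<in> {ereal t |t. 0 < t \<and> Limsup at_top (\<lambda>Q. ereal (Q powr t * min_form x Q)) < \<infinity>}"
    if t: "0 < t" "ereal t < w" for t
  proof -
    have "\<forall>\<^sub>F j in sequentially. ereal t < ereal (ln (X (Suc (Suc j))) / ln (X (Suc j)))"
      using order_tendstoD(1)[OF LIMSEQ_Suc[OF w(1)] t(2)] .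
    then obtain j1 where j1: "\<And>j. j1 \<le> j \<Longrightarrow> t < ln (X (Suc (Suc j))) / ln (X (Suc j))"
      by (auto simp: eventually_sequentially)
    have "\<forall>\<^sub>F Q in at_top. ereal (Q powr t * min_form x Q) \<le> ereal (2 powr t * 4)"
      using blk[of j1]
    proof eventually_elim
      case (elim Q)
      then obtain j where j: "j1 \<le> j" "J \<le> j" "real (c j) \<le> Q" "Q < real (c (Suc j))" by blast
      have "ln (X (Suc j) powr t) < ln (X (Suc (Suc j)))"
        using j1[OF j(1)] X0[of "Suc j"] by (simp add: lnp pos_less_divide_eq)
      then have XX: "X (Suc j) powr t < X (Suc (Suc j))" using X0(1) by (subst (asm) ln_less_cancel_iff) (auto simp: X0(1) Xne)
      have "Q powr t * min_form x Q = Q powr t * L j" using mf[OF j(2-4)] by simp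
      also have "\<dots> \<le> (2 * X (Suc j)) powr t * (4 / X (Suc (Suc j)))"
      proof (intro mult_mono powr_mono2 L)
        show "Q \<le> 2 * X (Suc j)" using j(4) c(3)[of "Suc j"] by linarith
        show "0 \<le> Q" using j(3) by linarith
        have "0 \<le> 1 / (2 * X (Suc (Suc j)))" using X0[of "Suc (Suc j)"] by simp
        then show "0 \<le> L j" using L(1)[of j] by linarith
      qed (use t in auto)
      also have "\<dots> = 2 powr t * 4 * (X (Suc j) powr t / X (Suc (Suc j)))"
        using X0[of "Suc j"] by (simp add: powr_mult)
      also have "\<dots> \<le> 2 powr t * 4 * 1"
        using XX X0[of "Suc (Suc j)"] by (intro mult_left_mono) auto
      finally show ?case by simp
    qed
    then have "Limsup at_top (\<lambda>Q. ereal (Q powr t * min_form x Q)) \<le> ereal (2 powr t * 4)" by (rule Limsup_bounded)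
    then have "Limsup at_top (\<lambda>Q. ereal (Q powr t * min_form x Q)) < \<infinity>" by (rule le_less_trans) simp
    then show ?thesis using t(1) by blast
  qed
  have up2: "ereal t \<le> w\<^sup>2" if t: "0 < t" "Liminf at_top (\<lambda>Q. ereal (Q powr t * min_form x Q)) < \<infinity>" for t
  proof (rule ccontr)
    assume "\<not> ereal t \<le> w\<^sup>2"
    then obtain t' where t': "w\<^sup>2 < ereal t'" "t' < t" using ereal_dense2[of "w\<^sup>2" "ereal t"] by (auto simp: not_le)
    obtain K where K: "Liminf at_top (\<lambda>Q. ereal (Q powr t * min_form x Q)) < ereal K"
      using ereal_dense2[OF t(2)] by blast
    have "\<forall>\<^sub>F j in sequentially. ereal (ln (X (Suc (Suc j))) / ln (X j)) < ereal t'"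
      using order_tendstoD(2)[OF r2 t'(1)] .
    moreover have "\<forall>\<^sub>F j in sequentially. 2 * K \<le> X j powr (t - t')"
      using powr_X[of "t - t'"] t' by (simp add: filterlim_at_top)
    ultimately have "\<forall>\<^sub>F j in sequentially. ln (X (Suc (Suc j))) / ln (X j) < t' \<and> 2 * K \<le> X j powr (t - t')"
      by eventually_elim simp
    then obtain j1 where j1: "\<And>j. j1 \<le> j \<Longrightarrow> ln (X (Suc (Suc j))) / ln (X j) < t' \<and> 2 * K \<le> X j powr (t - t')"
      by (auto simp: eventually_sequentially)
    have "\<forall>\<^sub>F Q in at_top. ereal K \<le> ereal (Q powr t * min_form x Q)"
      using blk[of j1]
    proof eventually_elim
      case (elim Q)
      then obtain j where j: "j1 \<le> j" "J \<le> j" "real (c j) \<le> Q" "Q < real (c (Suc j))" by blast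
      have "ln (X (Suc (Suc j))) < ln (X j powr t')"
        using j1[OF j(1)] X0[of j] by (simp add: lnp pos_divide_less_eq)
      then have XX: "X (Suc (Suc j)) < X j powr t'" using X0(1) by (subst (asm) ln_less_cancel_iff) (auto simp: X0(1) Xne)
      have "K \<le> X j powr (t - t') / 2" using j1[OF j(1)] by simp
      also have "\<dots> = X j powr t * (1 / (2 * X j powr t'))"
        using X0[of j] by (simp add: powr_diff)
      also have "\<dots> \<le> Q powr t * L j"
      proof (intro mult_mono powr_mono2)
        have "1 / (2 * X j powr t') \<le> 1 / (2 * X (Suc (Suc j)))"
          using XX X0[of "Suc (Suc j)"] X0[of j] by (intro divide_left_mono) auto
        then show "1 / (2 * X j powr t') \<le> L j" using L(1)[of j] by linarith
        show "X j \<le> Q" using c(2)[of j] j(3) by linarith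
      qed (use t X0[of j] in auto)
      also have "\<dots> = Q powr t * min_form x Q" using mf[OF j(2-4)] by simp
      finally show ?case by simp
    qed
    then have "ereal K \<le> Liminf at_top (\<lambda>Q. ereal (Q powr t * min_form x Q))" by (rule Liminf_bounded)
    then show False using K by simp
  qed
  have lo2: "ereal t \<in> {ereal t |t. 0 < t \<and> Liminf at_top (\<lambda>Q. ereal (Q powr t * min_form x Q)) < \<infinity>}"
    if t: "0 < t" "ereal t < w\<^sup>2" for t
  proof -
    define K where "K = 2 powr t * 4"
    have "\<not> ereal K < Liminf at_top (\<lambda>Q. ereal (Q powr t * min_form x Q))"
    proof
      assume "ereal K < Liminf at_top (\<lambda>Q. ereal (Q powr t * min_form x Q))"
      then have "\<forall>\<^sub>F Q in at_top. ereal K < ereal (Q powr t * min_form x Q)" by (rule less_LiminfD)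
      then obtain Q0 where Q0: "\<And>Q. Q0 \<le> Q \<Longrightarrow> K < Q powr t * min_form x Q"
        by (auto simp: eventually_at_top_linorder)
      have "\<forall>\<^sub>F j in sequentially. ereal t < ereal (ln (X (Suc (Suc j))) / ln (X j))"
        using order_tendstoD(1)[OF r2 t(2)] .
      moreover have "\<forall>\<^sub>F j in sequentially. Q0 \<le> real (c j)" by (rule c_large)
      moreover have "\<forall>\<^sub>F j in sequentially. J \<le> j" by (rule eventually_ge_at_top)
      ultimately have "\<forall>\<^sub>F j in sequentially. False"
      proof eventually_elim
        case (elim j)
        have cj: "c j < c (Suc j)" using c(1) by (simp add: strict_mono_less)
        have "ln (X j powr t) < ln (X (Suc (Suc j)))"
          using elim(1) X0[of j] by (simp add: lnp pos_less_divide_eq)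
        then have XX: "X j powr t < X (Suc (Suc j))" using X0(1) by (subst (asm) ln_less_cancel_iff) (auto simp: X0(1) Xne)
        have "K < real (c j) powr t * min_form x (real (c j))" by (rule Q0[OF elim(2)])
        also have "\<dots> = real (c j) powr t * L j" using mf[OF elim(3)] cj by simp
        also have "\<dots> \<le> (2 * X j) powr t * (4 / X (Suc (Suc j)))"
        proof (intro mult_mono powr_mono2 L c)
          have "0 \<le> 1 / (2 * X (Suc (Suc j)))" using X0[of "Suc (Suc j)"] by simp
          then show "0 \<le> L j" using L(1)[of j] by linarith
        qed (use t in auto)
        also have "\<dots> = 2 powr t * 4 * (X j powr t / X (Suc (Suc j)))"
          using X0[of j] by (simp add: powr_mult)
        also have "\<dots> \<le> 2 powr t * 4 * 1"
          using XX X0[of "Suc (Suc j)"] by (intro mult_left_mono) auto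
        finally show ?case by (simp add: K_def)
      qed
      then show False by simp
    qed
    then have "Liminf at_top (\<lambda>Q. ereal (Q powr t * min_form x Q)) < \<infinity>"
      by (metis ereal_less_PInfty le_less_trans not_le_imp_less order_refl less_ereal.simps(4) not_less)
    then show ?thesis using t(1) by blast
  qed
  have Sup_ge: "v \<le> Sup A" if "\<And>t. 0 < t \<Longrightarrow> ereal t < v \<Longrightarrow> ereal t \<in> A" "0 < v" for v and A :: "ereal set"
  proof (rule ccontr)
    assume "\<not> v \<le> Sup A"
    then have "max 0 (Sup A) < v" using that(2) by simp
    then obtain t where t: "max 0 (Sup A) < ereal t" "ereal t < v" using ereal_dense2 by blast
    then have "ereal t \<in> A" by (intro that(1)) (auto simp: max_less_iff_conj)
    then have "ereal t \<le> Sup A" by (rule Sup_upper)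
    moreover have "Sup A < ereal t" using t(1) by (rule le_less_trans[rotated]) simp
    ultimately show False by simp
  qed
  show "omega_hat x = w"
    unfolding omega_hat_def using up w(2) by (intro antisym Sup_ge Sup_least lo) auto
  have "0 < w\<^sup>2" using w(2) by (simp add: power2_eq_square ereal_zero_less_0_iff)
  then show "omega x = w ^ 2"
    unfolding omega_def using up2 by (intro antisym Sup_ge Sup_least lo2) auto
qed

section \<open>Random interlaced systems\<close>

text \<open>
  Disjoint translates of the slabs in the direction of the coordinate \<open>i\<close> all fit into a cube of side 3.
\<close>

lemma slab_measure_le:
  fixes v :: "real ^ 'n::finite"
  assumes i: "1 \<le> \<bar>v $ i\<bar>" and \<eta>: "0 < \<eta>"
  shows "emeasure lborel {y \<in> cbox 0 1. \<exists>t::int. \<bar>v \<bullet> y + a + real_of_int t\<bar> \<le> \<eta>} \<le> ennreal (8 * 3 ^ CARD('n) * \<eta>)"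
proof -
  define S where "S = {y \<in> cbox 0 1. \<exists>t::int. \<bar>v \<bullet> y + a + real_of_int t\<bar> \<le> \<eta>}"
  have S[measurable]: "S \<in> sets borel"
  proof -
    have "S = cbox 0 1 \<inter> (\<Union>t::int. {y. \<bar>v \<bullet> y + a + real_of_int t\<bar> \<le> \<eta>})" by (auto simp: S_def)
    moreover have "closed {y. \<bar>v \<bullet> y + a + real_of_int t\<bar> \<le> \<eta>}" for t
      by (intro closed_Collect_le continuous_intros)
    ultimately show ?thesis by (auto intro!: sets.Int sets.countable_UN borel_closed)
  qed
  have cube: "emeasure lborel (cbox 0 (1 :: real ^ 'n)) = 1"
  proof -
    have "cbox 0 (1 :: real ^ 'n) \<noteq> {}" by (simp add: interval_ne_empty_cart)
    then have "measure lborel (cbox 0 (1 :: real ^ 'n)) = 1" by (subst content_cbox_cart) auto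
    then show ?thesis
      using emeasure_eq_ennreal_measure[of lborel "cbox 0 (1 :: real ^ 'n)"] emeasure_lborel_cbox_finite[of 0 "1 :: real ^ 'n"]
      by (simp add: less_top)
  qed
  have S1: "emeasure lborel S \<le> 1"
    using emeasure_mono[of S "cbox 0 1" lborel] cube by (auto simp: S_def)
  show ?thesis
  proof (cases "1 / 8 \<le> \<eta>")
    case True
    have "1 * 1 \<le> 3 ^ CARD('n) * (8 * \<eta>)" using True by (intro mult_mono) auto
    then have "1 \<le> ennreal (8 * 3 ^ CARD('n) * \<eta>)" by (simp add: ac_simps)
    then show ?thesis using S1 unfolding S_def by (rule order_trans[rotated])
  next
    case False
    define K where "K = nat \<lfloor>1 / (4 * \<eta>)\<rfloor>"
    have K0: "2 < 1 / (4 * \<eta>)" using False \<eta> by (simp add: field_simps)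
    then have K: "real K \<le> 1 / (4 * \<eta>)" "1 / (4 * \<eta>) < real K + 1" 
    proof -
      have "0 \<le> \<lfloor>1 / (4 * \<eta>)\<rfloor>" using K0 by linarith
      then have "real K = real_of_int \<lfloor>1 / (4 * \<eta>)\<rfloor>" by (simp add: K_def)
      then show "real K \<le> 1 / (4 * \<eta>)" "1 / (4 * \<eta>) < real K + 1" by linarith+
    qed
    have "1 / (8 * \<eta>) = 1 / (4 * \<eta>) / 2" by simp
    then have K8: "1 / (8 * \<eta>) \<le> real K" using K K0 by linarith
    define u where "u k = (axis i (3 * \<eta> * real k / v $ i) :: real ^ 'n)" for k
    define T where "T k = (+) (- u k) -` S" for k :: nat
    have vi: "v $ i \<noteq> 0" using i by auto
    have vu: "v \<bullet> u k = 3 * \<eta> * real k" for k using vi by (simp add: u_def inner_axis)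
    have Tm: "T k \<in> sets borel" for k
      unfolding T_def by (intro measurable_sets_borel[OF _ S]) simp
    have Te: "emeasure lborel (T k) = emeasure lborel S" for k
    proof -
      have "emeasure lborel S = emeasure (distr lborel borel ((+) (- u k))) S" by (simp only: lborel_distr_plus)
      also have "\<dots> = emeasure lborel (T k)" by (subst emeasure_distr) (auto simp: T_def)
      finally show ?thesis by simp
    qed
    have k34: "3 * \<eta> * real k \<le> 3 / 4" if "k < K" for k
    proof -
      have "3 * \<eta> * real k \<le> 3 * \<eta> * (1 / (4 * \<eta>))" using that K(1) \<eta> by (intro mult_left_mono) auto
      then show ?thesis using \<eta> by simp
    qed
    have disj: "T k \<inter> T l = {}" if "k < l" "l < K" for k l
    proof (rule ccontr)
      assume "T k \<inter> T l \<noteq> {}"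
      then obtain y where "y - u k \<in> S" "y - u l \<in> S" by (auto simp: T_def)
      then obtain p q :: int where "\<bar>v \<bullet> (y - u k) + a + real_of_int p\<bar> \<le> \<eta>" "\<bar>v \<bullet> (y - u l) + a + real_of_int q\<bar> \<le> \<eta>"
        by (auto simp: S_def)
      then have pq: "\<bar>3 * \<eta> * real l - 3 * \<eta> * real k + real_of_int (p - q)\<bar> \<le> 2 * \<eta>"
        by (simp add: inner_diff_right vu)
      have "3 * \<eta> * real (Suc k) \<le> 3 * \<eta> * real l" using that(1) \<eta> by (intro mult_left_mono) auto
      then have lo: "3 * \<eta> \<le> 3 * \<eta> * real l - 3 * \<eta> * real k" by (simp add: algebra_simps)
      have "0 \<le> 3 * \<eta> * real k" using \<eta> by simp
      then have hi: "3 * \<eta> * real l - 3 * \<eta> * real k \<le> 3 / 4" using k34[OF that(2)] by linarith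
      have \<eta>8: "\<eta> < 1 / 8" using False by simp
      consider "p - q = 0" | "1 \<le> p - q" | "p - q \<le> - 1" by linarith
      then show False
      proof cases
        case 1 then show False using pq lo \<eta> by simp
      next
        case 2
        then have "1 \<le> real_of_int (p - q)" by linarith
        then show False using pq lo \<eta> \<eta>8 by linarith
      next
        case 3
        then have "real_of_int (p - q) \<le> - 1" by linarith
        then show False using pq hi \<eta> \<eta>8 by linarith
      qed
    qed
    have Tsub: "T k \<subseteq> cbox (- 1) 2" if "k < K" for k
    proof
      fix y assume "y \<in> T k"
      then have y: "y - u k \<in> cbox 0 1" by (auto simp: T_def S_def)
      have "\<bar>3 * \<eta> * real k / v $ i\<bar> \<le> 1"
      proof -
        have "\<bar>3 * \<eta> * real k\<bar> \<le> \<bar>v $ i\<bar>" using k34[OF that] i \<eta> by simp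
        then show ?thesis using vi by (simp add: divide_le_eq_1)
      qed
      then have u: "\<bar>u k $ m\<bar> \<le> 1" for m by (simp add: u_def axis_def)
      have "- 1 \<le> y $ m \<and> y $ m \<le> 2" for m
        using y u[of m] by (auto simp: mem_box_cart dest!: spec[of _ m])
      then show "y \<in> cbox (- 1) 2" by (simp add: mem_box_cart)
    qed
    have big: "emeasure lborel (cbox (- 1) (2 :: real ^ 'n)) = ennreal (3 ^ CARD('n))"
    proof -
      have "cbox (- 1) (2 :: real ^ 'n) \<noteq> {}" by (simp add: interval_ne_empty_cart)
      then have "measure lborel (cbox (- 1) (2 :: real ^ 'n)) = 3 ^ CARD('n)" by (subst content_cbox_cart) auto
      then show ?thesis
        using emeasure_eq_ennreal_measure[of lborel "cbox (- 1) (2 :: real ^ 'n)"] emeasure_lborel_cbox_finite[of "- 1" "2 :: real ^ 'n"]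
        by (simp add: less_top)
    qed
    have "disjoint_family_on T {..<K}"
      unfolding disjoint_family_on_def using disj by (metis Int_commute lessThan_iff linorder_neqE_nat)
    then have "(\<Sum>k<K. emeasure lborel (T k)) = emeasure lborel (\<Union>k<K. T k)"
      using Tm by (intro sum_emeasure) auto
    also have "\<dots> \<le> emeasure lborel (cbox (- 1) (2 :: real ^ 'n))" using Tsub by (intro emeasure_mono) auto
    finally have le: "of_nat K * emeasure lborel S \<le> ennreal (3 ^ CARD('n))" using Te big by simp
    define m where "m = measure lborel S"
    have "emeasure lborel S \<noteq> top" using S1 by (auto simp: top_unique)
    then have m: "emeasure lborel S = ennreal m" "0 \<le> m" by (auto simp: m_def emeasure_eq_ennreal_measure)
    have "ennreal (real K * m) \<le> ennreal (3 ^ CARD('n))"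
      using le m by (simp add: ennreal_mult ennreal_of_nat_eq_real_of_nat)
    then have "real K * m \<le> 3 ^ CARD('n)" by (subst (asm) ennreal_le_iff) auto
    moreover have "1 / (8 * \<eta>) * m \<le> real K * m" using K8 m by (intro mult_right_mono)
    ultimately have "1 / (8 * \<eta>) * m \<le> 3 ^ CARD('n)" by linarith
    then have "m \<le> 8 * 3 ^ CARD('n) * \<eta>" using \<eta> by (simp add: field_simps)
    then show ?thesis using m by (simp add: S_def[symmetric] ennreal_leI)
  qed
qed

section \<open>Random chains of fractions and their limits\<close>

lemma geometric_increments_limit:
  fixes f d :: "nat \<Rightarrow> real"
  assumes f: "\<And>k. f k < f (Suc k)" "\<And>k. f (Suc k) \<le> f k + d k" and d: "\<And>k. 0 < d k" "\<And>k. 2 * d (Suc k) \<le> d k"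
  shows "f \<longlonglongrightarrow> lim f" "f k < lim f" "lim f \<le> f k + 2 * d k"
proof -
  \<comment> \<open>The subtracted term makes the induction work: passing to the next index releases
    at least \<open>d (k + m)\<close>, by the halving of \<open>d\<close>.\<close>
  have up: "f (k + m) \<le> f k + 2 * d k - 2 * d (k + m)" for k m
  proof (induction m)
    case (Suc m)
    have "f (k + Suc m) \<le> f (k + m) + d (k + m)" using f(2)[of "k + m"] by simp
    then show ?case using Suc d(2)[of "k + m"] by simp
  qed simp
  have up': "f (k + m) \<le> f k + 2 * d k" for k m using up[of k m] d(1)[of "k + m"] by linarith
  have inc: "incseq f" using f(1) by (intro incseq_SucI) (auto intro: less_imp_le)
  have "convergent f"
  proof -
    have "\<forall>m. f m \<le> f 0 + 2 * d 0" using up'[of 0] by simp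
    then obtain L where "f \<longlonglongrightarrow> L" using incseq_convergent[OF inc] by blast
    then show ?thesis by (auto simp: convergent_def)
  qed
  then show lim: "f \<longlonglongrightarrow> lim f" by (simp add: convergent_LIMSEQ_iff)
  have "f (Suc k) \<le> lim f" by (rule incseq_le[OF inc lim])
  then show "f k < lim f" using f(1)[of k] by linarith
  show "lim f \<le> f k + 2 * d k"
  proof (rule LIMSEQ_le_const2[OF LIMSEQ_ignore_initial_segment[OF lim, of k]])
    show "\<exists>N. \<forall>m\<ge>N. f (m + k) \<le> f k + 2 * d k" using up'[of k] by (metis add.commute)
  qed
qed

type_synonym node = "int \<times> nat"

definition frac_of :: "node \<Rightarrow> real" where "frac_of u = real_of_int (fst u) / real (snd u)"

text \<open>Each term refines the one two places before it, so that the two coordinates take turns;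
  the immediate predecessor is passed on as well, since the new denominator has to be coprime to its
  denominator.\<close>

fun chain :: "(nat \<Rightarrow> node \<Rightarrow> node \<Rightarrow> nat \<Rightarrow> node) \<Rightarrow> node \<Rightarrow> node \<Rightarrow> (nat \<Rightarrow> nat) \<Rightarrow> nat \<Rightarrow> node" where
  "chain f a b \<omega> 0 = a"
| "chain f a b \<omega> (Suc 0) = b"
| "chain f a b \<omega> (Suc (Suc j)) = f j (chain f a b \<omega> j) (chain f a b \<omega> (Suc j)) (\<omega> j)"

text \<open>
  The even (odd) terms of the chain are fractions converging to the coordinate \<open>i1\<close> (\<open>i2\<close>).  The
  \<open>j\<close>-th choice is uniform among \<open>N j\<close> possibilities, \<open>X j\<close> is the size of the denominators,
  \<open>D j\<close> bounds the increments and \<open>1 / S j\<close> is the spacing of the possible \<open>j\<close>-th fractions.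
\<close>

locale random_system =
  fixes i1 i2 :: "'n::finite" and step :: "nat \<Rightarrow> node \<Rightarrow> node \<Rightarrow> nat \<Rightarrow> node" and u0 u1 :: node
    and N :: "nat \<Rightarrow> nat" and valid :: "nat \<Rightarrow> node \<Rightarrow> bool" and X D S :: "nat \<Rightarrow> real"
  assumes i12: "i1 \<noteq> i2" and n2: "2 \<le> CARD('n)"
    and N_pos: "\<And>j. 0 < N j"
    and X_ge: "\<And>j. 2 \<le> X j" and X_growth: "\<And>j. 2 * X j < X (Suc j)"
    and valid: "\<And>j u. valid j u \<Longrightarrow> coprime (fst u) (int (snd u)) \<and> X j \<le> real (snd u) \<and> real (snd u) \<le> 2 * X j"
    and start: "valid 0 u0" "valid (Suc 0) u1" "coprime (snd u0) (snd u1)"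
    and step: "\<And>j u u' v. valid j u \<Longrightarrow> valid (Suc j) u' \<Longrightarrow> coprime (snd u) (snd u') \<Longrightarrow> v < N j \<Longrightarrow>
        valid (Suc (Suc j)) (step j u u' v) \<and> coprime (snd u') (snd (step j u u' v)) \<and>
        frac_of u < frac_of (step j u u' v) \<and> frac_of (step j u u' v) \<le> frac_of u + D j"
    and step_inj: "\<And>j u w u' v v'. valid j u \<Longrightarrow> valid j w \<Longrightarrow> valid (Suc j) u' \<Longrightarrow>
        coprime (snd u) (snd u') \<Longrightarrow> coprime (snd w) (snd u') \<Longrightarrow> v < N j \<Longrightarrow> v' < N j \<Longrightarrow>
        step j u u' v = step j w u' v' \<Longrightarrow> u = w \<and> v = v'"
    and S_pos: "\<And>j. 0 < S j"
    and sep: "\<And>j u w. valid j u \<Longrightarrow> valid j w \<Longrightarrow> u \<noteq> w \<Longrightarrow> 1 / S j \<le> \<bar>frac_of u - frac_of w\<bar>"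
    and D_pos: "\<And>j. 0 < D j" and D_dec: "\<And>j. 2 * D (Suc j) \<le> D j"
    and D_small: "\<And>j. 32 * X j * D j * (2 * X (Suc j)) ^ CARD('n) * 2 ^ j \<le> 1"
begin

definition M :: "(nat \<Rightarrow> nat) measure" where "M = PiM UNIV (\<lambda>j. uniform_count_measure {..<N j})"

definition ch :: "(nat \<Rightarrow> nat) \<Rightarrow> nat \<Rightarrow> node" where "ch = chain step u0 u1"

definition xi :: "(nat \<Rightarrow> nat) \<Rightarrow> nat \<Rightarrow> real" where "xi \<omega> p = lim (\<lambda>k. frac_of (ch \<omega> (2 * k + p)))"

text \<open>Keeping a full vector \<open>y\<close>, whose entries at \<open>i1\<close> and
  \<open>i2\<close> are overwritten, allows Lebesgue measure on \<open>real ^ 'n\<close> for the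
  remaining coordinates.\<close>

definition pt :: "(nat \<Rightarrow> nat) \<Rightarrow> real ^ 'n \<Rightarrow> real ^ 'n" where
  "pt \<omega> y = (\<chi> i. if i = i1 then xi \<omega> 0 else if i = i2 then xi \<omega> 1 else y $ i)"

definition Lam :: "(real ^ 'n) measure" where "Lam = uniform_measure lborel (cbox 0 1)"

definition PP :: "((nat \<Rightarrow> nat) \<times> (real ^ 'n)) measure" where "PP = M \<Otimes>\<^sub>M Lam"

lemma space_M: "\<omega> \<in> space M \<longleftrightarrow> (\<forall>j. \<omega> j < N j)"
  by (auto simp: M_def space_PiM space_uniform_count_measure PiE_iff extensional_def)

lemma prob_U: "prob_space (uniform_count_measure {..<N j})"
  using N_pos[of j] by (intro prob_space_uniform_count_measure) (auto simp: lessThan_empty_iff)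

lemma product_U: "product_prob_space (\<lambda>j. uniform_count_measure {..<N j})"
  using prob_U by (simp add: product_prob_space_def product_prob_space_axioms_def product_sigma_finite_def
      prob_space_imp_sigma_finite)

sublocale M: prob_space M unfolding M_def by (rule prob_space_PiM) (rule prob_U)

lemma cube: "emeasure lborel (cbox 0 (1 :: real ^ 'n)) = 1"
proof -
  have "cbox 0 (1 :: real ^ 'n) \<noteq> {}" by (simp add: interval_ne_empty_cart)
  then have "measure lborel (cbox 0 (1 :: real ^ 'n)) = 1" by (subst content_cbox_cart) auto
  then show ?thesis
    using emeasure_eq_ennreal_measure[of lborel "cbox 0 (1 :: real ^ 'n)"] emeasure_lborel_cbox_finite[of 0 "1 :: real ^ 'n"]
    by (simp add: less_top)
qed

lemma sets_Lam[measurable_cong]: "sets Lam = sets borel" by (simp add: Lam_def)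

lemma space_Lam: "space Lam = UNIV" by (simp add: Lam_def)

lemma emeasure_Lam: "A \<in> sets borel \<Longrightarrow> emeasure Lam A = emeasure lborel (cbox 0 1 \<inter> A)"
  by (simp add: Lam_def cube divide_ennreal_def)

sublocale Lam: prob_space Lam
  by (rule prob_spaceI) (simp add: space_Lam emeasure_Lam cube)

sublocale PP: pair_prob_space M Lam ..

lemma space_PP: "space PP = space M \<times> UNIV" by (simp add: PP_def space_pair_measure space_Lam)

lemma prob_PP: "prob_space PP" unfolding PP_def by (rule PP.prob_space_axioms)

lemma ch_valid:
  assumes "\<omega> \<in> space M"
  shows "valid j (ch \<omega> j) \<and> valid (Suc j) (ch \<omega> (Suc j)) \<and> coprime (snd (ch \<omega> j)) (snd (ch \<omega> (Suc j)))"
proof (induction j)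
  case 0 show ?case using start by (simp add: ch_def)
next
  case (Suc j)
  then show ?case using step[of j "ch \<omega> j" "ch \<omega> (Suc j)" "\<omega> j"] assms by (auto simp: ch_def space_M)
qed

lemma ch_step:
  assumes "\<omega> \<in> space M"
  shows "frac_of (ch \<omega> j) < frac_of (ch \<omega> (Suc (Suc j)))"
    "frac_of (ch \<omega> (Suc (Suc j))) \<le> frac_of (ch \<omega> j) + D j"
  using step[of j "ch \<omega> j" "ch \<omega> (Suc j)" "\<omega> j"] ch_valid[OF assms, of j] assms by (auto simp: ch_def space_M)

text \<open>\<open>step_inj\<close> undoes one step at a time, so two consecutive terms determine
  all earlier choices. This turns the counting of fractions into the counting of cylinders.\<close>

lemma ch_inj:
  assumes "\<omega> \<in> space M" "\<omega>' \<in> space M" "ch \<omega> j = ch \<omega>' j" "ch \<omega> (Suc j) = ch \<omega>' (Suc j)" "i < j"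
  shows "\<omega> i = \<omega>' i"
  using assms(3-5)
proof (induction j)
  case (Suc j)
  have "step j (ch \<omega> j) (ch \<omega> (Suc j)) (\<omega> j) = step j (ch \<omega>' j) (ch \<omega> (Suc j)) (\<omega>' j)"
    using Suc.prems by (simp add: ch_def)
  then have "ch \<omega> j = ch \<omega>' j \<and> \<omega> j = \<omega>' j"
    using ch_valid[OF assms(1), of j] ch_valid[OF assms(2), of j] assms(1,2) Suc.prems
    by (intro step_inj[of j _ _ "ch \<omega> (Suc j)"]) (auto simp: space_M)
  then show ?case using Suc by (cases "i = j") auto
qed simp

lemma xi_bounds:
  assumes "\<omega> \<in> space M"
  shows "frac_of (ch \<omega> j) < xi \<omega> (if even j then 0 else 1)" "xi \<omega> (if even j then 0 else 1) \<le> frac_of (ch \<omega> j) + 2 * D j"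
    "(\<lambda>k. frac_of (ch \<omega> (2 * k + p))) \<longlonglongrightarrow> xi \<omega> p"
proof -
  define f where "f p k = frac_of (ch \<omega> (2 * k + p))" for p k :: nat
  have 1: "f p k < f p (Suc k)" "f p (Suc k) \<le> f p k + D (2 * k + p)" for p k
    using ch_step[OF assms, of "2 * k + p"] by (simp_all add: f_def)
  have 2: "2 * D (2 * Suc k + p) \<le> D (2 * k + p)" for p k
    using D_dec[of "2 * k + p"] D_dec[of "Suc (2 * k + p)"] D_pos[of "Suc (2 * k + p)"] by simp
  note lim = geometric_increments_limit[of "f p" "\<lambda>k. D (2 * k + p)" for p, OF 1 D_pos 2]
  have xi: "xi \<omega> p = lim (f p)" for p by (simp add: xi_def f_def[abs_def])
  show "(\<lambda>k. frac_of (ch \<omega> (2 * k + p))) \<longlonglongrightarrow> xi \<omega> p" using lim(1)[of p] by (simp add: xi f_def[abs_def])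
  define p :: nat where "p = (if even j then 0 else 1)"
  have j: "j = 2 * (j div 2) + p" by (simp add: p_def)
  show "frac_of (ch \<omega> j) < xi \<omega> (if even j then 0 else 1)"
    using lim(2)[of p "j div 2"] j by (simp add: xi f_def p_def[symmetric])
  show "xi \<omega> (if even j then 0 else 1) \<le> frac_of (ch \<omega> j) + 2 * D j"
    using lim(3)[of p "j div 2"] j by (simp add: xi f_def p_def[symmetric])
qed

lemma component_measurable[measurable]: "(\<lambda>\<omega>. \<omega> j) \<in> M \<rightarrow>\<^sub>M count_space UNIV"
proof -
  have "(\<lambda>\<omega>. \<omega> j) \<in> M \<rightarrow>\<^sub>M uniform_count_measure {..<N j}"
    unfolding M_def by (rule measurable_component_singleton) simp
  then have "(\<lambda>\<omega>. \<omega> j) \<in> M \<rightarrow>\<^sub>M count_space {..<N j}"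
    by (subst measurable_cong_sets[OF refl sets_uniform_count_measure_count_space[symmetric]])
  then show ?thesis using measurable_compose[of "\<lambda>\<omega>. \<omega> j" M "count_space {..<N j}" "\<lambda>x. x" "count_space UNIV"] by simp
qed

lemma ch_measurable: "(\<lambda>\<omega>. ch \<omega> j) \<in> M \<rightarrow>\<^sub>M count_space UNIV \<and> (\<lambda>\<omega>. ch \<omega> (Suc j)) \<in> M \<rightarrow>\<^sub>M count_space UNIV"
proof (induction j)
  case (Suc j)
  then have [measurable]: "(\<lambda>\<omega>. ch \<omega> j) \<in> M \<rightarrow>\<^sub>M count_space UNIV" "(\<lambda>\<omega>. ch \<omega> (Suc j)) \<in> M \<rightarrow>\<^sub>M count_space UNIV"
    by auto
  have "(\<lambda>\<omega>. step j a b (\<omega> j)) \<in> M \<rightarrow>\<^sub>M count_space UNIV" for a b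
    by (rule measurable_compose[OF component_measurable]) simp
  then have "(\<lambda>\<omega>. step j a (ch \<omega> (Suc j)) (\<omega> j)) \<in> M \<rightarrow>\<^sub>M count_space UNIV" for a
    by (rule measurable_compose_countable[where f = "\<lambda>b \<omega>. step j a b (\<omega> j)"]) measurable
  then have "(\<lambda>\<omega>. step j (ch \<omega> j) (ch \<omega> (Suc j)) (\<omega> j)) \<in> M \<rightarrow>\<^sub>M count_space UNIV"
    by (rule measurable_compose_countable[where f = "\<lambda>a \<omega>. step j a (ch \<omega> (Suc j)) (\<omega> j)"]) measurable
  then show ?case using Suc by (simp add: ch_def)
qed (simp add: ch_def)

lemma xi_measurable[measurable]: "(\<lambda>\<omega>. xi \<omega> p) \<in> borel_measurable M"
proof (rule borel_measurable_LIMSEQ_real)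
  show "(\<lambda>k. frac_of (ch \<omega> (2 * k + p))) \<longlonglongrightarrow> xi \<omega> p" if "\<omega> \<in> space M" for \<omega>
    by (rule xi_bounds(3)[OF that])
  show "(\<lambda>\<omega>. frac_of (ch \<omega> (2 * k + p))) \<in> borel_measurable M" for k
    by (rule measurable_compose[OF conjunct1[OF ch_measurable]]) simp
qed

lemma card_valid_le:
  assumes "0 \<le> d"
  shows "finite {u. valid j u \<and> frac_of u \<in> {a..a + d}}" "real (card {u. valid j u \<and> frac_of u \<in> {a..a + d}}) \<le> d * S j + 1"
proof -
  define F where "F = {u. valid j u \<and> frac_of u \<in> {a..a + d}}"
  have "0 < 1 / S j" using S_pos by simp
  have inj: "inj_on frac_of F"
  proof (rule inj_onI, rule ccontr)
    fix u w assume "u \<in> F" "w \<in> F" "frac_of u = frac_of w" "u \<noteq> w"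
    then have "1 / S j \<le> 0" using sep[of j u w] by (simp add: F_def)
    then show False using \<open>0 < 1 / S j\<close> by linarith
  qed
  have "pairwise (\<lambda>x y. 1 / S j \<le> \<bar>x - y\<bar>) (frac_of ` F)"
  proof (rule pairwiseI)
    fix x y assume "x \<in> frac_of ` F" "y \<in> frac_of ` F" "x \<noteq> y"
    then obtain u w where "x = frac_of u" "y = frac_of w" "u \<in> F" "w \<in> F" "u \<noteq> w" by blast
    then show "1 / S j \<le> \<bar>x - y\<bar>" using sep[of j u w] by (simp add: F_def)
  qed
  moreover have "frac_of ` F \<subseteq> {a..a + d}" by (auto simp: F_def)
  ultimately have "finite (frac_of ` F)" "real (card (frac_of ` F)) \<le> d / (1 / S j) + 1"
    using card_separated_le[of "frac_of ` F" a d "1 / S j"] \<open>0 < 1 / S j\<close> assms by auto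
  then have "finite F" "real (card F) \<le> d * S j + 1"
    using inj by (auto simp: card_image dest: finite_imageD)
  then show "finite {u. valid j u \<and> frac_of u \<in> {a..a + d}}" "real (card {u. valid j u \<and> frac_of u \<in> {a..a + d}}) \<le> d * S j + 1"
    unfolding F_def .
qed

text \<open>Since \<open>r\<close> is at least \<open>D j\<close>, the fractions of index
  \<open>j\<close> and \<open>Suc j\<close> belonging to points of the box lie in intervals of
  length \<open>4 * r\<close>, and the spacing bounds the number of pairs. Each pair comes from one
  cylinder of the first \<open>j\<close> choices, and all such cylinders have the same
  measure.\<close>

lemma measure_box:
  assumes r: "D j \<le> r"
  shows "\<exists>V\<in>sets M. {\<omega> \<in> space M. \<bar>xi \<omega> 0 - a\<bar> \<le> r \<and> \<bar>xi \<omega> 1 - b\<bar> \<le> r} \<subseteq> V \<and>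
    emeasure M V \<le> ennreal ((4 * r * S j + 1) * (4 * r * S (Suc j) + 1) / (\<Prod>i<j. real (N i)))"
proof -
  interpret U: product_prob_space "\<lambda>j. uniform_count_measure {..<N j}" UNIV by (rule product_U)
  define A where "A = {\<omega> \<in> space M. \<bar>xi \<omega> 0 - a\<bar> \<le> r \<and> \<bar>xi \<omega> 1 - b\<bar> \<le> r}"
  have r0: "0 < r" using r D_pos[of j] by linarith
  define R where "R \<omega> = restrict \<omega> {..<j}" for \<omega> :: "nat \<Rightarrow> nat"
  define \<Phi> where "\<Phi> \<omega> = (ch \<omega> j, ch \<omega> (Suc j))" for \<omega>
  define ctr where "ctr m = (if even m then a else b)" for m :: nat
  \<comment> \<open>A fraction is below its limit by at most \<open>2 * D m \<le> 2 * r\<close>, and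
    the limit is within \<open>r\<close> of the centre.\<close>
  define F where "F m = {u. valid m u \<and> frac_of u \<in> {ctr m - 3 * r..(ctr m - 3 * r) + 4 * r}}" for m
  have "\<Phi> ` A \<subseteq> F j \<times> F (Suc j)"
  proof
    fix p assume "p \<in> \<Phi> ` A"
    then obtain \<omega> where \<omega>: "\<omega> \<in> A" "p = \<Phi> \<omega>" by blast
    have in_F: "ch \<omega> m \<in> F m" if "D m \<le> r" for m
    proof -
      have "\<omega> \<in> space M" using \<omega> by (simp add: A_def)
      moreover have "\<bar>xi \<omega> (if even m then 0 else 1) - ctr m\<bar> \<le> r" using \<omega> by (simp add: A_def ctr_def)
      ultimately show ?thesis
        using xi_bounds[of \<omega> m] ch_valid[of \<omega> m] that unfolding F_def by (auto simp: abs_le_iff)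
    qed
    have "D (Suc j) \<le> r" using D_dec[of j] D_pos[of "Suc j"] r by linarith
    then show "p \<in> F j \<times> F (Suc j)" using in_F r \<omega> by (simp add: \<Phi>_def)
  qed
  have F: "finite (F m)" "real (card (F m)) \<le> 4 * r * S m + 1" for m
    unfolding F_def by (rule card_valid_le; use r0 in simp)+
  have fin: "finite (\<Phi> ` A)" using \<open>\<Phi> ` A \<subseteq> _\<close> F(1) by (meson finite_SigmaI finite_subset)
  \<comment> \<open>On \<open>A\<close> the first \<open>j\<close> choices are a function of the
    pair of fractions, so their number is at most that of the pairs.\<close>
  have Req: "R ` A = (\<lambda>p. R (inv_into A \<Phi> p)) ` (\<Phi> ` A)"
  proof -
    have "R (inv_into A \<Phi> (\<Phi> \<omega>)) = R \<omega>" if "\<omega> \<in> A" for \<omega>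
    proof -
      define \<omega>' where "\<omega>' = inv_into A \<Phi> (\<Phi> \<omega>)"
      have "\<omega>' \<in> A" "\<Phi> \<omega>' = \<Phi> \<omega>"
        using that by (auto simp: \<omega>'_def inv_into_into f_inv_into_f)
      then have "\<omega>' i = \<omega> i" if "i < j" for i
        using ch_inj[of \<omega>' \<omega> j i] that \<open>\<omega> \<in> A\<close> by (simp add: A_def \<Phi>_def)
      then show ?thesis unfolding R_def \<omega>'_def[symmetric] by (auto simp: restrict_def)
    qed
    then show ?thesis by (force simp: image_image)
  qed
  have finR: "finite (R ` A)" unfolding Req using fin by simp
  have "card (R ` A) \<le> card (\<Phi> ` A)" unfolding Req using fin by (rule card_image_le)
  also have "\<dots> \<le> card (F j \<times> F (Suc j))" using \<open>\<Phi> ` A \<subseteq> _\<close> F(1) by (intro card_mono) auto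
  also have "\<dots> = card (F j) * card (F (Suc j))" by (rule card_cartesian_product)
  finally have "real (card (R ` A)) \<le> real (card (F j)) * real (card (F (Suc j)))"
    by (simp flip: of_nat_mult)
  also have "\<dots> \<le> (4 * r * S j + 1) * (4 * r * S (Suc j) + 1)"
    using F(2) r0 S_pos[of j] by (intro mult_mono) auto
  finally have cR: "real (card (R ` A)) \<le> (4 * r * S j + 1) * (4 * r * S (Suc j) + 1)" .
  define cyl where "cyl \<tau> = {\<omega> \<in> space M. \<forall>i\<in>{..<j}. \<omega> i \<in> {\<tau> i}}" for \<tau> :: "nat \<Rightarrow> nat"
  have cyl: "cyl \<tau> \<in> sets M" "emeasure M (cyl \<tau>) = ennreal (1 / (\<Prod>i<j. real (N i)))" if \<tau>: "\<tau> \<in> R ` A" for \<tau>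
  proof -
    have \<tau>N: "\<tau> i < N i" if "i < j" for i using \<tau> that by (auto simp: R_def A_def space_M)
    then have sets: "{\<tau> i} \<in> sets (uniform_count_measure {..<N i})" if "i < j" for i
      using that by (simp add: sets_uniform_count_measure)
    have "{\<omega> \<in> space M. \<omega> i \<in> {\<tau> i}} \<in> sets M" for i
      using measurable_sets[OF component_measurable, of "{\<tau> i}" i] by (simp add: vimage_def Int_def conj_commute)
    then show "cyl \<tau> \<in> sets M" unfolding cyl_def by (intro sets.sets_Collect_finite_All) auto
    have "emeasure M (cyl \<tau>) = (\<Prod>i<j. emeasure (uniform_count_measure {..<N i}) {\<tau> i})"
      unfolding cyl_def M_def using sets by (intro U.emeasure_PiM_Collect) auto
    also have "\<dots> = (\<Prod>i<j. ennreal (1 / real (N i)))"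
      using \<tau>N by (intro prod.cong) (auto simp: emeasure_uniform_count_measure)
    also have "\<dots> = ennreal (\<Prod>i<j. 1 / real (N i))" by (intro prod_ennreal) simp
    also have "(\<Prod>i<j. 1 / real (N i)) = 1 / (\<Prod>i<j. real (N i))" by (simp add: prod_dividef)
    finally show "emeasure M (cyl \<tau>) = ennreal (1 / (\<Prod>i<j. real (N i)))" .
  qed
  have "A \<subseteq> (\<Union>\<tau>\<in>R ` A. cyl \<tau>)" by (auto simp: cyl_def R_def A_def)
  moreover have "(\<Union>\<tau>\<in>R ` A. cyl \<tau>) \<in> sets M" using cyl(1) finR by (intro sets.finite_UN) auto
  moreover have "emeasure M (\<Union>\<tau>\<in>R ` A. cyl \<tau>) \<le> ennreal ((4 * r * S j + 1) * (4 * r * S (Suc j) + 1) / (\<Prod>i<j. real (N i)))"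
  proof -
    have "emeasure M (\<Union>\<tau>\<in>R ` A. cyl \<tau>) \<le> (\<Sum>\<tau>\<in>R ` A. emeasure M (cyl \<tau>))"
      using cyl(1) finR by (intro emeasure_subadditive_finite) auto
    also have "\<dots> = (\<Sum>\<tau>\<in>R ` A. ennreal (1 / (\<Prod>i<j. real (N i))))" using cyl(2) by simp
    also have "\<dots> = ennreal (real (card (R ` A)) * (1 / (\<Prod>i<j. real (N i))))"
      by (simp add: ennreal_mult' ennreal_of_nat_eq_real_of_nat prod_nonneg del: times_divide_eq_right)
    also have "\<dots> \<le> ennreal (((4 * r * S j + 1) * (4 * r * S (Suc j) + 1)) * (1 / (\<Prod>i<j. real (N i))))"
      by (intro ennreal_leI mult_right_mono cR) (simp add: prod_nonneg)
    finally show ?thesis by simp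
  qed
  ultimately show ?thesis unfolding A_def by blast
qed

section \<open>Exceptional sets for the remaining coordinates\<close>

lemma pt_measurable: "(\<lambda>w. v \<bullet> pt (fst w) (snd w)) \<in> borel_measurable PP"
proof -
  have 1: "(\<lambda>w. xi (fst w) p) \<in> borel_measurable PP" for p
    unfolding PP_def by (rule measurable_compose[OF measurable_fst xi_measurable])
  have "(\<lambda>y :: real ^ 'n. y $ i) \<in> borel_measurable Lam" for i
    by (simp cong: measurable_cong_sets add: sets_Lam)
  then have 2: "(\<lambda>w. snd w $ i) \<in> borel_measurable PP" for i
    unfolding PP_def by (rule measurable_compose[OF measurable_snd])
  have "(\<lambda>w. \<Sum>i\<in>UNIV. v $ i * (if i = i1 then xi (fst w) 0 else if i = i2 then xi (fst w) 1 else snd w $ i)) \<in> borel_measurable PP"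
    by (intro borel_measurable_sum borel_measurable_times measurable_const) (use 1 2 in auto)
  then show ?thesis by (simp add: inner_vec_def pt_def)
qed

text \<open>Bounds the intended form of index \<open>j\<close>: the denominator is at most
  \<open>2 * X j\<close> and the error of the fraction at most \<open>2 * D j\<close>.\<close>

definition eta :: "nat \<Rightarrow> real" where "eta j = 4 * X j * D j"

definition Bad :: "nat \<Rightarrow> real ^ 'n \<Rightarrow> ((nat \<Rightarrow> nat) \<times> (real ^ 'n)) set" where
  "Bad j v = {w \<in> space PP. \<exists>t::int. \<bar>v \<bullet> pt (fst w) (snd w) + real_of_int t\<bar> \<le> eta j}"

definition Vec :: "nat \<Rightarrow> (real ^ 'n) set" where
  "Vec j = {v. (\<forall>i. v $ i \<in> \<int> \<and> \<bar>v $ i\<bar> \<le> 2 * X (Suc j)) \<and> (\<exists>i. i \<noteq> i1 \<and> i \<noteq> i2 \<and> v $ i \<noteq> 0)}"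

lemma eta_pos: "0 < eta j" using X_ge[of j] D_pos[of j] by (simp add: eta_def)

lemma eta_le: "8 * eta j * (2 * X (Suc j)) ^ CARD('n) \<le> (1 / 2) ^ j"
  using D_small[of j] by (simp add: eta_def power_one_over field_simps)

lemma Bad_sets: "Bad j v \<in> sets PP"
proof -
  note pt_measurable[measurable]
  show ?thesis unfolding Bad_def by measurable
qed

text \<open>Fubini: for fixed \<omega> the coordinates \<open>i1\<close> and \<open>i2\<close>
  contribute a constant shift, and the remaining vector \<open>v'\<close> still has a nonzero
  integer entry, so the slab estimate applies to the section.\<close>

lemma Bad_measure:
  assumes "v \<in> Vec j"
  shows "emeasure PP (Bad j v) \<le> ennreal (8 * 3 ^ CARD('n) * eta j)"
proof -
  obtain i where i: "i \<noteq> i1" "i \<noteq> i2" "v $ i \<noteq> 0" "v $ i \<in> \<int>" using assms by (auto simp: Vec_def)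
  then have vi: "1 \<le> \<bar>v $ i\<bar>" by (auto elim!: Ints_cases) 
  have "emeasure PP (Bad j v) = (\<integral>\<^sup>+\<omega>. emeasure Lam (Pair \<omega> -` Bad j v) \<partial>M)"
    using Bad_sets[of j v] unfolding PP_def by (rule Lam.emeasure_pair_measure_alt)
  also have "\<dots> \<le> (\<integral>\<^sup>+\<omega>. ennreal (8 * 3 ^ CARD('n) * eta j) \<partial>M)"
  proof (rule nn_integral_mono)
    fix \<omega> assume \<omega>: "\<omega> \<in> space M"
    define v' where "v' = (\<chi> m. if m = i1 \<or> m = i2 then 0 else v $ m)"
    define a where "a = v $ i1 * xi \<omega> 0 + v $ i2 * xi \<omega> 1"
    have eq: "v \<bullet> pt \<omega> y = v' \<bullet> y + a" for y
    proof -
      have "v \<bullet> pt \<omega> y = (\<Sum>m\<in>UNIV. v' $ m * y $ m + ((if m = i1 then v $ i1 * xi \<omega> 0 else 0) + (if m = i2 then v $ i2 * xi \<omega> 1 else 0)))"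
        unfolding inner_vec_def using i12 by (intro sum.cong) (auto simp: pt_def v'_def)
      also have "\<dots> = v' \<bullet> y + a" by (simp add: sum.distrib inner_vec_def a_def)
      finally show ?thesis .
    qed
    have "Pair \<omega> -` Bad j v = {y. \<exists>t::int. \<bar>v' \<bullet> y + a + real_of_int t\<bar> \<le> eta j}"
      using \<omega> by (auto simp: Bad_def space_PP eq)
    moreover have "Pair \<omega> -` Bad j v \<in> sets Lam"
      using Bad_sets[of j v] unfolding PP_def by (rule sets_Pair1)
    ultimately have "emeasure Lam (Pair \<omega> -` Bad j v) = emeasure lborel {y \<in> cbox 0 1. \<exists>t::int. \<bar>v' \<bullet> y + a + real_of_int t\<bar> \<le> eta j}"
      by (subst emeasure_Lam) (auto simp: sets_Lam intro!: arg_cong[where f = "emeasure lborel"])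
    also have "\<dots> \<le> ennreal (8 * 3 ^ CARD('n) * eta j)"
      by (rule slab_measure_le[of v' i, OF _ eta_pos]) (use i vi in \<open>simp add: v'_def\<close>)
    finally show "emeasure Lam (Pair \<omega> -` Bad j v) \<le> ennreal (8 * 3 ^ CARD('n) * eta j)" .
  qed
  also have "\<dots> = ennreal (8 * 3 ^ CARD('n) * eta j)" by (simp add: M.emeasure_space_1)
  finally show ?thesis .
qed

definition Good :: "nat \<Rightarrow> ((nat \<Rightarrow> nat) \<times> (real ^ 'n)) set" where
  "Good J = space PP - (\<Union>j. \<Union>v\<in>Vec (j + J). Bad (j + J) v)"

lemma Vec_finite: "finite (Vec j)" and Vec_card: "real (card (Vec j)) \<le> 3 ^ CARD('n) * (2 * X (Suc j)) ^ CARD('n)"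
proof -
  have X0: "0 \<le> 2 * X (Suc j)" using X_ge[of "Suc j"] by simp
  note b = int_vectors_bounded[OF X0, where 'n = 'n]
  have sub: "Vec j \<subseteq> {v. \<forall>i. v $ i \<in> \<int> \<and> \<bar>v $ i\<bar> \<le> 2 * X (Suc j)}" by (auto simp: Vec_def)
  show "finite (Vec j)" by (rule finite_subset[OF sub b(1)])
  have "real (card (Vec j)) \<le> real (card {v :: real ^ 'n. \<forall>i. v $ i \<in> \<int> \<and> \<bar>v $ i\<bar> \<le> 2 * X (Suc j)})"
    using card_mono[OF b(1) sub] by simp
  also have "\<dots> \<le> (2 * (2 * X (Suc j)) + 1) ^ CARD('n)" by (rule b(2))
  also have "\<dots> \<le> (3 * (2 * X (Suc j))) ^ CARD('n)" using X_ge[of "Suc j"] by (intro power_mono) auto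
  finally show "real (card (Vec j)) \<le> 3 ^ CARD('n) * (2 * X (Suc j)) ^ CARD('n)" by (simp only: power_mult_distrib)
qed

lemma Good_sets: "Good J \<in> sets PP"
  unfolding Good_def by (intro sets.Diff sets.top sets.countable_UN' sets.finite_UN) (auto simp: Bad_sets Vec_finite)

text \<open>Borel-Cantelli: there are at most \<open>3 ^ n * (2 * X (Suc j)) ^ n\<close> vectors,
  each excluded with probability at most \<open>8 * 3 ^ n * eta j\<close>. By \<open>D_small\<close>
  the product is at most \<open>9 ^ n * (1/2) ^ j\<close>, which is what the factor
  \<open>2 ^ j\<close> there is for.\<close>

lemma Good_pos: "\<exists>J. emeasure PP (Good J) \<noteq> 0"
proof -
  define B where "B j = (\<Union>v\<in>Vec j. Bad j v)" for j
  have B: "B j \<in> sets PP" for j unfolding B_def by (intro sets.finite_UN) (auto simp: Bad_sets Vec_finite)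
  have Bm: "emeasure PP (B j) \<le> ennreal (9 ^ CARD('n) * (1 / 2) ^ j)" for j
  proof -
    have "emeasure PP (B j) \<le> (\<Sum>v\<in>Vec j. emeasure PP (Bad j v))"
      unfolding B_def using Vec_finite by (intro emeasure_subadditive_finite) (auto simp: Bad_sets)
    also have "\<dots> \<le> (\<Sum>v\<in>Vec j. ennreal (8 * 3 ^ CARD('n) * eta j))" by (intro sum_mono Bad_measure)
    also have "\<dots> = ennreal (real (card (Vec j)) * (8 * 3 ^ CARD('n) * eta j))"
      using eta_pos[of j] by (simp add: ennreal_mult ennreal_of_nat_eq_real_of_nat)
    also have "\<dots> \<le> ennreal (9 ^ CARD('n) * (1 / 2) ^ j)"
    proof (rule ennreal_leI)
      have "real (card (Vec j)) * (8 * 3 ^ CARD('n) * eta j) \<le>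
          (3 ^ CARD('n) * (2 * X (Suc j)) ^ CARD('n)) * (8 * 3 ^ CARD('n) * eta j)"
        using eta_pos[of j] by (intro mult_right_mono Vec_card) auto
      also have "\<dots> = (3 * 3) ^ CARD('n) * (8 * eta j * (2 * X (Suc j)) ^ CARD('n))"
        unfolding power_mult_distrib by (simp only: mult_ac)
      also have "\<dots> \<le> (3 * 3) ^ CARD('n) * (1 / 2) ^ j" by (intro mult_left_mono eta_le) simp
      finally show "real (card (Vec j)) * (8 * 3 ^ CARD('n) * eta j) \<le> 9 ^ CARD('n) * (1 / 2) ^ j" by simp
    qed
    finally show ?thesis .
  qed
  obtain J where J: "2 * 9 ^ CARD('n) * (1 / 2) ^ J < (1 / 2 :: real)"
  proof -
    have "(\<lambda>J. 2 * 9 ^ CARD('n) * (1 / 2) ^ J) \<longlonglongrightarrow> 2 * 9 ^ CARD('n) * (0 :: real)"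
      by (intro tendsto_mult tendsto_const LIMSEQ_power_zero) simp
    then have "\<forall>\<^sub>F J in sequentially. 2 * 9 ^ CARD('n) * (1 / 2) ^ J < (1 / 2 :: real)"
      by (rule order_tendstoD(2)) simp
    then show ?thesis using that by (auto simp: eventually_sequentially)
  qed
  have "emeasure PP (\<Union>j. B (j + J)) \<le> (\<Sum>j. emeasure PP (B (j + J)))"
    using B by (intro emeasure_subadditive_countably) auto
  also have "\<dots> \<le> (\<Sum>j. ennreal (9 ^ CARD('n) * (1 / 2) ^ (j + J)))" by (intro suminf_le Bm) auto
  also have "\<dots> = (\<Sum>j. ennreal (2 * 9 ^ CARD('n) * (1 / 2) ^ J * (1 / 2) ^ Suc j))"
    by (simp add: power_add mult_ac)
  also have "\<dots> = ennreal (2 * 9 ^ CARD('n) * (1 / 2) ^ J)" by (rule suminf_ennreal_half_powers) simp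
  also have "\<dots> < ennreal 1" using J by (intro ennreal_lessI) auto
  finally have lt: "emeasure PP (\<Union>j. B (j + J)) < 1" by simp
  have "emeasure PP (Good J) \<noteq> 0"
  proof
    assume z: "emeasure PP (Good J) = 0"
    have "Good J = space PP - (\<Union>j. B (j + J))" by (simp add: Good_def B_def)
    moreover have "(\<Union>j. B (j + J)) \<in> sets PP" using B by auto
    ultimately have "emeasure PP (space PP) \<le> emeasure PP (Good J) + emeasure PP (\<Union>j. B (j + J))"
      using Good_sets[of J] by (intro order_trans[OF emeasure_mono emeasure_subadditive]) auto
    then show False using z lt prob_space.emeasure_space_1[OF prob_PP] by simp
  qed
  then show ?thesis by blast
qed

text \<open>\<open>eta\<close> bounds the intended form from above, and membership in
  \<open>Good\<close> puts all competing forms above \<open>eta\<close>; the remaining conditions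
  hold for every sequence of choices.\<close>

lemma Good_approximations:
  assumes "(\<omega>, y) \<in> Good J"
  shows "interlaced_approximations i1 i2 (pt \<omega> y) (\<lambda>j. snd (ch \<omega> j)) (\<lambda>j. fst (ch \<omega> j)) J"
proof -
  have \<omega>: "\<omega> \<in> space M" using assms by (simp add: Good_def space_PP)
  define c where "c j = snd (ch \<omega> j)" for j
  define P where "P j = fst (ch \<omega> j)" for j
  have v: "coprime (P j) (int (c j))" "X j \<le> real (c j)" "real (c j) \<le> 2 * X j" "coprime (c j) (c (Suc j))" for j
    using ch_valid[OF \<omega>, of j] valid[of j "ch \<omega> j"] by (auto simp: c_def P_def)
  have c0: "0 < real (c j)" for j using v(2)[of j] X_ge[of j] by linarith
  define x where "x = pt \<omega> y"
  have xk: "x $ (if even j then i1 else i2) = xi \<omega> (if even j then 0 else 1)" for j :: nat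
    using i12 by (simp add: x_def pt_def)
  have L: "real (c j) * x $ (if even j then i1 else i2) - real_of_int (P j) =
      real (c j) * (xi \<omega> (if even j then 0 else 1) - frac_of (ch \<omega> j))" for j
    using c0[of j] by (simp add: xk frac_of_def c_def P_def right_diff_distrib)
  have Lpos: "0 < real (c j) * x $ (if even j then i1 else i2) - real_of_int (P j)" for j
    unfolding L using xi_bounds(1)[OF \<omega>, of j] c0[of j] by (intro mult_pos_pos) auto
  have Leta: "real (c j) * x $ (if even j then i1 else i2) - real_of_int (P j) \<le> eta j" for j
  proof -
    have "real (c j) * (xi \<omega> (if even j then 0 else 1) - frac_of (ch \<omega> j)) \<le> (2 * X j) * (2 * D j)"
      using xi_bounds(1,2)[OF \<omega>, of j] c0[of j] v(3)[of j] X_ge[of j] by (intro mult_mono) auto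
    then show ?thesis unfolding L by (simp add: eta_def)
  qed
  show ?thesis
    unfolding c_def[symmetric] P_def[symmetric] x_def[symmetric]
  proof
    show "0 < c 0" using c0[of 0] by simp
    show "c j < c (Suc j)" for j using v(3)[of j] v(2)[of "Suc j"] X_growth[of j] by linarith
    show "8 * (real (c j) * x $ (if even j then i1 else i2) - real_of_int (P j)) * real (c (Suc j)) ^ CARD('n) \<le> 1" for j
    proof -
      have "8 * (real (c j) * x $ (if even j then i1 else i2) - real_of_int (P j)) * real (c (Suc j)) ^ CARD('n) \<le>
          8 * eta j * (2 * X (Suc j)) ^ CARD('n)"
        using Lpos[of j] Leta[of j] v(3)[of "Suc j"] c0[of "Suc j"] eta_pos[of j]
        by (intro mult_mono power_mono) auto
      also have "\<dots> \<le> (1 / 2) ^ j" by (rule eta_le)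
      also have "\<dots> \<le> 1" by (simp add: power_le_one)
      finally show ?thesis .
    qed
    fix j and v' :: "real ^ 'n" and t :: real
    assume j: "J \<le> j" and v': "\<And>i. v' $ i \<in> \<int>" "t \<in> \<int>" "\<exists>i. i \<noteq> i1 \<and> i \<noteq> i2 \<and> v' $ i \<noteq> 0"
      "\<And>i. \<bar>v' $ i\<bar> < real (c (Suc j))"
    have "\<bar>v' $ i\<bar> \<le> 2 * X (Suc j)" for i using v'(4)[of i] v(3)[of "Suc j"] by linarith
    then have "v' \<in> Vec j" using v' by (simp add: Vec_def)
    moreover have "(\<omega>, y) \<notin> (\<Union>v\<in>Vec ((j - J) + J). Bad ((j - J) + J) v)" using assms unfolding Good_def by blast
    ultimately have "(\<omega>, y) \<notin> Bad j v'" using j by auto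
    moreover obtain t' where "t = real_of_int t'" using v'(2) by (rule Ints_cases)
    ultimately have "eta j < \<bar>v' \<bullet> x + t\<bar>" using \<omega> by (auto simp: Bad_def space_PP x_def not_le)
    then show "real (c j) * x $ (if even j then i1 else i2) - real_of_int (P j) < \<bar>v' \<bullet> x + t\<bar>"
      using Leta[of j] by linarith
  qed (use i12 n2 v Lpos in auto)
qed

lemma Good_image_subset:
  assumes E: "\<And>\<omega> y J. \<omega> \<in> space M \<Longrightarrow>
      interlaced_approximations i1 i2 (pt \<omega> y) (\<lambda>j. snd (ch \<omega> j)) (\<lambda>j. fst (ch \<omega> j)) J \<Longrightarrow> pt \<omega> y \<in> E"
  shows "(\<lambda>(\<omega>, y). pt \<omega> y) ` Good J \<subseteq> E"
proof
  fix x assume "x \<in> (\<lambda>(\<omega>, y). pt \<omega> y) ` Good J"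
  then obtain \<omega> y where x: "x = pt \<omega> y" and G: "(\<omega>, y) \<in> Good J" by auto
  have "\<omega> \<in> space M" using G by (simp add: Good_def space_PP)
  then show "x \<in> E" unfolding x by (rule E[OF _ Good_approximations[OF G]])
qed

text \<open>The Euclidean distance bounds every coordinate difference, so the ball lies in the
  product of an event for the two limits and a box in the other \<open>n - 2\<close> coordinates.
  The entries of \<open>y\<close> at \<open>i1\<close> and \<open>i2\<close> contribute sides of
  length 1.\<close>

lemma ball_measure:
  assumes V1: "\<And>a b. \<exists>V\<in>sets M. {\<omega> \<in> space M. \<bar>xi \<omega> 0 - a\<bar> \<le> r \<and> \<bar>xi \<omega> 1 - b\<bar> \<le> r} \<subseteq> V \<and> emeasure M V \<le> ennreal B"
    and r: "0 < r" and B: "0 \<le> B"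
  shows "\<exists>V\<in>sets PP. {w \<in> Good J. dist x ((\<lambda>(\<omega>, y). pt \<omega> y) w) \<le> r} \<subseteq> V \<and>
    emeasure PP V \<le> ennreal (B * (2 * r) ^ (CARD('n) - 2))"
proof -
  obtain V where V: "V \<in> sets M" "{\<omega> \<in> space M. \<bar>xi \<omega> 0 - x $ i1\<bar> \<le> r \<and> \<bar>xi \<omega> 1 - x $ i2\<bar> \<le> r} \<subseteq> V"
    "emeasure M V \<le> ennreal B" using V1 by blast
  define lo hi where "lo = (\<chi> i. if i = i1 \<or> i = i2 then 0 else x $ i - r)"
    "hi = (\<chi> i. if i = i1 \<or> i = i2 then 1 else x $ i + r)"
  note lohi = this
  define W where "W = {y :: real ^ 'n. \<forall>i. i \<noteq> i1 \<longrightarrow> i \<noteq> i2 \<longrightarrow> \<bar>y $ i - x $ i\<bar> \<le> r}"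
  have Wm: "W \<in> sets borel"
  proof -
    have "closed W" unfolding W_def by (intro closed_Collect_all closed_Collect_imp open_Collect_const closed_Collect_le continuous_intros)
    then show ?thesis by (rule borel_closed)
  qed
  have "emeasure Lam W \<le> ennreal ((2 * r) ^ (CARD('n) - 2))"
  proof -
    have "cbox 0 1 \<inter> W \<subseteq> cbox lo hi"
    proof
      fix y assume y: "y \<in> cbox 0 1 \<inter> W"
      have "lo $ i \<le> y $ i \<and> y $ i \<le> hi $ i" for i
      proof (cases "i = i1 \<or> i = i2")
        case True
        then show ?thesis using y by (auto simp: lohi mem_box_cart)
      next
        case False
        then have "\<bar>y $ i - x $ i\<bar> \<le> r" using y by (auto simp: W_def)
        then have "x $ i - r \<le> y $ i" "y $ i \<le> x $ i + r" by linarith+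
        then show ?thesis using False by (simp add: lohi)
      qed
      then show "y \<in> cbox lo hi" by (simp add: mem_box_cart)
    qed
    then have "emeasure Lam W \<le> emeasure lborel (cbox lo hi)"
      unfolding emeasure_Lam[OF Wm] by (intro emeasure_mono) auto
    also have "\<dots> = ennreal (measure lborel (cbox lo hi))"
      using emeasure_lborel_cbox_finite[of lo hi] by (intro emeasure_eq_ennreal_measure) (simp add: less_top)
    also have "measure lborel (cbox lo hi) = (\<Prod>i\<in>UNIV. if i \<in> {i1, i2} then 1 else 2 * r)"
    proof -
      have "cbox lo hi \<noteq> {}" using r by (auto simp: interval_ne_empty_cart lohi)
      moreover have "hi $ i - lo $ i = (if i \<in> {i1, i2} then 1 else 2 * r)" for i
        by (cases "i = i1 \<or> i = i2") (auto simp: lohi)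
      ultimately show ?thesis by (subst content_cbox_cart) simp_all
    qed
    also have "\<dots> = (2 * r) ^ card (UNIV - {i1, i2})"
    proof -
      have "{i. i = i1 \<or> i = i2} = {i1, i2}" by auto
      then show ?thesis by (subst prod.If_cases) (auto simp: Compl_eq_Diff_UNIV)
    qed
    also have "card (UNIV - {i1, i2}) = CARD('n) - 2" using i12 by (simp add: card_Diff_subset)
    finally show ?thesis .
  qed
  moreover have "emeasure PP (V \<times> W) = emeasure M V * emeasure Lam W"
    unfolding PP_def using V(1) Wm by (intro Lam.emeasure_pair_measure_Times) (auto simp: sets_Lam)
  ultimately have "emeasure PP (V \<times> W) \<le> ennreal B * ennreal ((2 * r) ^ (CARD('n) - 2))"
    using V(3) by (metis mult_mono zero_le)
  then have "emeasure PP (V \<times> W) \<le> ennreal (B * (2 * r) ^ (CARD('n) - 2))"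
    using B r by (simp add: ennreal_mult)
  moreover have "V \<times> W \<in> sets PP" unfolding PP_def using V(1) Wm by (auto simp: sets_Lam)
  moreover have "{w \<in> Good J. dist x ((\<lambda>(\<omega>, y). pt \<omega> y) w) \<le> r} \<subseteq> V \<times> W"
  proof
    fix w assume w: "w \<in> {w \<in> Good J. dist x ((\<lambda>(\<omega>, y). pt \<omega> y) w) \<le> r}"
    obtain \<omega> y where wy: "w = (\<omega>, y)" by (cases w)
    have \<omega>: "\<omega> \<in> space M" using w by (simp add: wy Good_def space_PP)
    have c: "\<bar>pt \<omega> y $ i - x $ i\<bar> \<le> r" for i
      using w dist_vec_nth_le[of "pt \<omega> y" i x] unfolding wy dist_real_def by (simp add: dist_commute)
    have "\<omega> \<in> V" using V(2) \<omega> c[of i1] c[of i2] i12 by (auto simp: pt_def)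
    moreover have "y \<in> W" unfolding W_def
    proof (intro CollectI allI impI)
      fix i assume "i \<noteq> i1" "i \<noteq> i2"
      then show "\<bar>y $ i - x $ i\<bar> \<le> r" using c[of i] by (simp add: pt_def)
    qed
    ultimately show "w \<in> V \<times> W" by (simp add: wy)
  qed
  ultimately show ?thesis by blast
qed

section \<open>Positive measure for sets of limit points\<close>

lemma hausdorff_measure_ne_0:
  assumes E: "\<And>\<omega> y J. \<omega> \<in> space M \<Longrightarrow>
      interlaced_approximations i1 i2 (pt \<omega> y) (\<lambda>j. snd (ch \<omega> j)) (\<lambda>j. fst (ch \<omega> j)) J \<Longrightarrow> pt \<omega> y \<in> E"
    and V: "\<And>r a b. 0 < r \<Longrightarrow> r \<le> r0 \<Longrightarrow> \<exists>V\<in>sets M. {\<omega> \<in> space M. \<bar>xi \<omega> 0 - a\<bar> \<le> r \<and> \<bar>xi \<omega> 1 - b\<bar> \<le> r} \<subseteq> V \<and>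
        emeasure M V \<le> ennreal (C * r powr s)"
    and r0: "0 < r0" and C: "0 < C" and s: "0 < real (CARD('n) - 2) + s"
  shows "hausdorff_measure (real (CARD('n) - 2) + s) E \<noteq> 0"
proof -
  obtain J where J: "emeasure PP (Good J) \<noteq> 0" using Good_pos by blast
  show ?thesis
  proof (rule mass_distribution_hausdorff[where X = "\<lambda>(\<omega>, y). pt \<omega> y" and G = "Good J" and M = PP])
    show "emeasure PP (Good J) \<noteq> top"
      using finite_measure.emeasure_finite[of PP "Good J"] prob_PP by (auto simp: prob_space_def)
    show "(\<lambda>(\<omega>, y). pt \<omega> y) ` Good J \<subseteq> E" by (rule Good_image_subset[OF E])
    show "0 < C * 2 ^ (CARD('n) - 2)" using C by simp
    fix x and r :: real assume r: "0 < r" "r \<le> r0"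
    have "C * r powr s * (2 * r) ^ (CARD('n) - 2) = C * 2 ^ (CARD('n) - 2) * r powr (real (CARD('n) - 2) + s)"
      using r by (simp add: powr_add powr_realpow power_mult_distrib)
    moreover have "\<exists>V\<in>sets PP. {w \<in> Good J. dist x ((\<lambda>(\<omega>, y). pt \<omega> y) w) \<le> r} \<subseteq> V \<and>
        emeasure PP V \<le> ennreal (C * r powr s * (2 * r) ^ (CARD('n) - 2))"
      by (rule ball_measure) (use V r C in auto)
    ultimately show "\<exists>V\<in>sets PP. {w \<in> Good J. dist x ((\<lambda>(\<omega>, y). pt \<omega> y) w) \<le> r} \<subseteq> V \<and>
        emeasure PP V \<le> ennreal (C * 2 ^ (CARD('n) - 2) * r powr (real (CARD('n) - 2) + s))" by (simp only:)
  qed (use J r0 s Good_sets in auto)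
qed

lemma packing_measure_ne_0:
  assumes E: "\<And>\<omega> y J. \<omega> \<in> space M \<Longrightarrow>
      interlaced_approximations i1 i2 (pt \<omega> y) (\<lambda>j. snd (ch \<omega> j)) (\<lambda>j. fst (ch \<omega> j)) J \<Longrightarrow> pt \<omega> y \<in> E"
    and r: "\<And>k::nat. 0 < r k" "r \<longlonglongrightarrow> 0"
    and V: "\<And>k a b. \<exists>V\<in>sets M. {\<omega> \<in> space M. \<bar>xi \<omega> 0 - a\<bar> \<le> 2 * r k \<and> \<bar>xi \<omega> 1 - b\<bar> \<le> 2 * r k} \<subseteq> V \<and>
        emeasure M V \<le> ennreal (C * (2 * r k) powr s)"
    and C: "0 < C"
  shows "packing_measure (real (CARD('n) - 2) + s) E \<noteq> 0"
proof -
  obtain J where J: "emeasure PP (Good J) \<noteq> 0" using Good_pos by blast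
  show ?thesis
  proof (rule mass_distribution_packing[where X = "\<lambda>(\<omega>, y). pt \<omega> y" and G = "Good J" and M = PP])
    show "emeasure PP (Good J) \<noteq> top"
      using finite_measure.emeasure_finite[of PP "Good J"] prob_PP by (auto simp: prob_space_def)
    show "(\<lambda>(\<omega>, y). pt \<omega> y) ` Good J \<subseteq> E" by (rule Good_image_subset[OF E])
    show "0 < C * 2 ^ (CARD('n) - 2)" using C by simp
    fix x k
    define q where "q = 2 * r k"
    have q: "0 < q" using r(1)[of k] by (simp add: q_def)
    have "C * q powr s * (2 * q) ^ (CARD('n) - 2) = C * 2 ^ (CARD('n) - 2) * q powr (real (CARD('n) - 2) + s)"
      using q by (simp add: powr_add powr_realpow power_mult_distrib)
    moreover have "\<exists>V\<in>sets PP. {w \<in> Good J. dist x ((\<lambda>(\<omega>, y). pt \<omega> y) w) \<le> q} \<subseteq> V \<and>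
        emeasure PP V \<le> ennreal (C * q powr s * (2 * q) ^ (CARD('n) - 2))"
      by (rule ball_measure) (use V q C in \<open>auto simp: q_def\<close>)
    ultimately show "\<exists>V\<in>sets PP. {w \<in> Good J. dist x ((\<lambda>(\<omega>, y). pt \<omega> y) w) \<le> 2 * r k} \<subseteq> V \<and>
        emeasure PP V \<le> ennreal (C * 2 ^ (CARD('n) - 2) * (2 * r k) powr (real (CARD('n) - 2) + s))"
      unfolding q_def[symmetric] by (simp only:)
  qed (use J r Good_sets in auto)
qed

lemma nonempty:
  assumes E: "\<And>\<omega> y J. \<omega> \<in> space M \<Longrightarrow>
      interlaced_approximations i1 i2 (pt \<omega> y) (\<lambda>j. snd (ch \<omega> j)) (\<lambda>j. fst (ch \<omega> j)) J \<Longrightarrow> pt \<omega> y \<in> E"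
  shows "E \<noteq> {}"
proof -
  obtain J where "emeasure PP (Good J) \<noteq> 0" using Good_pos by blast
  then have "Good J \<noteq> {}" by auto
  then show ?thesis using Good_image_subset[where J = J, OF E] by auto
qed

end

section \<open>Prescribed digits\<close>

text \<open>
  The coordinates \<open>i1\<close> and \<open>i2\<close> are given by binary and ternary digits that are free in some blocks
  and fixed in others; the denominators of the truncations are powers of 2 and 3, hence coprime.
\<close>

definition base :: "nat \<Rightarrow> nat" where "base j = (if even j then 2 else 3)"

lemma base_ge: "2 \<le> base j" and base_le: "base j \<le> 3" and base_Suc_Suc: "base (Suc (Suc j)) = base j"
  by (auto simp: base_def)

text \<open>The unbounded factor \<open>2 * (j + K)\<close> makes the \<open>(j + K)\<close>-th
  power of a denominator at most the next denominator, so that every fixed power becomes negligible.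
  The factor 2 pays for the change of base, as \<open>3 \<le> 2 ^ 2\<close>.\<close>

primrec dexp :: "nat \<Rightarrow> nat \<Rightarrow> nat" where
  "dexp K 0 = K"
| "dexp K (Suc j) = 2 * (j + K) * dexp K j"

definition den :: "nat \<Rightarrow> nat \<Rightarrow> nat" where "den K j = base j ^ dexp K j"

text \<open>The largest increment that \<open>D_small\<close> permits.\<close>

definition incr :: "nat \<Rightarrow> nat \<Rightarrow> nat \<Rightarrow> real" where
  "incr n K j = 1 / (32 * 2 ^ j * real (den K j) * (2 * real (den K (Suc j))) ^ n)"

text \<open>The numerator added by a step is at most 3 times the number of choices, the base being
  at most 3; hence the division by 3.\<close>

definition choices :: "nat \<Rightarrow> nat \<Rightarrow> nat \<Rightarrow> nat" where
  "choices n K j = nat \<lfloor>incr n K j * real (den K (Suc (Suc j))) / 3\<rfloor>"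

text \<open>Appends a block of digits. Its last digit is 1, which keeps the fraction reduced and
  makes the increment positive; the other digits are those of \<open>v\<close>.\<close>

definition digit_step :: "nat \<Rightarrow> nat \<Rightarrow> node \<Rightarrow> node \<Rightarrow> nat \<Rightarrow> node" where
  "digit_step K j u u' v =
     (fst u * int (base j) ^ (dexp K (Suc (Suc j)) - dexp K j) + 1 + int (base j) * int v, den K (Suc (Suc j)))"

definition digit_valid :: "nat \<Rightarrow> nat \<Rightarrow> node \<Rightarrow> bool" where
  "digit_valid K j u \<longleftrightarrow> snd u = den K j \<and> coprime (fst u) (int (snd u))"

context
  fixes n K :: nat
  assumes n: "2 \<le> n" and K: "K = 40 * n"
begin

lemma dexp_ge: "K + j \<le> dexp K j"
proof (induction j)
  case (Suc j)
  have K1: "1 \<le> K" using K n by simp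
  have "1 \<le> dexp K j" using Suc K1 by linarith
  then have "2 * (j + K) * 1 \<le> 2 * (j + K) * dexp K j" by (rule mult_le_mono2)
  moreover have "K + Suc j \<le> 2 * (j + K) * 1" using K1 by simp
  ultimately show ?case unfolding dexp.simps by (rule order_trans[rotated])
qed simp

lemma dexp_mono: "2 * dexp K j \<le> dexp K (Suc j)"
proof -
  have "1 * dexp K j \<le> (j + K) * dexp K j" using K n by (intro mult_right_mono) auto
  then have "2 * (1 * dexp K j) \<le> 2 * ((j + K) * dexp K j)" by (rule mult_le_mono2)
  then show ?thesis by (simp only: dexp.simps mult.assoc mult_1)
qed

lemma dexp_less: "dexp K j < dexp K (Suc (Suc j))"
  using dexp_mono[of j] dexp_mono[of "Suc j"] dexp_ge[of j] K n by linarith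

lemma den_pos: "0 < den K j" using base_ge[of j] by (simp add: den_def)

lemma den_ge: "2 ^ (K + j) \<le> real (den K j)"
proof -
  have "2 ^ (K + j) \<le> (2::real) ^ dexp K j" by (intro power_increasing dexp_ge) simp
  also have "\<dots> \<le> real (base j) ^ dexp K j" using base_ge[of j] by (intro power_mono) auto
  finally show ?thesis by (simp add: den_def)
qed

lemma den_growth: "real (den K j) ^ (j + K) \<le> real (den K (Suc j))"
proof -
  have "real (den K j) ^ (j + K) \<le> (4 ^ dexp K j) ^ (j + K)"
    using base_le[of j] by (auto simp: den_def intro!: power_mono)
  also have "\<dots> = (2::real) ^ dexp K (Suc j)"
  proof -
    have "(4::real) ^ m = 2 ^ (2 * m)" for m by (simp add: power_mult)
    then show ?thesis by (simp add: power_mult[symmetric] mult_ac)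
  qed
  also have "\<dots> \<le> real (base (Suc j)) ^ dexp K (Suc j)" using base_ge[of "Suc j"] by (intro power_mono) auto
  finally show ?thesis by (simp add: den_def)
qed

lemma den_ge1: "1 \<le> real (den K j)" using den_pos[of j] by simp

lemma den_power_le: "m \<le> j + K \<Longrightarrow> real (den K j) ^ m \<le> real (den K (Suc j))"
  using power_increasing[OF _ den_ge1, of m "j + K" j] den_growth[of j] by linarith

lemma den_mono: "real (den K j) \<le> real (den K (Suc j))"
  using den_power_le[of 1 j] K n by simp

lemma pow2_le_den: "32 * 2 ^ j * 2 ^ n \<le> real (den K j)"
proof -
  have "32 * 2 ^ j * 2 ^ n = (2::real) ^ (5 + j + n)" by (simp add: power_add)
  also have "\<dots> \<le> 2 ^ (K + j)" using K n by (intro power_increasing) auto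
  finally show ?thesis using den_ge[of j] by linarith
qed

lemma incr_pos: "0 < incr n K j" using den_pos[of j] den_pos[of "Suc j"] by (simp add: incr_def)

lemma incr_ge: "1 \<le> incr n K j * (real (den K j) ^ 2 * real (den K (Suc j)) ^ n)"
proof -
  have "32 * 2 ^ j * real (den K j) * (2 * real (den K (Suc j))) ^ n = (32 * 2 ^ j * 2 ^ n) * (real (den K j) * real (den K (Suc j)) ^ n)"
    by (simp add: power_mult_distrib)
  also have "\<dots> \<le> real (den K j) * (real (den K j) * real (den K (Suc j)) ^ n)"
    by (intro mult_right_mono pow2_le_den) auto
  also have "\<dots> = real (den K j) ^ 2 * real (den K (Suc j)) ^ n" by (simp add: power2_eq_square)
  finally show ?thesis using den_pos[of j] den_pos[of "Suc j"] by (simp add: incr_def field_simps)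
qed

lemma incr_ge': "1 \<le> incr n K j * real (den K (Suc j)) ^ (n + 1)"
proof -
  have "incr n K j * (real (den K j) ^ 2 * real (den K (Suc j)) ^ n) \<le> incr n K j * (real (den K (Suc j)) * real (den K (Suc j)) ^ n)"
    using incr_pos[of j] den_power_le[of 2 j] K n by (intro mult_left_mono mult_right_mono) auto
  then show ?thesis using incr_ge[of j] by simp
qed

lemma one_le_pow2: "(1::real) \<le> 32 * 2 ^ j"
proof -
  have "(1::real) \<le> 2 ^ j" by simp
  then show ?thesis by linarith
qed

lemma incr_le: "incr n K j * real (den K (Suc j)) ^ n \<le> 1"
proof -
  have "(1 * 1) * (1 * real (den K (Suc j))) ^ n \<le> (32 * 2 ^ j) * real (den K j) * (2 * real (den K (Suc j))) ^ n"
    using den_ge1[of j] one_le_pow2[of j] by (intro mult_mono power_mono) auto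
  then show ?thesis using den_pos[of j] den_pos[of "Suc j"] by (simp add: incr_def field_simps)
qed

lemma incr_le1: "incr n K j * real (den K j) \<le> 1"
proof -
  have "1 * real (den K j) * 1 \<le> (32 * 2 ^ j) * real (den K j) * (2 * real (den K (Suc j))) ^ n"
    using den_ge1[of "Suc j"] one_le_pow2[of j] by (intro mult_mono one_le_power) auto
  then show ?thesis using den_pos[of j] den_pos[of "Suc j"] by (simp add: incr_def field_simps)
qed

text \<open>With a value of at least 6, rounding down its third still leaves a sixth, as
  \<open>choices_ge\<close> needs.\<close>

lemma incr_den_large: "6 \<le> incr n K j * real (den K (Suc (Suc j)))"
proof -
  define b where "b = real (den K (Suc j))"
  have b: "6 \<le> b" using pow2_le_den[of "Suc j"] power_increasing[of 0 n "2::real"] power_increasing[of 0 "Suc j" "2::real"] mult_mono[of 1 "2 ^ Suc j" 1 "2 ^ n :: real"]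
    by (simp add: b_def)
  have "6 * 1 \<le> b * (incr n K j * b ^ (n + 1))" using b incr_ge'[of j] by (intro mult_mono) (auto simp: b_def)
  also have "\<dots> = incr n K j * b ^ (n + 2)" by simp
  also have "\<dots> \<le> incr n K j * real (den K (Suc (Suc j)))"
    unfolding b_def using incr_pos[of j] K n by (intro mult_left_mono den_power_le) auto
  finally show ?thesis by simp
qed

lemma choices_le: "3 * real (choices n K j) \<le> incr n K j * real (den K (Suc (Suc j)))"
proof -
  have "0 \<le> \<lfloor>incr n K j * real (den K (Suc (Suc j))) / 3\<rfloor>" using incr_den_large[of j] by linarith
  then have "real (choices n K j) = real_of_int \<lfloor>incr n K j * real (den K (Suc (Suc j))) / 3\<rfloor>" by (simp add: choices_def)
  then show ?thesis by linarith
qed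

lemma choices_ge: "incr n K j * real (den K (Suc (Suc j))) / 6 \<le> real (choices n K j)"
proof -
  have "0 \<le> \<lfloor>incr n K j * real (den K (Suc (Suc j))) / 3\<rfloor>" using incr_den_large[of j] by linarith
  then have "real (choices n K j) = real_of_int \<lfloor>incr n K j * real (den K (Suc (Suc j))) / 3\<rfloor>" by (simp add: choices_def)
  then show ?thesis using incr_den_large[of j] by linarith
qed

lemma choices_ge1: "1 \<le> real (choices n K j)"
  using choices_ge[of j] incr_den_large[of j] by linarith

text \<open>The appended digits do not overflow into the old ones, so the old numerator can be
  recovered by division; injectivity of the step rests on this.\<close>

lemma choices_small: "base j * choices n K j \<le> base j ^ (dexp K (Suc (Suc j)) - dexp K j)"
proof -
  have "real (base j) \<le> 3" using base_le[of j] by linarith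
  then have "real (base j * choices n K j) \<le> 3 * real (choices n K j)"
    unfolding of_nat_mult by (rule mult_right_mono) simp
  also have "\<dots> \<le> incr n K j * real (den K (Suc (Suc j)))" by (rule choices_le)
  also have "real (den K (Suc (Suc j))) = real (den K j) * real (base j ^ (dexp K (Suc (Suc j)) - dexp K j))"
    using dexp_less[of j] by (simp add: den_def base_Suc_Suc power_add[symmetric] del: dexp.simps)
  also have "incr n K j * \<dots> = (incr n K j * real (den K j)) * real (base j ^ (dexp K (Suc (Suc j)) - dexp K j))" by simp
  also have "\<dots> \<le> 1 * real (base j ^ (dexp K (Suc (Suc j)) - dexp K j))" by (intro mult_right_mono incr_le1) simp
  finally show ?thesis by (metis mult_1 of_nat_le_iff)
qed

lemma coprime_base_pow: "coprime (a * int (base j) + 1) (int (den K (j + 2 * i)))"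
proof -
  have "coprime (a * int (base j) + 1) (int (base j))"
    by (rule coprimeI) (metis dvd_add_right_iff dvd_mult)
  moreover have "base (j + 2 * i) = base j" by (simp add: base_def)
  ultimately show ?thesis by (simp add: den_def)
qed

text \<open>All admissible fractions of index \<open>j\<close> share the denominator
  \<open>den K j\<close>, whose reciprocal is therefore their spacing; consecutive denominators are
  powers of 2 and 3 in turn.\<close>

lemma digit_random_system:
  fixes i1 i2 :: "'n::finite"
  assumes i12: "i1 \<noteq> i2" and nn: "n = CARD('n)"
  shows "random_system i1 i2 (digit_step K) (1, den K 0) (1, den K (Suc 0)) (choices n K) (digit_valid K)
    (\<lambda>j. real (den K j)) (incr n K) (\<lambda>j. real (den K j))"
proof
  show "i1 \<noteq> i2" "2 \<le> CARD('n)" using i12 nn n by auto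
  show "0 < choices n K j" for j using choices_ge1[of j] by simp
  have four: "4 \<le> real (den K j)" for j
  proof -
    have "(2::real) ^ 2 \<le> 2 ^ (K + j)" using K n by (intro power_increasing) auto
    then have "4 \<le> (2::real) ^ (K + j)" by simp
    then show ?thesis using den_ge[of j] by linarith
  qed
  show "2 \<le> real (den K j)" for j using four[of j] by simp
  show "2 * real (den K j) < real (den K (Suc j))" for j
  proof -
    have "4 * real (den K j) \<le> real (den K j) ^ 2" using four[of j] by (simp add: power2_eq_square mult_right_mono)
    also have "\<dots> \<le> real (den K (Suc j))" using K n by (intro den_power_le) simp
    finally show ?thesis using four[of j] by linarith
  qed
  show "coprime (fst u) (int (snd u)) \<and> real (den K j) \<le> real (snd u) \<and> real (snd u) \<le> 2 * real (den K j)"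
    if "digit_valid K j u" for j u using that by (auto simp: digit_valid_def)
  show "digit_valid K 0 (1, den K 0)" "digit_valid K (Suc 0) (1, den K (Suc 0))" by (simp_all add: digit_valid_def)
  have cop: "coprime (den K j) (den K (Suc j))" for j
    by (cases "even j") (auto simp: den_def base_def)
  then show "coprime (snd (1 :: int, den K 0)) (snd (1 :: int, den K (Suc 0)))" by simp
  show "0 < real (den K j)" for j using den_pos by simp
  show "0 < incr n K j" for j by (rule incr_pos)
  show "2 * incr n K (Suc j) \<le> incr n K j" for j
  proof -
    have "32 * 2 ^ j * real (den K j) * (2 * real (den K (Suc j))) ^ n \<le> 32 * 2 ^ j * real (den K (Suc j)) * (2 * real (den K (Suc (Suc j)))) ^ n"
      using den_mono[of j] den_mono[of "Suc j"] by (intro mult_mono power_mono) auto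
    then have "1 / (32 * 2 ^ j * real (den K (Suc j)) * (2 * real (den K (Suc (Suc j)))) ^ n) \<le> incr n K j"
      unfolding incr_def using den_pos[of j] den_pos[of "Suc j"] den_pos[of "Suc (Suc j)"] by (intro divide_left_mono) auto
    moreover have "2 * incr n K (Suc j) = 1 / (32 * 2 ^ j * real (den K (Suc j)) * (2 * real (den K (Suc (Suc j)))) ^ n)"
      by (simp add: incr_def)
    ultimately show ?thesis by (simp only:)
  qed
  show "32 * real (den K j) * incr n K j * (2 * real (den K (Suc j))) ^ CARD('n) * 2 ^ j \<le> 1" for j
    using den_pos[of j] den_pos[of "Suc j"] by (simp add: incr_def nn[symmetric])
  show "1 / real (den K j) \<le> \<bar>frac_of u - frac_of w\<bar>" if "digit_valid K j u" "digit_valid K j w" "u \<noteq> w" for j u w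
  proof -
    have "fst u \<noteq> fst w" using that by (auto simp: digit_valid_def prod_eq_iff)
    then have "1 \<le> \<bar>real_of_int (fst u - fst w)\<bar>" by linarith
    moreover have "\<bar>frac_of u - frac_of w\<bar> = \<bar>real_of_int (fst u - fst w)\<bar> / real (den K j)"
      using that by (simp add: frac_of_def digit_valid_def diff_divide_distrib[symmetric])
    ultimately show ?thesis by (simp add: divide_right_mono)
  qed
  fix j u u' v assume u: "digit_valid K j u" "digit_valid K (Suc j) u'" and v: "v < choices n K j"
  define d where "d = dexp K (Suc (Suc j)) - dexp K j"
  have den2: "den K (Suc (Suc j)) = den K j * base j ^ d"
    using dexp_less[of j] by (simp add: den_def base_Suc_Suc d_def power_add[symmetric] del: dexp.simps)
  have d1: "1 \<le> d" using dexp_less[of j] by (simp add: d_def)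
  have st: "digit_step K j u u' v = (fst u * int (base j) ^ d + 1 + int (base j) * int v, den K (Suc (Suc j)))"
    by (simp add: digit_step_def d_def)
  have fr: "frac_of (digit_step K j u u' v) = frac_of u + (1 + real (base j) * real v) / real (den K (Suc (Suc j)))"
  proof -
    have "real_of_int (fst u * int (base j) ^ d) / real (den K (Suc (Suc j))) = frac_of u"
      using u(1) den_pos[of j] base_ge[of j] by (simp add: den2 frac_of_def digit_valid_def)
    then show ?thesis by (simp add: frac_of_def st add_divide_distrib)
  qed
  show "digit_valid K (Suc (Suc j)) (digit_step K j u u' v) \<and> coprime (snd u') (snd (digit_step K j u u' v)) \<and>
      frac_of u < frac_of (digit_step K j u u' v) \<and> frac_of (digit_step K j u u' v) \<le> frac_of u + incr n K j"
  proof (intro conjI)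
    obtain d' where d': "d = Suc d'" using d1 by (cases d) auto
    have "fst u * int (base j) ^ d + 1 + int (base j) * int v = (fst u * int (base j) ^ d' + int v) * int (base j) + 1"
      by (simp add: d' algebra_simps)
    moreover have "coprime ((fst u * int (base j) ^ d' + int v) * int (base j) + 1) (int (den K (Suc (Suc j))))"
      using coprime_base_pow[of "fst u * int (base j) ^ d' + int v" j 1] by (simp del: dexp.simps)
    ultimately have "coprime (fst u * int (base j) ^ d + 1 + int (base j) * int v) (int (den K (Suc (Suc j))))"
      by (simp only:)
    then show "digit_valid K (Suc (Suc j)) (digit_step K j u u' v)" by (simp add: digit_valid_def st)
    show "coprime (snd u') (snd (digit_step K j u u' v))" using u(2) cop[of "Suc j"] by (simp add: st digit_valid_def)
    show "frac_of u < frac_of (digit_step K j u u' v)"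
      unfolding fr using den_pos[of "Suc (Suc j)"] by (simp add: add_pos_nonneg)
    have "1 + real (base j) * real v \<le> 3 * real (choices n K j)"
    proof -
      have "real (base j) * real v \<le> 3 * (real (choices n K j) - 1)" using base_le[of j] v by (intro mult_mono) auto
      then have "1 + real (base j) * real v \<le> 1 + 3 * (real (choices n K j) - 1)" by (rule add_left_mono)
      then show ?thesis by simp
    qed
    also have "\<dots> \<le> incr n K j * real (den K (Suc (Suc j)))" by (rule choices_le)
    finally show "frac_of (digit_step K j u u' v) \<le> frac_of u + incr n K j"
      unfolding fr using den_pos[of "Suc (Suc j)"] by (simp add: divide_le_eq)
  qed
next
  fix j u w u' v v'
  assume u: "digit_valid K j u" "digit_valid K j w" and v: "v < choices n K j" "v' < choices n K j"
    and eq: "digit_step K j u u' v = digit_step K j w u' v'"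
  define d where "d = dexp K (Suc (Suc j)) - dexp K j"
  define m where "m = int (base j) ^ d"
  have small: "int (base j) * int x < m" if "x < choices n K j" for x
  proof -
    have "base j * x < base j * choices n K j" using that base_ge[of j] by simp
    then have "base j * x < base j ^ d" using choices_small[of j] unfolding d_def by linarith
    then have "int (base j * x) < int (base j ^ d)" by (simp only: of_nat_less_iff)
    then show ?thesis by (simp add: m_def)
  qed
  have e: "fst u * m + int (base j) * int v = fst w * m + int (base j) * int v'"
    using eq by (simp add: digit_step_def d_def m_def)
  have "m > 0" using base_ge[of j] by (simp add: m_def)
  have q: "(fst y * m + int (base j) * int x) div m = fst y" if "x < choices n K j" for y :: node and x
    using small[OF that] \<open>m > 0\<close> by (simp add: div_pos_pos_trivial)
  have "fst u = fst w" using q[OF v(1), of u] q[OF v(2), of w] e by simp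
  moreover have "v = v'" using e \<open>fst u = fst w\<close> base_ge[of j] by simp
  ultimately show "u = w \<and> v = v'" using u by (auto simp: digit_valid_def prod_eq_iff)
qed

lemma prod_choices_ge: "real (choices n K j) * real (choices n K (Suc j)) \<le> (\<Prod>i<Suc (Suc j). real (choices n K i))"
proof -
  have "1 \<le> (\<Prod>i<j. real (choices n K i))" by (intro prod_ge_1 choices_ge1)
  then have "1 * (real (choices n K j) * real (choices n K (Suc j))) \<le>
      (\<Prod>i<j. real (choices n K i)) * (real (choices n K j) * real (choices n K (Suc j)))"
    by (intro mult_right_mono) auto
  then show ?thesis by (simp add: mult.assoc)
qed

text \<open>Let \<open>a\<close>, \<open>b\<close>, \<open>c\<close> be the denominators of index
  \<open>j + 1\<close>, \<open>j + 2\<close>, \<open>j + 3\<close>. The count of coarser fractions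
  in the box is at most 5, since \<open>r * b \<le> 1\<close>, that of finer ones
  \<open>4 * r * c + 1\<close>, out of at least \<open>b * c / (36 * a ^ (n + 3) * b ^ n)\<close>
  choices. The quotient is about \<open>(r + 1 / c) * b ^ (n - 1)\<close> up to powers of
  \<open>a\<close>, which half a power of \<open>b\<close> absorbs; then
  \<open>r \<le> b powr (- n)\<close> turns \<open>r * b powr (n - 1 / 2)\<close> into
  \<open>r powr (1 / (2 * n))\<close>.\<close>

lemma digit_box_le:
  defines "B \<equiv> \<lambda>j r. (4 * r * real (den K (Suc (Suc j))) + 1) * (4 * r * real (den K (Suc (Suc (Suc j)))) + 1) /
      (\<Prod>i<Suc (Suc j). real (choices n K i))"
  shows "incr n K (Suc (Suc j)) \<le> r \<Longrightarrow> r \<le> incr n K (Suc j) \<Longrightarrow> B j r \<le> 5 * r powr (1 / (2 * real n))"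
proof -
  assume r: "incr n K (Suc (Suc j)) \<le> r" "r \<le> incr n K (Suc j)"
  define a b c where "a = real (den K (Suc j))" "b = real (den K (Suc (Suc j)))" "c = real (den K (Suc (Suc (Suc j))))"
  note abc = this
  define y where "y = (\<Prod>i<Suc (Suc j). real (choices n K i))"
  have r0: "0 < r" using r(1) incr_pos[of "Suc (Suc j)"] by linarith
  have pos: "1 \<le> a" "1 \<le> b" "1 \<le> c" using den_ge1 by (auto simp: abc)
  have rb: "r * b ^ n \<le> 1"
  proof -
    have "r * b ^ n \<le> incr n K (Suc j) * b ^ n" using r(2) pos by (intro mult_right_mono) auto
    then show ?thesis using incr_le[of "Suc j"] by (simp add: abc)
  qed
  have rb1: "r * b \<le> 1"
  proof -
    have "b ^ 1 \<le> b ^ n" using n pos by (intro power_increasing) auto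
    then have "r * b \<le> r * b ^ n" using r0 by (intro mult_left_mono) auto
    then show ?thesis using rb by linarith
  qed
  have ylow: "b * c / (36 * a ^ (n + 3) * b ^ n) \<le> y"
  proof -
    define p q where "p = incr n K j" "q = incr n K (Suc j)"
    note pq = this
    have pq0: "0 < p" "0 < q" using incr_pos by (auto simp: pq)
    have p: "1 \<le> p * a ^ (n + 1)" using incr_ge'[of j] by (simp only: pq abc)
    have q: "1 \<le> q * (a ^ 2 * b ^ n)" using incr_ge[of "Suc j"] by (simp only: pq abc)
    have "1 * 1 \<le> (p * a ^ (n + 1)) * (q * (a ^ 2 * b ^ n))" using p q by (intro mult_mono) auto
    also have "\<dots> = p * q * (a ^ (n + 3) * b ^ n)" by (simp add: power_add power2_eq_square power3_eq_cube mult_ac)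
    finally have "1 / (a ^ (n + 3) * b ^ n) \<le> p * q" using pos by (simp add: divide_le_eq)
    then have "(1 / (a ^ (n + 3) * b ^ n)) * (b * c / 36) \<le> (p * q) * (b * c / 36)"
      using pos by (intro mult_right_mono) auto
    also have "\<dots> = (p * b / 6) * (q * c / 6)" by simp
    also have "\<dots> \<le> real (choices n K j) * real (choices n K (Suc j))"
      using choices_ge[of j] choices_ge[of "Suc j"] pq0 pos by (intro mult_mono) (auto simp: abc pq)
    also have "\<dots> \<le> y" unfolding y_def by (rule prod_choices_ge)
    finally show ?thesis by (simp add: mult_ac)
  qed
  have ylow0: "0 < b * c / (36 * a ^ (n + 3) * b ^ n)" using pos by simp
  then have y0: "0 < y" using ylow by linarith
  have "B j r = (4 * r * b + 1) * (4 * r * c + 1) / y" by (simp add: B_def abc y_def)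
  also have "\<dots> \<le> 5 * (4 * r * c + 1) / (b * c / (36 * a ^ (n + 3) * b ^ n))"
    using rb1 r0 pos ylow ylow0 by (intro frac_le mult_right_mono) auto
  also have "\<dots> = (4 * r + 1 / c) * (180 * a ^ (n + 3)) * (b ^ n / b)"
    using pos by (simp add: field_simps)
  also have "b ^ n / b = b powr (real n - 1)" using pos by (simp add: powr_diff powr_realpow)
  also have "(4 * r + 1 / c) * (180 * a ^ (n + 3)) * b powr (real n - 1) \<le> (4 * r + 1 / c) * b powr (1 / 2) * b powr (real n - 1)"
  proof (intro mult_right_mono mult_left_mono)
    have a180: "180 \<le> a"
    proof -
      have "(2::real) ^ 8 \<le> 2 ^ (K + Suc j)" using K n by (intro power_increasing) auto
      then have "180 \<le> (2::real) ^ (K + Suc j)" by simp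
      then show ?thesis using den_ge[of "Suc j"] unfolding abc by linarith
    qed
    have "180 * a ^ (n + 3) \<le> a * a ^ (n + 3)" using a180 pos by (intro mult_right_mono) auto
    also have "a * a ^ (n + 3) = a ^ (n + 4)" by (simp add: eval_nat_numeral)
    finally have "180 * a ^ (n + 3) \<le> a ^ (n + 4)" .
    moreover have "a ^ (n + 4) \<le> b powr (1 / 2)"
    proof -
      have "(a ^ (n + 4)) ^ 2 \<le> b" unfolding power_mult[symmetric] abc by (rule den_power_le) (use K n in simp)
      then have "a ^ (n + 4) \<le> sqrt b" by (rule real_le_rsqrt)
      then show ?thesis using pos by (simp add: powr_half_sqrt)
    qed
    ultimately show "180 * a ^ (n + 3) \<le> b powr (1 / 2)" by linarith
  qed (use r0 pos in auto)
  also have "\<dots> = 4 * (r * b powr (real n - 1 / 2)) + b powr (real n - 1 / 2) / c"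
    using pos by (simp add: mult.assoc powr_add[symmetric] ring_distribs)
  also have "r * b powr (real n - 1 / 2) \<le> r powr (1 / (2 * real n))"
  proof -
    have "r \<le> b powr (- real n)" using rb pos by (simp add: powr_minus powr_realpow field_simps)
    then have "r powr (1 - 1 / (2 * real n)) \<le> (b powr (- real n)) powr (1 - 1 / (2 * real n))"
      using r0 n by (intro powr_mono2) auto
    also have "\<dots> = b powr (- real n * (1 - 1 / (2 * real n)))" by (rule powr_powr)
    also have "- real n * (1 - 1 / (2 * real n)) = - (real n - 1 / 2)" using n by (simp add: field_simps)
    finally have le: "r powr (1 - 1 / (2 * real n)) \<le> b powr (- (real n - 1 / 2))" .
    define rs B where "rs = r powr (1 / (2 * real n))" "B = b powr (real n - 1 / 2)"
    note rsB = this
    have "r * B = r powr (1 - 1 / (2 * real n)) * (rs * B)"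
      using r0 by (simp add: rsB mult.assoc[symmetric] powr_add[symmetric])
    also have "\<dots> \<le> b powr (- (real n - 1 / 2)) * (rs * B)" by (intro mult_right_mono le) (simp add: rsB)
    also have "\<dots> = (b powr (- (real n - 1 / 2)) * B) * rs" by simp
    also have "b powr (- (real n - 1 / 2)) * B = 1" unfolding rsB powr_add[symmetric] using pos by simp
    finally show ?thesis by (simp add: rsB)
  qed
  \<comment> \<open>Here the lower bound on \<open>r\<close> enters: it is at least
    \<open>c powr (- (n + 1))\<close>, so the right side is at least
    \<open>c powr (- 3 / 4)\<close>, where 3/4 is the value of \<open>(n + 1) / (2 * n)\<close> in
    the worst case \<open>n = 2\<close>. On the left, \<open>b ^ n\<close> is at most
    \<open>c powr (1 / 4)\<close>.\<close>
  also have "b powr (real n - 1 / 2) / c \<le> r powr (1 / (2 * real n))"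
  proof -
    have "c powr (- (real n + 1)) \<le> r"
    proof -
      have "1 \<le> incr n K (Suc (Suc j)) * c ^ (n + 1)" using incr_ge'[of "Suc (Suc j)"] by (simp only: abc)
      also have "\<dots> \<le> r * c ^ (n + 1)" using r(1) pos by (intro mult_right_mono) auto
      finally have "1 / c ^ (n + 1) \<le> r" using pos by (simp add: divide_le_eq)
      moreover have "c powr (- (real n + 1)) = 1 / c ^ (n + 1)"
        unfolding powr_minus_divide using pos powr_realpow[of c "n + 1"] by (simp add: add.commute)
      ultimately show ?thesis by simp
    qed
    then have "(c powr (- (real n + 1))) powr (1 / (2 * real n)) \<le> r powr (1 / (2 * real n))"
      by (intro powr_mono2) auto
    moreover have "c powr (- 3 / 4) \<le> (c powr (- (real n + 1))) powr (1 / (2 * real n))"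
    proof -
      have "- 3 / 4 \<le> - (real n + 1) * (1 / (2 * real n))" using n by (simp add: field_simps)
      then show ?thesis using pos by (simp add: powr_powr powr_mono)
    qed
    moreover have "b powr (real n - 1 / 2) / c \<le> c powr (- 3 / 4)"
    proof -
      have "(b ^ n) ^ 4 \<le> c" unfolding power_mult[symmetric] abc by (rule den_power_le) (use K n in simp)
      then have "((b ^ n) ^ 4) powr (1 / 4) \<le> c powr (1 / 4)" using pos by (intro powr_mono2) auto
      moreover have "((b ^ n) ^ 4) powr (1 / 4) = b ^ n"
      proof -
        have "(b ^ n) powr real 4 = (b ^ n) ^ 4" by (rule powr_realpow) (use pos in simp)
        then have "((b ^ n) ^ 4) powr (1 / 4) = (b ^ n) powr (real 4 * (1 / 4))" by (metis powr_powr)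
        then show ?thesis using pos by simp
      qed
      moreover have "b powr (real n - 1 / 2) \<le> b ^ n" using pos powr_mono[of "real n - 1 / 2" "real n" b] by (simp add: powr_realpow)
      ultimately have "b powr (real n - 1 / 2) \<le> c powr (1 / 4)" by linarith
      then have "b powr (real n - 1 / 2) / c \<le> c powr (1 / 4) / c" using pos by (intro divide_right_mono) auto
      also have "c powr (1 / 4) / c = c powr (1 / 4 - 1)" using powr_diff[of c "1 / 4" 1] pos by simp
      finally show ?thesis by simp
    qed
    ultimately show ?thesis by linarith
  qed
  finally show "B j r \<le> 5 * r powr (1 / (2 * real n))" by simp
qed

text \<open>At the scale \<open>1 / c\<close> both counts of fractions in the box are at most 5,
  while the last block alone offers about \<open>c / b ^ (n + 1)\<close> choices. As
  \<open>c\<close> eventually exceeds any fixed power of \<open>b\<close>, the measure is almost as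
  small as the radius. A sequence of scales is enough for packing.\<close>

lemma digit_packing_box_le:
  fixes s :: real
  assumes s: "s < 1"
  defines "c \<equiv> \<lambda>j. real (den K (Suc (Suc (Suc j))))"
  shows "\<exists>j0. \<forall>j\<ge>j0. (4 * (1 / c j) * real (den K (Suc (Suc j))) + 1) * (4 * (1 / c j) * c j + 1) /
      (\<Prod>i<Suc (Suc j). real (choices n K i)) \<le> 150 * (1 / c j) powr s"
proof -
  obtain j0 :: nat where j0: "real (n + 2) / (1 - s) < real j0" using reals_Archimedean2 by blast
  have "(4 * (1 / c j) * real (den K (Suc (Suc j))) + 1) * (4 * (1 / c j) * c j + 1) /
      (\<Prod>i<Suc (Suc j). real (choices n K i)) \<le> 150 * (1 / c j) powr s" if j: "j0 \<le> j" for j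
  proof -
    define a b where "a = real (den K (Suc j))" "b = real (den K (Suc (Suc j)))"
    note ab = this
    define y where "y = (\<Prod>i<Suc (Suc j). real (choices n K i))"
    have pos: "1 \<le> a" "1 \<le> b" "1 \<le> c j" using den_ge1 by (auto simp: ab c_def)
    have bc: "b \<le> c j" using den_mono[of "Suc (Suc j)"] by (simp add: ab c_def)
    have "1 \<le> incr n K (Suc j) * b ^ (n + 1)" using incr_ge'[of "Suc j"] by (simp only: ab)
    then have "1 / b ^ (n + 1) \<le> incr n K (Suc j)" using pos by (simp add: divide_le_eq)
    then have "1 / b ^ (n + 1) * (c j / 6) \<le> incr n K (Suc j) * (c j / 6)" using pos by (intro mult_right_mono) auto
    also have "\<dots> \<le> real (choices n K (Suc j))" using choices_ge[of "Suc j"] by (simp add: c_def)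
    also have "\<dots> \<le> real (choices n K j) * real (choices n K (Suc j))"
      using choices_ge1[of j] by (simp add: mult_le_cancel_right1)
    also have "\<dots> \<le> y" unfolding y_def by (rule prod_choices_ge)
    finally have ylow: "c j / (6 * b ^ (n + 1)) \<le> y" by (simp add: mult_ac)
    have ylow0: "0 < c j / (6 * b ^ (n + 1))" using pos by simp
    have "(4 * (1 / c j) * b + 1) * (4 * (1 / c j) * c j + 1) / y \<le> (5 * 5) / (c j / (6 * b ^ (n + 1)))"
      using pos bc ylow ylow0 by (intro frac_le mult_mono) (auto simp: field_simps)
    also have "\<dots> = 150 * (b ^ (n + 1) / c j)" using pos by simp
    also have "b ^ (n + 1) / c j \<le> (1 / c j) powr s"
    proof -
      have "real (n + 2) \<le> real (j + 2 + K) * (1 - s)"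
      proof -
        have "real (n + 2) < real j0 * (1 - s)" using j0 s by (simp add: field_simps)
        also have "\<dots> \<le> real (j + 2 + K) * (1 - s)" using j s by (intro mult_right_mono) auto
        finally show ?thesis by simp
      qed
      have "b ^ (n + 1) = b powr real (n + 1)" using pos powr_realpow[of b "n + 1"] by simp
      also have "\<dots> \<le> b powr (real (j + 2 + K) * (1 - s))"
        using pos \<open>real (n + 2) \<le> _\<close> by (intro powr_mono) auto
      also have "\<dots> = (b ^ (j + 2 + K)) powr (1 - s)"
        using pos powr_realpow[of b "j + 2 + K"] by (simp add: powr_powr[symmetric])
      also have "\<dots> \<le> c j powr (1 - s)"
        using den_growth[of "Suc (Suc j)"] pos s by (intro powr_mono2) (auto simp: ab c_def)
      finally have "b ^ (n + 1) / c j \<le> c j powr (1 - s) / c j" using pos by (intro divide_right_mono) auto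
      also have "\<dots> = c j powr (- s)" using pos by (simp add: powr_diff powr_minus_divide)
      also have "\<dots> = (1 / c j) powr s" using pos by (simp add: powr_divide powr_minus_divide)
      finally show ?thesis .
    qed
    finally show ?thesis by (simp add: ab y_def)
  qed
  then show ?thesis by blast
qed

end

text \<open>For the Hausdorff bound an arbitrary small radius is located between two consecutive
  increments; for the packing bound only reciprocals of denominators serve as radii.\<close>

lemma Theta_digit_dimension:
  fixes i1 i2 :: "'n::finite"
  assumes i12: "i1 \<noteq> i2" and n2: "2 \<le> CARD('n)"
  shows "ereal (real CARD('n) - 2 + 1 / (2 * real CARD('n))) \<le> hausdorff_dim (Theta i1 i2)"
    "ereal (real CARD('n) - 1) \<le> packing_dim (Theta i1 i2)"
    "Theta i1 i2 \<noteq> {}"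
proof -
  define n where "n = CARD('n)"
  define K where "K = 40 * n"
  have n: "2 \<le> n" using n2 by (simp add: n_def)
  interpret T: random_system i1 i2 "digit_step K" "(1, den K 0)" "(1, den K (Suc 0))" "choices n K" "digit_valid K"
    "\<lambda>j. real (den K j)" "incr n K" "\<lambda>j. real (den K j)"
    by (rule digit_random_system[OF n K_def i12 n_def])
  have E: "T.pt \<omega> y \<in> Theta i1 i2"
    if "interlaced_approximations i1 i2 (T.pt \<omega> y) (\<lambda>j. snd (T.ch \<omega> j)) (\<lambda>j. fst (T.ch \<omega> j)) J" for \<omega> y J
    using interlaced_approximations.in_Theta[OF that] .
  show "Theta i1 i2 \<noteq> {}" by (rule T.nonempty) (rule E)
  have nr: "real (n - 2) = real n - 2" using n by (simp add: of_nat_diff)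
  define s1 where "s1 = 1 / (2 * real n)"
  have s1: "0 < s1" using n by (simp add: s1_def)
  have incr0: "incr n K \<longlonglongrightarrow> 0"
  proof (rule tendsto_sandwich[OF _ _ tendsto_const])
    show "\<forall>\<^sub>F j in sequentially. 0 \<le> incr n K j" by (intro always_eventually allI less_imp_le T.D_pos)
    have "incr n K j \<le> incr n K 0 * (1 / 2) ^ j" for j
    proof (induction j)
      case (Suc j)
      have "incr n K (Suc j) \<le> incr n K j / 2" using T.D_dec[of j] by simp
      also have "\<dots> \<le> incr n K 0 * (1 / 2) ^ j / 2" using Suc by simp
      finally show ?case by simp
    qed simp
    then show "\<forall>\<^sub>F j in sequentially. incr n K j \<le> incr n K 0 * (1 / 2) ^ j" by simp
    show "(\<lambda>j. incr n K 0 * (1 / 2) ^ j) \<longlonglongrightarrow> 0"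
      using tendsto_mult[OF tendsto_const LIMSEQ_power_zero[of "1/2 :: real"]] by simp
  qed
  have Hball: "\<exists>V\<in>sets T.M. {\<omega> \<in> space T.M. \<bar>T.xi \<omega> 0 - a\<bar> \<le> r \<and> \<bar>T.xi \<omega> 1 - b\<bar> \<le> r} \<subseteq> V \<and>
      emeasure T.M V \<le> ennreal (5 * r powr s1)" if r: "0 < r" "r \<le> incr n K 1" for r a b
  proof -
    define k where "k = (LEAST k. incr n K k \<le> r)"
    have "\<exists>k. incr n K k \<le> r"
      using order_tendstoD(2)[OF incr0 r(1)] by (auto simp: eventually_sequentially intro: less_imp_le)
    then have k: "incr n K k \<le> r" unfolding k_def by (rule LeastI_ex)
    have ex: "\<exists>j. incr n K (Suc (Suc j)) \<le> r \<and> r \<le> incr n K (Suc j)"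
    proof (cases "k \<le> 1")
      case True
      have "incr n K 1 \<le> incr n K k" using T.D_dec[of 0] T.D_pos[of "Suc 0"] True by (cases k) auto
      then have "r = incr n K 1" using k r by linarith
      moreover have "incr n K (Suc (Suc 0)) \<le> incr n K (Suc 0)" using T.D_dec[of "Suc 0"] T.D_pos[of "Suc (Suc 0)"] by linarith
      ultimately show ?thesis by (intro exI[of _ 0]) simp
    next
      case False
      then obtain j where j: "k = Suc (Suc j)" by (metis One_nat_def Suc_leI le_Suc_eq less_one not0_implies_Suc not_le)
      have "\<not> incr n K (Suc j) \<le> r" using not_less_Least[of "Suc j" "\<lambda>k. incr n K k \<le> r"] j by (simp add: k_def[symmetric])
      then show ?thesis using k j by (intro exI[of _ j]) auto
    qed
    then obtain j where j: "incr n K (Suc (Suc j)) \<le> r" "r \<le> incr n K (Suc j)" by blast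
    obtain V where V: "V \<in> sets T.M" "{\<omega> \<in> space T.M. \<bar>T.xi \<omega> 0 - a\<bar> \<le> r \<and> \<bar>T.xi \<omega> 1 - b\<bar> \<le> r} \<subseteq> V"
      "emeasure T.M V \<le> ennreal ((4 * r * real (den K (Suc (Suc j))) + 1) * (4 * r * real (den K (Suc (Suc (Suc j)))) + 1) / (\<Prod>i<Suc (Suc j). real (choices n K i)))"
      using T.measure_box[OF j(1)] by blast
    have "emeasure T.M V \<le> ennreal (5 * r powr s1)"
      using digit_box_le[OF n K_def j] unfolding s1_def by (intro order_trans[OF V(3)] ennreal_leI)
    then show ?thesis using V by blast
  qed
  show "ereal (real CARD('n) - 2 + 1 / (2 * real CARD('n))) \<le> hausdorff_dim (Theta i1 i2)"
  proof (rule hausdorff_dim_geI)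
    fix s :: real assume s: "0 < s" "s < real CARD('n) - 2 + 1 / (2 * real CARD('n))"
    \<comment> \<open>Possibly negative; as \<open>r \<le> 1\<close>, a smaller exponent only
      weakens the bound.\<close>
    define s' where "s' = s - (real n - 2)"
    have s': "s' < s1" using s by (simp add: s'_def s1_def n_def)
    have ball: "\<exists>V\<in>sets T.M. {\<omega> \<in> space T.M. \<bar>T.xi \<omega> 0 - a\<bar> \<le> r \<and> \<bar>T.xi \<omega> 1 - b\<bar> \<le> r} \<subseteq> V \<and>
      emeasure T.M V \<le> ennreal (5 * r powr s')" if r: "0 < r" "r \<le> min 1 (incr n K 1)" for r a b
    proof -
      have "r powr s1 \<le> r powr s'" using r s' by (intro powr_mono') auto
      then have "ennreal (5 * r powr s1) \<le> ennreal (5 * r powr s')" by (intro ennreal_leI) simp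
      then show ?thesis using Hball[of r a b] r by (meson min.boundedE order_trans)
    qed
    have "hausdorff_measure (real (CARD('n) - 2) + s') (Theta i1 i2) \<noteq> 0"
      by (rule T.hausdorff_measure_ne_0[where ?r0.0 = "min 1 (incr n K 1)" and C = 5, OF E ball]) (use s T.D_pos[of 1] nr in \<open>auto simp: s'_def n_def\<close>)
    then show "hausdorff_measure s (Theta i1 i2) \<noteq> 0" using nr by (simp add: s'_def n_def)
  qed
  show "ereal (real CARD('n) - 1) \<le> packing_dim (Theta i1 i2)"
  proof (rule packing_dim_geI)
    fix s :: real assume s: "0 < s" "s < real CARD('n) - 1"
    define s' where "s' = s - (real n - 2)"
    have s': "s' < 1" using s by (simp add: s'_def n_def)
    obtain j0 where j0: "\<And>j. j0 \<le> j \<Longrightarrow> (4 * (1 / real (den K (Suc (Suc (Suc j))))) * real (den K (Suc (Suc j))) + 1) *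
        (4 * (1 / real (den K (Suc (Suc (Suc j))))) * real (den K (Suc (Suc (Suc j)))) + 1) /
        (\<Prod>i<Suc (Suc j). real (choices n K i)) \<le> 150 * (1 / real (den K (Suc (Suc (Suc j))))) powr s'"
      using digit_packing_box_le[OF n K_def s'] by blast
    \<comment> \<open>The packing criterion is tested with balls of twice the radius, hence with
      radii \<open>q k / 2\<close>.\<close>
    define q where "q k = 1 / real (den K (Suc (Suc (Suc (k + j0)))))" for k
    have "packing_measure (real (CARD('n) - 2) + s') (Theta i1 i2) \<noteq> 0"
    proof (rule T.packing_measure_ne_0[where r = "\<lambda>k. q k / 2" and C = 150, OF E])
      show "0 < q k / 2" for k using den_pos[OF n K_def] by (simp add: q_def)
      have "q k \<le> (1 / 2) ^ k" for k
      proof -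
        have "2 ^ k \<le> (2::real) ^ (K + Suc (Suc (Suc (k + j0))))" by (intro power_increasing) auto
        also have "\<dots> \<le> real (den K (Suc (Suc (Suc (k + j0)))))" by (rule den_ge[OF n K_def])
        finally have "1 / real (den K (Suc (Suc (Suc (k + j0))))) \<le> 1 / 2 ^ k"
          by (rule divide_left_mono) (use den_pos[OF n K_def] in simp_all)
        then show ?thesis by (simp add: q_def power_one_over)
      qed
      then show "(\<lambda>k. q k / 2) \<longlonglongrightarrow> 0"
        by (intro tendsto_divide_zero tendsto_sandwich[of "\<lambda>_. 0" q _ "\<lambda>k. (1/2) ^ k"] LIMSEQ_power_zero)
          (auto simp: q_def)
      fix k a b
      have D: "incr n K (Suc (Suc (k + j0))) \<le> q k"
      proof -
        define c where "c = real (den K (Suc (Suc (Suc (k + j0)))))"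
        have c: "1 \<le> c" unfolding c_def by (rule den_ge1[OF n K_def])
        have "c ^ 1 \<le> c ^ n" using n c by (intro power_increasing) auto
        then have "incr n K (Suc (Suc (k + j0))) * c \<le> incr n K (Suc (Suc (k + j0))) * c ^ n"
          using T.D_pos[of "Suc (Suc (k + j0))"] by (intro mult_left_mono) auto
        also have "\<dots> \<le> 1" unfolding c_def by (rule incr_le[OF n K_def])
        finally show ?thesis using c by (simp add: q_def c_def[symmetric] le_divide_eq)
      qed
      obtain V where V: "V \<in> sets T.M" "{\<omega> \<in> space T.M. \<bar>T.xi \<omega> 0 - a\<bar> \<le> q k \<and> \<bar>T.xi \<omega> 1 - b\<bar> \<le> q k} \<subseteq> V"
        "emeasure T.M V \<le> ennreal ((4 * q k * real (den K (Suc (Suc (k + j0)))) + 1) * (4 * q k * real (den K (Suc (Suc (Suc (k + j0))))) + 1) / (\<Prod>i<Suc (Suc (k + j0)). real (choices n K i)))"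
        using T.measure_box[OF D] by blast
      have "emeasure T.M V \<le> ennreal (150 * q k powr s')"
        using j0[of "k + j0"] unfolding q_def by (intro order_trans[OF V(3)[unfolded q_def]] ennreal_leI) simp
      then show "\<exists>V\<in>sets T.M. {\<omega> \<in> space T.M. \<bar>T.xi \<omega> 0 - a\<bar> \<le> 2 * (q k / 2) \<and> \<bar>T.xi \<omega> 1 - b\<bar> \<le> 2 * (q k / 2)} \<subseteq> V \<and>
          emeasure T.M V \<le> ennreal (150 * (2 * (q k / 2)) powr s')" using V by auto
      show "0 < (150::real)" by simp
    qed
    then show "packing_measure s (Theta i1 i2) \<noteq> 0" using nr by (simp add: s'_def n_def)
  qed
qed

section \<open>Neighbouring fractions\<close>

text \<open>For \<open>m\<close> distinct integers from 2 on the product is smallest for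
  \<open>2, ..., m + 1\<close>, where it telescopes to \<open>1 / (m + 1)\<close>. The induction
  removes the maximum, which exceeds the cardinality.\<close>

lemma prod_one_plus_le:
  assumes "finite S" "\<And>p. p \<in> S \<Longrightarrow> 2 \<le> (p :: nat)"
  shows "1 \<le> (real (card S) + 1) * (\<Prod>p\<in>S. 1 - 1 / real p)"
  using assms
proof (induction "card S" arbitrary: S)
  case (Suc m)
  define p where "p = Max S"
  have "S \<noteq> {}" using Suc.hyps(2) by auto
  then have p: "p \<in> S" using Suc.prems by (simp add: p_def)
  have "S \<subseteq> {2..p}" using Suc.prems by (auto simp: p_def)
  then have "card S \<le> card {2..p}" by (intro card_mono) auto
  then have pm: "Suc m + 1 \<le> p" using Suc.hyps(2) by simp
  define T where "T = S - {p}"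
  have T: "card T = m" "finite T" "S = insert p T" "p \<notin> T" using Suc p by (auto simp: T_def)
  have IH: "1 \<le> (real m + 1) * (\<Prod>q\<in>T. 1 - 1 / real q)"
    using Suc.hyps(1)[of T] T Suc.prems by auto
  have pr: "0 < (\<Prod>q\<in>T. 1 - 1 / real q)"
  proof (rule ccontr)
    assume "\<not> 0 < (\<Prod>q\<in>T. 1 - 1 / real q)"
    then have "(real m + 1) * (\<Prod>q\<in>T. 1 - 1 / real q) \<le> 0" by (intro mult_nonneg_nonpos) auto
    then show False using IH by linarith
  qed
  have "(real m + 1) \<le> (real m + 2) * (1 - 1 / real p)"
  proof -
    have "(real m + 2) / real p \<le> 1" using pm by simp
    moreover have "(real m + 2) * (1 - 1 / real p) = (real m + 2) - (real m + 2) / real p" by (simp add: right_diff_distrib)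
    ultimately show ?thesis by linarith
  qed
  then have "(real m + 1) * (\<Prod>q\<in>T. 1 - 1 / real q) \<le> ((real m + 2) * (1 - 1 / real p)) * (\<Prod>q\<in>T. 1 - 1 / real q)"
    using pr by (intro mult_right_mono) auto
  then have "1 \<le> ((real m + 2) * (1 - 1 / real p)) * (\<Prod>q\<in>T. 1 - 1 / real q)" using IH by linarith
  moreover have "(\<Prod>q\<in>S. 1 - 1 / real q) = (1 - 1 / real p) * (\<Prod>q\<in>T. 1 - 1 / real q)"
    unfolding T(3) using T by simp
  moreover have "real (card S) + 1 = real m + 2" using Suc.hyps(2) by simp
  ultimately show ?case by (simp only: mult.assoc)
qed simp

text \<open>A positive \<open>b\<close> has at most \<open>log 2 b\<close> prime factors, and
  Euler's product over them is bounded below by the previous lemma. The logarithmic loss is harmless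
  for the dimensions.\<close>

lemma totient_lower_bound:
  assumes "0 < b"
  shows "real b \<le> real (totient b) * (1 + log 2 (real b))"
proof -
  define S where "S = prime_factors b"
  have S: "finite S" "\<And>p. p \<in> S \<Longrightarrow> 2 \<le> p" by (auto simp: S_def intro: prime_ge_2_nat)
  have "2 ^ card S \<le> b"
  proof -
    have "2 ^ card S = (\<Prod>p\<in>S. 2 :: nat)" by simp
    also have "\<dots> \<le> (\<Prod>p\<in>S. p)" using S by (intro prod_mono) auto
    also have "\<dots> \<le> b"
    proof (rule dvd_imp_le[OF _ assms])
      have "(\<Prod>p\<in>S. p) dvd (\<Prod>p\<in>S. p ^ multiplicity p b)"
      proof (rule prod_dvd_prod)
        fix p assume "p \<in> S"
        then have "0 < multiplicity p b" by (simp add: S_def prime_factors_multiplicity)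
        then show "p dvd p ^ multiplicity p b" by (intro dvd_power) auto
      qed
      also have "\<dots> = b" using prime_factorization_nat[OF assms] by (simp add: S_def)
      finally show "(\<Prod>p\<in>S. p) dvd b" .
    qed
    finally show ?thesis .
  qed
  then have "real (2 ^ card S) \<le> real b" by (rule of_nat_mono)
  then have "2 powr real (card S) \<le> real b" by (simp add: powr_realpow)
  then have "real (card S) \<le> log 2 (real b)" using assms by (subst le_log_iff) auto
  then have le: "real (card S) + 1 \<le> 1 + log 2 (real b)" by simp
  have "real b * 1 \<le> real b * ((real (card S) + 1) * (\<Prod>p\<in>S. 1 - 1 / real p))"
    by (intro mult_left_mono prod_one_plus_le S) auto
  also have "\<dots> = real (totient b) * (real (card S) + 1)" by (simp add: totient_formula2 S_def mult_ac)
  also have "\<dots> \<le> real (totient b) * (1 + log 2 (real b))" by (intro mult_left_mono le) simp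
  finally show ?thesis by simp
qed

text \<open>As \<open>c\<close> is invertible modulo \<open>b\<close>, the values for
  \<open>b\<close> consecutive \<open>m\<close> meet every residue class exactly once.\<close>

lemma card_coprime_progression:
  fixes b c c0 a K :: nat
  assumes cb: "coprime c b" and b: "1 < b"
  shows "card {m \<in> {a..<a + K * b}. coprime (c0 + m * c) b} = K * totient b"
proof (induction K)
  case (Suc K)
  define A where "A = {m \<in> {a + K * b..<a + K * b + b}. coprime (c0 + m * c) b}"
  define h where "h m = (c0 + m * c) mod b" for m
  have inj: "inj_on h {a + K * b..<a + K * b + b}"
  proof (rule linorder_inj_onI')
    fix i j assume ij: "i \<in> {a + K * b..<a + K * b + b}" "j \<in> {a + K * b..<a + K * b + b}" "i < j"
    show "h i \<noteq> h j"
    proof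
      assume "h i = h j"
      moreover have "c0 + i * c \<le> c0 + j * c" using ij by simp
      ultimately have "b dvd (c0 + j * c) - (c0 + i * c)" by (simp only: h_def mod_eq_dvd_iff_nat eq_commute[of "(c0 + i * c) mod b"])
      then have "b dvd (j - i) * c" by (simp add: diff_mult_distrib)
      then have "b dvd j - i" using cb by (simp add: coprime_dvd_mult_left_iff coprime_commute)
      then have "b \<le> j - i" using ij by (intro dvd_imp_le) auto
      then show False using ij by auto
    qed
  qed
  have "h ` {a + K * b..<a + K * b + b} \<subseteq> {..<b}" using b by (auto simp: h_def)
  moreover have "card (h ` {a + K * b..<a + K * b + b}) = card {..<b}" using inj by (simp add: card_image)
  ultimately have img: "h ` {a + K * b..<a + K * b + b} = {..<b}" by (intro card_subset_eq) auto
  have "h ` A = totatives b"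
  proof (intro equalityI subsetI)
    fix r assume "r \<in> h ` A"
    then obtain m where m: "m \<in> A" "r = h m" by blast
    then have "coprime r b" by (simp add: A_def h_def)
    moreover have "r < b" using b by (simp add: m h_def)
    moreover have "r \<noteq> 0" using \<open>coprime r b\<close> b by (intro notI) simp
    ultimately show "r \<in> totatives b" by (simp add: in_totatives_iff)
  next
    fix r assume r: "r \<in> totatives b"
    then have "r < b" using b by (rule totatives_less)
    then obtain m where m: "m \<in> {a + K * b..<a + K * b + b}" "r = h m" using img by blast
    then have "coprime (c0 + m * c) b" using r by (simp add: in_totatives_iff h_def)
    then show "r \<in> h ` A" using m by (auto simp: A_def)
  qed
  moreover have "inj_on h A" by (rule inj_on_subset[OF inj]) (auto simp: A_def)
  ultimately have cA: "card A = totient b" by (simp add: totient_def card_image[symmetric])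
  have "{m \<in> {a..<a + Suc K * b}. coprime (c0 + m * c) b} = {m \<in> {a..<a + K * b}. coprime (c0 + m * c) b} \<union> A"
    by (auto simp: A_def)
  moreover have "{m \<in> {a..<a + K * b}. coprime (c0 + m * c) b} \<inter> A = {}" by (auto simp: A_def)
  ultimately show ?case using Suc cA by (simp add: card_Un_disjoint A_def)
qed simp

text \<open>The equation makes \<open>w\<close> a neighbour of \<open>u\<close>: the two fractions
  differ by exactly \<open>1 / (snd u * snd w)\<close>, the least possible for distinct fractions
  with these denominators.\<close>

definition children :: "real \<Rightarrow> node \<Rightarrow> nat \<Rightarrow> node set" where
  "children Y u b = {w. fst w * int (snd u) - fst u * int (snd w) = 1 \<and> Y \<le> real (snd w) \<and> real (snd w) \<le> 2 * Y \<and> coprime (snd w) b}"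

text \<open>The solutions form a progression with denominators \<open>c1 + m * c\<close>, so about
  \<open>Y / c\<close> of them lie between \<open>Y\<close> and \<open>2 * Y\<close>, and among
  \<open>b\<close> consecutive ones \<open>totient b\<close> are coprime to \<open>b\<close>. The
  assumption on \<open>Y\<close> ensures that rounding and the incomplete last period lose at most
  half.\<close>

lemma children_many:
  fixes u :: node
  assumes cop: "coprime (fst u) (int (snd u))" "coprime (snd u) b" and c: "0 < snd u" and b: "1 < b"
    and Y: "4 * real (snd u) * (1 + real b) \<le> Y * 2"
  shows "\<exists>T \<subseteq> children Y u b. finite T \<and> Y / (2 * real (snd u)) / (1 + log 2 (real b)) \<le> real (card T)"
proof -
  define P c where "P = fst u" "c = snd u"
  note Pc = this
  have c0: "0 < c" using c by (simp add: Pc)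
  obtain x y where xy: "x * P + y * int c = 1" using cop(1) unfolding Pc by (metis bezout_int coprime_iff_gcd_eq_1)
  \<comment> \<open>By \<open>x * P + y * c = 1\<close>, the product of \<open>P\<close> with the
    residue of \<open>- x\<close> is congruent to -1 modulo \<open>c\<close>, so this residue starts
    the progression of denominators.\<close>
  define c1 where "c1 = nat ((- x) mod int c)"
  have c1: "int c1 = (- x) mod int c" "c1 < c" using c0 by (auto simp: c1_def nat_less_iff)
  have "int c dvd 1 + P * int c1"
  proof -
    have "int c dvd (- x) mod int c - (- x)" by (metis dvd_minus_mod dvd_minus_iff minus_diff_eq)
    then have "int c dvd P * ((- x) mod int c + x)" by simp
    moreover have "1 + P * int c1 = P * ((- x) mod int c + x) + y * int c" using xy by (simp add: c1(1) algebra_simps)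
    ultimately show ?thesis by simp
  qed
  then obtain P1 where P1: "1 + P * int c1 = int c * P1" by blast
  define f where "f m = (P1 + int m * P, c1 + m * c)" for m
  have f1: "fst (f m) * int c - P * int (snd (f m)) = 1" for m
    using P1 by (simp add: f_def algebra_simps)
  define m0 where "m0 = nat \<lceil>Y / real c\<rceil>"
  define K where "K = nat \<lfloor>(2 * Y / real c - real m0) / real b\<rfloor>"
  have "0 < 4 * real (snd u) * (1 + real b)" using c by (intro mult_pos_pos) auto
  then have Y0: "0 < Y" using Y by linarith
  have m0: "Y / real c \<le> real m0" "real m0 < Y / real c + 1"
  proof -
    have "0 \<le> Y / real c" using Y0 by simp
    then have "real m0 = real_of_int \<lceil>Y / real c\<rceil>" by (simp add: m0_def)
    then show "Y / real c \<le> real m0" "real m0 < Y / real c + 1" by linarith+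
  qed
  have Yc: "2 * (1 + real b) \<le> Y / real c" using Y c0 by (simp add: Pc[symmetric] field_simps)
  have Kge: "0 \<le> (2 * Y / real c - real m0) / real b" using m0 Yc b by simp
  have K: "real K \<le> (2 * Y / real c - real m0) / real b" "(2 * Y / real c - real m0) / real b - 1 < real K"
  proof -
    have "real K = real_of_int \<lfloor>(2 * Y / real c - real m0) / real b\<rfloor>" using Kge by (simp add: K_def)
    then show "real K \<le> (2 * Y / real c - real m0) / real b" "(2 * Y / real c - real m0) / real b - 1 < real K" by linarith+
  qed
  define G where "G = {m \<in> {m0..<m0 + K * b}. coprime (c1 + m * c) b}"
  have cG: "card G = K * totient b" unfolding G_def by (rule card_coprime_progression) (use cop b in \<open>auto simp: Pc\<close>)
  have "f ` G \<subseteq> children Y u b"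
  proof
    fix w assume "w \<in> f ` G"
    then obtain m where m: "m \<in> G" "w = f m" by blast
    have lo: "Y \<le> real (c1 + m * c)"
    proof -
      have "Y \<le> real m0 * real c" using m0(1) c0 by (simp add: divide_le_eq)
      also have "\<dots> \<le> real m * real c" using m by (intro mult_right_mono) (auto simp: G_def)
      finally show ?thesis by simp
    qed
    have hi: "real (c1 + m * c) \<le> 2 * Y"
    proof -
      have "c1 + m * c \<le> (m + 1) * c" using c1(2) by simp
      also have "\<dots> \<le> (m0 + K * b) * c" using m by (intro mult_right_mono) (auto simp: G_def)
      finally have "real (c1 + m * c) \<le> (real m0 + real K * real b) * real c" by (metis of_nat_add of_nat_le_iff of_nat_mult)
      also have "\<dots> \<le> (2 * Y / real c) * real c"
      proof (rule mult_right_mono)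
        have "real K * real b \<le> 2 * Y / real c - real m0" using K(1) b by (simp add: le_divide_eq)
        then show "real m0 + real K * real b \<le> 2 * Y / real c" by linarith
      qed simp
      finally show ?thesis using c0 by simp
    qed
    show "w \<in> children Y u b"
      using f1[of m] lo hi m by (simp add: children_def Pc[symmetric] f_def G_def)
  qed
  moreover have "finite (f ` G)" by (simp add: G_def)
  moreover have "Y / (2 * real (snd u)) / (1 + log 2 (real b)) \<le> real (card (f ` G))"
  proof -
    have "inj_on f G" using c0 by (auto simp: inj_on_def f_def)
    then have cf: "real (card (f ` G)) = real K * real (totient b)" using cG by (simp add: card_image)
    have "Y / (2 * real c) \<le> real K * real b"
    proof -
      have "(2 * Y / real c - real m0) - real b < real K * real b"
        using K(2) b by (simp add: field_simps)
      moreover have "Y / real c \<ge> 2 * (1 + real b)" "2 * Y / real c = 2 * (Y / real c)" "Y / (2 * real c) = (Y / real c) / 2"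
        using Yc by simp_all
      moreover have "B / 2 \<le> k" if "2 * (1 + real b) \<le> B" "m < B + 1" "2 * B - m - real b < k" for B m k :: real
      proof -
        have "2 * B - (B + 1) - real b \<le> k" using that by linarith
        then have "B - (1 + real b) \<le> k" by simp
        moreover have "1 + real b \<le> B / 2" using that by simp
        ultimately show ?thesis by linarith
      qed
      ultimately show ?thesis using m0(2) by metis
    qed
    also have "\<dots> \<le> real K * (real (totient b) * (1 + log 2 (real b)))"
      using b by (intro mult_left_mono totient_lower_bound) auto
    finally have "Y / (2 * real c) \<le> real (card (f ` G)) * (1 + log 2 (real b))" by (simp add: cf)
    moreover have "0 < 1 + log 2 (real b)" using b by (intro add_pos_pos) auto
    ultimately show ?thesis using c0 by (simp only: pos_divide_le_eq Pc)
  qed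
  ultimately show ?thesis by blast
qed

text \<open>
  The logarithms of the denominators.  For finite \<open>w\<close> the weights are \<open>w\<close>; the additive terms,
  negligible against the doubly exponential growth, make the sums in the Borel--Cantelli argument converge.
\<close>

context
  fixes n :: nat and wt :: "nat \<Rightarrow> real"
  assumes n: "2 \<le> n" and wt: "\<And>j. real n \<le> wt j"
begin

section \<open>Chains of neighbours with denominators of prescribed size\<close>

primrec lg :: "nat \<Rightarrow> real" where
  "lg 0 = 100 + real n"
| "lg (Suc j) = wt j * lg j + (real j + 5 + real n)"

definition size :: "nat \<Rightarrow> real" where "size j = 2 powr lg j"

definition nbr_incr :: "nat \<Rightarrow> real" where "nbr_incr j = 1 / (size j * size (Suc (Suc j)))"

text \<open>A lower bound, valid for every admissible node, for the number supplied by
  \<open>children_many\<close>: the denominator is at most \<open>2 * size j\<close>, and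
  \<open>1 + log 2 b\<close> is at most \<open>size (Suc j) powr (1 / 8)\<close>. A number of
  choices independent of the node is needed for a product measure.\<close>

definition nbr_choices :: "nat \<Rightarrow> nat" where
  "nbr_choices j = nat \<lfloor>size (Suc (Suc j)) / (4 * size j * size (Suc j) powr (1 / 8))\<rfloor>"

definition nbr_valid :: "nat \<Rightarrow> node \<Rightarrow> bool" where
  "nbr_valid j u \<longleftrightarrow> coprime (fst u) (int (snd u)) \<and> size j \<le> real (snd u) \<and> real (snd u) \<le> 2 * size j"

text \<open>Some injective numbering of \<open>nbr_choices j\<close> of the children; which of them
  are taken does not matter.\<close>

definition nbr_step :: "nat \<Rightarrow> node \<Rightarrow> node \<Rightarrow> nat \<Rightarrow> node" where
  "nbr_step j u u' = (SOME g. inj_on g {..<nbr_choices j} \<and> g ` {..<nbr_choices j} \<subseteq> children (size (Suc (Suc j))) u (snd u'))"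

lemma lg_Suc_ge: "2 * lg j + (real j + 5 + real n) \<le> lg (Suc j)" and lg_ge: "100 + real n + real j \<le> lg j"
proof -
  have "100 + real n + real j \<le> lg j \<and> 2 * lg j + (real j + 5 + real n) \<le> lg (Suc j)" for j
  proof (induction j)
    case 0
    have "2 * lg 0 \<le> wt 0 * lg 0" using wt[of 0] n by (intro mult_right_mono) auto
    then show ?case by simp
  next
    case (Suc j)
    then have 1: "100 + real n + real (Suc j) \<le> lg (Suc j)" by (simp del: lg.simps)
    then have "2 * lg (Suc j) \<le> wt (Suc j) * lg (Suc j)" using wt[of "Suc j"] n by (intro mult_right_mono) (auto simp del: lg.simps)
    then show ?case using 1 lg.simps(2)[of "Suc j"] by (simp del: lg.simps)
  qed
  then show "2 * lg j + (real j + 5 + real n) \<le> lg (Suc j)" "100 + real n + real j \<le> lg j" by auto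
qed

lemma lg_exp: "(100 + real n) * 2 ^ j \<le> lg j"
proof (induction j)
  case (Suc j)
  have "(100 + real n) * 2 ^ Suc j = 2 * ((100 + real n) * 2 ^ j)" by simp
  also have "\<dots> \<le> 2 * lg j" by (intro mult_left_mono Suc) simp
  also have "\<dots> \<le> lg (Suc j)" using lg_Suc_ge[of j] by linarith
  finally show ?case .
qed simp

lemma lg_n: "real n * lg j + (real j + 5 + real n) \<le> lg (Suc j)"
proof -
  have "real n * lg j \<le> wt j * lg j" using wt[of j] lg_ge[of j] by (intro mult_right_mono) auto
  then show ?thesis by simp
qed

declare lg.simps [simp del]

lemma size_pos: "0 < size j" by (simp add: size_def)

lemma size_ge1: "2 \<le> size j"
proof -
  have "2 powr 1 \<le> size j" unfolding size_def using lg_ge[of j] by (intro powr_mono) auto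
  then show ?thesis by simp
qed

lemma size_square: "size j * size j \<le> size (Suc j)"
proof -
  have "lg j + lg j \<le> lg (Suc j)" using lg_Suc_ge[of j] by linarith
  then show ?thesis by (simp add: size_def powr_add[symmetric])
qed

text \<open>The start value of \<open>lg\<close> is large enough for this:
  \<open>2 powr (100 / 8)\<close> is at least 4096, and from there on the exponential stays ahead of
  the linear function.\<close>

lemma log_small: "2 + lg j \<le> size j powr (1 / 8)"
proof -
  have "2 + y \<le> 2 powr (y / 8)" if y: "100 \<le> y" for y :: real
  proof -
    define z where "z = (y - 100) / 8"
    have z: "0 \<le> z" using y by (simp add: z_def)
    have "1 + z / 2 \<le> 2 powr z"
    proof -
      have "1 / 2 \<le> ln (2::real)" using ln2_ge_two_thirds by linarith
      then have "1 + z / 2 \<le> 1 + z * ln 2" using mult_left_mono[of "1/2" "ln 2" z] z by simp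
      also have "\<dots> \<le> exp (z * ln 2)" by (rule exp_ge_add_one_self)
      finally show ?thesis by (simp add: powr_def)
    qed
    moreover have "(4096 :: real) \<le> 2 powr (100 / 8)"
    proof -
      have "(2::real) powr 12 \<le> 2 powr (100 / 8)" by (intro powr_mono) auto
      then show ?thesis by (simp add: powr_numeral)
    qed
    ultimately have "4096 * (1 + z / 2) \<le> 2 powr (100 / 8) * 2 powr z" using z by (intro mult_mono) auto
    also have "\<dots> = 2 powr (y / 8)" by (simp add: powr_add[symmetric] z_def diff_divide_distrib)
    finally have "4096 * (1 + z / 2) \<le> 2 powr (y / 8)" .
    moreover have "2 + y \<le> 4096 * (1 + z / 2)" using y by (simp add: z_def field_simps)
    ultimately show ?thesis by linarith
  qed
  from this[of "lg j"] show ?thesis using lg_ge[of j] by (simp add: size_def powr_powr)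
qed

text \<open>Makes the number rounded down in \<open>nbr_choices\<close> at least 2, so that rounding
  loses at most half.\<close>

lemma nbr_ratio_ge: "2 * size (Suc j) powr (1 / 8) * 4 \<le> size (Suc (Suc j)) / size j"
proof -
  have "2 * size (Suc j) powr (1 / 8) * 4 = 2 powr (3 + lg (Suc j) / 8)"
    by (simp add: size_def powr_powr powr_add powr_numeral)
  also have "\<dots> \<le> 2 powr (lg (Suc (Suc j)) - lg j)"
    using lg_Suc_ge[of "Suc j"] lg_Suc_ge[of j] lg_ge[of j] by (intro powr_mono) auto
  also have "\<dots> = size (Suc (Suc j)) / size j" by (simp add: size_def powr_diff)
  finally show ?thesis .
qed

lemma nbr_choices_bounds:
  "real (nbr_choices j) \<le> size (Suc (Suc j)) / (4 * size j * size (Suc j) powr (1 / 8))"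
  "size (Suc (Suc j)) / (8 * size j * size (Suc j) powr (1 / 8)) \<le> real (nbr_choices j)"
  "1 \<le> real (nbr_choices j)"
proof -
  define y where "y = size (Suc (Suc j)) / (4 * size j * size (Suc j) powr (1 / 8))"
  have p: "0 < size j" "0 < size (Suc j) powr (1 / 8)" using size_pos[of j] size_pos[of "Suc j"] by simp_all
  then have y2: "2 \<le> y" using nbr_ratio_ge[of j] by (simp add: y_def le_divide_eq mult_ac)
  then have "real (nbr_choices j) = real_of_int \<lfloor>y\<rfloor>" by (simp add: nbr_choices_def y_def)
  then have b: "real (nbr_choices j) \<le> y" "y - 1 < real (nbr_choices j)" by linarith+
  show "real (nbr_choices j) \<le> size (Suc (Suc j)) / (4 * size j * size (Suc j) powr (1 / 8))" using b by (simp add: y_def)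
  have "size (Suc (Suc j)) / (8 * size j * size (Suc j) powr (1 / 8)) = y / 2" by (simp add: y_def)
  then show "size (Suc (Suc j)) / (8 * size j * size (Suc j) powr (1 / 8)) \<le> real (nbr_choices j)" using b y2 by linarith
  show "1 \<le> real (nbr_choices j)" using b y2 by linarith
qed

text \<open>\<open>children_many\<close> applies because \<open>size j * size (Suc j)\<close> is far
  below \<open>size (Suc (Suc j))\<close>.\<close>

lemma nbr_step_spec:
  assumes u: "nbr_valid j u" "nbr_valid (Suc j) u'" "coprime (snd u) (snd u')"
  shows "inj_on (nbr_step j u u') {..<nbr_choices j}"
    "v < nbr_choices j \<Longrightarrow> nbr_step j u u' v \<in> children (size (Suc (Suc j))) u (snd u')"
proof -
  define Y where "Y = size (Suc (Suc j))"
  define b where "b = snd u'"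
  have c: "size j \<le> real (snd u)" "real (snd u) \<le> 2 * size j" and b': "size (Suc j) \<le> real b" "real b \<le> 2 * size (Suc j)"
    using u by (auto simp: nbr_valid_def b_def)
  have c0: "0 < snd u" using c size_pos[of j] by (cases "snd u") auto
  have b1: "1 < b" using b' size_ge1[of "Suc j"] by linarith
  have "4 * real (snd u) * (1 + real b) \<le> Y * 2"
  proof -
    have "4 * real (snd u) * (1 + real b) \<le> 4 * (2 * size j) * (2 * (2 * size (Suc j)))"
      using c b' size_ge1[of "Suc j"] by (intro mult_mono) auto
    also have "\<dots> = 16 * (size j * size (Suc j)) * 2" by simp
    also have "16 * (size j * size (Suc j)) = 2 powr (4 + lg j + lg (Suc j))"
      by (simp add: size_def powr_add powr_numeral)
    also have "\<dots> \<le> Y" unfolding Y_def size_def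
      using lg_Suc_ge[of "Suc j"] lg_Suc_ge[of j] lg_ge[of j] by (intro powr_mono) auto
    finally show ?thesis by simp
  qed
  then obtain T where T: "T \<subseteq> children Y u b" "finite T" "Y / (2 * real (snd u)) / (1 + log 2 (real b)) \<le> real (card T)"
    using children_many[of u b Y] u c0 b1 by (auto simp: nbr_valid_def b_def)
  have "real (nbr_choices j) \<le> Y / (4 * size j * size (Suc j) powr (1 / 8))"
    unfolding Y_def by (rule nbr_choices_bounds)
  also have "\<dots> \<le> Y / (2 * real (snd u) * (1 + log 2 (real b)))"
  proof (rule divide_left_mono)
    have lb: "0 < log 2 (real b)" using b1 by simp
    have "log 2 (real b) \<le> log 2 (2 * size (Suc j))" using b' b1 by (intro log_le_cancel_iff[THEN iffD2]) auto
    also have "\<dots> = 1 + lg (Suc j)" using size_pos[of "Suc j"] by (simp add: log_mult size_def)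
    finally have "1 + log 2 (real b) \<le> size (Suc j) powr (1 / 8)" using log_small[of "Suc j"] by linarith
    then have "2 * real (snd u) * (1 + log 2 (real b)) \<le> 2 * (2 * size j) * size (Suc j) powr (1 / 8)"
      using c lb by (intro mult_mono) auto
    then show "2 * real (snd u) * (1 + log 2 (real b)) \<le> 4 * size j * size (Suc j) powr (1 / 8)" by simp
    have "0 < 2 * real (snd u) * (1 + log 2 (real b))" using c0 lb by (intro mult_pos_pos add_pos_pos) auto
    moreover have "0 < 4 * size j * size (Suc j) powr (1 / 8)" using size_pos[of j] size_pos[of "Suc j"] by simp
    ultimately show "0 < 4 * size j * size (Suc j) powr (1 / 8) * (2 * real (snd u) * (1 + log 2 (real b)))"
      by (intro mult_pos_pos[of _ "2 * real (snd u) * (1 + log 2 (real b))"])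
  qed (use size_pos in \<open>simp add: Y_def less_imp_le\<close>)
  also have "\<dots> = Y / (2 * real (snd u)) / (1 + log 2 (real b))" by simp
  finally have "nbr_choices j \<le> card T" using T(3) by linarith
  then obtain g where g: "inj_on g {..<nbr_choices j}" "g ` {..<nbr_choices j} \<subseteq> T"
    using card_le_inj[of "{..<nbr_choices j}" T] T(2) by auto
  then have "\<exists>g. inj_on g {..<nbr_choices j} \<and> g ` {..<nbr_choices j} \<subseteq> children (size (Suc (Suc j))) u (snd u')"
    using T(1) unfolding Y_def b_def by blast
  then have "inj_on (nbr_step j u u') {..<nbr_choices j} \<and> nbr_step j u u' ` {..<nbr_choices j} \<subseteq> children (size (Suc (Suc j))) u (snd u')"
    unfolding nbr_step_def by (rule someI_ex)
  then show "inj_on (nbr_step j u u') {..<nbr_choices j}"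
    "v < nbr_choices j \<Longrightarrow> nbr_step j u u' v \<in> children (size (Suc (Suc j))) u (snd u')" by auto
qed

definition start0 :: node where "start0 = (1, nat \<lceil>size 0\<rceil>)"

text \<open>A multiple of the first denominator plus 1 is coprime to it; the multiplier brings it
  slightly above \<open>size 1\<close>.\<close>

definition start1 :: node where "start1 = (1, snd start0 * nat \<lceil>size 1 / real (snd start0)\<rceil> + 1)"

lemma start_valid: "nbr_valid 0 start0" "nbr_valid (Suc 0) start1" "coprime (snd start0) (snd start1)"
proof -
  define c where "c = snd start0"
  have c: "size 0 \<le> real c" "real c \<le> size 0 + 1"
  proof -
    have "0 \<le> \<lceil>size 0\<rceil>" using size_pos[of 0] by linarith
    then have "real c = real_of_int \<lceil>size 0\<rceil>" by (simp add: c_def start0_def)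
    then show "size 0 \<le> real c" "real c \<le> size 0 + 1" by linarith+
  qed
  then show "nbr_valid 0 start0" using size_ge1[of 0]
    unfolding nbr_valid_def c_def[symmetric] by (simp add: start0_def)
  define m where "m = nat \<lceil>size 1 / real c\<rceil>"
  have c0: "0 < real c" using c size_pos[of 0] by linarith
  have m: "size 1 / real c \<le> real m" "real m \<le> size 1 / real c + 1"
  proof -
    have "0 \<le> size 1 / real c" using size_pos[of 1] by simp
    then have "real m = real_of_int \<lceil>size 1 / real c\<rceil>" by (simp add: m_def)
    then show "size 1 / real c \<le> real m" "real m \<le> size 1 / real c + 1" by linarith+
  qed
  have cm: "size 1 \<le> real c * real m" using m(1) c0 by (simp add: divide_le_eq mult.commute)
  have "real c * real m \<le> real c * (size 1 / real c + 1)" using m(2) c0 by (intro mult_left_mono) auto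
  then have cm2: "real c * real m \<le> size 1 + real c" using c0 by (simp add: distrib_left)
  have "size 0 + 2 \<le> size 1"
  proof -
    have "4 \<le> size 0"
    proof -
      have "2 powr 2 \<le> size 0" unfolding size_def using lg_ge[of 0] by (intro powr_mono) auto
      then show ?thesis by (simp add: powr_numeral)
    qed
    then have "4 * size 0 \<le> size 0 * size 0" by (intro mult_right_mono) auto
    then have "4 * size 0 \<le> size 1" using size_square[of 0] by simp
    then show ?thesis using \<open>4 \<le> size 0\<close> by linarith
  qed
  then show "nbr_valid (Suc 0) start1"
    using cm cm2 c unfolding nbr_valid_def start1_def c_def[symmetric] m_def[symmetric] by simp
  show "coprime (snd start0) (snd start1)"
  proof -
    have "coprime c (c * m + 1)" by (rule coprimeI) (metis dvd_add_right_iff dvd_mult2)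
    then show ?thesis unfolding start1_def c_def[symmetric] m_def[symmetric] by simp
  qed
qed

lemma children_props:
  assumes u: "nbr_valid j u" and w: "w \<in> children (size (Suc (Suc j))) u b"
  shows "nbr_valid (Suc (Suc j)) w" "coprime b (snd w)" "frac_of w = frac_of u + 1 / (real (snd u) * real (snd w))"
    "snd u < snd w"
proof -
  have eq: "fst w * int (snd u) - fst u * int (snd w) = 1" and sz: "size (Suc (Suc j)) \<le> real (snd w)" "real (snd w) \<le> 2 * size (Suc (Suc j))"
    and cop: "coprime (snd w) b" using w by (auto simp: children_def)
  have "coprime (fst w) (int (snd w))"
  proof (rule coprimeI)
    fix d assume "d dvd fst w" "d dvd int (snd w)"
    then have "d dvd fst w * int (snd u) - fst u * int (snd w)" by simp
    then show "d dvd 1" by (simp only: eq)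
  qed
  then show "nbr_valid (Suc (Suc j)) w" using sz by (simp add: nbr_valid_def)
  show "coprime b (snd w)" using cop by (simp add: coprime_commute)
  have pos: "0 < real (snd u)" "0 < real (snd w)" using u sz size_pos[of j] size_pos[of "Suc (Suc j)"] by (auto simp: nbr_valid_def)
  have "real_of_int (fst w * int (snd u) - fst u * int (snd w)) = 1" using eq by simp
  then have "real_of_int (fst w) * real (snd u) = 1 + real_of_int (fst u) * real (snd w)" by simp
  then show "frac_of w = frac_of u + 1 / (real (snd u) * real (snd w))"
    using pos by (simp add: frac_of_def field_simps)
  have "2 * size j < size (Suc (Suc j))"
  proof -
    have "2 * size j = 2 powr (1 + lg j)" by (simp add: size_def powr_add)
    also have "\<dots> < size (Suc (Suc j))" unfolding size_def
      using lg_Suc_ge[of "Suc j"] lg_Suc_ge[of j] lg_ge[of j] by (intro powr_less_mono) auto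
    finally show ?thesis .
  qed
  then show "snd u < snd w" using u sz by (auto simp: nbr_valid_def)
qed

lemma nbr_incr_powr: "nbr_incr j = 2 powr (- (lg j + lg (Suc (Suc j))))"
  unfolding nbr_incr_def size_def powr_add[symmetric] powr_minus_divide ..

text \<open>Distinct reduced fractions with denominators up to \<open>2 * size j\<close> differ by
  at least \<open>1 / (4 * size j ^ 2)\<close>. For injectivity, a child determines its parent: the
  determinant equation fixes the parent's denominator modulo that of the child, which is
  larger.\<close>

lemma nbr_random_system:
  fixes i1 i2 :: "'n::finite"
  assumes i12: "i1 \<noteq> i2" and nn: "n = CARD('n)"
  shows "random_system i1 i2 nbr_step start0 start1 nbr_choices nbr_valid size nbr_incr (\<lambda>j. 4 * (size j * size j))"
proof
  show "i1 \<noteq> i2" "2 \<le> CARD('n)" using i12 nn n by auto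
  show "0 < nbr_choices j" for j using nbr_choices_bounds(3)[of j] by simp
  show "2 \<le> size j" for j by (rule size_ge1)
  show "2 * size j < size (Suc j)" for j
  proof -
    have "2 * size j = 2 powr (1 + lg j)" by (simp add: size_def powr_add)
    also have "\<dots> < size (Suc j)" unfolding size_def
      using lg_Suc_ge[of j] lg_ge[of j] by (intro powr_less_mono) auto
    finally show ?thesis .
  qed
  show "coprime (fst u) (int (snd u)) \<and> size j \<le> real (snd u) \<and> real (snd u) \<le> 2 * size j" if "nbr_valid j u" for j u
    using that by (simp add: nbr_valid_def)
  show "nbr_valid 0 start0" "nbr_valid (Suc 0) start1" "coprime (snd start0) (snd start1)" by (rule start_valid)+
  show "0 < 4 * (size j * size j)" for j using size_pos[of j] by simp
  show "0 < nbr_incr j" for j using size_pos[of j] size_pos[of "Suc (Suc j)"] by (simp add: nbr_incr_def)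
  show "2 * nbr_incr (Suc j) \<le> nbr_incr j" for j
  proof -
    have "2 * nbr_incr (Suc j) = 2 powr (1 - (lg (Suc j) + lg (Suc (Suc (Suc j)))))"
      "nbr_incr j = 2 powr (0 - (lg j + lg (Suc (Suc j))))" by (simp_all only: nbr_incr_powr powr_diff powr_one powr_minus_divide powr_zero_eq_one) simp_all
    then show ?thesis
      using lg_Suc_ge[of j] lg_Suc_ge[of "Suc (Suc j)"] lg_ge[of j] lg_ge[of "Suc (Suc j)"] by simp
  qed
  show "32 * size j * nbr_incr j * (2 * size (Suc j)) ^ CARD('n) * 2 ^ j \<le> 1" for j
  proof -
    have "(2 * size (Suc j)) ^ CARD('n) = 2 powr (real n * (1 + lg (Suc j)))"
    proof -
      have "2 * size (Suc j) = 2 powr (1 + lg (Suc j))" by (simp add: size_def powr_add)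
      then have "(2 * size (Suc j)) ^ CARD('n) = (2 powr (1 + lg (Suc j))) powr real n" by (simp add: nn powr_realpow)
      then show ?thesis by (simp only: powr_powr mult.commute)
    qed
    moreover have "32 * size j * nbr_incr j = 2 powr (5 - lg (Suc (Suc j)))"
      by (simp add: nbr_incr_def size_def powr_diff powr_numeral)
    moreover have "(2::real) ^ j = 2 powr real j" by (simp add: powr_realpow)
    ultimately have "32 * size j * nbr_incr j * (2 * size (Suc j)) ^ CARD('n) * 2 ^ j =
        2 powr (5 - lg (Suc (Suc j)) + real n * (1 + lg (Suc j)) + real j)"
      by (simp add: powr_add[symmetric])
    \<comment> \<open>The additive term of the recursion for \<open>lg\<close> pays for the factors
      32, \<open>2 ^ n\<close> and \<open>2 ^ j\<close>.\<close>
    also have "\<dots> \<le> 2 powr 0"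
      using lg_n[of "Suc j"] by (intro powr_mono) (auto simp: algebra_simps)
    finally show ?thesis by simp
  qed
  show "1 / (4 * (size j * size j)) \<le> \<bar>frac_of u - frac_of w\<bar>" if uw: "nbr_valid j u" "nbr_valid j w" "u \<noteq> w" for j u w
  proof -
    have pos: "0 < real (snd u)" "0 < real (snd w)" using uw size_pos[of j] by (auto simp: nbr_valid_def)
    have "fst u * int (snd w) - fst w * int (snd u) \<noteq> 0"
    proof
      assume "fst u * int (snd w) - fst w * int (snd u) = 0"
      then have e: "fst u * int (snd w) = fst w * int (snd u)" by simp
      then have "int (snd u) dvd fst u * int (snd w)" "int (snd w) dvd fst w * int (snd u)" by (metis dvd_triv_right)+
      then have "int (snd u) dvd int (snd w)" "int (snd w) dvd int (snd u)"
        using uw by (auto simp: nbr_valid_def coprime_dvd_mult_right_iff coprime_commute)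
      then have "snd u = snd w" by (simp add: dvd_antisym)
      then show False using e pos uw(3) by (auto simp: prod_eq_iff)
    qed
    then have "1 \<le> \<bar>real_of_int (fst u * int (snd w) - fst w * int (snd u))\<bar>" by linarith
    moreover have "frac_of u - frac_of w = real_of_int (fst u * int (snd w) - fst w * int (snd u)) / (real (snd u) * real (snd w))"
      using pos by (simp add: frac_of_def field_simps)
    ultimately have "1 / (real (snd u) * real (snd w)) \<le> \<bar>frac_of u - frac_of w\<bar>"
      using pos by (simp add: abs_mult divide_right_mono)
    moreover have "real (snd u) * real (snd w) \<le> (2 * size j) * (2 * size j)"
      using uw size_pos[of j] by (intro mult_mono) (auto simp: nbr_valid_def)
    then have "1 / (4 * (size j * size j)) \<le> 1 / (real (snd u) * real (snd w))"
      using pos size_pos[of j] by (intro divide_left_mono) auto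
    ultimately show ?thesis by linarith
  qed
  fix j u u' v assume u: "nbr_valid j u" "nbr_valid (Suc j) u'" "coprime (snd u) (snd u')" and v: "v < nbr_choices j"
  note w = nbr_step_spec(2)[OF u v]
  note cw = children_props[OF u(1) w]
  show "nbr_valid (Suc (Suc j)) (nbr_step j u u' v) \<and> coprime (snd u') (snd (nbr_step j u u' v)) \<and>
      frac_of u < frac_of (nbr_step j u u' v) \<and> frac_of (nbr_step j u u' v) \<le> frac_of u + nbr_incr j"
  proof (intro conjI)
    have s: "size j \<le> real (snd u)" "size (Suc (Suc j)) \<le> real (snd (nbr_step j u u' v))"
      using u(1) cw(1) by (auto simp: nbr_valid_def)
    have p: "0 < size j * size (Suc (Suc j))" using size_pos by simp
    have m: "size j * size (Suc (Suc j)) \<le> real (snd u) * real (snd (nbr_step j u u' v))"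
      using s size_pos[of j] size_pos[of "Suc (Suc j)"] by (intro mult_mono) auto
    then have "0 < real (snd u) * real (snd (nbr_step j u u' v))" using p by linarith
    then show "frac_of u < frac_of (nbr_step j u u' v)" unfolding cw(3) by simp
    show "frac_of (nbr_step j u u' v) \<le> frac_of u + nbr_incr j"
      unfolding cw(3) nbr_incr_def using m p by (simp add: frac_le)
  qed (use cw in auto)
next
  fix j u w u' v v'
  assume u: "nbr_valid j u" "nbr_valid j w" "nbr_valid (Suc j) u'" "coprime (snd u) (snd u')" "coprime (snd w) (snd u')"
    and v: "v < nbr_choices j" "v' < nbr_choices j" and eq: "nbr_step j u u' v = nbr_step j w u' v'"
  define y where "y = nbr_step j u u' v"
  have y1: "y \<in> children (size (Suc (Suc j))) u (snd u')" unfolding y_def by (rule nbr_step_spec(2)[OF u(1,3,4) v(1)])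
  have y2: "y \<in> children (size (Suc (Suc j))) w (snd u')" unfolding y_def eq by (rule nbr_step_spec(2)[OF u(2,3,5) v(2)])
  have lt: "snd u < snd y" "snd w < snd y" using children_props(4)[OF u(1) y1] children_props(4)[OF u(2) y2] by auto
  have e1: "fst y * int (snd u) - fst u * int (snd y) = 1" and e2: "fst y * int (snd w) - fst w * int (snd y) = 1"
    using y1 y2 by (auto simp: children_def)
  have "fst y * (int (snd u) - int (snd w)) = int (snd y) * (fst u - fst w)" using e1 e2 by (simp add: algebra_simps)
  then have "int (snd y) dvd fst y * (int (snd u) - int (snd w))" by simp
  moreover have "coprime (int (snd y)) (fst y)"
    using children_props(1)[OF u(1) y1] by (simp add: nbr_valid_def coprime_commute)
  ultimately have "int (snd y) dvd int (snd u) - int (snd w)" by (simp add: coprime_dvd_mult_right_iff)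
  moreover have "\<bar>int (snd u) - int (snd w)\<bar> < int (snd y)" using lt by linarith
  ultimately have uw: "snd u = snd w" using dvd_imp_le_int[of "int (snd u) - int (snd w)" "int (snd y)"] by auto
  have "fst u * int (snd y) = fst w * int (snd y)" using e1 e2 unfolding uw by linarith
  then have "fst u = fst w" using lt by simp
  then have "u = w" using uw by (simp add: prod_eq_iff)
  moreover have "v = v'" using nbr_step_spec(1)[OF u(1,3,4)] v eq \<open>u = w\<close> by (auto simp: inj_on_def)
  ultimately show "u = w \<and> v = v'" by simp
qed

text \<open>The quotients \<open>size (i + 2) / size i\<close> telescope to
  \<open>size j * size (Suc j) / (size 0 * size 1)\<close>; giving up half a power of
  \<open>size j\<close> pays for the factors \<open>8 * size (Suc i) powr (1 / 8)\<close>.\<close>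

lemma prod_nbr_choices_ge:
  "size j powr (1 / 2) * size (Suc j) / (size 0 * size 1) \<le> (\<Prod>i<j. real (nbr_choices i))"
proof (induction j)
  case 0
  have "size 0 powr (1 / 2) \<le> size 0 powr 1" using size_ge1[of 0] by (intro powr_mono) auto
  then show ?case using size_pos[of 0] size_pos[of 1] by (simp add: divide_le_eq)
next
  case (Suc j)
  have "2 powr (lg (Suc j) / 2 + lg (Suc (Suc j))) \<le>
      2 powr (lg j / 2 + lg (Suc j)) * 2 powr (lg (Suc (Suc j)) - (3 + lg j + lg (Suc j) / 8))"
    unfolding powr_add[symmetric] using lg_Suc_ge[of j] lg_ge[of j] by (intro powr_mono) auto
  also have "2 powr (lg (Suc (Suc j)) - (3 + lg j + lg (Suc j) / 8)) = size (Suc (Suc j)) / (8 * size j * size (Suc j) powr (1 / 8))"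
    by (simp add: size_def powr_diff powr_add powr_powr powr_numeral)
  also have "2 powr (lg j / 2 + lg (Suc j)) = size j powr (1 / 2) * size (Suc j)"
    by (simp add: size_def powr_add powr_powr)
  also have "2 powr (lg (Suc j) / 2 + lg (Suc (Suc j))) = size (Suc j) powr (1 / 2) * size (Suc (Suc j))"
    by (simp add: size_def powr_add powr_powr)
  finally have "size (Suc j) powr (1 / 2) * size (Suc (Suc j)) / (size 0 * size 1) \<le>
      (size j powr (1 / 2) * size (Suc j) / (size 0 * size 1)) * (size (Suc (Suc j)) / (8 * size j * size (Suc j) powr (1 / 8)))"
    unfolding times_divide_eq_left by (rule divide_right_mono) (use size_pos[of 0] size_pos[of 1] in simp)
  also have "\<dots> \<le> (\<Prod>i<j. real (nbr_choices i)) * real (nbr_choices j)"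
    using size_pos by (intro mult_mono Suc nbr_choices_bounds) (auto simp: prod_nonneg less_imp_le)
  finally show ?case by simp
qed

text \<open>With \<open>a\<close>, \<open>b\<close>, \<open>c\<close>, \<open>d\<close> the values
  of \<open>lg\<close> at \<open>j\<close> to \<open>j + 3\<close>, the quantity is at most
  \<open>(r * 2 powr (2 * c) + 1) / 2 powr (b / 2 + c)\<close> up to constants. Compared with a
  power of \<open>r\<close>, the term with \<open>r\<close> is worst at the upper end
  \<open>2 powr (- (a + c))\<close>, the other one at the lower end
  \<open>2 powr (- (b + d))\<close>. Each logarithm being about \<open>w\<close> times the previous
  one, \<open>b + d\<close> is about \<open>(w^2 + 1) * b\<close>, so this power of the lower end is
  about \<open>2 powr (- b)\<close>.\<close>

lemma nbr_box_le:
  assumes w: "\<And>j. wt j = w" and r: "nbr_incr (Suc j) \<le> r" "r \<le> nbr_incr j"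
  shows "(4 * r * (4 * (size (Suc j) * size (Suc j))) + 1) * (4 * r * (4 * (size (Suc (Suc j)) * size (Suc (Suc j)))) + 1) /
      (\<Prod>i<Suc j. real (nbr_choices i)) \<le> 289 * (size 0 * size 1) * r powr (1 / (w\<^sup>2 + 1))"
proof -
  define s where "s = 1 / (w\<^sup>2 + 1)"
  define a b c d where "a = lg j" "b = lg (Suc j)" "c = lg (Suc (Suc j))" "d = lg (Suc (Suc (Suc j)))"
  note abcd = this
  have wn: "2 \<le> w" using wt[of 0] n w by simp
  have w2: "4 \<le> w\<^sup>2" using power_mono[OF wn, of 2] by simp
  have s: "0 < s" "s < 1" using w2 by (auto simp: s_def)
  have sw: "s * (w\<^sup>2 + 1) = 1" using w2 by (simp add: s_def)
  have bb: "b = w * a + (real j + 5 + real n)" and cc: "c = w * b + (real j + 6 + real n)" and dd: "d = w * c + (real j + 7 + real n)"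
    by (simp_all add: abcd w lg.simps)
  have a: "100 + real n + real j \<le> a" unfolding abcd by (rule lg_ge)
  have b: "2 * a \<le> b" and c: "2 * b \<le> c" using lg_Suc_ge[of j] lg_Suc_ge[of "Suc j"] by (auto simp: abcd)
  have incr: "nbr_incr j = 2 powr (- (a + c))" "nbr_incr (Suc j) = 2 powr (- (b + d))"
    unfolding nbr_incr_powr abcd by (rule refl)+
  have sz: "size (Suc j) = 2 powr b" "size (Suc (Suc j)) = 2 powr c" by (simp_all add: size_def abcd)
  have r0: "0 < r" using r(1) by (simp add: incr less_le_trans[of 0 "2 powr (- (b + d))"])
  have r2: "r \<le> 2 powr (- (a + c))" using r(2) by (simp add: incr)
  define Z where "Z = size 0 * size 1"
  have Z: "0 < Z" using size_pos by (simp add: Z_def)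
  define y where "y = (\<Prod>i<Suc j. real (nbr_choices i))"
  have ylow: "2 powr (b / 2 + c) / Z \<le> y"
    using prod_nbr_choices_ge[of "Suc j"] unfolding y_def Z_def sz by (simp add: powr_powr powr_add)
  have first: "4 * r * (4 * (size (Suc j) * size (Suc j))) + 1 \<le> 17"
  proof -
    have "r * (size (Suc j) * size (Suc j)) \<le> 2 powr (- (a + c)) * (2 powr b * 2 powr b)"
      unfolding sz using r2 by (intro mult_right_mono) auto
    also have "\<dots> = 2 powr (- (a + c) + (b + b))" by (simp only: powr_add)
    also have "\<dots> \<le> 2 powr 0" using a c by (intro powr_mono) auto
    finally show ?thesis by simp
  qed
  have rs: "2 powr (- s * (b + d)) \<le> r powr s"
  proof -
    have "(2 powr (- (b + d))) powr s \<le> r powr s" using r(1) s by (intro powr_mono2) (auto simp: incr)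
    moreover have "- (b + d) * s = - s * (b + d)" by (simp add: algebra_simps)
    ultimately show ?thesis by (simp only: powr_powr)
  qed
  have term2: "1 / 2 powr (b / 2 + c) \<le> r powr s"
  proof -
    have e: "b + d = (w\<^sup>2 + 1) * b + (w * (real j + 6 + real n) + (real j + 7 + real n))"
      unfolding dd cc by (simp add: power2_eq_square algebra_simps)
    have "s * (b + d) = b + s * (w * (real j + 6 + real n) + (real j + 7 + real n))"
    proof -
      have "s * ((w\<^sup>2 + 1) * b) = b" unfolding mult.assoc[symmetric] sw by simp
      then show ?thesis by (simp only: e distrib_left[of s "(w\<^sup>2 + 1) * b"])
    qed
    also have "s * (w * (real j + 6 + real n) + (real j + 7 + real n)) \<le> (real j + 6 + real n) + (real j + 7 + real n)"
    proof -
      have "1 * w \<le> w * w" using wn by (intro mult_right_mono) auto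
      then have "w \<le> w\<^sup>2 + 1" by (simp add: power2_eq_square)
      then have "s * w \<le> 1" using w2 by (simp add: s_def)
      then have "(s * w) * (real j + 6 + real n) \<le> 1 * (real j + 6 + real n)" by (intro mult_right_mono) auto
      moreover have "s * (real j + 7 + real n) \<le> 1 * (real j + 7 + real n)" using s by (intro mult_right_mono) auto
      ultimately show ?thesis by (simp add: distrib_left mult.assoc)
    qed
    finally have "s * (b + d) \<le> b / 2 + c" using a b c by linarith
    then have "2 powr (- (b / 2 + c)) \<le> 2 powr (- s * (b + d))" by (intro powr_mono) auto
    then show ?thesis using rs unfolding powr_minus_divide[of 2 "b / 2 + c"] by linarith
  qed
  have term1: "r * (2 powr c * 2 powr c) / 2 powr (b / 2 + c) \<le> r powr s"
  proof -
    have "r powr (1 - s) \<le> (2 powr (- (a + c))) powr (1 - s)" using r0 r2 s by (intro powr_mono2) auto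
    then have r1: "r powr (1 - s) \<le> 2 powr (- (a + c) * (1 - s))" by (simp add: powr_powr)
    \<comment> \<open>Multiplied by \<open>w^2 + 1\<close>, this says
      \<open>c \<le> w^2 * a + (w^2 + 1) * b / 2\<close>; the main part \<open>w * b\<close> of
      \<open>c\<close> is covered by \<open>2 * w \<le> w^2 + 1\<close>, its additive part by
      \<open>w^2 * a\<close>.\<close>
    have "c - b / 2 \<le> (a + c) * (1 - s)"
    proof -
      have "c \<le> w\<^sup>2 * a + (w\<^sup>2 + 1) * b / 2"
      proof -
        have "0 \<le> (w - 1)\<^sup>2 * b" using a b by simp
        then have "2 * w * b \<le> (w\<^sup>2 + 1) * b" by (simp add: power2_eq_square algebra_simps)
        moreover have "4 * a \<le> w\<^sup>2 * a" using w2 a by (intro mult_right_mono) auto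
        moreover have "real j + 6 + real n \<le> 4 * a" using a by linarith
        moreover have "2 * w * b = 2 * (w * b)" by simp
        ultimately show ?thesis unfolding cc by linarith
      qed
      then have "(w\<^sup>2 + 1) * (c - b / 2) \<le> w\<^sup>2 * (a + c)"
        by (simp add: algebra_simps add_divide_distrib)
      then have "s * ((w\<^sup>2 + 1) * (c - b / 2)) \<le> s * (w\<^sup>2 * (a + c))" using s by (intro mult_left_mono) auto
      moreover have "s * w\<^sup>2 = 1 - s" using sw by (simp add: algebra_simps)
      ultimately show ?thesis unfolding mult.assoc[symmetric] sw by (simp add: mult.commute)
    qed
    then have "2 powr (- (a + c) * (1 - s)) \<le> 2 powr (- (c - b / 2))"
      by (intro powr_mono) (simp_all only: mult_minus_left neg_le_iff_le one_le_numeral)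
    then have "r powr (1 - s) \<le> 2 powr (- (c - b / 2))" using r1 by linarith
    then have le: "r powr (1 - s) * (r powr s * 2 powr (c - b / 2)) \<le> 2 powr (- (c - b / 2)) * (r powr s * 2 powr (c - b / 2))"
      by (intro mult_right_mono) auto
    have "2 powr c * 2 powr c / 2 powr (b / 2 + c) = 2 powr (c - b / 2)"
    proof -
      have "c + c - (b / 2 + c) = c - b / 2" by simp
      then show ?thesis by (simp only: powr_add[symmetric] powr_diff[symmetric])
    qed
    then have "r * (2 powr c * 2 powr c) / 2 powr (b / 2 + c) = r * 2 powr (c - b / 2)"
      by (simp only: times_divide_eq_right[symmetric])
    also have "\<dots> = r powr (1 - s) * (r powr s * 2 powr (c - b / 2))"
    proof -
      have "r powr (1 - s) * r powr s = r" unfolding powr_add[symmetric] using r0 by simp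
      then show ?thesis by (simp only: mult.assoc[symmetric])
    qed
    also note le
    also have "2 powr (- (c - b / 2)) * (r powr s * 2 powr (c - b / 2)) = r powr s"
    proof -
      have "2 powr (- (c - b / 2)) * 2 powr (c - b / 2) = (1::real)" unfolding powr_add[symmetric] by simp
      then show ?thesis by (simp only: mult.left_commute[of _ "r powr s"] mult_1_right)
    qed
    finally show ?thesis .
  qed
  have y0: "0 < 2 powr (b / 2 + c) / Z" using Z by simp
  have "(4 * r * (4 * (size (Suc j) * size (Suc j))) + 1) * (4 * r * (4 * (size (Suc (Suc j)) * size (Suc (Suc j)))) + 1) / y \<le>
      17 * (16 * (r * (2 powr c * 2 powr c)) + 1) / (2 powr (b / 2 + c) / Z)"
    using first r0 ylow y0 unfolding sz by (intro frac_le mult_mono) auto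
  also have "\<dots> = 17 * Z * (16 * (r * (2 powr c * 2 powr c) / 2 powr (b / 2 + c)) + 1 / 2 powr (b / 2 + c))"
    using Z by (simp add: field_simps)
  also have "\<dots> \<le> 17 * Z * (16 * r powr s + r powr s)"
    using Z by (intro mult_left_mono add_mono term1 term2) auto
  finally show ?thesis by (simp add: y_def Z_def s_def)
qed

section \<open>Exponents of the limit points\<close>

lemma lg_ratio: "lg (Suc j) / lg j = wt j + (real j + 5 + real n) / lg j"
  using lg_ge[of j] by (simp add: lg.simps field_simps)

text \<open>The additive terms of \<open>lg\<close> grow linearly, \<open>lg\<close> itself at least
  like \<open>2 ^ j\<close>, so the ratio of logarithms has the same limit as the weights, infinite
  limits included.\<close>

lemma lg_ratio_limit:
  fixes w :: ereal
  assumes w: "(\<lambda>j. ereal (wt j)) \<longlonglongrightarrow> w"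
  shows "(\<lambda>j. ereal (ln (size (Suc j)) / ln (size j))) \<longlonglongrightarrow> w"
proof -
  have eq: "ln (size (Suc j)) / ln (size j) = wt j + (real j + 5 + real n) / lg j" for j
    unfolding lg_ratio[symmetric] by (simp add: size_def ln_powr)
  have small: "(\<lambda>j. (real j + 5 + real n) / lg j) \<longlonglongrightarrow> 0"
  proof (rule tendsto_sandwich[OF _ _ tendsto_const])
    show "\<forall>\<^sub>F j in sequentially. 0 \<le> (real j + 5 + real n) / lg j"
    proof (intro always_eventually allI)
      fix j show "0 \<le> (real j + 5 + real n) / lg j" using lg_ge[of j] by (intro divide_nonneg_nonneg) auto
    qed
    have "(real j + 5 + real n) / lg j \<le> real j * (1 / 2) ^ j + (1 / 2) ^ j" for j
    proof -
      have p: "0 < (100 + real n) * 2 ^ j" by simp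
      have "(real j + 5 + real n) / lg j \<le> (real j + 5 + real n) / ((100 + real n) * 2 ^ j)"
        using lg_exp[of j] p by (intro divide_left_mono mult_pos_pos[OF _ p]) linarith+
      also have "\<dots> \<le> ((real j + 1) * (100 + real n)) / ((100 + real n) * 2 ^ j)"
        by (intro divide_right_mono) (auto simp: algebra_simps)
      also have "\<dots> = ((100 + real n) * (real j + 1)) / ((100 + real n) * 2 ^ j)" by (simp only: mult.commute)
      also have "\<dots> = (real j + 1) / 2 ^ j" by (rule mult_divide_mult_cancel_left) linarith
      also have "\<dots> = real j * (1 / 2) ^ j + (1 / 2) ^ j" by (simp add: power_one_over add_divide_distrib)
      finally show ?thesis .
    qed
    then show "\<forall>\<^sub>F j in sequentially. (real j + 5 + real n) / lg j \<le> real j * (1 / 2) ^ j + (1 / 2) ^ j" by simp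
    show "(\<lambda>j. real j * (1 / 2) ^ j + (1 / 2) ^ j) \<longlonglongrightarrow> (0::real)"
      using tendsto_add[OF powser_times_n_limit_0[of "1/2::real"] LIMSEQ_power_zero[of "1/2::real"]] by simp
  qed
  then have "(\<lambda>j. ereal ((real j + 5 + real n) / lg j)) \<longlonglongrightarrow> 0" by (simp add: zero_ereal_def)
  moreover have "0 \<le> w"
  proof (rule LIMSEQ_le_const[OF w])
    have "0 \<le> wt j" for j using wt[of j] of_nat_0_le_iff[of n, where 'a = real] by linarith
    then show "\<exists>N. \<forall>m\<ge>N. 0 \<le> ereal (wt m)" by simp
  qed
  ultimately have "(\<lambda>j. ereal (wt j) + ereal ((real j + 5 + real n) / lg j)) \<longlonglongrightarrow> w + 0"
    by (intro tendsto_add_ereal_general w) auto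
  then show ?thesis by (simp add: eq)
qed

lemma size_at_top: "filterlim size at_top sequentially"
proof (rule filterlim_at_top_mono)
  show "filterlim (\<lambda>j. real j) at_top sequentially" by (rule filterlim_real_sequentially)
  have "real j \<le> size j" for j
  proof -
    have "real j \<le> 2 ^ j" using less_exp[of j] by (simp add: of_nat_less_two_power less_imp_le)
    also have "\<dots> = 2 powr real j" by (simp add: powr_realpow)
    also have "\<dots> \<le> size j" unfolding size_def using lg_ge[of j] by (intro powr_mono) auto
    finally show ?thesis .
  qed
  then show "\<forall>\<^sub>F j in sequentially. real j \<le> size j" by simp
qed

text \<open>The limit lies above the neighbour chosen two steps later, hence at distance at least
  \<open>1 / (c j * c (j + 2))\<close> from the \<open>j\<close>-th fraction, and at most twice
  \<open>nbr_incr j\<close>. So the \<open>j\<close>-th form has order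
  \<open>1 / size (j + 2)\<close> from both sides.\<close>

lemma nbr_exponents:
  fixes i1 i2 :: "'n::finite" and w :: ereal
  assumes i12: "i1 \<noteq> i2" and nn: "n = CARD('n)" and w: "(\<lambda>j. ereal (wt j)) \<longlonglongrightarrow> w" "0 < w"
    and \<omega>: "\<omega> \<in> space (random_system.M nbr_choices)"
    and A: "interlaced_approximations i1 i2 (random_system.pt i1 i2 nbr_step start0 start1 \<omega> y)
       (\<lambda>j. snd (random_system.ch nbr_step start0 start1 \<omega> j)) (\<lambda>j. fst (random_system.ch nbr_step start0 start1 \<omega> j)) J"
  shows "random_system.pt i1 i2 nbr_step start0 start1 \<omega> y \<in> Theta_exp i1 i2 w"
proof -
  interpret T: random_system i1 i2 nbr_step start0 start1 nbr_choices nbr_valid size nbr_incr "\<lambda>j. 4 * (size j * size j)"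
    by (rule nbr_random_system[OF i12 nn])
  define c P where "c j = snd (T.ch \<omega> j)" "P j = fst (T.ch \<omega> j)" for j
  note cP = this
  interpret I: interlaced_approximations i1 i2 "T.pt \<omega> y" c P J
    using A unfolding cP[abs_def] .
  have v: "size j \<le> real (c j)" "real (c j) \<le> 2 * size j" for j
    using T.valid[OF conjunct1[OF T.ch_valid[OF \<omega>, of j]]] by (auto simp: cP)
  have c0: "0 < real (c j)" for j using v(1)[of j] size_pos[of j] by linarith
  have L: "I.L j = real (c j) * (T.xi \<omega> (if even j then 0 else 1) - frac_of (T.ch \<omega> j))" for j
    unfolding I.L_def I.k_def using c0[of j] i12 by (simp add: T.pt_def frac_of_def cP right_diff_distrib)
  have Lhi: "I.L j \<le> 4 / size (Suc (Suc j))" for j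
  proof -
    have "I.L j \<le> (2 * size j) * (2 * nbr_incr j)"
      unfolding L using T.xi_bounds(1,2)[OF \<omega>, of j] v(2)[of j] size_pos[of j] by (intro mult_mono) auto
    also have "\<dots> = 4 / size (Suc (Suc j))" using size_pos[of j] by (simp add: nbr_incr_def)
    finally show ?thesis .
  qed
  have Llo: "1 / (2 * size (Suc (Suc j))) \<le> I.L j" for j
  proof -
    have ch: "T.ch \<omega> (Suc (Suc j)) = nbr_step j (T.ch \<omega> j) (T.ch \<omega> (Suc j)) (\<omega> j)" by (simp add: T.ch_def)
    have va: "nbr_valid j (T.ch \<omega> j)" "nbr_valid (Suc j) (T.ch \<omega> (Suc j))" "coprime (snd (T.ch \<omega> j)) (snd (T.ch \<omega> (Suc j)))"
      using T.ch_valid[OF \<omega>, of j] by auto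
    have "\<omega> j < nbr_choices j" using \<omega> by (simp add: T.space_M)
    then have "T.ch \<omega> (Suc (Suc j)) \<in> children (size (Suc (Suc j))) (T.ch \<omega> j) (snd (T.ch \<omega> (Suc j)))"
      unfolding ch by (rule nbr_step_spec(2)[OF va])
    from children_props(3)[OF va(1) this]
    have "frac_of (T.ch \<omega> (Suc (Suc j))) = frac_of (T.ch \<omega> j) + 1 / (real (c j) * real (c (Suc (Suc j))))" by (simp add: cP)
    moreover have "frac_of (T.ch \<omega> (Suc (Suc j))) < T.xi \<omega> (if even j then 0 else 1)"
      using T.xi_bounds(1)[OF \<omega>, of "Suc (Suc j)"] by simp
    ultimately have "1 / (real (c j) * real (c (Suc (Suc j)))) \<le> T.xi \<omega> (if even j then 0 else 1) - frac_of (T.ch \<omega> j)" by linarith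
    then have "real (c j) * (1 / (real (c j) * real (c (Suc (Suc j))))) \<le> I.L j"
      unfolding L by (intro mult_left_mono) auto
    then have "1 / real (c (Suc (Suc j))) \<le> I.L j" using c0[of j] by simp
    moreover have "1 / (2 * size (Suc (Suc j))) \<le> 1 / real (c (Suc (Suc j)))"
      using v(2)[of "Suc (Suc j)"] c0[of "Suc (Suc j)"] size_pos[of "Suc (Suc j)"] by (intro divide_left_mono) auto
    ultimately show ?thesis by linarith
  qed
  have "omega_hat (T.pt \<omega> y) = w" "omega (T.pt \<omega> y) = w ^ 2"
    using omega_exponents[OF I.min_form_eq I.c_strict v Llo Lhi size_ge1 size_at_top lg_ratio_limit[OF w(1)] w(2)] by auto
  then show ?thesis using I.in_Theta by (simp add: Theta_exp_def)
qed

lemma nbr_incr_tendsto: "nbr_incr \<longlonglongrightarrow> 0"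
proof (rule tendsto_sandwich[OF _ _ tendsto_const])
  show "\<forall>\<^sub>F j in sequentially. 0 \<le> nbr_incr j"
    using size_pos by (intro always_eventually allI) (simp add: nbr_incr_def less_imp_le)
  have "nbr_incr j \<le> inverse (size j)" for j
  proof -
    have "1 / (size j * size (Suc (Suc j))) \<le> 1 / (size j * 1)"
      using size_pos[of j] size_ge1[of "Suc (Suc j)"] by (intro divide_left_mono mult_left_mono) auto
    then show ?thesis by (simp add: nbr_incr_def inverse_eq_divide)
  qed
  then show "\<forall>\<^sub>F j in sequentially. nbr_incr j \<le> inverse (size j)" by simp
  show "(\<lambda>j. inverse (size j)) \<longlonglongrightarrow> 0" by (rule tendsto_inverse_0_at_top[OF size_at_top])
qed

lemma nbr_hausdorff_finite:
  fixes i1 i2 :: "'n::finite"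
  assumes i12: "i1 \<noteq> i2" and nn: "n = CARD('n)" and w: "\<And>j. wt j = w"
    and s: "0 < real n - 2 + s" "s \<le> 1 / (w\<^sup>2 + 1)"
  shows "hausdorff_measure (real n - 2 + s) (Theta_exp i1 i2 (ereal w)) \<noteq> 0"
proof -
  interpret T: random_system i1 i2 nbr_step start0 start1 nbr_choices nbr_valid size nbr_incr "\<lambda>j. 4 * (size j * size j)"
    by (rule nbr_random_system[OF i12 nn])
  have w0: "0 < w" using wt[of 0] n w by simp
  have lim: "(\<lambda>j. ereal (wt j)) \<longlonglongrightarrow> ereal w" by (simp add: w)
  have E: "T.pt \<omega> y \<in> Theta_exp i1 i2 (ereal w)"
    if "\<omega> \<in> space T.M" "interlaced_approximations i1 i2 (T.pt \<omega> y) (\<lambda>j. snd (T.ch \<omega> j)) (\<lambda>j. fst (T.ch \<omega> j)) J" for \<omega> y J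
    by (rule nbr_exponents[OF i12 nn lim _ that]) (use w0 in simp)
  define C where "C = 289 * (size 0 * size 1)"
  have C: "0 < C" using size_pos by (simp add: C_def)
  have ball: "\<exists>V\<in>sets T.M. {\<omega> \<in> space T.M. \<bar>T.xi \<omega> 0 - a\<bar> \<le> r \<and> \<bar>T.xi \<omega> 1 - b\<bar> \<le> r} \<subseteq> V \<and>
      emeasure T.M V \<le> ennreal (C * r powr s)" if r: "0 < r" "r \<le> min 1 (nbr_incr 0)" for r a b
  proof -
    define k where "k = (LEAST k. nbr_incr k \<le> r)"
    have "\<exists>k. nbr_incr k \<le> r"
      using order_tendstoD(2)[OF nbr_incr_tendsto r(1)] by (auto simp: eventually_sequentially intro: less_imp_le)
    then have k: "nbr_incr k \<le> r" unfolding k_def by (rule LeastI_ex)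
    have "\<exists>j. nbr_incr (Suc j) \<le> r \<and> r \<le> nbr_incr j"
    proof (cases k)
      case 0
      have "nbr_incr (Suc 0) \<le> nbr_incr 0" using T.D_dec[of 0] T.D_pos[of "Suc 0"] by linarith
      then show ?thesis using k 0 r by (intro exI[of _ 0]) auto
    next
      case (Suc j)
      have "\<not> nbr_incr j \<le> r" using not_less_Least[of j "\<lambda>k. nbr_incr k \<le> r"] Suc by (simp add: k_def[symmetric])
      then show ?thesis using k Suc by (intro exI[of _ j]) auto
    qed
    then obtain j where j: "nbr_incr (Suc j) \<le> r" "r \<le> nbr_incr j" by blast
    obtain V where V: "V \<in> sets T.M" "{\<omega> \<in> space T.M. \<bar>T.xi \<omega> 0 - a\<bar> \<le> r \<and> \<bar>T.xi \<omega> 1 - b\<bar> \<le> r} \<subseteq> V"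
      "emeasure T.M V \<le> ennreal ((4 * r * (4 * (size (Suc j) * size (Suc j))) + 1) *
        (4 * r * (4 * (size (Suc (Suc j)) * size (Suc (Suc j)))) + 1) / (\<Prod>i<Suc j. real (nbr_choices i)))"
      using T.measure_box[OF j(1)] by blast
    have "r powr (1 / (w\<^sup>2 + 1)) \<le> r powr s" using r s by (intro powr_mono') auto
    then have "C * r powr (1 / (w\<^sup>2 + 1)) \<le> C * r powr s" using C by (intro mult_left_mono) auto
    then have "emeasure T.M V \<le> ennreal (C * r powr s)"
      using nbr_box_le[OF w j] unfolding C_def by (intro order_trans[OF V(3)] ennreal_leI) linarith
    then show ?thesis using V by blast
  qed
  have "hausdorff_measure (real (CARD('n) - 2) + s) (Theta_exp i1 i2 (ereal w)) \<noteq> 0"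
    by (rule T.hausdorff_measure_ne_0[where ?r0.0 = "min 1 (nbr_incr 0)" and C = C, OF E ball])
       (use C T.D_pos[of 0] s n nn in \<open>auto simp: of_nat_diff\<close>)
  then show ?thesis using n by (simp add: of_nat_diff nn[symmetric])
qed

text \<open>For \<open>s \<le> 0\<close> and \<open>r \<le> 1\<close> the total mass 1 is already at
  most \<open>r powr s\<close>, so the two limits need no estimate: all of \<open>n - 2\<close>
  comes from the remaining coordinates.\<close>

lemma nbr_hausdorff_infinite:
  fixes i1 i2 :: "'n::finite"
  assumes i12: "i1 \<noteq> i2" and nn: "n = CARD('n)" and w: "(\<lambda>j. ereal (wt j)) \<longlonglongrightarrow> \<infinity>"
    and s: "0 < real n - 2 + s" "s \<le> 0"
  shows "hausdorff_measure (real n - 2 + s) (Theta_exp i1 i2 \<infinity>) \<noteq> 0"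
proof -
  interpret T: random_system i1 i2 nbr_step start0 start1 nbr_choices nbr_valid size nbr_incr "\<lambda>j. 4 * (size j * size j)"
    by (rule nbr_random_system[OF i12 nn])
  have E: "T.pt \<omega> y \<in> Theta_exp i1 i2 \<infinity>"
    if "\<omega> \<in> space T.M" "interlaced_approximations i1 i2 (T.pt \<omega> y) (\<lambda>j. snd (T.ch \<omega> j)) (\<lambda>j. fst (T.ch \<omega> j)) J" for \<omega> y J
    by (rule nbr_exponents[OF i12 nn w _ that]) simp
  have ball: "\<exists>V\<in>sets T.M. {\<omega> \<in> space T.M. \<bar>T.xi \<omega> 0 - a\<bar> \<le> r \<and> \<bar>T.xi \<omega> 1 - b\<bar> \<le> r} \<subseteq> V \<and>
      emeasure T.M V \<le> ennreal (1 * r powr s)" if r: "0 < r" "r \<le> 1" for r a b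
  proof -
    have "1 \<le> r powr s" using r s powr_mono'[of s 0 r] by simp
    then have "emeasure T.M (space T.M) \<le> ennreal (1 * r powr s)" by (simp add: T.M.emeasure_space_1)
    then show ?thesis by (intro bexI[of _ "space T.M"]) auto
  qed
  have "hausdorff_measure (real (CARD('n) - 2) + s) (Theta_exp i1 i2 \<infinity>) \<noteq> 0"
    by (rule T.hausdorff_measure_ne_0[where ?r0.0 = 1 and C = 1, OF E ball]) (use s n nn in \<open>auto simp: of_nat_diff\<close>)
  then show ?thesis using n by (simp add: of_nat_diff nn[symmetric])
qed

end

lemma Theta_exp_dimension:
  fixes i1 i2 :: "'n::finite" and w :: ereal
  assumes i12: "i1 \<noteq> i2" and n2: "2 \<le> CARD('n)" and w: "ereal (real CARD('n)) \<le> w"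
  shows "ereal (real CARD('n) - 2) + 1 / (w ^ 2 + 1) \<le> hausdorff_dim (Theta_exp i1 i2 w)"
proof (cases w)
  case (real v)
  define wt :: "nat \<Rightarrow> real" where "wt j = v" for j
  have wt: "real CARD('n) \<le> wt j" for j using w real by (simp add: wt_def)
  have "0 < v\<^sup>2 + 1" by (simp add: add_nonneg_pos)
  have "ereal (real CARD('n) - 2) + 1 / (w ^ 2 + 1) = ereal (real CARD('n) - 2 + 1 / (v\<^sup>2 + 1))"
    using \<open>0 < v\<^sup>2 + 1\<close> by (simp add: real power2_eq_square one_ereal_def)
  also have "\<dots> \<le> hausdorff_dim (Theta_exp i1 i2 w)"
  proof (rule hausdorff_dim_geI)
    fix s :: real assume s: "0 < s" "s < real CARD('n) - 2 + 1 / (v\<^sup>2 + 1)"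
    have "hausdorff_measure (real CARD('n) - 2 + (s - (real CARD('n) - 2))) (Theta_exp i1 i2 (ereal v)) \<noteq> 0"
      by (rule nbr_hausdorff_finite[OF n2 wt i12 refl]) (use s in \<open>auto simp: wt_def\<close>)
    then show "hausdorff_measure s (Theta_exp i1 i2 w) \<noteq> 0" by (simp add: real)
  qed
  finally show ?thesis .
next
  case PInf
  \<comment> \<open>For an infinite exponent any weights of at least \<open>n\<close> that tend to
    infinity will do.\<close>
  define wt :: "nat \<Rightarrow> real" where "wt j = real CARD('n) + real j" for j
  have wt: "real CARD('n) \<le> wt j" for j by (simp add: wt_def)
  have lim: "(\<lambda>j. ereal (wt j)) \<longlonglongrightarrow> \<infinity>"
  proof -
    have "filterlim wt at_top sequentially"
      unfolding wt_def by (intro filterlim_tendsto_add_at_top[OF tendsto_const] filterlim_real_sequentially)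
    then show ?thesis by (simp add: tendsto_PInfty_eq_at_top)
  qed
  have "ereal (real CARD('n) - 2) + 1 / (w ^ 2 + 1) = ereal (real CARD('n) - 2)"
    by (simp add: PInf power2_eq_square)
  also have "\<dots> \<le> hausdorff_dim (Theta_exp i1 i2 w)"
  proof (rule hausdorff_dim_geI)
    fix s :: real assume s: "0 < s" "s < real CARD('n) - 2"
    have "hausdorff_measure (real CARD('n) - 2 + (s - (real CARD('n) - 2))) (Theta_exp i1 i2 \<infinity>) \<noteq> 0"
      by (rule nbr_hausdorff_infinite[OF n2 wt i12 refl lim]) (use s in auto)
    then show "hausdorff_measure s (Theta_exp i1 i2 w) \<noteq> 0" by (simp add: PInf)
  qed
  finally show ?thesis .
qed (use w in auto)

section \<open>The dimensions\<close>

text \<open>Prepares a countable decomposition into bounded parts, for both orders of the two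
  coordinates.\<close>

lemma Theta_cover:
  fixes i1 i2 :: "'n::finite"
  assumes n2: "2 \<le> CARD('n)" and x: "x \<in> Theta i1 i2"
  shows "\<exists>g :: bool. \<exists>m c P. (\<forall>i. \<bar>x $ i\<bar> \<le> real m) \<and> interlaced (if g then i1 else i2) (if g then i2 else i1) c P x"
proof -
  obtain m :: nat where m: "infnorm x \<le> real m" using real_arch_simple by blast
  then have "\<forall>i. \<bar>x $ i\<bar> \<le> real m" by (simp add: infnorm_le_iff)
  moreover obtain c P where "interlaced i1 i2 c P x \<or> interlaced i2 i1 c P x" using Theta_interlaced[OF x n2] by blast
  ultimately show ?thesis by (metis (full_types))
qed

lemma Theta_hausdorff_upper:
  fixes i1 i2 :: "'n::finite"
  assumes i12: "i1 \<noteq> i2" and n2: "2 \<le> CARD('n)"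
  shows "hausdorff_dim (Theta i1 i2) \<le> ereal (real CARD('n) - 2 + 2 / real CARD('n))"
proof (rule hausdorff_dim_leI)
  fix s :: real assume s: "0 < s" "real CARD('n) - 2 + 2 / real CARD('n) < s"
  define F where "F g m = {x :: real ^ 'n. (\<forall>i. \<bar>x $ i\<bar> \<le> real m) \<and>
      (\<exists>c P. interlaced (if g then i1 else i2) (if g then i2 else i1) c P x)}" for g and m :: nat
  have F: "hausdorff_measure s (F g m) = 0" for g m
    unfolding F_def by (rule interlaced_hausdorff_null) (use i12 n2 s in auto)
  show "hausdorff_measure s (Theta i1 i2) = 0"
  proof (rule hausdorff_measure_UN_eq_0)
    show "hausdorff_measure s (case from_nat k of (g, m) \<Rightarrow> F g m) = 0" for k
      using F by (simp add: case_prod_unfold)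
    show "Theta i1 i2 \<subseteq> (\<Union>k. case from_nat k of (g, m) \<Rightarrow> F g m)"
    proof
      fix x assume "x \<in> Theta i1 i2"
      then obtain g m where "x \<in> F g m" using Theta_cover[OF n2] unfolding F_def by blast
      then show "x \<in> (\<Union>k. case from_nat k of (g, m) \<Rightarrow> F g m)"
        by (intro UN_I[of "to_nat (g, m)"]) auto
    qed
  qed
qed (use n2 in simp)

lemma Theta_packing_upper:
  fixes i1 i2 :: "'n::finite"
  assumes i12: "i1 \<noteq> i2" and n3: "3 \<le> CARD('n)"
  shows "packing_dim (Theta i1 i2) \<le> ereal (real CARD('n) - 1)"
proof (rule packing_dim_leI)
  fix s :: real assume s: "0 < s" "real CARD('n) - 1 < s"
  \<comment> \<open>The pieces are also indexed by the first two denominators, on which the scale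
    threshold in the packing estimate depends.\<close>
  define F where "F t = (case t of (g, m, a0, a1) \<Rightarrow> {x :: real ^ 'n. (\<forall>i. \<bar>x $ i\<bar> \<le> real m) \<and>
      (\<exists>c P. interlaced (if g then i1 else i2) (if g then i2 else i1) c P x \<and> c 0 = a0 \<and> c 1 = a1)})"
    for t :: "bool \<times> nat \<times> nat \<times> nat"
  have F: "packing_premeasure s (F t) = 0" for t
  proof -
    obtain g m a0 a1 where t: "t = (g, m, a0, a1)" by (cases t) auto
    show ?thesis
    proof (cases "0 < a0 \<and> 0 < a1")
      case True
      show ?thesis unfolding F_def t prod.case by (rule interlaced_packing_null) (use i12 n3 s True in auto)
    next
      case False
      have "F t = {}" unfolding F_def t using False by (auto simp: interlaced_def)
      have "packing_premeasure s ({} :: (real ^ 'n) set) = 0"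
        by (rule packing_premeasure_eq_0[of 1 0 s 0]) (use s in \<open>auto intro!: exI[of _ "{}"]\<close>)
      then show ?thesis by (simp add: \<open>F t = {}\<close>)
    qed
  qed
  show "packing_measure s (Theta i1 i2) = 0"
  proof (rule packing_measure_eq_0[OF _ F])
    show "Theta i1 i2 \<subseteq> (\<Union>t. F t)"
    proof
      fix x assume "x \<in> Theta i1 i2"
      then obtain g m c P where "(\<forall>i. \<bar>x $ i\<bar> \<le> real m) \<and> interlaced (if g then i1 else i2) (if g then i2 else i1) c P x"
        using Theta_cover[of x i1 i2] n3 by auto
      then have "x \<in> F (g, m, c 0, c 1)" unfolding F_def prod.case by blast
      then show "x \<in> (\<Union>t. F t)" by blast
    qed
  qed
qed (use n3 in simp)

theorem theorem4:
  fixes i1 i2 :: "'n::finite"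
  assumes "CARD('n) \<ge> 2" and "i1 \<noteq> i2"
  defines "n \<equiv> real CARD('n)"
  shows "(\<forall>w::ereal. ereal n \<le> w \<longrightarrow>
            hausdorff_dim (Theta_exp i1 i2 w) \<ge> ereal (n - 2) + 1 / (w ^ 2 + 1)) \<and>
         hausdorff_dim (Theta i1 i2) > ereal (n - 2 + 1 / (n ^ 2 + 1)) \<and>
         (CARD('n) = 2 \<longrightarrow> packing_dim (Theta i1 i2) \<ge> 1) \<and>
         (CARD('n) \<ge> 3 \<longrightarrow> packing_dim (Theta i1 i2) = ereal (n - 1)) \<and>
         Theta i1 i2 \<noteq> {} \<and>
         (CARD('n) = 2 \<longrightarrow> hausdorff_dim (Theta i1 i2) \<le> ereal (7 / 5)) \<and>
         (CARD('n) = 3 \<longrightarrow> hausdorff_dim (Theta i1 i2) \<le> ereal ((17 - sqrt 13) / 8)) \<and>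
         (CARD('n) \<ge> 4 \<longrightarrow> hausdorff_dim (Theta i1 i2) \<le> ereal (n - 2 + 2 / n))"
proof (intro conjI allI impI)
  note i12 = assms(2) and n2 = assms(1)
  note low = Theta_digit_dimension[OF i12 n2, folded n_def]
  note up = Theta_hausdorff_upper[OF i12 n2, folded n_def]
  show "hausdorff_dim (Theta_exp i1 i2 w) \<ge> ereal (n - 2) + 1 / (w ^ 2 + 1)" if "ereal n \<le> w" for w
    using Theta_exp_dimension[OF i12 n2, of w] that by (simp add: n_def)
  show "hausdorff_dim (Theta i1 i2) > ereal (n - 2 + 1 / (n ^ 2 + 1))"
  proof (rule less_le_trans[OF _ low(1)])
    have "2 \<le> n" using n2 by (simp add: n_def)
    \<comment> \<open>Expanded, this is \<open>2 * n < n^2 + 1\<close>, which puts the digit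
      exponent strictly above the required one.\<close>
    then have "0 < (n - 1)\<^sup>2" by simp
    then have "2 * n < n\<^sup>2 + 1" by (simp add: power2_eq_square algebra_simps)
    then have "1 / (n\<^sup>2 + 1) < 1 / (2 * n)" using \<open>2 \<le> n\<close> by (intro divide_strict_left_mono mult_pos_pos) auto
    then show "ereal (n - 2 + 1 / (n ^ 2 + 1)) < ereal (n - 2 + 1 / (2 * n))" by simp
  qed
  show "packing_dim (Theta i1 i2) \<ge> 1" if "CARD('n) = 2"
    using low(2) that by (simp add: n_def one_ereal_def)
  show "packing_dim (Theta i1 i2) = ereal (n - 1)" if "CARD('n) \<ge> 3"
    using Theta_packing_upper[OF i12 that, folded n_def] low(2) by (rule antisym)
  show "Theta i1 i2 \<noteq> {}" by (rule low(3))
  show "hausdorff_dim (Theta i1 i2) \<le> ereal (7 / 5)" if "CARD('n) = 2"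
    \<comment> \<open>For \<open>n = 2\<close> the general bound is 1.\<close>
    by (rule order_trans[OF up]) (simp add: n_def that)
  show "hausdorff_dim (Theta i1 i2) \<le> ereal ((17 - sqrt 13) / 8)" if "CARD('n) = 3"
  proof (rule order_trans[OF up])
    \<comment> \<open>Equivalent to \<open>5 / 3 \<le> (17 - sqrt 13) / 8\<close>, where 5/3 is the
      general bound for \<open>n = 3\<close>.\<close>
    have "sqrt 13 \<le> 11 / 3" by (rule real_le_lsqrt) (auto simp: power2_eq_square)
    then show "ereal (n - 2 + 2 / n) \<le> ereal ((17 - sqrt 13) / 8)" by (simp add: n_def that)
  qed
  show "hausdorff_dim (Theta i1 i2) \<le> ereal (n - 2 + 2 / n)" if "CARD('n) \<ge> 4" by (rule up)
qed

end
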